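(* Let $d\in\mathbb{N}$, let $\boldsymbol\omega=(\omega_1,\ldots,\omega_d)$ with $\omega_i>0$, let $\boldsymbol p=(p_1,\ldots,p_d)$ with $p_i>0$ and $\sum_{i=1}^d p_i=1$, and let the inter-inspection times be distributed as the hyperexponential random variable $T_{\boldsymbol\omega,\boldsymbol p}$ with density $\sum_{i=1}^d p_i\omega_i e^{-\omega_i t}$, $t>0$. For any $\alpha\geqslant 0$ and $\beta>0$, \[ \pi(\alpha,\beta\,|\,T_{\boldsymbol\omega,\boldsymbol p})=\frac{\displaystyle\sum_{i=1}^d p_i\frac{\omega_i}{\beta+\omega_i}\Big(F(\alpha,\beta,\omega_i)-\bar G(\alpha,\beta,\omega_i)\,z_i\Big)}{\displaystyle 1-\sum_{i=1}^d p_i\frac{\omega_i}{\beta+\omega_i-\varphi(\alpha)}}, \] where the vector $\boldsymbol z=(z_1,\ldots,z_d)$, with $z_i=\pi(\theta_i,\beta\,|\,T_{\boldsymbol\omega,\boldsymbol p})$, follows from the linear equations \[ \sum_{i=1}^d p_i\frac{\omega_i}{\beta+\omega_i}\Big(F(\alpha_j,\beta,\omega_i)-\bar G(\alpha_j,\beta,\omega_i)\,z_i\Big)=0,\qquad j=1,\ldots,d, \] with $\alpha_1,\ldots,\alpha_d$ the $d$ roots in the right half of the complex plane of $\sum_{i=1}^d p_i\,\omega_i/(\beta+\omega_i-\varphi(\alpha))=1$.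
   Context: $Y=(Y(t))_{t\geqslant0}$ is a spectrally positive Lévy process (no negative jumps) with $Y(0)=0$, which is not monotonically increasing or decreasing. Its Laplace exponent is $\varphi(\alpha)=\log\mathbb{E}\,e^{-\alpha Y(1)}$, and $\psi$ is the right inverse of $\varphi$. Write $\bar Y(t)=\sup_{0\leqslant s\leqslant t}Y(s)$. $T_\beta$ denotes an exponentially distributed random variable with rate $\beta$, independent of everything else. Put \[\xi(\alpha,\beta)=\mathbb{E}\,e^{-\alpha\bar Y(T_\beta)}=\frac{\alpha-\psi(\beta)}{\varphi(\alpha)-\beta}\,\frac{\beta}{\psi(\beta)}.\] The inter-inspection times $\Omega_1,\Omega_2,\ldots$ are i.i.d. copies of a non-negative random variable $\Omega$, independent of $Y$, and $\bar\Omega_n=\sum_{m=1}^n\Omega_m$. Define \[p(u,t\,|\,\Omega)=\mathbb{P}\big(\exists n\in\mathbb{N}:\bar\Omega_n\leqslant t,\ Y(\bar\Omega_n)>u\big),\qquad \pi(\alpha,\beta\,|\,\Omega)=\int_0^\infty e^{-\alpha u}\,p(u,T_\beta\,|\,\Omega)\,du,\] where $p(u,T_\beta\,|\,\Omega)$ is the probability of the event with $t$ replaced by the independent time $T_\beta$. For $i=1,\ldots,d$ put $\theta_i=\psi(\beta+\omega_i)$ and \[F(\alpha,\beta,\omega_i)=\frac{\alpha\,\xi(\theta_i,\beta+\omega_i)-\theta_i\,\xi(\alpha,\beta+\omega_i)}{\alpha(\theta_i-\alpha)}+\frac1\alpha,\qquad \bar G(\alpha,\beta,\omega_i)=\fr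ac{\theta_i\,\xi(\theta_i,\beta+\omega_i)}{\theta_i-\alpha}.\]
   Formalization: That there are d roots and that they determine z is claimed only for pairwise distinct ω_i (with repeated rates there are fewer than d roots); at α=0, α=θ_i and zeros of the denominator, where the displayed formula is undefined, it is read as a limit. *)

theory Defs
  imports "HOL-Probability.Probability"
begin

definition process_events :: "'a measure \<Rightarrow> 'i set \<Rightarrow> ('i \<Rightarrow> 'a \<Rightarrow> real) \<Rightarrow> 'a set set" where
  "process_events M I X =
     sigma_sets (space M) {X i -` A \<inter> space M | i A. i \<in> I \<and> A \<in> sets borel}"

text \<open>Paths are only constrained on the half-line \<open>t \<ge> 0\<close>. The path properties are required
  of every path rather than almost every path, so that running suprema and the process sampled at
  random times are measurable without completing the probability space.\<close>

locale levy_process = prob_space M for M :: "'a measure" +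
  fixes Y :: "real \<Rightarrow> 'a \<Rightarrow> real"
  assumes random_variable_Y: "0 \<le> t \<Longrightarrow> Y t \<in> borel_measurable M"
    and Y_zero: "w \<in> space M \<Longrightarrow> Y 0 w = 0"
    and right_continuous: "w \<in> space M \<Longrightarrow> 0 \<le> t \<Longrightarrow> continuous (at_right t) (\<lambda>s. Y s w)"
    and left_limits: "w \<in> space M \<Longrightarrow> 0 < t \<Longrightarrow> \<exists>l. ((\<lambda>s. Y s w) \<longlongrightarrow> l) (at_left t)"
    and independent_increments:
      "0 \<le> \<tau> (0::nat) \<Longrightarrow> (\<forall>i<n. \<tau> i \<le> \<tau> (Suc i)) \<Longrightarrow>
        indep_vars (\<lambda>_. borel) (\<lambda>i w. Y (\<tau> (Suc i)) w - Y (\<tau> i) w) {..<n}"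
    and stationary_increments:
      "0 \<le> s \<Longrightarrow> 0 \<le> h \<Longrightarrow> distr M borel (\<lambda>w. Y (s + h) w - Y s w) = distr M borel (Y h)"

locale spectrally_positive_levy_process = levy_process M Y
  for M :: "'a measure" and Y :: "real \<Rightarrow> 'a \<Rightarrow> real" +
  assumes no_negative_jumps:
      "w \<in> space M \<Longrightarrow> 0 < t \<Longrightarrow> ((\<lambda>s. Y s w) \<longlongrightarrow> l) (at_left t) \<Longrightarrow> l \<le> Y t w"
    and not_increasing: "\<not> (AE w in M. mono_on {0..} (\<lambda>t. Y t w))"
    and not_decreasing: "\<not> (AE w in M. antimono_on {0..} (\<lambda>t. Y t w))"

text \<open>The inter-inspection times are \<open>\<Omega> 1, \<Omega> 2, \<dots>\<close>; the value \<open>\<Omega> 0\<close> is never used.\<close>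

locale inspected_levy_process = spectrally_positive_levy_process M Y
  for M :: "'a measure" and Y :: "real \<Rightarrow> 'a \<Rightarrow> real" +
  fixes \<Omega> :: "nat \<Rightarrow> 'a \<Rightarrow> real"
  assumes nonneg_\<Omega>: "1 \<le> n \<Longrightarrow> w \<in> space M \<Longrightarrow> 0 \<le> \<Omega> n w"
    and indep_\<Omega>: "indep_vars (\<lambda>_. borel) \<Omega> {1..}"
    and identically_distributed_\<Omega>: "1 \<le> n \<Longrightarrow> distr M borel (\<Omega> n) = distr M borel (\<Omega> 1)"
    and indep_Y_\<Omega>: "indep_set (process_events M {0..} Y) (process_events M {1..} \<Omega>)"

definition laplace_exponent :: "'a measure \<Rightarrow> (real \<Rightarrow> 'a \<Rightarrow> real) \<Rightarrow> real \<Rightarrow> real" where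
  "laplace_exponent M Y \<alpha> = ln (\<integral>w. exp (- \<alpha> * Y 1 w) \<partial>M)"

text \<open>The extension of the Laplace exponent to complex \<open>\<alpha>\<close> with nonnegative real part.
  The principal branch of the logarithm of the transform of \<open>Y 1\<close> would be discontinuous in
  \<open>\<alpha>\<close>; the correct branch is singled out by requiring
  \<open>E exp (- \<alpha> Y(t)) = exp (t c)\<close> for all \<open>t \<ge> 0\<close>, which determines \<open>c\<close>.\<close>

definition complex_laplace_exponent ::
    "'a measure \<Rightarrow> (real \<Rightarrow> 'a \<Rightarrow> real) \<Rightarrow> complex \<Rightarrow> complex" where
  "complex_laplace_exponent M Y \<alpha> =
     (THE c. \<forall>t\<ge>0. (\<integral>w. exp (- \<alpha> * complex_of_real (Y t w)) \<partial>M) = exp (complex_of_real t * c))"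

definition right_inverse :: "'a measure \<Rightarrow> (real \<Rightarrow> 'a \<Rightarrow> real) \<Rightarrow> real \<Rightarrow> real" where
  "right_inverse M Y q = Sup {\<alpha>. 0 \<le> \<alpha> \<and> laplace_exponent M Y \<alpha> = q}"

text \<open>An exponential time with rate \<open>\<beta>\<close>, independent of everything living on \<open>M\<close>, is the second
  coordinate on the following product space.\<close>

definition with_exponential_time :: "'a measure \<Rightarrow> real \<Rightarrow> ('a \<times> real) measure" where
  "with_exponential_time M \<beta> = M \<Otimes>\<^sub>M density lborel (exponential_density \<beta>)"

definition running_sup :: "(real \<Rightarrow> 'a \<Rightarrow> real) \<Rightarrow> real \<Rightarrow> 'a \<Rightarrow> real" where
  "running_sup Y t w = (SUP s\<in>{0..t}. Y s w)"

text \<open>The functions \<open>\<xi>\<close>, \<open>F\<close> and \<open>G\<close> are needed both for real and for complex \<open>\<alpha>\<close>,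
  hence the polymorphic definitions.\<close>

definition xi :: "'a measure \<Rightarrow> (real \<Rightarrow> 'a \<Rightarrow> real) \<Rightarrow>
    'b::{real_normed_field, banach, second_countable_topology} \<Rightarrow> real \<Rightarrow> 'b" where
  "xi M Y \<alpha> \<beta> =
     (\<integral>(w, t). exp (- \<alpha> * of_real (running_sup Y t w)) \<partial>with_exponential_time M \<beta>)"

definition exceedance_probability ::
    "'a measure \<Rightarrow> (real \<Rightarrow> 'a \<Rightarrow> real) \<Rightarrow> (nat \<Rightarrow> 'a \<Rightarrow> real) \<Rightarrow> real \<Rightarrow> real \<Rightarrow> real" where
  "exceedance_probability M Y \<Omega> u \<beta> =
     measure (with_exponential_time M \<beta>)
       {(w, t) \<in> space (with_exponential_time M \<beta>).
          \<exists>n\<ge>1. (\<Sum>m=1..n. \<Omega> m w) \<le> t \<and> Y (\<Sum>m=1..n. \<Omega> m w) w > u}"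

text \<open>Extended-valued, because at \<open>\<alpha> = 0\<close> the integral may be infinite.\<close>

definition exceedance_transform ::
    "'a measure \<Rightarrow> (real \<Rightarrow> 'a \<Rightarrow> real) \<Rightarrow> (nat \<Rightarrow> 'a \<Rightarrow> real) \<Rightarrow> real \<Rightarrow> real \<Rightarrow> ennreal" where
  "exceedance_transform M Y \<Omega> \<alpha> \<beta> =
     (\<integral>\<^sup>+ u \<in> {0..}. ennreal (exp (- \<alpha> * u) * exceedance_probability M Y \<Omega> u \<beta>) \<partial>lborel)"

definition F :: "'a measure \<Rightarrow> (real \<Rightarrow> 'a \<Rightarrow> real) \<Rightarrow>
    'b::{real_normed_field, banach, second_countable_topology} \<Rightarrow> real \<Rightarrow> real \<Rightarrow> 'b" where
  "F M Y \<alpha> \<beta> \<omega> =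
     (let \<theta> = of_real (right_inverse M Y (\<beta> + \<omega>))
      in (\<alpha> * xi M Y \<theta> (\<beta> + \<omega>) - \<theta> * xi M Y \<alpha> (\<beta> + \<omega>)) / (\<alpha> * (\<theta> - \<alpha>)) + 1 / \<alpha>)"

definition Gbar :: "'a measure \<Rightarrow> (real \<Rightarrow> 'a \<Rightarrow> real) \<Rightarrow>
    'b::{real_normed_field, banach, second_countable_topology} \<Rightarrow> real \<Rightarrow> real \<Rightarrow> 'b" where
  "Gbar M Y \<alpha> \<beta> \<omega> =
     (let \<theta> = of_real (right_inverse M Y (\<beta> + \<omega>))
      in \<theta> * xi M Y \<theta> (\<beta> + \<omega>) / (\<theta> - \<alpha>))"

definition hyperexponential_density ::
    "nat \<Rightarrow> (nat \<Rightarrow> real) \<Rightarrow> (nat \<Rightarrow> real) \<Rightarrow> real \<Rightarrow> real" where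
  "hyperexponential_density d \<omega> p t =
     (if t > 0 then \<Sum>i=1..d. p i * \<omega> i * exp (- \<omega> i * t) else 0)"

text \<open>The equation defining the roots is meaningful only where none of its denominators vanishes;
  this has to be said explicitly because division by zero yields zero.\<close>

definition hyperexponential_roots ::
    "'a measure \<Rightarrow> (real \<Rightarrow> 'a \<Rightarrow> real) \<Rightarrow> nat \<Rightarrow> (nat \<Rightarrow> real) \<Rightarrow> (nat \<Rightarrow> real) \<Rightarrow> real \<Rightarrow> complex set"
  where
  "hyperexponential_roots M Y d \<omega> p \<beta> =
     {\<alpha>. Re \<alpha> > 0 \<and>
         (\<forall>i\<in>{1..d}. complex_of_real (\<beta> + \<omega> i) - complex_laplace_exponent M Y \<alpha> \<noteq> 0) \<and>
         (\<Sum>i=1..d. complex_of_real (p i * \<omega> i) /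
            (complex_of_real (\<beta> + \<omega> i) - complex_laplace_exponent M Y \<alpha>)) = 1}"

end

theory Submission
  imports Defs "HOL-Computational_Algebra.Fundamental_Theorem_Algebra"
begin

text \<open>
  Sampling \<open>Y\<close> on finer and finer grids and stopping the sampled walk when it leaves
  \<open>[-x, \<infinity>)\<close> or at the exponential time of rate \<open>q\<close>, one obtains in the limit, since \<open>Y\<close> passes
  downwards continuously, the identity
  \<open>1 + (\<phi> a - q) / q * E (exp (- a Y(T)); Y \<ge> -x on [0, T]) = exp (a x) * P (Y < -x somewhere on [0, T])\<close>
  for \<open>Re a \<ge> 0\<close>. At a root of \<open>\<phi> a = q\<close> the left-hand side is \<open>1\<close>, so the running infimum at \<open>T\<close>
  is exponential with parameter \<open>a\<close>. Hence for \<open>q > 0\<close> the root in the right half-plane is unique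
  and equals \<open>\<psi> q\<close>. Time reversal turns the identity into the formula for \<open>\<xi>\<close>, and by uniqueness
  of characteristic functions \<open>Y(T)\<close> is distributed as the supremum at \<open>T\<close> minus an independent
  exponential variable of rate \<open>\<psi> q\<close>.

  Under hyperexponential inspection the discounted first inspected increment is a mixture of these laws with
  \<open>q = \<beta> + \<omega> i\<close> and weights \<open>p i * \<omega> i / (\<beta> + \<omega> i)\<close>. The exceedance probability satisfies a renewal
  equation with this step distribution; its transform reads
  \<open>\<pi>(\<alpha>) * denominator(\<alpha>) = numerator(\<alpha>)\<close>, the terms with \<open>z i\<close> coming from the exponential parts.
  Since the weights are positive, a level \<open>c = \<phi> \<alpha>\<close> with vanishing denominator is real and positive, so
  that the roots are \<open>\<psi>\<close> of the \<open>d\<close> simple zeros of a polynomial, and at such roots the linear system is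
  a Cauchy system in the unknowns \<open>z i\<close>.
\<close>

section \<open>Small drops and random walks above a level\<close>

text \<open>The obstacle is that nothing analytic about \<phi> is given:
  \<open>laplace_exponent\<close> is the logarithm of an integral that is \<open>0\<close> by
  default unless it converges. Exponential moments therefore have to be produced, and their source
  is the absence of negative jumps: along each path all sufficiently short increments in a bounded
  time span exceed \<open>-1\<close>, and a walk with downward steps of size at most
  \<open>1\<close> that rarely gets below \<open>-1\<close> cannot have a large exponential moment.
  Exponential times are reached through deterministic grids because stopping a finite walk uses only
  the independence of the next increment from the past; neither continuous-time stopping nor
  martingale arguments enter. For the same reason the factorisation at an exponential time appears
  only as an equality of one-dimensional laws, obtained from a product of transforms on the
  imaginary axis. This is enough because the renewal equation sees the inspected increments through
  their law alone.\<close>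

lemma (in prob_space) integral_tendsto_zero_if_L2_bounded:
  fixes f :: "nat \<Rightarrow> 'a \<Rightarrow> real"
  assumes [measurable]: "\<And>n. f n \<in> borel_measurable M"
    and nonneg: "\<And>n w. w \<in> space M \<Longrightarrow> 0 \<le> f n w"
    and lim: "AE w in M. (\<lambda>n. f n w) \<longlonglongrightarrow> 0"
    and sq_int: "\<And>n. integrable M (\<lambda>w. (f n w)\<^sup>2)"
    and sq_le: "\<And>n. (\<integral>w. (f n w)\<^sup>2 \<partial>M) \<le> C"
  shows "(\<lambda>n. \<integral>w. f n w \<partial>M) \<longlonglongrightarrow> 0"
proof -
  have C0: "0 \<le> C" using order_trans[OF integral_nonneg_AE sq_le[of 0]] by simp
  \<comment> \<open>This replaces uniform integrability: the excess of \<open>f n\<close> over K is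
    at most \<open>(f n)\<^sup>2 / K\<close>, so its mean is at most \<open>C / K\<close> uniformly
    in n, while the truncated part is left to dominated convergence.\<close>
  have bound: "(\<integral>w. f n w \<partial>M) \<le> (\<integral>w. min (f n w) K \<partial>M) + C / K" if K: "K > 0" for n K
  proof -
    have int_min: "integrable M (\<lambda>w. min (f n w) K)"
      using K nonneg by (intro integrable_const_bound[of _ K]) auto
    have pw: "f n w \<le> min (f n w) K + (f n w)\<^sup>2 / K" if "w \<in> space M" for w
      using K nonneg[OF that, of n] mult_right_mono[of K "f n w" "f n w"]
      by (auto simp: min_def field_simps power2_eq_square intro: add_increasing)
    have "(\<integral>w. f n w \<partial>M) \<le> (\<integral>w. min (f n w) K + (f n w)\<^sup>2 / K \<partial>M)"
      using int_min sq_int K nonneg pw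
      by (intro integral_mono_AE' integrable_add integrable_divide) auto
    also have "\<dots> = (\<integral>w. min (f n w) K \<partial>M) + (\<integral>w. (f n w)\<^sup>2 \<partial>M) / K"
      using int_min sq_int by simp
    also have "\<dots> \<le> (\<integral>w. min (f n w) K \<partial>M) + C / K"
      using K sq_le by (simp add: divide_right_mono)
    finally show ?thesis .
  qed
  have lim_min: "(\<lambda>n. \<integral>w. min (f n w) K \<partial>M) \<longlonglongrightarrow> 0" if K: "K > 0" for K
  proof -
    have "(\<lambda>n. \<integral>w. min (f n w) K \<partial>M) \<longlonglongrightarrow> (\<integral>w. 0 \<partial>M)"
    proof (rule integral_dominated_convergence[where w="\<lambda>_. K"])
      show "AE w in M. (\<lambda>n. min (f n w) K) \<longlonglongrightarrow> 0"
        using lim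
      proof eventually_elim
        case (elim w)
        have "(\<lambda>n. min (f n w) K) \<longlonglongrightarrow> min 0 K" by (intro tendsto_min elim tendsto_const)
        then show ?case using K by simp
      qed
    qed (use K nonneg in auto)
    then show ?thesis by simp
  qed
  have nn: "0 \<le> (\<integral>w. f n w \<partial>M)" for n using nonneg by (intro integral_nonneg_AE) auto
  show ?thesis
  proof (rule LIMSEQ_I)
    fix e :: real assume e: "0 < e"
    \<comment> \<open>The summand \<open>1\<close> keeps K positive when \<open>C = 0\<close> and
      makes \<open>C / K < e / 2\<close> strict.\<close>
    define K where "K = 2 * (C + 1) / e"
    have K: "K > 0" using C0 e by (simp add: K_def)
    have "C / K < e / 2" using C0 e by (simp add: K_def field_simps)
    obtain N where N: "\<And>n. n \<ge> N \<Longrightarrow> norm (\<integral>w. min (f n w) K \<partial>M) < e / 2"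
      using LIMSEQ_D[OF lim_min[OF K], of "e/2"] e by auto
    from \<open>C / K < e / 2\<close> show "\<exists>N. \<forall>n\<ge>N. norm ((\<integral>w. f n w \<partial>M) - 0) < e"
    proof (intro exI[of _ N] allI impI)
      fix n assume "n \<ge> N"
      then have "norm (\<integral>w. min (f n w) K \<partial>M) < e / 2" by (rule N)
      with bound[OF K, of n] nn[of n] \<open>C / K < e / 2\<close> show "norm ((\<integral>w. f n w \<partial>M) - 0) < e"
        unfolding real_norm_def by linarith
    qed
  qed
qed

section \<open>Local structure of the paths\<close>

context levy_process
begin

text \<open>Both one-sided limits with a common radius, the form in which the compactness arguments
  use the path regularity. At \<open>x = 0\<close> the clauses about l are vacuous and l is a dummy
  value.\<close>

lemma path_local:
  assumes w: "w \<in> space M" and x: "0 \<le> x" and e: "0 < e"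
  obtains d l where "d > 0" "\<And>s. x \<le> s \<Longrightarrow> s < x + d \<Longrightarrow> \<bar>Y s w - Y x w\<bar> < e"
    "\<And>s. 0 \<le> s \<Longrightarrow> x - d < s \<Longrightarrow> s < x \<Longrightarrow> \<bar>Y s w - l\<bar> < e"
    "0 < x \<Longrightarrow> ((\<lambda>s. Y s w) \<longlongrightarrow> l) (at_left x)"
proof -
  have "((\<lambda>s. Y s w) \<longlongrightarrow> Y x w) (at_right x)"
    using right_continuous[OF w x] by (simp add: continuous_within)
  from tendstoD[OF this e] obtain b where b: "b > x" "\<And>s. x < s \<Longrightarrow> s < b \<Longrightarrow> \<bar>Y s w - Y x w\<bar> < e"
    unfolding eventually_at_right_field by (auto simp: dist_real_def)
  show thesis
  proof (cases "x = 0")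
    case True
    show thesis
      by (rule that[of "b - x" 0]) (use b e True in \<open>force simp: le_less\<close>)+
  next
    case False
    with x have x0: "0 < x" by simp
    from left_limits[OF w x0] obtain l where l: "((\<lambda>s. Y s w) \<longlongrightarrow> l) (at_left x)" by blast
    from tendstoD[OF this e] obtain a where a: "a < x" "\<And>s. a < s \<Longrightarrow> s < x \<Longrightarrow> \<bar>Y s w - l\<bar> < e"
      unfolding eventually_at_left_field by (auto simp: dist_real_def)
    show thesis
    proof (rule that[of "min (b - x) (x - a)" l])
      show "\<bar>Y s w - Y x w\<bar> < e" if "x \<le> s" "s < x + min (b - x) (x - a)" for s
        using b e that by (cases "s = x") auto
    qed (use a b l in auto)
  qed
qed

lemma path_bounded:
  assumes w: "w \<in> space M"
  obtains B where "\<And>t. 0 \<le> t \<Longrightarrow> t \<le> T \<Longrightarrow> \<bar>Y t w\<bar> \<le> B"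
proof (cases "0 \<le> T")
  case True
  \<comment> \<open>Bisection is used because the path need not be continuous. The guard
    \<open>0 \<le> t\<close> inside the predicate allows neighbourhoods of \<open>0\<close> to reach
    into negative times, where nothing is known about the path.\<close>
  have "\<exists>B. \<forall>t\<in>{0..T}. 0 \<le> t \<longrightarrow> \<bar>Y t w\<bar> \<le> B"
  proof (rule Bolzano[where P = "\<lambda>a b. \<exists>B. \<forall>t\<in>{a..b}. 0 \<le> t \<longrightarrow> \<bar>Y t w\<bar> \<le> B", OF True], goal_cases)
    case (1 a b c)
    then obtain B B' where "\<forall>t\<in>{a..b}. 0 \<le> t \<longrightarrow> \<bar>Y t w\<bar> \<le> B" "\<forall>t\<in>{b..c}. 0 \<le> t \<longrightarrow> \<bar>Y t w\<bar> \<le> B'" by auto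
    then have "\<forall>t\<in>{a..c}. 0 \<le> t \<longrightarrow> \<bar>Y t w\<bar> \<le> max B B'"
      by (metis (no_types, lifting) atLeastAtMost_iff le_cases max.coboundedI1 max.coboundedI2)
    then show ?case by (rule exI)
  next
    case (2 x)
    obtain d l where d: "d > 0" "\<And>s. x \<le> s \<Longrightarrow> s < x + d \<Longrightarrow> \<bar>Y s w - Y x w\<bar> < 1"
      "\<And>s. 0 \<le> s \<Longrightarrow> x - d < s \<Longrightarrow> s < x \<Longrightarrow> \<bar>Y s w - l\<bar> < 1"
      by (rule path_local[OF w 2(1), of 1]) auto
    show ?case
    proof (rule exI[of _ d], intro conjI allI impI d(1))
      fix a b assume ab: "a \<le> x \<and> x \<le> b \<and> b - a < d"
      show "\<exists>B. \<forall>t\<in>{a..b}. 0 \<le> t \<longrightarrow> \<bar>Y t w\<bar> \<le> B"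
      proof (intro exI[of _ "\<bar>Y x w\<bar> + \<bar>l\<bar> + 1"] ballI impI)
        fix t assume "t \<in> {a..b}" "0 \<le> t"
        then show "\<bar>Y t w\<bar> \<le> \<bar>Y x w\<bar> + \<bar>l\<bar> + 1"
          using d(2)[of t] d(3)[of t] ab by (cases "x \<le> t") auto
      qed
    qed
  qed
  then obtain B where "\<forall>t\<in>{0..T}. 0 \<le> t \<longrightarrow> \<bar>Y t w\<bar> \<le> B" ..
  then show thesis by (intro that) auto
qed (use that in auto)

end

context spectrally_positive_levy_process
begin

text \<open>The substitute for uniform continuity when all jumps go upwards. Just before x the path
  is close to its left limit l, from x on it is close to \<open>Y x w\<close>, and l \<le>
  \<open>Y x w\<close>; so even a pair of times on different sides of x falls by less than e. A
  Lebesgue number of the cover by such balls makes the radius uniform.\<close>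

lemma uniformly_small_drops:
  assumes w: "w \<in> space M" and e: "0 < e" and T: "0 \<le> T"
  obtains \<delta> where "\<delta> > 0" "\<And>s u. 0 \<le> s \<Longrightarrow> s \<le> u \<Longrightarrow> u \<le> T \<Longrightarrow> u - s < \<delta> \<Longrightarrow> Y u w - Y s w > - e"
proof -
  define good where "good x d \<longleftrightarrow> (\<forall>s u. 0 \<le> s \<and> s \<le> u \<and> s \<in> ball x d \<and> u \<in> ball x d \<longrightarrow> Y u w - Y s w > - e)" for x d
  have ex: "\<exists>d>0. good x d" if x: "0 \<le> x" for x
  proof -
    obtain d l where d: "d > 0" "\<And>s. x \<le> s \<Longrightarrow> s < x + d \<Longrightarrow> \<bar>Y s w - Y x w\<bar> < e/2"
      "\<And>s. 0 \<le> s \<Longrightarrow> x - d < s \<Longrightarrow> s < x \<Longrightarrow> \<bar>Y s w - l\<bar> < e/2"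
      "0 < x \<Longrightarrow> ((\<lambda>s. Y s w) \<longlongrightarrow> l) (at_left x)"
      by (rule path_local[OF w x, of "e/2"]) (use e in auto)
    have l: "0 < x \<Longrightarrow> l \<le> Y x w" using no_negative_jumps[OF w] d(4) by blast
    have "good x d" unfolding good_def
    proof (intro allI impI)
      fix s u assume su: "0 \<le> s \<and> s \<le> u \<and> s \<in> ball x d \<and> u \<in> ball x d"
      consider "x \<le> s" | "s < x" "u < x" | "s < x" "x \<le> u" by linarith
      then show "Y u w - Y s w > - e"
      proof cases
        case 1
        with su d(2)[of s] d(2)[of u] have "\<bar>Y s w - Y x w\<bar> < e/2" "\<bar>Y u w - Y x w\<bar> < e/2"
          by (auto simp: dist_real_def)
        then show ?thesis by linarith
      next
        case 2
        with su d(3)[of s] d(3)[of u] have "\<bar>Y s w - l\<bar> < e/2" "\<bar>Y u w - l\<bar> < e/2"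
          by (auto simp: dist_real_def)
        then show ?thesis by linarith
      next
        case 3
        with su d(3)[of s] d(2)[of u] have "\<bar>Y s w - l\<bar> < e/2" "\<bar>Y u w - Y x w\<bar> < e/2" "0 < x"
          by (auto simp: dist_real_def)
        with l show ?thesis by linarith
      qed
    qed
    with d(1) show ?thesis by blast
  qed
  define \<C> where "\<C> = {ball x d | x d. x \<in> {0..T} \<and> d > 0 \<and> good x d}"
  have cover: "{0..T} \<subseteq> \<Union>\<C>"
  proof
    fix x assume x: "x \<in> {0..T}"
    then obtain d where "d > 0" "good x d" using ex[of x] by auto
    then have "ball x d \<in> \<C>" "x \<in> ball x d" using x by (auto simp: \<C>_def)
    then show "x \<in> \<Union>\<C>" by blast
  qed
  moreover have "\<C> \<noteq> {}" using cover T by auto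
  moreover have "\<And>B. B \<in> \<C> \<Longrightarrow> open B" by (auto simp: \<C>_def)
  ultimately obtain \<delta> where \<delta>: "0 < \<delta>" "\<And>S. \<lbrakk>S \<subseteq> {0..T}; diameter S < \<delta>\<rbrakk> \<Longrightarrow> \<exists>B\<in>\<C>. S \<subseteq> B"
    using Lebesgue_number_lemma[of "{0..T}" \<C>] by (metis compact_Icc)
  show thesis
  proof (rule that[OF \<delta>(1)])
    fix s u assume su: "0 \<le> s" "s \<le> u" "u \<le> T" "u - s < \<delta>"
    then have "\<exists>B\<in>\<C>. {s..u} \<subseteq> B" by (intro \<delta>(2)) auto
    then obtain x d where "good x d" "{s..u} \<subseteq> ball x d" by (auto simp: \<C>_def)
    then show "Y u w - Y s w > - e" using su unfolding good_def by (meson atLeastAtMost_iff order_refl subsetD)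
  qed
qed

end

section \<open>Random walks restricted to staying above a level\<close>

context prob_space
begin

text \<open>Here f may look at the whole past, in particular contain the indicator of not yet having
  left a half-line; this is the only form of the Markov property that the grid arguments
  use.\<close>

lemma indep_walk_step:
  fixes f :: "(nat \<Rightarrow> real) \<Rightarrow> 'b::{real_normed_field, banach, second_countable_topology}"
  assumes ind: "indep_vars (\<lambda>_. borel) X {..<Suc k}"
    and f: "f \<in> borel_measurable (PiM {..<k} (\<lambda>_. borel))" and g: "g \<in> borel_measurable borel"
    and intf: "integrable M (\<lambda>w. f (\<lambda>i\<in>{..<k}. X i w))" and intg: "integrable M (\<lambda>w. g (X k w))"
  shows "integrable M (\<lambda>w. f (\<lambda>i\<in>{..<k}. X i w) * g (X k w))"
    and "(\<integral>w. f (\<lambda>i\<in>{..<k}. X i w) * g (X k w) \<partial>M) = (\<integral>w. f (\<lambda>i\<in>{..<k}. X i w) \<partial>M) * (\<integral>w. g (X k w) \<partial>M)"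
proof -
  have "indep_var (PiM {..<k} (\<lambda>_. borel)) (\<lambda>w. \<lambda>i\<in>{..<k}. X i w) (PiM {k} (\<lambda>_. borel)) (\<lambda>w. \<lambda>i\<in>{k}. X i w)"
    by (rule indep_var_restrict[OF ind]) auto
  from indep_var_compose[OF this f, of "\<lambda>x. g (x k)" borel]
  have "indep_var borel (f \<circ> (\<lambda>w. \<lambda>i\<in>{..<k}. X i w)) borel ((\<lambda>x. g (x k)) \<circ> (\<lambda>w. \<lambda>i\<in>{k}. X i w))"
    using g by (simp add: measurable_compose[OF measurable_component_singleton])
  then have *: "indep_var borel (\<lambda>w. f (\<lambda>i\<in>{..<k}. X i w)) borel (\<lambda>w. g (X k w))"
    by (simp add: comp_def)
  show "integrable M (\<lambda>w. f (\<lambda>i\<in>{..<k}. X i w) * g (X k w))"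
    by (rule indep_var_integrable[OF * intf intg])
  show "(\<integral>w. f (\<lambda>i\<in>{..<k}. X i w) * g (X k w) \<partial>M) = (\<integral>w. f (\<lambda>i\<in>{..<k}. X i w) \<partial>M) * (\<integral>w. g (X k w) \<partial>M)"
    by (rule indep_var_lebesgue_integral[OF * intf intg])
qed

definition walk_above :: "(nat \<Rightarrow> 'a \<Rightarrow> real) \<Rightarrow> real \<Rightarrow> nat \<Rightarrow> 'a set" where
  "walk_above X x k = {w \<in> space M. \<forall>j\<le>k. - x \<le> (\<Sum>i<j. X i w)}"

lemma walk_above_measurable:
  assumes "\<And>i. i < k \<Longrightarrow> X i \<in> borel_measurable M"
  shows "walk_above X x k \<in> events"
proof -
  have "walk_above X x k = space M \<inter> (\<Inter>j\<in>{..k}. {w \<in> space M. - x \<le> (\<Sum>i<j. X i w)})"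
    by (auto simp: walk_above_def)
  also have "\<dots> \<in> events"
    using assms by (intro sets.Int sets.finite_INT sets.top borel_measurable_le borel_measurable_sum) auto
  finally show ?thesis .
qed

text \<open>The event concerns the first k steps only, so the next increment is independent of it.
  On the event the exponential of the walk is bounded by B, hence only the single increment needs an
  integrability assumption.\<close>

lemma walk_exp_step:
  fixes e :: "real \<Rightarrow> 'b::{real_normed_field, banach, second_countable_topology}"
  assumes ind: "indep_vars (\<lambda>_. borel) X {..<Suc k}"
    and e [measurable]: "e \<in> borel_measurable borel" and e_add: "\<And>s y. e (s + y) = e s * e y"
    and bound: "\<And>y. - x \<le> y \<Longrightarrow> norm (e y) \<le> B"
    and inte: "integrable M (\<lambda>w. e (X k w))"
  shows "integrable M (\<lambda>w. e (\<Sum>i<k. X i w) * indicator (walk_above X x k) w)"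
    and "integrable M (\<lambda>w. e (\<Sum>i<Suc k. X i w) * indicator (walk_above X x k) w)"
    and "(\<integral>w. e (\<Sum>i<Suc k. X i w) * indicator (walk_above X x k) w \<partial>M) =
      (\<integral>w. e (\<Sum>i<k. X i w) * indicator (walk_above X x k) w \<partial>M) * (\<integral>w. e (X k w) \<partial>M)"
proof -
  have X[measurable]: "X i \<in> borel_measurable M" if "i < Suc k" for i
    using ind that by (auto simp: indep_vars_def)
  have wa: "walk_above X x k \<in> events" by (rule walk_above_measurable) auto
  have B: "0 \<le> B" using bound[of "max 0 (-x)"] norm_ge_zero order_trans by (metis max.cobounded2)
  define f where "f = (\<lambda>z::nat\<Rightarrow>real. e (\<Sum>i<k. z i) * (if \<forall>j\<in>{..k}. - x \<le> (\<Sum>i<j. z i) then 1 else 0))"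
  have fm: "f \<in> borel_measurable (PiM {..<k} (\<lambda>_. borel))"
  proof -
    have "Measurable.pred (PiM {..<k} (\<lambda>_. borel)) (\<lambda>z::nat\<Rightarrow>real. \<forall>j\<in>{..k}. - x \<le> (\<Sum>i<j. z i))"
      by (rule pred_intros_finite) (auto intro!: borel_measurable_sum measurable_component_singleton)
    then show ?thesis unfolding f_def
      by (intro borel_measurable_times measurable_If measurable_compose[OF _ e] borel_measurable_sum) auto
  qed
  have fX: "f (\<lambda>i\<in>{..<k}. X i w) = e (\<Sum>i<k. X i w) * indicator (walk_above X x k) w" if "w \<in> space M" for w
  proof -
    have "(\<Sum>i<j. (\<lambda>i\<in>{..<k}. X i w) i) = (\<Sum>i<j. X i w)" if "j \<le> k" for j
      using that by (intro sum.cong) auto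
    then show ?thesis using that by (auto simp: f_def walk_above_def indicator_def)
  qed
  show int1: "integrable M (\<lambda>w. e (\<Sum>i<k. X i w) * indicator (walk_above X x k) w)"
    using wa B bound
    by (intro integrable_const_bound[of _ B] borel_measurable_times borel_measurable_indicator measurable_compose[OF _ e] borel_measurable_sum)
      (auto simp: indicator_def norm_mult walk_above_def)
  have intf: "integrable M (\<lambda>w. f (\<lambda>i\<in>{..<k}. X i w))"
    using int1 fX by (simp cong: Bochner_Integration.integrable_cong)
  note step = indep_walk_step[OF ind fm e intf inte]
  have eq: "f (\<lambda>i\<in>{..<k}. X i w) * e (X k w) = e (\<Sum>i<Suc k. X i w) * indicator (walk_above X x k) w" if "w \<in> space M" for w
    using fX[OF that] by (simp add: e_add)
  show "integrable M (\<lambda>w. e (\<Sum>i<Suc k. X i w) * indicator (walk_above X x k) w)"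
  proof -
    have "integrable M (\<lambda>w. f (\<lambda>i\<in>{..<k}. X i w) * e (X k w)) \<longleftrightarrow>
        integrable M (\<lambda>w. e (\<Sum>i<Suc k. X i w) * indicator (walk_above X x k) w)"
      by (intro Bochner_Integration.integrable_cong refl eq)
    with step(1) show ?thesis by blast
  qed
  show "(\<integral>w. e (\<Sum>i<Suc k. X i w) * indicator (walk_above X x k) w \<partial>M) =
      (\<integral>w. e (\<Sum>i<k. X i w) * indicator (walk_above X x k) w \<partial>M) * (\<integral>w. e (X k w) \<partial>M)"
  proof -
    have "(\<integral>w. f (\<lambda>i\<in>{..<k}. X i w) * e (X k w) \<partial>M) =
        (\<integral>w. e (\<Sum>i<Suc k. X i w) * indicator (walk_above X x k) w \<partial>M)"
      by (intro Bochner_Integration.integral_cong refl eq)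
    moreover have "(\<integral>w. f (\<lambda>i\<in>{..<k}. X i w) \<partial>M) = (\<integral>w. e (\<Sum>i<k. X i w) * indicator (walk_above X x k) w \<partial>M)"
      by (intro Bochner_Integration.integral_cong refl fX)
    ultimately show ?thesis using step(2) by metis
  qed
qed

text \<open>Let V k be the exponential moment on the event of staying above \<open>-1\<close> for k
  steps. One step multiplies it by g and loses at most \<open>exp (2 * a)\<close> times the
  probability of leaving at that step, since an exit from above \<open>-1\<close> cannot land below
  \<open>-2\<close>. For \<open>g > 1\<close> this accumulates to a lower bound of V N by g^N times
  one minus \<open>exp (2 * a)\<close> times the probability of ever leaving. The threshold in
  \<open>above\<close> makes that factor at least 1/2, and V N is at most
  \<open>exp a\<close>.\<close>

lemma walk_exp_moment_le:
  assumes ind: "indep_vars (\<lambda>_. borel) X {..<N}"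
    and lb: "\<And>i w. i < N \<Longrightarrow> w \<in> space M \<Longrightarrow> -1 \<le> X i w"
    and a: "0 \<le> a" and g: "\<And>i. i < N \<Longrightarrow> (\<integral>w. exp (- a * X i w) \<partial>M) = g"
    and above: "prob (walk_above X 1 N) \<ge> 1 - exp (- (2 * a)) / 2"
  shows "g ^ N \<le> 2 * exp (2 * a)"
proof (cases "g \<le> 1")
  case True
  have "0 \<le> g" if "N > 0" using g[OF that] by (metis Bochner_Integration.integral_nonneg exp_ge_zero)
  then have "g ^ N \<le> 1" using True by (cases "N = 0") (auto intro: power_le_one)
  also have "1 \<le> 2 * exp (2 * a)" using a by (smt (verit) one_le_exp_iff)
  finally show ?thesis .
next
  case False
  have X[measurable]: "X i \<in> borel_measurable M" if "i < N" for i
    using ind that by (auto simp: indep_vars_def)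
  define e :: "real \<Rightarrow> real" where "e = (\<lambda>y. exp (- a * y))"
  have e[measurable]: "e \<in> borel_measurable borel" by (simp add: e_def)
  have e_add: "e (s + y) = e s * e y" for s y by (simp add: e_def exp_add[symmetric] algebra_simps)
  have e_bound: "norm (e y) \<le> exp a" if "- 1 \<le> y" for y
    using a that mult_left_mono[of "-1" y a] by (simp add: e_def)
  have inte: "integrable M (\<lambda>w. e (X k w))" if "k < N" for k
    using that lb[OF that] e_bound by (intro integrable_const_bound[of _ "exp a"] measurable_compose[OF _ e]) auto
  let ?B = "walk_above X 1"
  have B[measurable]: "?B k \<in> events" if "k \<le> N" for k using that by (intro walk_above_measurable) auto
  define V where "V k = (\<integral>w. e (\<Sum>i<k. X i w) * indicator (?B k) w \<partial>M)" for k
  have int_V: "integrable M (\<lambda>w. e (\<Sum>i<k. X i w) * indicator (?B k) w)" if "k \<le> N" for k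
    using that e_bound
    by (intro integrable_const_bound[of _ "exp a"] borel_measurable_times borel_measurable_indicator B measurable_compose[OF _ e] borel_measurable_sum)
      (auto simp: indicator_def walk_above_def)
  have V_le: "V N \<le> exp a"
  proof -
    have "V N \<le> (\<integral>w. exp a \<partial>M)" unfolding V_def
      using int_V
    proof (intro integral_mono)
      fix w show "e (\<Sum>i<N. X i w) * indicator (?B N) w \<le> exp a"
        using e_bound[of "\<Sum>i<N. X i w"] by (auto simp: indicator_def walk_above_def)
    qed auto
    then show ?thesis by (simp add: prob_space)
  qed
  have step: "V k * g \<le> V (Suc k) + exp (2 * a) * (prob (?B k) - prob (?B (Suc k)))" if k: "k < N" for k
  proof -
    have ind_k: "indep_vars (\<lambda>_. borel) X {..<Suc k}" using k by (intro indep_vars_subset[OF ind]) auto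
    note st = walk_exp_step[OF ind_k e e_add e_bound inte[OF k]]
    have sub: "?B (Suc k) \<subseteq> ?B k" by (auto simp: walk_above_def)
    have "V k * g = (\<integral>w. e (\<Sum>i<Suc k. X i w) * indicator (?B k) w \<partial>M)"
      using st(3) g[OF k] by (simp add: V_def e_def)
    also have "\<dots> \<le> (\<integral>w. e (\<Sum>i<Suc k. X i w) * indicator (?B (Suc k)) w + exp (2 * a) * indicator (?B k - ?B (Suc k)) w \<partial>M)"
    proof (rule integral_mono[OF st(2)])
      show "integrable M (\<lambda>w. e (\<Sum>i<Suc k. X i w) * indicator (?B (Suc k)) w + exp (2 * a) * indicator (?B k - ?B (Suc k)) w)"
        using k
        by (intro Bochner_Integration.integrable_add int_V integrable_mult_right integrable_real_indicator sets.Diff B) (auto simp: emeasure_eq_measure)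
      fix w assume w: "w \<in> space M"
      have "e (\<Sum>i<Suc k. X i w) \<le> exp (2 * a)" if "w \<in> ?B k"
      proof -
        have "- 2 \<le> (\<Sum>i<Suc k. X i w)" using that lb[OF k w] by (auto simp: walk_above_def)
        then show ?thesis using a mult_left_mono[of "-2" "\<Sum>i<Suc k. X i w" a] by (simp add: e_def)
      qed
      then show "e (\<Sum>i<Suc k. X i w) * indicator (?B k) w \<le> e (\<Sum>i<Suc k. X i w) * indicator (?B (Suc k)) w + exp (2 * a) * indicator (?B k - ?B (Suc k)) w"
        using sub by (auto simp: indicator_def simp del: sum.lessThan_Suc)
    qed
    also have "\<dots> = V (Suc k) + exp (2 * a) * prob (?B k - ?B (Suc k))"
      using k int_V[of "Suc k"] unfolding V_def
      by (subst Bochner_Integration.integral_add)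
        (auto simp: emeasure_eq_measure intro!: integrable_mult_right integrable_real_indicator simp del: sum.lessThan_Suc)
    also have "prob (?B k - ?B (Suc k)) = prob (?B k) - prob (?B (Suc k))"
      using k sub by (intro finite_measure_Diff) auto
    finally show ?thesis .
  qed
  have V0: "V 0 = 1" by (simp add: V_def e_def walk_above_def prob_space)
  \<comment> \<open>The loss of each step is inflated by the current power of g, which is at least
    \<open>1\<close>; all losses then carry the same power and the exit probabilities
    telescope.\<close>
  have main: "g ^ k * (1 - exp (2 * a) * (1 - prob (?B k))) \<le> V k" if "k \<le> N" for k
    using that
  proof (induction k)
    case 0
    have "?B 0 = space M" by (auto simp: walk_above_def)
    then show ?case by (simp add: V0 prob_space)
  next
    case (Suc k)
    have mono: "prob (?B (Suc k)) \<le> prob (?B k)" using Suc.prems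
      by (intro finite_measure_mono B) (auto simp: walk_above_def)
    have "g ^ Suc k \<ge> 1" using False by (intro one_le_power) auto
    then have "exp (2 * a) * (prob (?B k) - prob (?B (Suc k))) \<le> g ^ Suc k * (exp (2 * a) * (prob (?B k) - prob (?B (Suc k))))"
      using mono mult_right_mono[of 1 "g ^ Suc k" "exp (2 * a) * (prob (?B k) - prob (?B (Suc k)))"] by simp
    moreover have "g * (g ^ k * (1 - exp (2 * a) * (1 - prob (?B k)))) \<le> g * V k"
      using Suc False by (intro mult_left_mono) auto
    ultimately show ?case using step[of k] Suc.prems by (simp add: algebra_simps)
  qed
  have "exp (2 * a) * (1 - prob (?B N)) \<le> exp (2 * a) * (exp (- (2 * a)) / 2)"
    using above by (intro mult_left_mono) auto
  also have "\<dots> = 1 / 2" by (simp add: exp_minus)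
  finally have "g ^ N * (1 / 2) \<le> g ^ N * (1 - exp (2 * a) * (1 - prob (?B N)))"
    using False by (intro mult_left_mono) auto
  also have "\<dots> \<le> exp a" using main[of N] V_le by simp
  also have "exp a \<le> exp (2 * a)" using a by simp
  finally show ?thesis by simp
qed

end

section \<open>The Laplace exponent\<close>

text \<open>Close to time \<open>0\<close> the values lie in the open right half-plane, so repeated
  halving of the time always selects the square root with positive real part. This fixes g at dyadic
  fractions of one small time, and continuity at \<open>0\<close> carries the formula to all
  times.\<close>

lemma multiplicative_imp_exp:
  fixes g :: "real \<Rightarrow> complex"
  assumes add: "\<And>s t. 0 \<le> s \<Longrightarrow> 0 \<le> t \<Longrightarrow> g (s + t) = g s * g t"
    and lim: "(g \<longlongrightarrow> 1) (at 0 within {0..})" and g0: "g 0 = 1"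
  obtains c where "\<And>t. 0 \<le> t \<Longrightarrow> g t = exp (of_real t * c)"
proof -
  obtain \<delta>' where \<delta>': "\<delta>' > 0" "\<And>s. 0 \<le> s \<Longrightarrow> s < \<delta>' \<Longrightarrow> dist (g s) 1 < 1"
  proof -
    have "\<forall>\<^sub>F s in at 0 within {0..}. dist (g s) 1 < 1" using tendstoD[OF lim, of 1] by simp
    then obtain d where d: "d > 0" "\<forall>x\<in>{0..}. x \<noteq> 0 \<and> x < d \<longrightarrow> dist (g x) 1 < 1"
      unfolding eventually_at by (auto simp: dist_real_def)
    show thesis
    proof (rule that[OF d(1)])
      fix s :: real assume "0 \<le> s" "s < d"
      then show "dist (g s) 1 < 1" using d(2) g0 by (cases "s = 0") auto
    qed
  qed
  define \<delta> where "\<delta> = \<delta>' / 2"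
  have \<delta>: "\<delta> > 0" using \<delta>'(1) by (simp add: \<delta>_def)
  have Re_pos: "Re (g s) > 0" if "0 \<le> s" "s \<le> \<delta>" for s
  proof -
    have "norm (1 - g s) < 1" using \<delta>'(2)[of s] that \<delta> by (simp add: \<delta>_def dist_norm norm_minus_commute)
    then have "\<bar>Re (1 - g s)\<bar> < 1" using abs_Re_le_cmod order_le_less_trans by blast
    then show ?thesis by simp
  qed
  define L where "L = Ln (g \<delta>)"
  have nz: "g \<delta> \<noteq> 0" using Re_pos[of \<delta>] \<delta> by auto
  have expL: "exp L = g \<delta>" using nz by (simp add: L_def)
  have ImL: "\<bar>Im L\<bar> < pi / 2" using Re_Ln_pos_lt[OF nz] Re_pos[of \<delta>] \<delta> by (auto simp: L_def)
  have Im_div: "Im (L / 2 ^ k) = Im L / 2 ^ k" for k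
    using Im_divide_of_real[of L "2 ^ k"] by simp
  have cos_pos: "0 < cos y" if "\<bar>y\<bar> < pi / 2" for y
    using that by (intro cos_gt_zero_pi) auto
  have dyadic: "g (\<delta> / 2 ^ n) = exp (L / 2 ^ n)" for n
  proof (induction n)
    case 0 then show ?case by (simp add: expL)
  next
    case (Suc n)
    let ?s = "\<delta> / 2 ^ Suc n"
    have "g ?s * g ?s = g (\<delta> / 2 ^ n)" using add[of ?s ?s] \<delta> by simp
    also have "\<dots> = exp (L / 2 ^ Suc n) * exp (L / 2 ^ Suc n)" by (simp add: Suc exp_add[symmetric])
    finally have "(g ?s)\<^sup>2 = (exp (L / 2 ^ Suc n))\<^sup>2" by (simp add: power2_eq_square)
    then have "g ?s = exp (L / 2 ^ Suc n) \<or> g ?s = - exp (L / 2 ^ Suc n)" by (simp add: power2_eq_iff)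
    moreover have "Re (exp (L / 2 ^ Suc n)) > 0"
    proof -
      have "\<bar>Im (L / 2 ^ Suc n)\<bar> = \<bar>Im L\<bar> / 2 ^ Suc n"
        unfolding Im_div by (simp only: abs_divide abs_of_pos zero_less_power zero_less_numeral)
      also have "\<dots> \<le> \<bar>Im L\<bar>" 
      proof -
        have "(1::real) \<le> 2 ^ Suc n" by (rule one_le_power) simp
        then have "\<bar>Im L\<bar> / 2 ^ Suc n \<le> \<bar>Im L\<bar> / 1" by (intro divide_left_mono) auto
        then show ?thesis by simp
      qed
      finally have "\<bar>Im (L / 2 ^ Suc n)\<bar> < pi / 2" using ImL by simp
      then have "cos (Im (L / 2 ^ Suc n)) > 0" by (rule cos_pos)
      then show ?thesis unfolding Re_exp by (intro mult_pos_pos exp_gt_zero)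
    qed
    moreover have "Re (g ?s) > 0"
    proof (rule Re_pos)
      have "(1::real) \<le> 2 ^ Suc n" by (rule one_le_power) simp
      then have "\<delta> / 2 ^ Suc n \<le> \<delta> / 1" using \<delta> by (intro divide_left_mono) auto
      then show "\<delta> / 2 ^ Suc n \<le> \<delta>" by simp
    qed (use \<delta> in simp)
    ultimately show ?case by fastforce
  qed
  have mult: "g (of_nat k * s) = g s ^ k" if "0 \<le> s" for k s
    by (induction k) (use g0 add[of s] that in \<open>auto simp: distrib_right\<close>)
  define c where "c = L / of_real \<delta>"
  show thesis
  proof (rule that)
    fix t :: real assume t: "0 \<le> t"
    \<comment> \<open>The largest multiple of \<open>\<delta> / 2 ^ n\<close> not exceeding t; the
      remainder r n tends to \<open>0\<close> from the right, where g tends to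
      \<open>1\<close>.\<close>
    define k where "k n = nat \<lfloor>t * 2 ^ n / \<delta>\<rfloor>" for n :: nat
    define r where "r n = t - of_nat (k n) * (\<delta> / 2 ^ n)" for n
    have fl: "of_nat (k n) \<le> t * 2 ^ n / \<delta>" "t * 2 ^ n / \<delta> < of_nat (k n) + 1" for n
      using t \<delta> by (auto simp: k_def)
    have r: "0 \<le> r n" "r n \<le> \<delta> / 2 ^ n" for n
    proof -
      define q where "q = \<delta> / 2 ^ n"
      have q: "q > 0" using \<delta> by (simp add: q_def)
      have "t * 2 ^ n / \<delta> = t / q" by (simp add: q_def)
      then have "of_nat (k n) \<le> t / q" "t / q < of_nat (k n) + 1" using fl[of n] by auto
      then have "of_nat (k n) * q \<le> t" "t < (of_nat (k n) + 1) * q"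
        using q by (auto simp: pos_le_divide_eq pos_divide_less_eq)
      then show "0 \<le> r n" "r n \<le> \<delta> / 2 ^ n"
        unfolding r_def q_def[symmetric] by (auto simp: algebra_simps)
    qed
    have r0: "r \<longlonglongrightarrow> 0"
    proof (rule tendsto_sandwich[OF _ _ tendsto_const])
      have "(\<lambda>n. \<delta> * (1/2) ^ n) \<longlonglongrightarrow> \<delta> * 0" by (intro tendsto_mult tendsto_const LIMSEQ_power_zero) auto
      then show "(\<lambda>n. \<delta> / 2 ^ n) \<longlonglongrightarrow> 0" by (simp add: power_divide)
    qed (use r in auto)
    have gr: "(\<lambda>n. g (r n)) \<longlonglongrightarrow> 1"
    proof -
      have "continuous (at 0 within {0..}) g" using lim g0 by (simp add: continuous_within)
      from continuous_within_tendsto_compose[OF this, of r sequentially] r r0 g0 show ?thesis by simp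
    qed
    have eq: "g t = exp (of_real (t - r n) * c) * g (r n)" for n
    proof -
      have "g t = g (of_nat (k n) * (\<delta> / 2 ^ n)) * g (r n)"
        using add[of "of_nat (k n) * (\<delta> / 2 ^ n)" "r n"] r \<delta> by (simp add: r_def)
      also have "g (of_nat (k n) * (\<delta> / 2 ^ n)) = exp (of_nat (k n) * (L / 2 ^ n))"
      proof -
        have "g (of_nat (k n) * (\<delta> / 2 ^ n)) = g (\<delta> / 2 ^ n) ^ k n"
          by (rule mult) (use \<delta> in simp)
        then show ?thesis by (simp only: dyadic exp_of_nat_mult)
      qed
      also have "of_nat (k n) * (L / 2 ^ n) = of_real (t - r n) * c"
        using \<delta> by (simp add: r_def c_def)
      finally show ?thesis .
    qed
    have "(\<lambda>n. exp (of_real (t - r n) * c) * g (r n)) \<longlonglongrightarrow> exp (of_real (t - 0) * c) * 1"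
      by (intro tendsto_intros r0 gr)
    moreover have "(\<lambda>n. exp (of_real (t - r n) * c) * g (r n)) = (\<lambda>n. g t)" using eq by auto
    ultimately show "g t = exp (of_real t * c)" by (simp add: LIMSEQ_const_iff)
  qed
qed

lemma exp_scaling_unique:
  fixes c c' :: complex
  assumes eq: "\<And>t. 0 \<le> t \<Longrightarrow> exp (of_real t * c) = exp (of_real t * c')"
  shows "c = c'"
proof (rule ccontr)
  assume "c \<noteq> c'"
  define d where "d = c - c'"
  have d: "exp (of_real t * d) = 1" if "0 \<le> t" for t
    using eq[OF that] by (simp add: d_def right_diff_distrib exp_diff)
  have "Re d = 0" using d[of 1] by (simp add: exp_eq_1)
  then have Im: "Im d \<noteq> 0" using \<open>c \<noteq> c'\<close> by (auto simp: d_def complex_eq_iff)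
  \<comment> \<open>At this time the exponent is plus or minus pi times the imaginary unit, with
    exponential \<open>-1\<close>. A single fixed time would determine c only up to a
    period.\<close>
  then obtain n where "pi / \<bar>Im d\<bar> * Im d = of_int (2 * n) * pi"
    using d[of "pi / \<bar>Im d\<bar>"] by (auto simp: exp_eq_1)
  moreover have "pi / \<bar>Im d\<bar> * Im d = pi \<or> pi / \<bar>Im d\<bar> * Im d = - pi"
    using Im by (cases "Im d > 0") auto
  ultimately have "of_int (2 * n) * pi = 1 * pi \<or> of_int (2 * n) * pi = (- 1) * pi" by auto
  then have "(of_int (2 * n) :: real) = of_int 1 \<or> (of_int (2 * n) :: real) = of_int (- 1)"
    unfolding mult_cancel_right by auto
  then have "2 * n = 1 \<or> 2 * n = - 1" unfolding of_int_eq_iff .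
  then show False by presburger
qed

context levy_process
begin

definition increment :: "real \<Rightarrow> nat \<Rightarrow> 'a \<Rightarrow> real" where
  "increment h k w = Y (real (Suc k) * h) w - Y (real k * h) w"

lemma increment_measurable: "0 \<le> h \<Longrightarrow> increment h k \<in> borel_measurable M"
  unfolding increment_def by (intro borel_measurable_diff random_variable_Y) auto

lemma indep_increments: "0 \<le> h \<Longrightarrow> indep_vars (\<lambda>_. borel) (increment h) {..<n}"
  using independent_increments[of "\<lambda>k. real k * h" n]
  by (simp add: increment_def[abs_def] mult_right_mono)

lemma sum_increment: "w \<in> space M \<Longrightarrow> (\<Sum>i<k. increment h i w) = Y (real k * h) w"
  by (induction k) (auto simp: increment_def Y_zero)

lemma distr_increment: "0 \<le> h \<Longrightarrow> distr M borel (increment h k) = distr M borel (Y h)"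
  using stationary_increments[of "real k * h" h]
  by (simp add: increment_def[abs_def] algebra_simps)

lemma integrable_increment:
  fixes e :: "real \<Rightarrow> 'b::{banach, second_countable_topology}"
  assumes h: "0 \<le> h" and e: "e \<in> borel_measurable borel"
  shows "integrable M (\<lambda>w. e (increment h k w)) \<longleftrightarrow> integrable M (\<lambda>w. e (Y h w))"
  using integrable_distr_eq[OF increment_measurable[OF h] e, of k] integrable_distr_eq[OF random_variable_Y[OF h] e]
  by (simp add: distr_increment[OF h])

lemma integral_increment:
  fixes e :: "real \<Rightarrow> 'b::{banach, second_countable_topology}"
  assumes h: "0 \<le> h" and e: "e \<in> borel_measurable borel"
  shows "(\<integral>w. e (increment h k w) \<partial>M) = (\<integral>w. e (Y h w) \<partial>M)"
  using integral_distr[OF increment_measurable[OF h] e, of k] integral_distr[OF random_variable_Y[OF h] e]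
  by (simp add: distr_increment[OF h])

end

section \<open>Finiteness of exponential moments\<close>

context spectrally_positive_levy_process
begin

text \<open>Paths start at \<open>0\<close> and are right-continuous, so the events of staying above
  \<open>-1\<close> up to time 1/(n+1) increase to the whole space. Testing rational times suffices
  by right-continuity, but only strictly before the end of the interval, which is why
  \<open>t0\<close> is half its length.\<close>

lemma prob_stays_above_near_zero:
  assumes e: "0 < e"
  obtains t0 A where "t0 > 0" "A \<in> events" "prob A \<ge> 1 - e"
    "\<And>w t. w \<in> A \<Longrightarrow> 0 \<le> t \<Longrightarrow> t \<le> t0 \<Longrightarrow> - 1 \<le> Y t w"
proof -
  define I where "I n = {r \<in> \<rat>. 0 \<le> r \<and> r \<le> 1 / real (Suc n)}" for n
  define D where "D n = {w \<in> space M. \<forall>s\<in>I n. - 1 \<le> Y s w}" for n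
  have cI: "countable (I n)" for n unfolding I_def by (rule countable_subset[OF _ countable_rat]) auto
  have D_meas: "D n \<in> events" for n
  proof -
    have 0: "0 \<in> I n" by (simp add: I_def)
    then have "D n = (\<Inter>s\<in>I n. {w \<in> space M. - 1 \<le> Y s w})" by (auto simp: D_def)
    also have "\<dots> \<in> events"
      using 0 by (intro sets.countable_INT' cI)
        (auto intro!: borel_measurable_le borel_measurable_const random_variable_Y simp: I_def)
    finally show ?thesis .
  qed
  have D_above: "- 1 \<le> Y t w" if w: "w \<in> D n" and t: "0 \<le> t" "t < 1 / real (Suc n)" for n w t
  proof (rule ccontr)
    assume "\<not> - 1 \<le> Y t w"
    moreover have ws: "w \<in> space M" using w by (simp add: D_def)
    ultimately obtain d l where d: "d > 0" "\<And>s. t \<le> s \<Longrightarrow> s < t + d \<Longrightarrow> \<bar>Y s w - Y t w\<bar> < - 1 - Y t w"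
      using path_local[OF ws t(1), of "- 1 - Y t w"] by (smt (verit))
    obtain r where r: "r \<in> \<rat>" "t < r" "r < min (t + d) (1 / real (Suc n))"
      using Rats_dense_in_real[of t "min (t + d) (1 / real (Suc n))"] t d(1) by auto
    then have "r \<in> I n" using t by (auto simp: I_def)
    then have "- 1 \<le> Y r w" using w by (simp add: D_def)
    with d(2)[of r] r show False by auto
  qed
  have "incseq D"
  proof (rule incseq_SucI)
    fix n
    have "I (Suc n) \<subseteq> I n" by (auto simp: I_def field_simps intro: order_trans)
    then show "D n \<le> D (Suc n)" by (auto simp: D_def)
  qed
  moreover have "(\<Union>n. D n) = space M"
  proof
    show "space M \<subseteq> (\<Union>n. D n)"
    proof
      fix w assume w: "w \<in> space M"
      obtain d l where d: "d > 0" "\<And>s. 0 \<le> s \<Longrightarrow> s < 0 + d \<Longrightarrow> \<bar>Y s w - Y 0 w\<bar> < 1"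
        by (rule path_local[OF w, of 0 1]) auto
      obtain n where "inverse (real (Suc n)) < d" using reals_Archimedean d(1) by blast
      then have "w \<in> D n" using d(2) w Y_zero[OF w] by (fastforce simp: D_def I_def inverse_eq_divide)
      then show "w \<in> (\<Union>n. D n)" by blast
    qed
  qed (auto simp: D_def)
  ultimately have "(\<lambda>n. prob (D n)) \<longlonglongrightarrow> 1"
    using finite_Lim_measure_incseq[of D] D_meas by (auto simp: prob_space image_subset_iff)
  from LIMSEQ_D[OF this e] obtain n where "norm (prob (D n) - 1) < e" by blast
  then have "prob (D n) \<ge> 1 - e" by auto
  then show thesis
    using D_above by (intro that[of "1 / real (Suc n) / 2" "D n"] D_meas) (auto simp: field_simps)
qed

text \<open>Cutting the grid increments off below \<open>-1\<close> makes
  \<open>walk_exp_moment_le\<close> applicable, and since the cut only raises the walk, it stays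
  above \<open>-1\<close> whenever Y does. By \<open>uniformly_small_drops\<close> a fine enough
  grid has no increment left to cut along a given path, so the products converge pointwise to the
  exponential of \<open>- a * Y t\<close>, and Fatou's lemma transfers the uniform bound.\<close>

lemma exp_moment_small_time:
  assumes a: "0 \<le> a"
  obtains t0 where "t0 > 0" "\<And>t. 0 \<le> t \<Longrightarrow> t \<le> t0 \<Longrightarrow> integrable M (\<lambda>w. exp (- a * Y t w))"
    "\<And>t. 0 \<le> t \<Longrightarrow> t \<le> t0 \<Longrightarrow> (\<integral>w. exp (- a * Y t w) \<partial>M) \<le> 2 * exp (2 * a)"
proof -
  obtain t0 A where t0: "t0 > 0" and A: "A \<in> events" "prob A \<ge> 1 - exp (- (2 * a)) / 2"
    and above: "\<And>w t. w \<in> A \<Longrightarrow> 0 \<le> t \<Longrightarrow> t \<le> t0 \<Longrightarrow> - 1 \<le> Y t w"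
    using prob_stays_above_near_zero[of "exp (- (2 * a)) / 2"] by auto
  have main: "integrable M (\<lambda>w. exp (- a * Y t w)) \<and> (\<integral>w. exp (- a * Y t w) \<partial>M) \<le> 2 * exp (2 * a)"
    if t: "0 \<le> t" "t \<le> t0" for t
  proof -
    define h where "h n = t / real (Suc n)" for n
    have h: "0 \<le> h n" for n using t by (simp add: h_def)
    define X where "X n i w = max (increment (h n) i w) (- 1)" for n i w
    have X_meas[measurable]: "X n i \<in> borel_measurable M" for n i
      unfolding X_def using increment_measurable[OF h] by (intro borel_measurable_max) auto
    have indX: "indep_vars (\<lambda>_. borel) (X n) {..<Suc n}" for n
      using indep_vars_compose2[OF indep_increments[OF h], of "Suc n" "\<lambda>_ x. max x (- 1)" "\<lambda>_. borel"]
      by (simp add: X_def[abs_def])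
    define g where "g n = (\<integral>w. exp (- a * max (Y (h n) w) (- 1)) \<partial>M)" for n
    have gX: "(\<integral>w. exp (- a * X n i w) \<partial>M) = g n" for n i
      unfolding X_def g_def using integral_increment[OF h, of "\<lambda>x. exp (- a * max x (- 1))"] by simp
    have intX: "integrable M (\<lambda>w. exp (- a * X n i w))" for n i
    proof (rule integrable_const_bound[of _ "exp a"])
      have "- (a * X n i w) \<le> a" for w
        using mult_left_mono[of "- 1" "X n i w" a] a by (simp add: X_def)
      then show "AE w in M. norm (exp (- a * X n i w)) \<le> exp a" by simp
    qed simp
    have g_le: "g n ^ Suc n \<le> 2 * exp (2 * a)" for n
    proof (rule walk_exp_moment_le[OF indX])
      have "A \<subseteq> walk_above (X n) 1 (Suc n)"
      proof
        fix w assume w: "w \<in> A"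
        then have ws: "w \<in> space M" using A(1) sets.sets_into_space by blast
        have "- 1 \<le> (\<Sum>i<j. X n i w)" if j: "j \<le> Suc n" for j
        proof -
          have "real j * h n \<le> real (Suc n) * h n" using j h by (intro mult_right_mono) auto
          also have "\<dots> = t" by (simp add: h_def)
          finally have "real j * h n \<le> t" .
          then have "- 1 \<le> Y (real j * h n) w" using above[OF w] h[of n] t by simp
          also have "\<dots> = (\<Sum>i<j. increment (h n) i w)" using sum_increment[OF ws] by simp
          also have "\<dots> \<le> (\<Sum>i<j. X n i w)" by (intro sum_mono) (auto simp: X_def)
          finally show ?thesis .
        qed
        then show "w \<in> walk_above (X n) 1 (Suc n)" using ws by (simp add: walk_above_def)
      qed
      then have "prob A \<le> prob (walk_above (X n) 1 (Suc n))"
        by (intro finite_measure_mono walk_above_measurable X_meas)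
      then show "1 - exp (- (2 * a)) / 2 \<le> prob (walk_above (X n) 1 (Suc n))" using A(2) by simp
    qed (use a gX in \<open>auto simp: X_def\<close>)
    define P where "P n w = (\<Prod>i<Suc n. exp (- a * X n i w))" for n w
    have P_int: "integrable M (P n)" "(\<integral>w. P n w \<partial>M) = g n ^ Suc n" for n
    proof -
      have ind: "indep_vars (\<lambda>_. borel) (\<lambda>i w. exp (- a * X n i w)) {..<Suc n}"
        by (rule indep_vars_compose2[OF indX]) auto
      show "integrable M (P n)" unfolding P_def by (rule indep_vars_integrable[OF _ ind intX]) simp
      show "(\<integral>w. P n w \<partial>M) = g n ^ Suc n"
        unfolding P_def by (subst indep_vars_lebesgue_integral[OF _ ind intX]) (simp_all only: gX, auto)
    qed
    have P_nn: "(\<integral>\<^sup>+w. P n w \<partial>M) \<le> ennreal (2 * exp (2 * a))" for n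
    proof -
      have "(\<integral>\<^sup>+w. P n w \<partial>M) = ennreal (g n ^ Suc n)"
        unfolding P_int(2)[symmetric] by (intro nn_integral_eq_integral P_int AE_I2) (auto simp: P_def intro!: mult_nonneg_nonneg prod_nonneg)
      also have "\<dots> \<le> ennreal (2 * exp (2 * a))" by (intro ennreal_leI g_le)
      finally show ?thesis .
    qed
    have lim: "(\<lambda>n. P n w) \<longlonglongrightarrow> exp (- a * Y t w)" if w: "w \<in> space M" for w
    proof -
      obtain \<delta> where \<delta>: "\<delta> > 0" "\<And>s u. 0 \<le> s \<Longrightarrow> s \<le> u \<Longrightarrow> u \<le> t \<Longrightarrow> u - s < \<delta> \<Longrightarrow> Y u w - Y s w > - 1"
        using uniformly_small_drops[OF w zero_less_one t(1)] by metis
      have "(\<lambda>n. t * inverse (real (Suc n))) \<longlonglongrightarrow> t * 0" by (intro tendsto_mult tendsto_const LIMSEQ_inverse_real_of_nat)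
      then have "eventually (\<lambda>n. t * inverse (real (Suc n)) < \<delta>) sequentially"
        using order_tendstoD(2)[of _ "t * 0" sequentially \<delta>] \<delta>(1) by simp
      then have "eventually (\<lambda>n. P n w = exp (- a * Y t w)) sequentially"
      proof eventually_elim
        case (elim n)
        have "X n i w = increment (h n) i w" if "i < Suc n" for i
        proof -
          have "real (Suc i) * h n \<le> real (Suc n) * h n" using that h by (intro mult_right_mono) auto
          also have "\<dots> = t" by (simp add: h_def)
          finally have "real (Suc i) * h n \<le> t" .
          then have "increment (h n) i w > - 1"
            unfolding increment_def
          proof (intro \<delta>(2))
            show "real (Suc i) * h n - real i * h n < \<delta>" using elim by (simp add: algebra_simps h_def divide_inverse)
            show "real i * h n \<le> real (Suc i) * h n" by (intro mult_right_mono h) simp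
            show "real (Suc i) * h n \<le> t" by fact
          qed (simp add: h)
          then show ?thesis by (simp add: X_def)
        qed
        then have "P n w = exp (- a * (\<Sum>i<Suc n. increment (h n) i w))"
          by (simp add: P_def exp_sum[symmetric] sum_distrib_left del: sum.lessThan_Suc prod.lessThan_Suc)
        also have "(\<Sum>i<Suc n. increment (h n) i w) = Y t w"
          by (subst sum_increment[OF w]) (simp add: h_def)
        finally show ?case .
      qed
      then show ?thesis by (rule tendsto_eventually)
    qed
    have "(\<integral>\<^sup>+w. ennreal (exp (- a * Y t w)) \<partial>M) = (\<integral>\<^sup>+w. liminf (\<lambda>n. ennreal (P n w)) \<partial>M)"
      using lim by (intro nn_integral_cong lim_imp_Liminf[symmetric] tendsto_ennrealI) auto
    also have "\<dots> \<le> liminf (\<lambda>n. \<integral>\<^sup>+w. ennreal (P n w) \<partial>M)"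
      by (intro nn_integral_liminf) (auto simp: P_def)
    also have "\<dots> \<le> ennreal (2 * exp (2 * a))"
      by (rule Liminf_le) (auto intro!: always_eventually P_nn)
    finally have nn: "(\<integral>\<^sup>+w. ennreal (exp (- a * Y t w)) \<partial>M) \<le> ennreal (2 * exp (2 * a))" .
    have "integrable M (\<lambda>w. exp (- a * Y t w))"
      using nn random_variable_Y[OF t(1)] by (intro integrableI_bounded) (auto simp: top.not_eq_extremum intro: le_less_trans)
    then show ?thesis using nn by (simp add: nn_integral_eq_integral)
  qed
  show thesis using t0 main by (intro that[of t0]) auto
qed

lemma exp_moment_bounded:
  assumes a: "0 \<le> a"
  obtains B where "\<And>t. 0 \<le> t \<Longrightarrow> t \<le> T \<Longrightarrow> integrable M (\<lambda>w. exp (- a * Y t w)) \<and> (\<integral>w. exp (- a * Y t w) \<partial>M) \<le> B"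
proof -
  obtain t0 where t0: "t0 > 0" "\<And>t. 0 \<le> t \<Longrightarrow> t \<le> t0 \<Longrightarrow> integrable M (\<lambda>w. exp (- a * Y t w))"
    "\<And>t. 0 \<le> t \<Longrightarrow> t \<le> t0 \<Longrightarrow> (\<integral>w. exp (- a * Y t w) \<partial>M) \<le> 2 * exp (2 * a)"
    using exp_moment_small_time[OF a] by metis
  obtain n where n: "T / t0 < real n" using reals_Archimedean2 by blast
  show thesis
  proof (rule that[of "(2 * exp (2 * a)) ^ Suc n"])
    fix t assume t: "0 \<le> t" "t \<le> T"
    define h where "h = t / real (Suc n)"
    have h: "0 \<le> h" "h \<le> t0" using t n t0(1) by (auto simp: h_def field_simps)
    have e: "(\<lambda>x. exp (- a * x)) \<in> borel_measurable borel" by simp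
    have ind: "indep_vars (\<lambda>_. borel) (\<lambda>i w. exp (- a * increment h i w)) {..<Suc n}"
      by (rule indep_vars_compose2[OF indep_increments[OF h(1)]]) auto
    have int: "integrable M (\<lambda>w. exp (- a * increment h i w))" for i
      using integrable_increment[OF h(1) e] t0(2)[OF h] by simp
    have eq: "(\<Prod>i<Suc n. exp (- a * increment h i w)) = exp (- a * Y t w)" if "w \<in> space M" for w
    proof -
      have "(\<Prod>i<Suc n. exp (- a * increment h i w)) = exp (- a * (\<Sum>i<Suc n. increment h i w))"
        by (simp add: exp_sum[symmetric] sum_distrib_left del: sum.lessThan_Suc prod.lessThan_Suc)
      also have "(\<Sum>i<Suc n. increment h i w) = Y t w"
        by (subst sum_increment[OF that]) (simp add: h_def)
      finally show ?thesis .
    qed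
    have "integrable M (\<lambda>w. \<Prod>i<Suc n. exp (- a * increment h i w))"
      by (rule indep_vars_integrable[OF _ ind int]) simp
    moreover have "integrable M (\<lambda>w. \<Prod>i<Suc n. exp (- a * increment h i w)) \<longleftrightarrow> integrable M (\<lambda>w. exp (- a * Y t w))"
      by (intro Bochner_Integration.integrable_cong refl eq)
    moreover have "(\<integral>w. exp (- a * Y t w) \<partial>M) = (\<integral>w. (\<Prod>i<Suc n. exp (- a * increment h i w)) \<partial>M)"
      by (intro Bochner_Integration.integral_cong refl eq[symmetric])
    moreover have "\<dots> = (\<Prod>i<Suc n. \<integral>w. exp (- a * increment h i w) \<partial>M)"
      by (rule indep_vars_lebesgue_integral[OF _ ind int]) simp
    moreover have "\<dots> = (\<integral>w. exp (- a * Y h w) \<partial>M) ^ Suc n"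
      by (subst integral_increment[OF h(1) e]) simp
    moreover have "\<dots> \<le> (2 * exp (2 * a)) ^ Suc n"
      by (intro power_mono t0(3)[OF h] Bochner_Integration.integral_nonneg) auto
    ultimately show "integrable M (\<lambda>w. exp (- a * Y t w)) \<and> (\<integral>w. exp (- a * Y t w) \<partial>M) \<le> (2 * exp (2 * a)) ^ Suc n"
      by metis
  qed
qed

lemma exp_integrable: "0 \<le> a \<Longrightarrow> 0 \<le> t \<Longrightarrow> integrable M (\<lambda>w. exp (- a * Y t w))"
  using exp_moment_bounded[of a t] by (metis order_refl)

lemma exp_integrable_complex:
  assumes "0 \<le> Re a" "0 \<le> t"
  shows "integrable M (\<lambda>w. exp (- a * complex_of_real (Y t w)))"
proof (rule Bochner_Integration.integrable_bound[OF exp_integrable[OF assms]])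
  show "(\<lambda>w. exp (- a * complex_of_real (Y t w))) \<in> borel_measurable M"
    using random_variable_Y[OF assms(2)] by measurable
qed (auto simp: norm_exp_eq_Re)

section \<open>The semigroup of transforms and its exponent\<close>

definition mgf :: "complex \<Rightarrow> real \<Rightarrow> complex" where
  "mgf a t = (\<integral>w. exp (- a * complex_of_real (Y t w)) \<partial>M)"

lemma mgf_0: "mgf a 0 = 1"
proof -
  have "mgf a 0 = (\<integral>w. 1 \<partial>M)" unfolding mgf_def
    by (intro Bochner_Integration.integral_cong) (auto simp: Y_zero)
  then show ?thesis by (simp add: prob_space)
qed

lemma mgf_add:
  assumes a: "0 \<le> Re a" and st: "0 \<le> s" "0 \<le> t"
  shows "mgf a (s + t) = mgf a s * mgf a t"
proof -
  define \<tau> where "\<tau> i = (if i = 0 then 0 else if i = Suc 0 then s else s + t)" for i :: nat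
  define X where "X i w = Y (\<tau> (Suc i)) w - Y (\<tau> i) w" for i w
  have ind: "indep_vars (\<lambda>_. borel) X {..<Suc 1}"
    unfolding X_def by (rule independent_increments) (use st in \<open>auto simp: \<tau>_def less_Suc_eq\<close>)
  define e where "e y = exp (- a * complex_of_real y)" for y
  have e[measurable]: "e \<in> borel_measurable borel" by (simp add: e_def[abs_def])
  have X0: "X 0 w = Y s w" if "w \<in> space M" for w using that by (simp add: X_def \<tau>_def Y_zero)
  have X1: "distr M borel (X 1) = distr M borel (Y t)"
    using stationary_increments[OF st] by (simp add: X_def[abs_def] \<tau>_def)
  have X1m: "X 1 \<in> borel_measurable M" using ind by (auto simp: indep_vars_def)
  have int0: "integrable M (\<lambda>w. e (X 0 w)) \<longleftrightarrow> integrable M (\<lambda>w. e (Y s w))"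
    by (intro Bochner_Integration.integrable_cong refl) (simp add: X0)
  have int1: "integrable M (\<lambda>w. e (X 1 w))"
    using integrable_distr_eq[OF X1m e] integrable_distr_eq[OF random_variable_Y[OF st(2)] e]
      exp_integrable_complex[OF a st(2)] unfolding X1 e_def by simp
  have m: "(\<lambda>z::nat\<Rightarrow>real. e (z 0)) \<in> borel_measurable (PiM {..<1} (\<lambda>_. borel))"
    by (rule measurable_compose[OF _ e]) (auto intro!: measurable_component_singleton)
  have "(\<integral>w. e (X 0 w) * e (X 1 w) \<partial>M) = (\<integral>w. e (X 0 w) \<partial>M) * (\<integral>w. e (X 1 w) \<partial>M)"
    using indep_walk_step(2)[OF ind m e] int0 int1 exp_integrable_complex[OF a st(1)] by (simp add: e_def)
  moreover have "(\<integral>w. e (X 0 w) * e (X 1 w) \<partial>M) = mgf a (s + t)"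
    unfolding mgf_def by (intro Bochner_Integration.integral_cong refl)
      (auto simp: e_def exp_add[symmetric] X_def \<tau>_def Y_zero algebra_simps)
  moreover have "(\<integral>w. e (X 0 w) \<partial>M) = mgf a s"
    unfolding mgf_def by (intro Bochner_Integration.integral_cong refl) (auto simp: X0 e_def)
  moreover have "(\<integral>w. e (X 1 w) \<partial>M) = mgf a t"
    using integral_distr[OF X1m e] integral_distr[OF random_variable_Y[OF st(2)] e]
    unfolding X1 e_def mgf_def by simp
  ultimately show ?thesis by simp
qed

lemma path_tendsto_right:
  assumes w: "w \<in> space M" and t: "0 \<le> t" and lim: "u \<longlonglongrightarrow> t" and ge: "\<And>n. t \<le> u n"
  shows "(\<lambda>n. Y (u n) w) \<longlonglongrightarrow> Y t w"
proof (rule LIMSEQ_I)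
  fix e :: real assume e: "0 < e"
  obtain d l where d: "d > 0" "\<And>s. t \<le> s \<Longrightarrow> s < t + d \<Longrightarrow> \<bar>Y s w - Y t w\<bar> < e"
    by (rule path_local[OF w t e]) auto
  obtain N where "\<And>n. n \<ge> N \<Longrightarrow> norm (u n - t) < d" using LIMSEQ_D[OF lim d(1)] by blast
  then show "\<exists>N. \<forall>n\<ge>N. norm (Y (u n) w - Y t w) < e"
  proof (intro exI[of _ N] allI impI)
    fix n assume "n \<ge> N"
    then have "\<bar>u n - t\<bar> < d" using \<open>\<And>n. n \<ge> N \<Longrightarrow> norm (u n - t) < d\<close> by simp
    then show "norm (Y (u n) w - Y t w) < e" using d(2)[of "u n"] ge[of n] by simp
  qed
qed

lemma mgf_tendsto_1:
  assumes a: "0 \<le> Re a"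
  shows "(mgf a \<longlongrightarrow> 1) (at 0 within {0..})"
  unfolding tendsto_at_iff_sequentially
proof (intro allI impI)
  fix u :: "nat \<Rightarrow> real" assume u: "\<forall>i. u i \<in> {0..} - {0}" "u \<longlonglongrightarrow> 0"
  have u0: "0 \<le> u n" for n using u(1) by (auto simp: less_imp_le)
  obtain T where T: "\<And>n. u n \<le> T"
  proof -
    have "Bseq u" using u(2) by (auto intro: convergent_imp_Bseq convergentI)
    then obtain K where "\<And>n. norm (u n) \<le> K" by (auto simp: Bseq_def)
    then show thesis by (intro that[of K]) (metis abs_ge_self order_trans real_norm_def)
  qed
  \<comment> \<open>Squaring the modulus doubles the exponent, so moments at
    \<open>2 * Re a\<close>, bounded locally in time, give the L2 bound that stands in for a
    dominating function.\<close>
  obtain B where B: "\<And>t. 0 \<le> t \<Longrightarrow> t \<le> T \<Longrightarrow> integrable M (\<lambda>w. exp (- (2 * Re a) * Y t w)) \<and> (\<integral>w. exp (- (2 * Re a) * Y t w) \<partial>M) \<le> B"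
    using exp_moment_bounded[of "2 * Re a" T] a by auto
  define f where "f n w = norm (exp (- a * complex_of_real (Y (u n) w)) - 1)" for n w
  have fm[measurable]: "f n \<in> borel_measurable M" for n
    unfolding f_def using random_variable_Y[OF u0] by measurable
  have sq: "(f n w)\<^sup>2 \<le> 2 * exp (- (2 * Re a) * Y (u n) w) + 2" for n w
  proof -
    define z where "z = exp (- a * complex_of_real (Y (u n) w))"
    have "(norm (z - 1))\<^sup>2 \<le> (norm z + 1)\<^sup>2"
      by (intro power_mono) (auto intro: order_trans[OF norm_triangle_ineq4])
    also have "\<dots> \<le> 2 * (norm z)\<^sup>2 + 2"
      using sum_squares_bound[of "norm z" 1] by (simp add: power2_eq_square algebra_simps)
    also have "(norm z)\<^sup>2 = exp (- (2 * Re a) * Y (u n) w)"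
      by (simp add: z_def norm_exp_eq_Re power2_eq_square exp_add[symmetric])
    finally show ?thesis by (simp add: f_def z_def)
  qed
  have int2: "integrable M (\<lambda>w. 2 * exp (- (2 * Re a) * Y (u n) w) + 2)" for n
    using B[OF u0 T] by simp
  have sq_int: "integrable M (\<lambda>w. (f n w)\<^sup>2)" for n
    by (rule Bochner_Integration.integrable_bound[OF int2[of n]]) (use sq in \<open>auto intro: order_trans[OF _ abs_ge_self]\<close>)
  have "(\<lambda>n. \<integral>w. f n w \<partial>M) \<longlonglongrightarrow> 0"
  proof (rule integral_tendsto_zero_if_L2_bounded[OF fm _ _ sq_int])
    show "AE w in M. (\<lambda>n. f n w) \<longlonglongrightarrow> 0"
    proof (rule AE_I2)
      fix w assume w: "w \<in> space M"
      have "(\<lambda>n. Y (u n) w) \<longlonglongrightarrow> 0"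
        using path_tendsto_right[OF w order_refl u(2) u0] Y_zero[OF w] by simp
      then have "(\<lambda>n. f n w) \<longlonglongrightarrow> norm (exp (- a * complex_of_real 0) - 1)"
        unfolding f_def by (intro tendsto_intros)
      then show "(\<lambda>n. f n w) \<longlonglongrightarrow> 0" by simp
    qed
    show "(\<integral>w. (f n w)\<^sup>2 \<partial>M) \<le> 2 * B + 2" for n
    proof -
      have "(\<integral>w. (f n w)\<^sup>2 \<partial>M) \<le> (\<integral>w. 2 * exp (- (2 * Re a) * Y (u n) w) + 2 \<partial>M)"
        by (intro integral_mono sq_int int2 sq)
      also have "\<dots> = 2 * (\<integral>w. exp (- (2 * Re a) * Y (u n) w) \<partial>M) + 2"
        using B[OF u0 T, of n] by (simp add: prob_space)
      also have "\<dots> \<le> 2 * B + 2" using B[OF u0 T, of n] by simp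
      finally show ?thesis .
    qed
  qed (auto simp: f_def)
  moreover have "norm (mgf a (u n) - 1) \<le> (\<integral>w. f n w \<partial>M)" for n
  proof -
    have "mgf a (u n) - 1 = (\<integral>w. exp (- a * complex_of_real (Y (u n) w)) - 1 \<partial>M)"
      using exp_integrable_complex[OF a u0] by (simp add: mgf_def prob_space)
    also have "norm \<dots> \<le> (\<integral>w. f n w \<partial>M)" unfolding f_def by (rule integral_norm_bound)
    finally show ?thesis .
  qed
  ultimately have "(\<lambda>n. mgf a (u n) - 1) \<longlonglongrightarrow> 0"
    by (rule Lim_null_comparison[rotated, OF _ always_eventually, OF _ allI])
  then show "(mgf a \<circ> u) \<longlonglongrightarrow> 1" by (simp add: LIM_zero_iff comp_def)
qed

abbreviation "\<phi> \<equiv> complex_laplace_exponent M Y"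

text \<open>This makes the definite description in \<open>complex_laplace_exponent\<close>
  meaningful: existence comes from the semigroup property, and uniqueness from quantifying over all
  times.\<close>

lemma mgf_eq_exp:
  assumes a: "0 \<le> Re a" and t: "0 \<le> t"
  shows "mgf a t = exp (of_real t * \<phi> a)"
proof -
  obtain c where c: "\<And>t. 0 \<le> t \<Longrightarrow> mgf a t = exp (of_real t * c)"
    using multiplicative_imp_exp[of "mgf a", OF mgf_add[OF a] mgf_tendsto_1[OF a] mgf_0] by auto
  have "\<phi> a = c"
    unfolding complex_laplace_exponent_def
  proof (rule the_equality)
    show "\<forall>t\<ge>0. (\<integral>w. exp (- a * complex_of_real (Y t w)) \<partial>M) = exp (complex_of_real t * c)"
      using c unfolding mgf_def by blast
    show "c' = c" if "\<forall>t\<ge>0. (\<integral>w. exp (- a * complex_of_real (Y t w)) \<partial>M) = exp (complex_of_real t * c')" for c'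
    proof (rule exp_scaling_unique)
      fix t :: real assume "0 \<le> t"
      with that c[of t] show "exp (of_real t * c') = exp (of_real t * c)" unfolding mgf_def by metis
    qed
  qed
  with c t show ?thesis by simp
qed

abbreviation "\<phi>\<^sub>r \<equiv> laplace_exponent M Y"

lemma real_mgf_pos: "0 \<le> a \<Longrightarrow> 0 \<le> t \<Longrightarrow> 0 < (\<integral>w. exp (- a * Y t w) \<partial>M)"
  using exp_integrable[of a t] integral_less_AE_space[of "\<lambda>_. 0" "\<lambda>w. exp (- a * Y t w)"]
  by (simp add: emeasure_space_1)

text \<open>The transform is real at real a, so \<phi> a and its conjugate have the same
  exponentials at all times and coincide; for a real exponent the logarithm in
  \<open>laplace_exponent\<close> is the right branch.\<close>

lemma complex_exponent_of_real:
  assumes a: "0 \<le> a"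
  shows "\<phi> (of_real a) = of_real (\<phi>\<^sub>r a)"
proof -
  have mgf_real: "mgf (of_real a) t = of_real (\<integral>w. exp (- a * Y t w) \<partial>M)" for t
    unfolding mgf_def integral_complex_of_real[symmetric] by (simp add: exp_of_real[symmetric])
  have "cnj (\<phi> (of_real a)) = \<phi> (of_real a)"
  proof (rule exp_scaling_unique)
    fix t :: real assume "0 \<le> t"
    then have "exp (of_real t * \<phi> (of_real a)) = mgf (of_real a) t" using a by (simp add: mgf_eq_exp)
    moreover have "cnj (exp (of_real t * \<phi> (of_real a))) = exp (of_real t * cnj (\<phi> (of_real a)))" by (simp add: exp_cnj)
    ultimately show "exp (of_real t * cnj (\<phi> (of_real a))) = exp (of_real t * \<phi> (of_real a))"
      by (metis mgf_real complex_cnj_complex_of_real)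
  qed
  then obtain r where r: "\<phi> (of_real a) = of_real r" by (metis complex_is_Real_iff Reals_cnj_iff Reals_cases)
  have "mgf (of_real a) 1 = exp (of_real r)" using a r by (simp add: mgf_eq_exp)
  then have "(\<integral>w. exp (- a * Y 1 w) \<partial>M) = exp r" by (simp add: mgf_real exp_of_real)
  then show ?thesis by (simp add: r laplace_exponent_def)
qed

lemma real_mgf_eq_exp:
  assumes "0 \<le> a" "0 \<le> t"
  shows "(\<integral>w. exp (- a * Y t w) \<partial>M) = exp (t * \<phi>\<^sub>r a)"
proof -
  have "complex_of_real (\<integral>w. exp (- a * Y t w) \<partial>M) = mgf (of_real a) t"
    unfolding mgf_def integral_complex_of_real[symmetric] by (simp add: exp_of_real[symmetric])
  also have "\<dots> = of_real (exp (t * \<phi>\<^sub>r a))"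
    using assms by (simp add: mgf_eq_exp complex_exponent_of_real exp_of_real[symmetric])
  finally show ?thesis using of_real_eq_iff by blast
qed

end

section \<open>Exponential times and grids\<close>

abbreviation exponential_law :: "real \<Rightarrow> real measure" where
  "exponential_law q \<equiv> density lborel (exponential_density q)"

lemma exponential_law_nonneg: "AE t in exponential_law q. 0 \<le> t"
  by (subst AE_density) (auto simp: exponential_density_def split: if_splits)

lemma exponential_law_neq: "AE t in exponential_law q. t \<noteq> c"
  using AE_lborel_singleton[of c] by (subst AE_density) (auto elim: eventually_mono)

lemma measure_exponential_law_gt:
  assumes "0 < q" "0 \<le> a"
  shows "measure (exponential_law q) {t. a < t} = exp (- (q * a))"
proof -
  interpret prob_space "exponential_law q" using assms(1) by (rule prob_space_exponential_density)
  have "distributed (exponential_law q) lborel (\<lambda>x. x) (exponential_density q)"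
    unfolding distributed_def by (auto simp: distr_id2)
  from exponential_distributedD_gt[OF this assms(2,1)] show ?thesis by (simp add: mult.commute)
qed

text \<open>The integer part of T/h is geometric. The grid points are null sets, so the half-open
  cell may be replaced by a difference of two open half-lines.\<close>

lemma measure_exponential_law_grid:
  assumes q: "0 < q" and h: "0 < h"
  shows "measure (exponential_law q) {t. nat \<lfloor>t / h\<rfloor> = k} = exp (- (q * h)) ^ k - exp (- (q * h)) ^ Suc k"
proof -
  interpret prob_space "exponential_law q" using q by (rule prob_space_exponential_density)
  have pow: "exp (- (q * (real k * h))) = exp (- (q * h)) ^ k" for k
    by (simp add: exp_of_nat_mult[symmetric] mult_ac)
  have "measure (exponential_law q) {t. nat \<lfloor>t / h\<rfloor> = k} = measure (exponential_law q) ({t. real k * h < t} - {t. real (Suc k) * h < t})"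
  proof (rule finite_measure_eq_AE)
    show "AE t in exponential_law q. (t \<in> {t. nat \<lfloor>t / h\<rfloor> = k}) = (t \<in> {t. real k * h < t} - {t. real (Suc k) * h < t})"
      using exponential_law_nonneg[of q] exponential_law_neq[of "real k * h" q] exponential_law_neq[of "real (Suc k) * h" q]
    proof eventually_elim
      case (elim t)
      have "nat \<lfloor>t / h\<rfloor> = k \<longleftrightarrow> \<lfloor>t / h\<rfloor> = int k" using elim h by auto
      also have "\<dots> \<longleftrightarrow> real k \<le> t / h \<and> t / h < real k + 1" by (simp add: floor_eq_iff)
      also have "\<dots> \<longleftrightarrow> real k * h \<le> t \<and> t < (real k + 1) * h" using h by (simp add: pos_le_divide_eq pos_divide_less_eq)
      finally show ?case using elim by (auto simp: add.commute)
    qed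
  qed auto
  also have "\<dots> = measure (exponential_law q) {t. real k * h < t} - measure (exponential_law q) {t. real (Suc k) * h < t}"
    using h by (intro finite_measure_Diff) (auto simp: algebra_simps)
  also have "\<dots> = exp (- (q * (real k * h))) - exp (- (q * (real (Suc k) * h)))"
    using q h by (subst (1 2) measure_exponential_law_gt) auto
  finally show ?thesis unfolding pow .
qed

lemma integral_exponential_law_grid:
  fixes c :: "nat \<Rightarrow> 'b::{banach, second_countable_topology}"
  assumes q: "0 < q" and h: "0 < h" and bound: "\<And>k. norm (c k) \<le> B"
  shows "(\<lambda>k. (exp (- (q * h)) ^ k - exp (- (q * h)) ^ Suc k) *\<^sub>R c k) sums (\<integral>t. c (nat \<lfloor>t / h\<rfloor>) \<partial>exponential_law q)"
proof -
  interpret prob_space "exponential_law q" using q by (rule prob_space_exponential_density)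
  define r where "r = exp (- (q * h))"
  have r: "0 \<le> r" "r < 1" using q h by (auto simp: r_def)
  define pr where "pr k = r ^ k - r ^ Suc k" for k
  have pr: "0 \<le> pr k" for k using r by (simp add: pr_def mult_left_le_one_le)
  define K where "K t = nat \<lfloor>t / h\<rfloor>" for t :: real
  have K[measurable]: "K \<in> measurable (exponential_law q) (count_space UNIV)"
    unfolding K_def by measurable
  have eq: "distr (exponential_law q) (count_space UNIV) K = density (count_space UNIV) pr"
  proof (rule measure_eqI_countable[where A=UNIV])
    fix a :: nat
    have "emeasure (distr (exponential_law q) (count_space UNIV) K) {a} = emeasure (exponential_law q) {t. nat \<lfloor>t / h\<rfloor> = a}"
      by (subst emeasure_distr) (auto simp: K_def intro!: arg_cong[where f="emeasure _"])
    also have "\<dots> = ennreal (pr a)"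
      using measure_exponential_law_grid[OF q h, of a] by (simp add: emeasure_eq_measure pr_def r_def)
    also have "\<dots> = emeasure (density (count_space UNIV) pr) {a}"
      by (subst emeasure_density) (auto simp: nn_integral_count_space_indicator[symmetric] nn_integral_count_space_finite
          intro!: trans[OF _ nn_integral_count_space_indicator])
    finally show "emeasure (distr (exponential_law q) (count_space UNIV) K) {a} = emeasure (density (count_space UNIV) pr) {a}" .
  qed auto
  have "integrable (distr (exponential_law q) (count_space UNIV) K) c"
    using prob_space_distr[OF K] bound
    by (intro finite_measure.integrable_const_bound[of _ _ B]) (auto intro: prob_space.finite_measure)
  then have "integrable (count_space UNIV) (\<lambda>k. pr k *\<^sub>R c k)"
    unfolding eq by (subst (asm) integrable_density) (auto simp: pr)
  from sums_integral_count_space_nat[OF this]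
  have "(\<lambda>k. pr k *\<^sub>R c k) sums (\<integral>k. c k \<partial>density (count_space UNIV) pr)"
    by (subst integral_density) (auto simp: pr)
  also have "(\<integral>k. c k \<partial>density (count_space UNIV) pr) = (\<integral>t. c (K t) \<partial>exponential_law q)"
    unfolding eq[symmetric] by (subst integral_distr) auto
  finally show ?thesis by (simp add: pr_def r_def K_def)
qed

text \<open>The index of the first grid point strictly after t, for the mesh 1/(n+1). Approaching t
  only from the right turns right-continuity into convergence along the grids.\<close>

definition grid_index :: "nat \<Rightarrow> real \<Rightarrow> nat" where
  "grid_index n t = Suc (nat \<lfloor>t / (1 / real (Suc n))\<rfloor>)"

definition grid_time :: "nat \<Rightarrow> real \<Rightarrow> real" where
  "grid_time n t = real (grid_index n t) * (1 / real (Suc n))"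

lemma grid_index_measurable [measurable]: "grid_index n \<in> measurable borel (count_space UNIV)"
  unfolding grid_index_def by measurable

lemma grid_time_bounds:
  assumes t: "0 \<le> t"
  shows "t < grid_time n t" "grid_time n t \<le> t + 1 / real (Suc n)"
proof -
  define h where "h = 1 / real (Suc n)"
  have h: "h > 0" by (simp add: h_def)
  have "real (nat \<lfloor>t / h\<rfloor>) \<le> t / h" "t / h < real (nat \<lfloor>t / h\<rfloor>) + 1" using t h by auto
  then have "real (nat \<lfloor>t / h\<rfloor>) * h \<le> t" "t < (real (nat \<lfloor>t / h\<rfloor>) + 1) * h"
    using h by (auto simp: pos_le_divide_eq pos_divide_less_eq)
  then show "t < grid_time n t" "grid_time n t \<le> t + 1 / real (Suc n)"
    unfolding grid_time_def grid_index_def h_def[symmetric] by (auto simp: algebra_simps)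
qed

lemma inverse_Suc_tendsto_0: "(\<lambda>n. 1 / real (Suc n)) \<longlonglongrightarrow> 0"
  using LIMSEQ_inverse_real_of_nat by (simp add: inverse_eq_divide)

lemma eventually_grid_small: "0 < d \<Longrightarrow> eventually (\<lambda>n. 1 / real (Suc n) < d) sequentially"
  using order_tendstoD(2)[OF inverse_Suc_tendsto_0] .

lemma grid_index_mono: "s \<le> t \<Longrightarrow> grid_index n s \<le> grid_index n t"
  unfolding grid_index_def by (intro Suc_le_mono[THEN iffD2] nat_mono floor_mono divide_right_mono) auto

lemma grid_time_tendsto: "0 \<le> t \<Longrightarrow> (\<lambda>n. grid_time n t) \<longlonglongrightarrow> t"
proof (rule tendsto_sandwich[of "\<lambda>_. t" _ _ "\<lambda>n. t + 1 / real (Suc n)"])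
  show "(\<lambda>n. t + 1 / real (Suc n)) \<longlonglongrightarrow> t" using tendsto_add[OF tendsto_const inverse_Suc_tendsto_0, of t] by simp
qed (auto intro!: always_eventually less_imp_le[OF grid_time_bounds(1)] grid_time_bounds(2)[simplified])

text \<open>The values at the next grid point involve countably many times, hence are jointly
  measurable, and they converge by right-continuity; \<open>max 0\<close> avoids negative times. N
  is arbitrary because the result serves M as well as the coarser sigma-algebra generated by the
  paths.\<close>

lemma right_continuous_measurable_pair:
  fixes Z :: "real \<Rightarrow> 'a \<Rightarrow> real"
  assumes Z: "\<And>t. 0 \<le> t \<Longrightarrow> Z t \<in> borel_measurable N"
    and rc: "\<And>w t. w \<in> space N \<Longrightarrow> 0 \<le> t \<Longrightarrow> continuous (at_right t) (\<lambda>s. Z s w)"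
  shows "(\<lambda>(w, t). Z (max 0 t) w) \<in> borel_measurable (N \<Otimes>\<^sub>M borel)"
proof (rule borel_measurable_LIMSEQ_real)
  fix x assume x: "x \<in> space (N \<Otimes>\<^sub>M (borel :: real measure))"
  then obtain w t where wt: "x = (w, t)" "w \<in> space N" by (auto simp: space_pair_measure)
  have t: "0 \<le> max 0 t" by simp
  have "(\<lambda>n. Z (grid_time n (max 0 t)) w) \<longlonglongrightarrow> Z (max 0 t) w"
    using continuous_within_tendsto_compose[OF rc[OF wt(2) t], of "\<lambda>n. grid_time n (max 0 t)" sequentially]
      grid_time_bounds(1)[OF t] grid_time_tendsto[OF t] by simp
  then show "(\<lambda>n. (\<lambda>(w, t). Z (grid_time n (max 0 t)) w) x) \<longlonglongrightarrow> (\<lambda>(w, t). Z (max 0 t) w) x"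
    by (simp add: wt(1))
next
  fix n
  have Zk: "(\<lambda>x. Z (real k * (1 / real (Suc n))) (fst x)) \<in> borel_measurable (N \<Otimes>\<^sub>M (borel :: real measure))" for k
    by (rule measurable_compose[OF measurable_fst Z]) simp
  have gi: "(\<lambda>x. grid_index n (max 0 (snd x))) \<in> measurable (N \<Otimes>\<^sub>M borel) (count_space UNIV)"
    by (rule measurable_compose[OF _ grid_index_measurable]) measurable
  from measurable_compose_countable[OF Zk gi]
  show "(\<lambda>(w, t). Z (grid_time n (max 0 t)) w) \<in> borel_measurable (N \<Otimes>\<^sub>M borel)"
    by (simp add: grid_time_def split_beta)
qed

section \<open>Joint measurability in path and time\<close>

context levy_process
begin

lemma Y_pair_measurable [measurable]: "(\<lambda>(w, t). Y (max 0 t) w) \<in> borel_measurable (M \<Otimes>\<^sub>M borel)"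
  by (rule right_continuous_measurable_pair[OF random_variable_Y right_continuous])

lemma Y_compose_measurable:
  assumes "f \<in> measurable N M" "g \<in> borel_measurable N" "\<And>x. x \<in> space N \<Longrightarrow> 0 \<le> g x"
  shows "(\<lambda>x. Y (g x) (f x)) \<in> borel_measurable N"
proof -
  have "(\<lambda>x. (f x, g x)) \<in> measurable N (M \<Otimes>\<^sub>M borel)" using assms by measurable
  from measurable_compose[OF this Y_pair_measurable]
  have "(\<lambda>x. Y (max 0 (g x)) (f x)) \<in> borel_measurable N" by simp
  then show ?thesis using assms(3) by (simp cong: measurable_cong add: max_absorb2)
qed

definition stays_above :: "real \<Rightarrow> real \<Rightarrow> 'a \<Rightarrow> bool" where
  "stays_above x t w \<longleftrightarrow> (\<forall>s\<in>{0..t}. - x \<le> Y s w)"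

lemma right_open_strict:
  assumes w: "w \<in> space M" and s: "0 \<le> s" and lt: "Y s w < y"
  obtains d where "d > 0" "\<And>u. s \<le> u \<Longrightarrow> u < s + d \<Longrightarrow> Y u w < y"
proof -
  obtain d l where d: "d > 0" "\<And>u. s \<le> u \<Longrightarrow> u < s + d \<Longrightarrow> \<bar>Y u w - Y s w\<bar> < y - Y s w"
    by (rule path_local[OF w s, of "y - Y s w"]) (use lt in auto)
  show thesis by (rule that[OF d(1)]) (use d(2) in fastforce)
qed

text \<open>Rational fractions of t are tested instead of rational times, so that the countable
  index set is the same for every t and contains the endpoint through the fraction \<open>1\<close>.
  This is what makes the event jointly measurable in path and time.\<close>

lemma stays_above_iff_Rats:
  assumes w: "w \<in> space M" and t: "0 \<le> t"
  shows "stays_above x t w \<longleftrightarrow> (\<forall>r\<in>\<rat> \<inter> {0..1}. - x \<le> Y (r * t) w)"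
proof
  assume "stays_above x t w"
  then show "\<forall>r\<in>\<rat> \<inter> {0..1}. - x \<le> Y (r * t) w"
    using t by (auto simp: stays_above_def mult_left_le_one_le)
next
  assume *: "\<forall>r\<in>\<rat> \<inter> {0..1}. - x \<le> Y (r * t) w"
  show "stays_above x t w" unfolding stays_above_def
  proof (rule ballI, rule ccontr)
    fix s assume s: "s \<in> {0..t}" "\<not> - x \<le> Y s w"
    then have s0: "0 \<le> s" "Y s w < - x" by auto
    show False
    proof (cases "s = t")
      case True
      then show False using bspec[OF *, of 1] s0 by simp
    next
      case False
      then have st: "s < t" using s by simp
      obtain d where d: "d > 0" "\<And>u. s \<le> u \<Longrightarrow> u < s + d \<Longrightarrow> Y u w < - x"
        using right_open_strict[OF w s0] by blast
      have "s / t < min ((s + d) / t) 1" using d(1) st s0(1) by (simp add: divide_strict_right_mono)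
      then obtain r where r: "r \<in> \<rat>" "s / t < r" "r < min ((s + d) / t) 1"
        using Rats_dense_in_real by blast
      have "s < r * t" "r * t < s + d" using r st s0(1) by (auto simp: field_simps)
      moreover have "0 \<le> r" using r(2) st s0(1) by (meson divide_nonneg_nonneg less_le_not_le order_trans less_imp_le t)
      ultimately show False using d(2)[of "r * t"] bspec[OF *, of r] r by auto
    qed
  qed
qed

lemma stays_above_pair_measurable [measurable]:
  "Measurable.pred (M \<Otimes>\<^sub>M borel) (\<lambda>(w, t). stays_above x (max 0 t) w)"
proof -
  have c: "countable (\<rat> \<inter> {0..1::real})" by (rule countable_subset[OF _ countable_rat]) auto
  have "Measurable.pred (M \<Otimes>\<^sub>M borel) (\<lambda>p. \<forall>r\<in>\<rat> \<inter> {0..1}. - x \<le> Y (r * max 0 (snd p)) (fst p))"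
  proof -
    have "{p \<in> space (M \<Otimes>\<^sub>M borel). \<forall>r\<in>\<rat> \<inter> {0..1}. - x \<le> Y (r * max 0 (snd p)) (fst p)} =
        (\<Inter>r\<in>\<rat> \<inter> {0..1}. {p \<in> space (M \<Otimes>\<^sub>M borel). - x \<le> Y (r * max 0 (snd p)) (fst p)})"
      by (auto intro: bexI[of _ 0])
    also have "\<dots> \<in> sets (M \<Otimes>\<^sub>M borel)"
    proof (rule sets.countable_INT'[OF c])
      show "\<rat> \<inter> {0..1::real} \<noteq> {}" by (auto intro: bexI[of _ 0])
      show "(\<lambda>r. {p \<in> space (M \<Otimes>\<^sub>M borel). - x \<le> Y (r * max 0 (snd p)) (fst p)}) ` (\<rat> \<inter> {0..1}) \<subseteq> sets (M \<Otimes>\<^sub>M borel)"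
        by (auto intro!: borel_measurable_le borel_measurable_const Y_compose_measurable)
    qed
    finally show ?thesis by (simp add: pred_def)
  qed
  then show ?thesis
    by (rule measurable_cong[THEN iffD1, rotated])
      (auto simp: space_pair_measure stays_above_iff_Rats)
qed

end

section \<open>The grid walk up to an exponential time\<close>

context spectrally_positive_levy_process
begin

lemma walk_above_increment:
  "walk_above (increment h) x k = {w \<in> space M. \<forall>j\<le>k. - x \<le> Y (real j * h) w}"
  unfolding walk_above_def by (auto simp: sum_increment)

definition grid_mgf :: "complex \<Rightarrow> real \<Rightarrow> real \<Rightarrow> nat \<Rightarrow> complex" where
  "grid_mgf a x h k = (\<integral>w. exp (- a * complex_of_real (Y (real k * h) w)) * indicator (walk_above (increment h) x k) w \<partial>M)"

definition grid_exit :: "real \<Rightarrow> real \<Rightarrow> nat \<Rightarrow> 'a set" where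
  "grid_exit x h k = walk_above (increment h) x k - walk_above (increment h) x (Suc k)"

lemma walk_above_increment_measurable [measurable]: "0 \<le> h \<Longrightarrow> walk_above (increment h) x k \<in> events"
  by (intro walk_above_measurable increment_measurable)

lemma grid_exit_measurable [measurable]: "0 \<le> h \<Longrightarrow> grid_exit x h k \<in> events"
  unfolding grid_exit_def by (intro sets.Diff walk_above_increment_measurable)

lemma norm_exp_above:
  assumes "0 \<le> Re a" "- x \<le> y"
  shows "norm (exp (- a * complex_of_real y)) \<le> exp (Re a * x)"
  using mult_left_mono[OF assms(2,1)] by (simp add: norm_exp_eq_Re)

lemma grid_mgf_0: "0 \<le> x \<Longrightarrow> grid_mgf a x h 0 = 1"
proof -
  assume x: "0 \<le> x"
  have "grid_mgf a x h 0 = (\<integral>w. 1 \<partial>M)"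
    unfolding grid_mgf_def walk_above_increment
    by (intro Bochner_Integration.integral_cong refl) (auto simp: Y_zero x)
  then show ?thesis by (simp add: prob_space)
qed

lemma grid_integrable:
  assumes a: "0 \<le> Re a" and h: "0 \<le> h" and A: "A \<in> events"
  shows "integrable M (\<lambda>w. exp (- a * complex_of_real (Y (real k * h) w)) * indicator A w)"
  using integrable_mult_indicator[OF A exp_integrable_complex[OF a, of "real k * h"]] h
  by (simp add: scaleR_conv_of_real mult.commute of_real_indicator)

lemma norm_grid_mgf_le:
  assumes a: "0 \<le> Re a" and h: "0 \<le> h"
  shows "norm (grid_mgf a x h k) \<le> exp (Re a * x)"
proof -
  have "norm (grid_mgf a x h k) \<le> (\<integral>w. norm (exp (- a * complex_of_real (Y (real k * h) w)) * indicator (walk_above (increment h) x k) w) \<partial>M)"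
    unfolding grid_mgf_def by (rule integral_norm_bound)
  also have "\<dots> \<le> (\<integral>w. exp (Re a * x) \<partial>M)"
  proof (intro integral_mono integrable_norm grid_integrable[OF a h] walk_above_increment_measurable[OF h])
    fix w
    show "norm (exp (- a * complex_of_real (Y (real k * h) w)) * indicator (walk_above (increment h) x k) w) \<le> exp (Re a * x)"
      using norm_exp_above[OF a, of x "Y (real k * h) w"]
      by (auto simp: indicator_def walk_above_increment norm_mult simp del: mult_minus_left)
  qed simp
  finally show ?thesis by (simp add: prob_space)
qed

text \<open>Among the walks still above the level after k steps, the next step either leaves or not;
  the mean over both kinds together is the old transform times that of one increment.\<close>

lemma grid_exit_mgf:
  assumes a: "0 \<le> Re a" and h: "0 \<le> h"
  shows "(\<integral>w. exp (- a * complex_of_real (Y (real (Suc k) * h) w)) * indicator (grid_exit x h k) w \<partial>M)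
    = grid_mgf a x h k * mgf a h - grid_mgf a x h (Suc k)"
proof -
  define e where "e y = exp (- a * complex_of_real y)" for y
  have e[measurable]: "e \<in> borel_measurable borel" by (simp add: e_def[abs_def])
  have e_add: "e (s + y) = e s * e y" for s y by (simp add: e_def exp_add[symmetric] algebra_simps)
  have e_bound: "- x \<le> y \<Longrightarrow> norm (e y) \<le> exp (Re a * x)" for y
    unfolding e_def by (rule norm_exp_above[OF a])
  have inte: "integrable M (\<lambda>w. e (increment h k w))"
    using integrable_increment[OF h e] exp_integrable_complex[OF a h] by (simp add: e_def)
  note st = walk_exp_step(3)[where x = x and B = "exp (Re a * x)", OF indep_increments[OF h] e e_add e_bound inte]
  let ?B = "walk_above (increment h) x"
  have eq: "(\<integral>w. e (\<Sum>i<l. increment h i w) * indicator (?B k) w \<partial>M) = (\<integral>w. e (Y (real l * h) w) * indicator (?B k) w \<partial>M)" for l k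
    by (intro Bochner_Integration.integral_cong refl) (simp add: sum_increment)
  have "(\<integral>w. e (increment h k w) \<partial>M) = mgf a h"
    using integral_increment[OF h e] by (simp add: e_def mgf_def)
  then have 1: "(\<integral>w. e (Y (real (Suc k) * h) w) * indicator (?B k) w \<partial>M) = grid_mgf a x h k * mgf a h"
    using st unfolding eq grid_mgf_def e_def[symmetric] by simp
  have sub: "?B (Suc k) \<subseteq> ?B k" by (auto simp: walk_above_def)
  have "(\<integral>w. e (Y (real (Suc k) * h) w) * indicator (grid_exit x h k) w \<partial>M) =
      (\<integral>w. e (Y (real (Suc k) * h) w) * indicator (?B k) w - e (Y (real (Suc k) * h) w) * indicator (?B (Suc k)) w \<partial>M)"
    using sub by (intro Bochner_Integration.integral_cong refl) (auto simp: grid_exit_def indicator_def)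
  also have "\<dots> = (\<integral>w. e (Y (real (Suc k) * h) w) * indicator (?B k) w \<partial>M) - grid_mgf a x h (Suc k)"
    unfolding e_def grid_mgf_def
    by (intro Bochner_Integration.integral_diff grid_integrable[OF a h] walk_above_increment_measurable[OF h])
  finally show ?thesis using 1 unfolding e_def by simp
qed

text \<open>At \<open>a = 0\<close> this is the probability of no passage below \<open>-x\<close>
  before T, so \<open>1 - killed_mgf 0 x q\<close> is the passage probability.\<close>

definition killed_mgf :: "complex \<Rightarrow> real \<Rightarrow> real \<Rightarrow> complex" where
  "killed_mgf a x q = (\<integral>(w, t). (if stays_above x (max 0 t) w then exp (- a * complex_of_real (Y (max 0 t) w)) else 0)
     \<partial>with_exponential_time M q)"

definition grid_killed_mgf :: "complex \<Rightarrow> real \<Rightarrow> real \<Rightarrow> nat \<Rightarrow> complex" where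
  "grid_killed_mgf a x q n = (\<integral>(w, t). exp (- a * complex_of_real (Y (grid_time n t) w)) *
     indicator (walk_above (increment (1 / real (Suc n))) x (grid_index n t)) w \<partial>with_exponential_time M q)"

lemma grid_killed_integrand_measurable:
  "(\<lambda>(w, t). exp (- a * complex_of_real (Y (grid_time n t) w)) *
     indicator (walk_above (increment (1 / real (Suc n))) x (grid_index n t)) w) \<in> borel_measurable (M \<Otimes>\<^sub>M exponential_law q)"
proof -
  let ?h = "1 / real (Suc n)"
  have 1: "(\<lambda>p. exp (- a * complex_of_real (Y (real k * ?h) (fst p))) * indicator (walk_above (increment ?h) x k) (fst p))
      \<in> borel_measurable (M \<Otimes>\<^sub>M exponential_law q)" for k
  proof (rule measurable_compose[OF measurable_fst])
    show "(\<lambda>w. exp (- a * complex_of_real (Y (real k * ?h) w)) * indicator (walk_above (increment ?h) x k) w) \<in> borel_measurable M"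
      using random_variable_Y[of "real k * ?h"] walk_above_increment_measurable[of ?h x k] by measurable
  qed
  have 2: "(\<lambda>p. grid_index n (snd p)) \<in> measurable (M \<Otimes>\<^sub>M exponential_law q) (count_space UNIV)"
    by (rule measurable_compose[OF _ grid_index_measurable]) measurable
  from measurable_compose_countable[OF 1 2] show ?thesis by (simp add: grid_time_def split_beta)
qed

lemma grid_killed_integrand_le:
  assumes "0 \<le> Re a" "w \<in> space M"
  shows "norm (exp (- a * complex_of_real (Y (grid_time n t) w)) *
     indicator (walk_above (increment (1 / real (Suc n))) x (grid_index n t)) w) \<le> exp (Re a * x)"
  using assms norm_exp_above[OF assms(1), of x "Y (grid_time n t) w"]
  by (auto simp: indicator_def walk_above_increment grid_time_def norm_mult simp del: mult_minus_left)

lemma integrable_bounded_on_time: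
  fixes f :: "'a \<times> real \<Rightarrow> 'b::{banach, second_countable_topology}"
  assumes q: "0 < q" and f: "f \<in> borel_measurable (M \<Otimes>\<^sub>M exponential_law q)"
    and bound: "\<And>w t. w \<in> space M \<Longrightarrow> norm (f (w, t)) \<le> B"
  shows "integrable (M \<Otimes>\<^sub>M exponential_law q) f"
proof -
  interpret E: prob_space "exponential_law q" using q by (rule prob_space_exponential_density)
  interpret P: pair_prob_space M "exponential_law q" ..
  show ?thesis
    by (rule P.integrable_const_bound[of _ B]) (use f bound in \<open>auto simp: space_pair_measure\<close>)
qed

lemma grid_killed_mgf_sums:
  assumes a: "0 \<le> Re a" and q: "0 < q"
  defines "h \<equiv> \<lambda>n. 1 / real (Suc n)"
  shows "(\<lambda>k. (exp (- (q * h n)) ^ k - exp (- (q * h n)) ^ Suc k) *\<^sub>R grid_mgf a x (h n) (Suc k)) sums grid_killed_mgf a x q n"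
proof -
  have h: "0 < h n" by (simp add: h_def)
  interpret E: prob_space "exponential_law q" using q by (rule prob_space_exponential_density)
  interpret P: pair_prob_space M "exponential_law q" ..
  let ?f = "\<lambda>(w, t). exp (- a * complex_of_real (Y (grid_time n t) w)) *
     indicator (walk_above (increment (h n)) x (grid_index n t)) w"
  have "integrable (M \<Otimes>\<^sub>M exponential_law q) ?f"
    using grid_killed_integrand_le[OF a, of _ n _ x] grid_killed_integrand_measurable
    unfolding h_def by (intro integrable_bounded_on_time[OF q]) auto
  from P.integral_snd[OF this]
  have "grid_killed_mgf a x q n = (\<integral>t. grid_mgf a x (h n) (Suc (nat \<lfloor>t / h n\<rfloor>)) \<partial>exponential_law q)"
    by (simp add: grid_killed_mgf_def with_exponential_time_def grid_mgf_def h_def grid_time_def grid_index_def)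
  moreover have "norm (grid_mgf a x (h n) (Suc k)) \<le> exp (Re a * x)" for k
    by (rule norm_grid_mgf_le[OF a less_imp_le[OF h]])
  note integral_exponential_law_grid[OF q h this]
  ultimately show ?thesis by simp
qed

text \<open>The one-step balance is summed with weights r^(k+1), where r is the chance that T
  survives one grid step. These weights are r/(1-r) times the geometric probabilities of the cells
  of T, which is how \<open>grid_killed_mgf\<close> enters; the term at index \<open>0\<close>
  equals \<open>1\<close> and yields the part that is free of it.\<close>

lemma grid_exit_mgf_sums:
  assumes a: "0 \<le> Re a" and q: "0 < q" and x: "0 \<le> x"
  defines "h \<equiv> \<lambda>n. 1 / real (Suc n)"
  defines "r \<equiv> \<lambda>n. exp (- (q * h n))"
  shows "(\<lambda>k. of_real (r n ^ Suc k) * (\<integral>w. exp (- a * complex_of_real (Y (real (Suc k) * h n) w)) * indicator (grid_exit x (h n) k) w \<partial>M))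
    sums (of_real (r n) * mgf a (h n) + (of_real (r n) * mgf a (h n) - 1) * (of_real (r n / (1 - r n)) * grid_killed_mgf a x q n))"
proof -
  have h: "0 < h n" by (simp add: h_def)
  have r: "0 < r n" "r n < 1" using q h by (auto simp: r_def)
  let ?v = "grid_mgf a x (h n)" and ?r = "complex_of_real (r n)" and ?g = "mgf a (h n)"
  let ?V = "of_real (r n / (1 - r n)) * grid_killed_mgf a x q n"
  have "(\<lambda>k. of_real (r n / (1 - r n)) * ((r n ^ k - r n ^ Suc k) *\<^sub>R ?v (Suc k))) sums ?V"
    using grid_killed_mgf_sums[OF a q, of n x] unfolding r_def h_def by (rule sums_mult)
  moreover have "of_real (r n / (1 - r n)) * ((r n ^ k - r n ^ Suc k) *\<^sub>R ?v (Suc k)) = ?r ^ Suc k * ?v (Suc k)" for k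
  proof -
    have "r n / (1 - r n) * (r n ^ k - r n ^ Suc k) = r n ^ Suc k" using r by (simp add: field_simps)
    then show ?thesis by (metis mult.assoc of_real_mult of_real_power scaleR_conv_of_real)
  qed
  ultimately have V: "(\<lambda>k. ?r ^ Suc k * ?v (Suc k)) sums ?V" by (simp only:)
  then have V0: "(\<lambda>k. ?r ^ k * ?v k) sums (?V + 1)"
    using sums_Suc_iff[of "\<lambda>k. ?r ^ k * ?v k" ?V] grid_mgf_0[OF x] by simp
  have "(\<lambda>k. ?r * ?g * (?r ^ k * ?v k) - ?r ^ Suc k * ?v (Suc k)) sums (?r * ?g * (?V + 1) - ?V)"
    by (intro sums_diff sums_mult V V0)
  also have "R * (V + 1) - V = R + (R - 1) * V" for R V :: complex by (simp add: algebra_simps)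
  also have "(\<lambda>k. ?r * ?g * (?r ^ k * ?v k) - ?r ^ Suc k * ?v (Suc k)) = (\<lambda>k. of_real (r n ^ Suc k) * (?v k * ?g - ?v (Suc k)))"
    by (simp add: algebra_simps)
  finally show ?thesis unfolding grid_exit_mgf[OF a less_imp_le[OF h]] .
qed

text \<open>The times up to which the path stays above the level form an initial interval, so at
  most its right end cannot be prolonged. At that single time the walk, which looks slightly beyond
  t, may already have left; an exponential time avoids it almost surely.\<close>

lemma critical_time:
  obtains c where "\<And>t. 0 \<le> t \<Longrightarrow> t \<noteq> c \<Longrightarrow> stays_above x t w \<Longrightarrow> \<exists>\<delta>>0. stays_above x (t + \<delta>) w"
proof (cases "\<exists>c. stays_above x c w \<and> (\<forall>\<delta>>0. \<not> stays_above x (c + \<delta>) w)")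
  case True
  then obtain c where c: "stays_above x c w" "\<And>\<delta>. \<delta> > 0 \<Longrightarrow> \<not> stays_above x (c + \<delta>) w" by blast
  show thesis
  proof (rule that[of c])
    fix t assume t: "t \<noteq> c" "stays_above x t w"
    then have "t < c" using c(2)[of "t - c"] by (cases "t < c") auto
    then show "\<exists>\<delta>>0. stays_above x (t + \<delta>) w" using c(1) by (intro exI[of _ "c - t"]) auto
  qed
qed (use that in blast)

lemma eventually_leaves_grid:
  assumes w: "w \<in> space M" and s: "0 \<le> s" "Y s w < - x"
  shows "eventually (\<lambda>n. w \<notin> walk_above (increment (1 / real (Suc n))) x (grid_index n s)) sequentially"
proof -
  obtain d where d: "d > 0" "\<And>u. s \<le> u \<Longrightarrow> u < s + d \<Longrightarrow> Y u w < - x"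
    using right_open_strict[OF w s] by blast
  from eventually_grid_small[OF d(1)] show ?thesis
  proof eventually_elim
    case (elim n)
    have "Y (grid_time n s) w < - x" using grid_time_bounds[OF s(1), of n] elim by (intro d(2)) auto
    then have "\<not> - x \<le> Y (real (grid_index n s) * (1 / real (Suc n))) w" by (simp add: grid_time_def)
    then show ?case unfolding walk_above_increment by blast
  qed
qed

lemma grid_killed_mgf_tendsto:
  assumes a: "0 \<le> Re a" and q: "0 < q"
  shows "(\<lambda>n. grid_killed_mgf a x q n) \<longlonglongrightarrow> killed_mgf a x q"
proof -
  interpret E: prob_space "exponential_law q" using q by (rule prob_space_exponential_density)
  interpret P: pair_prob_space M "exponential_law q" ..
  define f where "f n p = (case p of (w, t) \<Rightarrow> exp (- a * complex_of_real (Y (grid_time n t) w)) *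
     indicator (walk_above (increment (1 / real (Suc n))) x (grid_index n t)) w)" for n p
  define F where "F p = (case p of (w, t) \<Rightarrow> if stays_above x (max 0 t) w then exp (- a * complex_of_real (Y (max 0 t) w)) else 0)" for p
  have fm[measurable]: "f n \<in> borel_measurable (M \<Otimes>\<^sub>M exponential_law q)" for n
    unfolding f_def by (rule grid_killed_integrand_measurable)
  have Fm[measurable]: "F \<in> borel_measurable (M \<Otimes>\<^sub>M exponential_law q)"
    unfolding F_def split_beta using stays_above_pair_measurable[of x] Y_pair_measurable
    unfolding split_beta by measurable
  have f_le: "norm (f n (w, t)) \<le> exp (Re a * x)" if "w \<in> space M" for n w t
    unfolding f_def using grid_killed_integrand_le[OF a that, of n t x] by simp
  have F_le: "norm (F (w, t)) \<le> exp (Re a * x)" if "w \<in> space M" for w t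
    unfolding F_def using norm_exp_above[OF a, of x "Y (max 0 t) w"] by (auto simp: stays_above_def simp del: mult_minus_left)
  have f_int: "integrable (M \<Otimes>\<^sub>M exponential_law q) (f n)" for n by (rule integrable_bounded_on_time[OF q fm f_le])
  have F_int: "integrable (M \<Otimes>\<^sub>M exponential_law q) F" by (rule integrable_bounded_on_time[OF q Fm F_le])
  \<comment> \<open>The exceptional time c depends on the path, so the limit is taken in t for a
    fixed path and only then integrated over the paths.\<close>
  have inner: "(\<lambda>n. \<integral>t. f n (w, t) \<partial>exponential_law q) \<longlonglongrightarrow> (\<integral>t. F (w, t) \<partial>exponential_law q)" if w: "w \<in> space M" for w
  proof (rule integral_dominated_convergence[where w="\<lambda>_. exp (Re a * x)"])
    obtain c where c: "\<And>t. 0 \<le> t \<Longrightarrow> t \<noteq> c \<Longrightarrow> stays_above x t w \<Longrightarrow> \<exists>\<delta>>0. stays_above x (t + \<delta>) w"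
      using critical_time by blast
    show "AE t in exponential_law q. (\<lambda>n. f n (w, t)) \<longlonglongrightarrow> F (w, t)"
      using exponential_law_nonneg[of q] exponential_law_neq[of c q]
    proof eventually_elim
      case (elim t)
      show ?case
      proof (cases "stays_above x t w")
        case True
        then obtain \<delta> where \<delta>: "\<delta> > 0" "stays_above x (t + \<delta>) w" using c elim by blast
        have ev: "eventually (\<lambda>n. exp (- a * complex_of_real (Y (grid_time n t) w)) = f n (w, t)) sequentially"
          using eventually_grid_small[OF \<delta>(1)]
        proof eventually_elim
          case (elim n)
          have "- x \<le> Y (real j * (1 / real (Suc n))) w" if j: "j \<le> grid_index n t" for j
          proof -
            have "real j * (1 / real (Suc n)) \<le> grid_time n t" unfolding grid_time_def using j by (intro mult_right_mono) auto
            also have "\<dots> \<le> t + \<delta>" using grid_time_bounds(2)[of t n] elim \<open>0 \<le> t\<close> by simp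
            finally show ?thesis using \<delta>(2) unfolding stays_above_def by simp
          qed
          then have "w \<in> walk_above (increment (1 / real (Suc n))) x (grid_index n t)"
            using w unfolding walk_above_increment by blast
          then show ?case by (simp add: f_def)
        qed
        have "(\<lambda>n. Y (grid_time n t) w) \<longlonglongrightarrow> Y t w"
          using grid_time_bounds(1)[of t] elim by (intro path_tendsto_right[OF w _ grid_time_tendsto]) (auto intro: less_imp_le)
        then have "(\<lambda>n. exp (- a * complex_of_real (Y (grid_time n t) w))) \<longlonglongrightarrow> exp (- a * complex_of_real (Y t w))"
          by (intro tendsto_intros)
        from Lim_transform_eventually[OF this ev] show ?thesis using True elim by (simp add: F_def)
      next
        case False
        then obtain s where s: "0 \<le> s" "s \<le> t" "Y s w < - x" by (auto simp: stays_above_def)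
        from eventually_leaves_grid[OF w s(1,3)]
        have "eventually (\<lambda>n. f n (w, t) = 0) sequentially"
        proof eventually_elim
          case (elim n)
          have "walk_above (increment (1 / real (Suc n))) x (grid_index n t) \<subseteq> walk_above (increment (1 / real (Suc n))) x (grid_index n s)"
            using grid_index_mono[OF s(2), of n] by (auto simp: walk_above_def)
          then have "w \<notin> walk_above (increment (1 / real (Suc n))) x (grid_index n t)" using elim by blast
          then show ?case unfolding f_def by simp
        qed
        then have "(\<lambda>n. f n (w, t)) \<longlonglongrightarrow> 0" by (rule tendsto_eventually)
        then show ?thesis using False elim by (simp add: F_def)
      qed
    qed
  next
    show "(\<lambda>t. F (w, t)) \<in> borel_measurable (exponential_law q)" by (rule measurable_Pair2[OF Fm w])
    show "(\<lambda>t. f n (w, t)) \<in> borel_measurable (exponential_law q)" for n by (rule measurable_Pair2[OF fm w])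
    show "AE t in exponential_law q. norm (f n (w, t)) \<le> exp (Re a * x)" for n using f_le[OF w] by simp
  qed simp
  have "(\<lambda>n. \<integral>w. \<integral>t. f n (w, t) \<partial>exponential_law q \<partial>M) \<longlonglongrightarrow> (\<integral>w. \<integral>t. F (w, t) \<partial>exponential_law q \<partial>M)"
  proof (rule integral_dominated_convergence[where w="\<lambda>_. exp (Re a * x)"])
    show "AE w in M. (\<lambda>n. \<integral>t. f n (w, t) \<partial>exponential_law q) \<longlonglongrightarrow> (\<integral>t. F (w, t) \<partial>exponential_law q)"
      using inner by simp
    show "AE w in M. norm (\<integral>t. f n (w, t) \<partial>exponential_law q) \<le> exp (Re a * x)" for n
    proof (rule AE_I2)
      fix w assume w: "w \<in> space M"
      have "norm (\<integral>t. f n (w, t) \<partial>exponential_law q) \<le> (\<integral>t. norm (f n (w, t)) \<partial>exponential_law q)"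
        by (rule integral_norm_bound)
      also have "\<dots> \<le> (\<integral>t. exp (Re a * x) \<partial>exponential_law q)"
        using f_le[OF w] measurable_Pair2[OF fm w]
        by (intro integral_mono integrable_norm E.integrable_const_bound[of _ "exp (Re a * x)"]) auto
      finally show "norm (\<integral>t. f n (w, t) \<partial>exponential_law q) \<le> exp (Re a * x)" using E.prob_space by simp
    qed
    show "(\<lambda>w. \<integral>t. F (w, t) \<partial>exponential_law q) \<in> borel_measurable M"
      by (rule E.borel_measurable_lebesgue_integral) (use Fm in simp)
    show "(\<lambda>w. \<integral>t. f n (w, t) \<partial>exponential_law q) \<in> borel_measurable M" for n
      by (rule E.borel_measurable_lebesgue_integral) (use fm in simp)
  qed simp
  then show ?thesis
    using P.integral_fst'[OF f_int] P.integral_fst'[OF F_int]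
    by (simp add: grid_killed_mgf_def killed_mgf_def with_exponential_time_def f_def[abs_def] F_def[abs_def])
qed

end

section \<open>Passage below a level before an exponential time\<close>

lemma exp_difference_quotient_tendsto:
  fixes z :: complex
  shows "(\<lambda>n. (exp (of_real (1 / real (Suc n)) * z) - 1) / of_real (1 / real (Suc n))) \<longlonglongrightarrow> z"
proof -
  have "((\<lambda>u. exp (u * z)) has_field_derivative z) (at 0)"
    by (auto intro!: derivative_eq_intros)
  then have "((\<lambda>u. (exp (u * z) - 1) / u) \<longlongrightarrow> z) (at 0)"
    by (simp add: DERIV_def)
  moreover have "filterlim (\<lambda>n. complex_of_real (1 / real (Suc n))) (at 0) sequentially"
    unfolding filterlim_at using tendsto_of_real[OF inverse_Suc_tendsto_0, where 'a=complex]
    by (auto intro!: always_eventually simp del: of_real_divide)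
  ultimately show ?thesis by (rule filterlim_compose)
qed

context spectrally_positive_levy_process
begin

lemma exponent_0: "\<phi> 0 = 0"
  using complex_exponent_of_real[of 0] by (simp add: laplace_exponent_def prob_space)

text \<open>The discounted transform of the position at which the grid walk first lies below
  \<open>-x\<close>; the power of the exponential is the probability that T exceeds the time of that
  grid point.\<close>

definition exit_sum :: "complex \<Rightarrow> real \<Rightarrow> real \<Rightarrow> nat \<Rightarrow> complex" where
  "exit_sum a x q n = (\<Sum>k. of_real (exp (- (q * (1 / real (Suc n)))) ^ Suc k) *
     (\<integral>w. exp (- a * complex_of_real (Y (real (Suc k) * (1 / real (Suc n))) w)) * indicator (grid_exit x (1 / real (Suc n)) k) w \<partial>M))"

text \<open>Both the exponential increment with rate \<phi> a - q and the killing probability 1 - r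
  are of the order of the mesh; their quotient supplies the factor (\<phi> a - q)/q.\<close>

lemma exit_sum_tendsto:
  assumes a: "0 \<le> Re a" and q: "0 < q" and x: "0 \<le> x"
  shows "exit_sum a x q \<longlonglongrightarrow> 1 + (\<phi> a - of_real q) / of_real q * killed_mgf a x q"
proof -
  define h where "h n = 1 / real (Suc n)" for n
  define r where "r n = exp (- (q * h n))" for n
  have h: "0 < h n" for n by (simp add: h_def)
  have r: "0 < r n" "r n < 1" for n using q h by (auto simp: r_def)
  have rg: "of_real (r n) * mgf a (h n) = exp (of_real (h n) * (\<phi> a - of_real q))" for n
    by (simp add: r_def mgf_eq_exp[OF a less_imp_le[OF h]] exp_of_real[symmetric] exp_add[symmetric] algebra_simps)
  have eq: "exit_sum a x q n = exp (of_real (h n) * (\<phi> a - of_real q)) +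
      ((exp (of_real (h n) * (\<phi> a - of_real q)) - 1) / of_real (h n)) /
      (- ((exp (of_real (h n) * - of_real q) - 1) / of_real (h n))) * of_real (r n) * grid_killed_mgf a x q n" for n
  proof -
    have 1: "exit_sum a x q n = exp (of_real (h n) * (\<phi> a - of_real q)) +
      (exp (of_real (h n) * (\<phi> a - of_real q)) - 1) * (of_real (r n / (1 - r n)) * grid_killed_mgf a x q n)"
      using sums_unique[OF grid_exit_mgf_sums[OF a q x, of n]] rg[of n]
      unfolding exit_sum_def h_def r_def by metis
    have 2: "exp (of_real (h n) * - complex_of_real q) = of_real (r n)"
      by (simp add: r_def exp_of_real[symmetric] mult.commute)
    have 3: "(A / u) / (- ((B - 1) / u)) * B * G = A * (B / (1 - B) * G)" if "u \<noteq> 0" for A B G u :: complex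
    proof -
      have "- ((B - 1) / u) = (1 - B) / u" by (simp add: minus_divide_left)
      then show ?thesis using that by simp
    qed
    have "complex_of_real (h n) \<noteq> 0" using h[of n] by simp
    note 3[OF this, symmetric]
    then show ?thesis unfolding 2 1 of_real_divide of_real_diff of_real_1 by (intro arg_cong2[where f = "(+)"] refl)
  qed
  have h0: "(\<lambda>n. complex_of_real (h n)) \<longlonglongrightarrow> of_real 0"
    unfolding h_def by (rule tendsto_of_real[OF inverse_Suc_tendsto_0])
  have r1: "(\<lambda>n. complex_of_real (r n)) \<longlonglongrightarrow> of_real 1"
  proof -
    have "(\<lambda>n. exp (- (q * h n))) \<longlonglongrightarrow> exp (- (q * 0))"
      unfolding h_def by (intro tendsto_intros inverse_Suc_tendsto_0)
    then show ?thesis unfolding r_def by (intro tendsto_of_real) simp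
  qed
  have "(\<lambda>n. exp (of_real (h n) * (\<phi> a - of_real q)) +
      ((exp (of_real (h n) * (\<phi> a - of_real q)) - 1) / of_real (h n)) /
      (- ((exp (of_real (h n) * - of_real q) - 1) / of_real (h n))) * of_real (r n) * grid_killed_mgf a x q n)
    \<longlonglongrightarrow> exp (of_real 0 * (\<phi> a - of_real q)) + (\<phi> a - of_real q) / (- (- of_real q)) * of_real 1 * killed_mgf a x q"
    using q unfolding h_def
    by (intro tendsto_intros exp_difference_quotient_tendsto grid_killed_mgf_tendsto[OF a q] r1[unfolded h_def] h0[unfolded h_def]) auto
  then show ?thesis unfolding eq[abs_def, symmetric] by (simp add: eq)
qed

text \<open>As the mesh shrinks, the walk leaves arbitrarily close to \<open>-x\<close>, so the
  exponential of its exit position may be replaced by \<open>exp (a * of_real x)\<close>. This turns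
  the exit sum at a into a multiple of the exit sum at \<open>0\<close>, and comparing the limits of
  both by \<open>exit_sum_tendsto\<close> gives the claim.\<close>

lemma killed_identity:
  assumes a: "0 \<le> Re a" and q: "0 < q" and x: "0 < x"
  shows "1 + (\<phi> a - of_real q) / of_real q * killed_mgf a x q = exp (a * of_real x) * (1 - killed_mgf 0 x q)"
proof -
  have x0: "0 \<le> x" using x by simp
  define h where "h n = 1 / real (Suc n)" for n
  define r where "r n = exp (- (q * h n))" for n
  have h: "0 < h n" "0 \<le> h n" for n by (simp_all add: h_def)
  have r: "0 < r n" "r n < 1" for n using q h by (auto simp: r_def)
  have r0: "0 \<le> r n" for n using r(1) by (rule less_imp_le)
  define b where "b = Re a"
  have b: "0 \<le> b" using a by (simp add: b_def)
  define C where "C n k = grid_exit x (h n) k" for n k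
  have C[measurable]: "C n k \<in> events" for n k unfolding C_def by (rule grid_exit_measurable[OF h(2)])
  have C_disj: "k = l" if "w \<in> C n k" "w \<in> C n l" for w n k l
  proof -
    have "\<not> k < l" if "w \<in> C n k" "w \<in> C n l" for k l
      using that by (auto simp: C_def grid_exit_def walk_above_def)
    then show ?thesis using that by (meson linorder_less_linear)
  qed
  have Ym[measurable]: "Y (real k * h n) \<in> borel_measurable M" for n k by (intro random_variable_Y) (simp add: h)
  define z where "z n k w = norm (exp (- a * complex_of_real (Y (real (Suc k) * h n) w)) - exp (a * of_real x))" for n k w
  have zm[measurable]: "z n k \<in> borel_measurable M" for n k unfolding z_def by measurable
  \<comment> \<open>the discounted error made by replacing the position at the exit from the grid walk by the
    level \<open>- x\<close>; it vanishes pathwise because a path without negative jumps passes downwards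
    continuously, and in mean because of an \<open>L\<^sup>2\<close> bound\<close>
  define g where "g n w = (\<Sum>k. r n ^ Suc k * z n k w * indicator (C n k) w)" for n w
  have g_in: "g n w = r n ^ Suc k * z n k w" if "w \<in> C n k" for n k w
  proof -
    have "(\<lambda>l. r n ^ Suc l * z n l w * indicator (C n l) w) = (\<lambda>l. if l = k then r n ^ Suc k * z n k w else 0)"
      using that C_disj by (fastforce simp: indicator_def)
    then show ?thesis unfolding g_def using suminf_finite[of "{k}" "\<lambda>l. if l = k then r n ^ Suc k * z n k w else 0"] by simp
  qed
  have g_out: "g n w = 0" if "\<And>k. w \<notin> C n k" for n w using that by (simp add: g_def)
  have gm[measurable]: "g n \<in> borel_measurable M" for n
    unfolding g_def by (intro borel_measurable_suminf) measurable
  have g_nonneg: "0 \<le> g n w" for n w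
  proof (cases "\<exists>k. w \<in> C n k")
    case True then show ?thesis using g_in r(1) by (auto simp: z_def less_imp_le)
  qed (simp add: g_out)
  have g_lim: "(\<lambda>n. g n w) \<longlonglongrightarrow> 0" if w: "w \<in> space M" for w
  proof (cases "\<exists>s\<ge>0. Y s w < - x")
    case False
    have "w \<notin> C n k" for n k
      using False w h[of n] by (auto simp: C_def grid_exit_def walk_above_increment not_less simp del: of_nat_Suc)
    then show ?thesis using g_out by simp
  next
    case True
    then obtain s where s: "0 \<le> s" "Y s w < - x" by blast
    show ?thesis
    proof (rule order_tendstoI)
      fix e :: real assume e: "0 < e"
      have "isCont (\<lambda>y. exp (- a * complex_of_real y)) (- x)" by (intro continuous_intros)
      then obtain \<eta> where \<eta>: "\<eta> > 0" "\<And>y. dist y (- x) < \<eta> \<Longrightarrow> dist (exp (- a * complex_of_real y)) (exp (- a * complex_of_real (- x))) < e"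
        using e unfolding continuous_at_eps_delta by (metis dist_norm real_norm_def)
      obtain \<delta> where \<delta>: "\<delta> > 0" "\<And>u v. 0 \<le> u \<Longrightarrow> u \<le> v \<Longrightarrow> v \<le> s + 1 \<Longrightarrow> v - u < \<delta> \<Longrightarrow> Y v w - Y u w > - \<eta>"
        using uniformly_small_drops[OF w \<eta>(1), of "s + 1"] s(1) by (metis add_nonneg_nonneg zero_le_one)
      from eventually_leaves_grid[OF w s] eventually_grid_small[OF \<delta>(1)]
      show "eventually (\<lambda>n. g n w < e) sequentially"
      proof eventually_elim
        case (elim n)
        show ?case
        proof (cases "\<exists>k. w \<in> C n k")
          case True
          then obtain k where k: "w \<in> C n k" by blast
          have above: "\<forall>j\<le>k. - x \<le> Y (real j * h n) w" and below: "Y (real (Suc k) * h n) w < - x"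
            using k by (auto simp: C_def grid_exit_def walk_above_increment not_le le_Suc_eq)
          \<comment> \<open>The walk is out by the grid point after s, so the exit step lies within
            the time span up to \<open>s + 1\<close> on which the drop estimate is uniform.\<close>
          have "k < grid_index n s"
          proof (rule ccontr)
            assume "\<not> k < grid_index n s"
            with above have "w \<in> walk_above (increment (1 / real (Suc n))) x (grid_index n s)"
              using w unfolding walk_above_increment h_def by auto
            with elim show False by blast
          qed
          then have "real (Suc k) * h n \<le> grid_time n s"
            unfolding grid_time_def h_def by (intro mult_right_mono) auto
          also have "\<dots> \<le> s + 1"
            using grid_time_bounds(2)[OF s(1), of n] by (rule order_trans) (simp add: field_simps)
          finally have "Y (real (Suc k) * h n) w - Y (real k * h n) w > - \<eta>"
          proof (intro \<delta>(2))
            have "real (Suc k) * h n - real k * h n = h n" by (simp add: algebra_simps)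
            also have "\<dots> < \<delta>" using elim by (simp add: h_def)
            finally show "real (Suc k) * h n - real k * h n < \<delta>" .
            show "real k * h n \<le> real (Suc k) * h n" using h(2) by (intro mult_right_mono) auto
          qed (simp_all add: h)
          then have "dist (Y (real (Suc k) * h n) w) (- x) < \<eta>"
            using above below by (auto simp: dist_real_def simp del: of_nat_Suc)
          then have z: "z n k w < e" using \<eta>(2) by (simp add: z_def dist_norm)
          have "g n w \<le> 1 * z n k w"
            unfolding g_in[OF k] using r[of n] by (intro mult_right_mono power_le_one) (auto simp: z_def)
          then show ?thesis using z by simp
        qed (use e g_out in simp)
      qed
    next
      fix e :: real assume "e < 0"
      then show "eventually (\<lambda>n. e < g n w) sequentially"
        by (intro always_eventually allI less_le_trans[OF _ g_nonneg])
    qed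
  qed
  define I where "I c n k = (\<integral>w. exp (- c * Y (real (Suc k) * h n) w) * indicator (C n k) w \<partial>M)" for c n k
  have I_int: "integrable M (\<lambda>w. exp (- c * Y (real (Suc k) * h n) w) * indicator (C n k) w)" if "0 \<le> c" for c n k
    using integrable_mult_indicator[OF C exp_integrable[OF that, of "real (Suc k) * h n"]] h
    by (simp add: mult.commute)
  have I_nonneg: "0 \<le> I c n k" for c n k unfolding I_def by (intro Bochner_Integration.integral_nonneg) auto
  have I_complex: "(\<integral>w. exp (- of_real c * complex_of_real (Y (real (Suc k) * h n) w)) * indicator (C n k) w \<partial>M) = of_real (I c n k)" for c n k
    unfolding I_def integral_complex_of_real[symmetric]
    by (intro Bochner_Integration.integral_cong refl) (simp add: exp_of_real[symmetric] of_real_indicator)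
  have I_sums: "(\<lambda>k. r n ^ Suc k * I c n k) sums Re (exit_sum (of_real c) x q n)" if c: "0 \<le> c" for c n
  proof -
    have "summable (\<lambda>k. of_real (r n ^ Suc k) * (\<integral>w. exp (- of_real c * complex_of_real (Y (real (Suc k) * h n) w)) * indicator (C n k) w \<partial>M))"
      using grid_exit_mgf_sums[of "of_real c" q x n] c q x0 unfolding h_def r_def C_def by (auto dest: sums_summable)
    from summable_sums[OF this] have "(\<lambda>k. of_real (r n ^ Suc k) * of_real (I c n k)) sums exit_sum (of_real c) x q n"
      unfolding exit_sum_def h_def[symmetric] r_def[symmetric] C_def[symmetric] I_complex .
    from sums_Re[OF this] show ?thesis unfolding of_real_mult[symmetric] Re_complex_of_real .
  qed
  have z_sq: "(z n k w)\<^sup>2 \<le> 2 * exp (- (2 * b) * Y (real (Suc k) * h n) w) + 2 * exp (2 * b * x)" for n k w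
  proof -
    define u where "u = exp (- a * complex_of_real (Y (real (Suc k) * h n) w))"
    define v where "v = exp (a * complex_of_real x)"
    have "(norm (u - v))\<^sup>2 \<le> (norm u + norm v)\<^sup>2" by (intro power_mono norm_triangle_ineq4) auto
    also have "\<dots> \<le> 2 * (norm u)\<^sup>2 + 2 * (norm v)\<^sup>2"
      using sum_squares_bound[of "norm u" "norm v"] by (simp add: power2_eq_square algebra_simps)
    also have "(norm u)\<^sup>2 = exp (- (2 * b) * Y (real (Suc k) * h n) w)"
      by (simp add: u_def b_def norm_exp_eq_Re power2_eq_square exp_add[symmetric])
    also have "(norm v)\<^sup>2 = exp (2 * b * x)"
      by (simp add: v_def b_def norm_exp_eq_Re power2_eq_square exp_add[symmetric])
    finally show ?thesis by (simp add: z_def u_def v_def)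
  qed
  \<comment> \<open>A bound for the second moment of \<open>g n\<close>. It is made of exit sums
    itself, at the parameters \<open>2 * b\<close> and \<open>0\<close>, so their convergence bounds
    it in n.\<close>
  define K where "K n = 2 * Re (exit_sum (of_real (2 * b)) x q n) + 2 * exp (2 * b * x) * Re (exit_sum (of_real 0) x q n)" for n
  have K_sums: "(\<lambda>k. 2 * (r n ^ Suc k * I (2 * b) n k) + 2 * exp (2 * b * x) * (r n ^ Suc k * I 0 n k)) sums K n" for n
    unfolding K_def using b by (intro sums_add sums_mult I_sums) auto
  have K_nonneg: "0 \<le> K n" for n
    using r0 by (intro sums_le[OF _ sums_zero K_sums]) (auto intro!: add_nonneg_nonneg mult_nonneg_nonneg I_nonneg)
  have "convergent K"
  proof -
    have "convergent (\<lambda>n. Re (exit_sum (of_real c) x q n))" if "0 \<le> c" for c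
      using tendsto_Re[OF exit_sum_tendsto[of "of_real c" q x]] that q x0 by (auto intro: convergentI)
    from this[of "2 * b"] this[of 0] b show ?thesis unfolding K_def
      by (intro convergent_add convergent_mult convergent_const) auto
  qed
  then obtain K' where K': "\<And>n. K n \<le> K'"
    using Bseq_def convergent_imp_Bseq by (metis abs_le_D1 real_norm_def)
  have nn_sq: "(\<integral>\<^sup>+w. ennreal ((g n w)\<^sup>2) \<partial>M) \<le> ennreal (K n)" for n
  proof -
    define f where "f k w = r n ^ Suc k * (2 * exp (- (2 * b) * Y (real (Suc k) * h n) w) + 2 * exp (2 * b * x)) * indicator (C n k) w" for k w
    have fm[measurable]: "f k \<in> borel_measurable M" for k unfolding f_def by measurable
    have f_nonneg: "0 \<le> f k w" for k w
      unfolding f_def using r(1)[of n] by (intro mult_nonneg_nonneg) auto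
    have f_eq: "f k w = 2 * (r n ^ Suc k * (exp (- (2 * b) * Y (real (Suc k) * h n) w) * indicator (C n k) w)) +
        2 * exp (2 * b * x) * (r n ^ Suc k * (exp (- 0 * Y (real (Suc k) * h n) w) * indicator (C n k) w))" for k w
      by (simp add: f_def algebra_simps)
    have f_int: "integrable M (f k)" for k
      unfolding f_eq using b by (intro Bochner_Integration.integrable_add integrable_mult_right I_int) auto
    have f_integral: "(\<integral>w. f k w \<partial>M) = 2 * (r n ^ Suc k * I (2 * b) n k) + 2 * exp (2 * b * x) * (r n ^ Suc k * I 0 n k)" for k
      unfolding f_eq I_def using b I_int[of "2 * b" k n] I_int[of 0 k n]
      by (subst Bochner_Integration.integral_add) (simp_all del: power_Suc mult_minus_left mult_zero_left minus_zero)
    have "ennreal ((g n w)\<^sup>2) \<le> (\<Sum>k. ennreal (f k w))" for w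
    proof (cases "\<exists>k. w \<in> C n k")
      case True
      then obtain k where k: "w \<in> C n k" by blast
      have "(g n w)\<^sup>2 = (r n ^ Suc k)\<^sup>2 * (z n k w)\<^sup>2" unfolding g_in[OF k] by (rule power_mult_distrib)
      also have "(r n ^ Suc k)\<^sup>2 \<le> r n ^ Suc k"
        using r[of n] power_le_one[of "r n" "Suc k"] unfolding power2_eq_square
        by (intro mult_left_le_one_le) auto
      then have "(r n ^ Suc k)\<^sup>2 * (z n k w)\<^sup>2 \<le> r n ^ Suc k * (2 * exp (- (2 * b) * Y (real (Suc k) * h n) w) + 2 * exp (2 * b * x))"
        using r(1)[of n] by (intro mult_mono z_sq) auto
      also have "\<dots> = f k w" using k by (simp add: f_def)
      finally have "ennreal ((g n w)\<^sup>2) \<le> ennreal (f k w)" by (intro ennreal_leI)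
      also have "\<dots> = (\<Sum>l\<in>{k}. ennreal (f l w))" by simp
      also have "\<dots> \<le> (\<Sum>l. ennreal (f l w))" by (rule sum_le_suminf) auto
      finally show ?thesis .
    qed (simp add: g_out)
    then have "(\<integral>\<^sup>+w. ennreal ((g n w)\<^sup>2) \<partial>M) \<le> (\<integral>\<^sup>+w. (\<Sum>k. ennreal (f k w)) \<partial>M)" by (intro nn_integral_mono) auto
    also have "\<dots> = (\<Sum>k. \<integral>\<^sup>+w. ennreal (f k w) \<partial>M)" by (intro nn_integral_suminf) measurable
    also have "\<dots> = (\<Sum>k. ennreal (\<integral>w. f k w \<partial>M))"
      by (intro suminf_cong nn_integral_eq_integral f_int) (auto intro: f_nonneg)
    also have "\<dots> = ennreal (\<Sum>k. \<integral>w. f k w \<partial>M)"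
      unfolding f_integral
      using sums_summable[OF K_sums[of n]] r0
      by (intro suminf_ennreal2) (auto intro!: add_nonneg_nonneg mult_nonneg_nonneg I_nonneg)
    also have "(\<Sum>k. \<integral>w. f k w \<partial>M) = K n" unfolding f_integral using K_sums by (simp add: sums_unique[symmetric])
    finally show ?thesis .
  qed
  have sq_int: "integrable M (\<lambda>w. (g n w)\<^sup>2)" for n
    using nn_sq[of n] by (intro integrableI_bounded) (auto intro: le_less_trans)
  have sq_le: "(\<integral>w. (g n w)\<^sup>2 \<partial>M) \<le> K'" for n
  proof -
    have "ennreal (\<integral>w. (g n w)\<^sup>2 \<partial>M) \<le> ennreal (K n)"
      using nn_sq[of n] by (subst nn_integral_eq_integral[OF sq_int, symmetric]) auto
    then show ?thesis using K'[of n] K_nonneg[of n] by simp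
  qed
  have Eg: "(\<lambda>n. \<integral>w. g n w \<partial>M) \<longlonglongrightarrow> 0"
    by (rule integral_tendsto_zero_if_L2_bounded[OF gm g_nonneg _ sq_int sq_le]) (use g_lim in auto)
  have g_int: "integrable M (g n)" for n
    using square_integrable_imp_integrable[OF gm sq_int] by blast
  define J where "J c n k = (\<integral>w. exp (- c * complex_of_real (Y (real (Suc k) * h n) w)) * indicator (C n k) w \<partial>M)" for c n k
  have J_int: "integrable M (\<lambda>w. exp (- c * complex_of_real (Y (real (Suc k) * h n) w)) * indicator (C n k) w)" if "0 \<le> Re c" for c n k
    by (rule grid_integrable[OF that h(2) C])
  have J_sums: "(\<lambda>k. of_real (r n ^ Suc k) * J c n k) sums exit_sum c x q n" if c: "0 \<le> Re c" for c n
  proof -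
    have "summable (\<lambda>k. of_real (r n ^ Suc k) * J c n k)"
      using grid_exit_mgf_sums[OF c q x0, of n] unfolding h_def r_def C_def J_def by (rule sums_summable)
    from summable_sums[OF this] show ?thesis unfolding exit_sum_def h_def r_def C_def J_def .
  qed
  have diff_le: "norm (exit_sum a x q n - exp (a * of_real x) * exit_sum 0 x q n) \<le> (\<integral>w. g n w \<partial>M)" for n
  proof -
    have S: "(\<lambda>k. of_real (r n ^ Suc k) * J a n k - exp (a * of_real x) * (of_real (r n ^ Suc k) * J 0 n k))
        sums (exit_sum a x q n - exp (a * of_real x) * exit_sum 0 x q n)"
      using a by (intro sums_diff sums_mult J_sums) auto
    have summand: "norm (of_real (r n ^ Suc k) * J a n k - exp (a * of_real x) * (of_real (r n ^ Suc k) * J 0 n k))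
        \<le> (\<integral>w. r n ^ Suc k * z n k w * indicator (C n k) w \<partial>M)" for k
    proof -
      have "of_real (r n ^ Suc k) * J a n k - exp (a * of_real x) * (of_real (r n ^ Suc k) * J 0 n k) =
          of_real (r n ^ Suc k) * (J a n k - exp (a * of_real x) * J 0 n k)" by (simp only: algebra_simps)
      also have "J a n k - exp (a * of_real x) * J 0 n k =
          (\<integral>w. exp (- a * complex_of_real (Y (real (Suc k) * h n) w)) * indicator (C n k) w -
            exp (a * of_real x) * (exp (- 0 * complex_of_real (Y (real (Suc k) * h n) w)) * indicator (C n k) w) \<partial>M)"
        unfolding J_def using J_int[OF a, of k n] J_int[of 0 k n]
        by (subst Bochner_Integration.integral_diff) simp_all
      finally have "norm (of_real (r n ^ Suc k) * J a n k - exp (a * of_real x) * (of_real (r n ^ Suc k) * J 0 n k)) =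
          r n ^ Suc k * norm (\<integral>w. exp (- a * complex_of_real (Y (real (Suc k) * h n) w)) * indicator (C n k) w -
            exp (a * of_real x) * (exp (- 0 * complex_of_real (Y (real (Suc k) * h n) w)) * indicator (C n k) w) \<partial>M)"
        using r(1)[of n] by (simp add: norm_mult norm_power less_imp_le)
      also have "\<dots> \<le> r n ^ Suc k * (\<integral>w. norm (exp (- a * complex_of_real (Y (real (Suc k) * h n) w)) * indicator (C n k) w -
            exp (a * of_real x) * (exp (- 0 * complex_of_real (Y (real (Suc k) * h n) w)) * indicator (C n k) w)) \<partial>M)"
        using r(1)[of n] by (intro mult_left_mono integral_norm_bound) auto
      also have "\<dots> = (\<integral>w. r n ^ Suc k * norm (exp (- a * complex_of_real (Y (real (Suc k) * h n) w)) * indicator (C n k) w -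
            exp (a * of_real x) * (exp (- 0 * complex_of_real (Y (real (Suc k) * h n) w)) * indicator (C n k) w)) \<partial>M)"
        by simp
      also have "\<dots> = (\<integral>w. r n ^ Suc k * z n k w * indicator (C n k) w \<partial>M)"
        by (intro Bochner_Integration.integral_cong refl) (auto simp: z_def indicator_def)
      finally show ?thesis .
    qed
    have partial: "(\<Sum>k<N. \<integral>w. r n ^ Suc k * z n k w * indicator (C n k) w \<partial>M) \<le> (\<integral>w. g n w \<partial>M)" for N
    proof -
      have le: "(\<Sum>k<N. r n ^ Suc k * z n k w * indicator (C n k) w) \<le> g n w" for w
      proof (cases "\<exists>k. w \<in> C n k")
        case True
        then obtain k where k: "w \<in> C n k" by blast
        have "(\<Sum>l<N. r n ^ Suc l * z n l w * indicator (C n l) w) = (\<Sum>l<N. if l = k then r n ^ Suc k * z n k w else 0)"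
          using k C_disj by (intro sum.cong refl) (fastforce simp: indicator_def)
        also have "\<dots> \<le> r n ^ Suc k * z n k w" using r(1)[of n] by (simp add: z_def less_imp_le)
        finally show ?thesis using g_in[OF k] by simp
      qed (use g_out in simp)
      have int: "integrable M (\<lambda>w. r n ^ Suc k * z n k w * indicator (C n k) w)" for k
      proof (rule Bochner_Integration.integrable_bound[OF g_int[of n]])
        show "AE w in M. norm (r n ^ Suc k * z n k w * indicator (C n k) w) \<le> norm (g n w)"
          using g_in r(1)[of n] by (auto simp: indicator_def)
      qed measurable
      have "(\<Sum>k<N. \<integral>w. r n ^ Suc k * z n k w * indicator (C n k) w \<partial>M) = (\<integral>w. (\<Sum>k<N. r n ^ Suc k * z n k w * indicator (C n k) w) \<partial>M)"
        using int by (subst Bochner_Integration.integral_sum) auto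
      also have "\<dots> \<le> (\<integral>w. g n w \<partial>M)" by (intro integral_mono Bochner_Integration.integrable_sum int g_int le)
      finally show ?thesis .
    qed
    show ?thesis
    proof (rule Lim_bounded[OF tendsto_norm[OF S[unfolded sums_def]]], intro allI impI)
      fix N
      show "norm (\<Sum>k<N. of_real (r n ^ Suc k) * J a n k - exp (a * of_real x) * (of_real (r n ^ Suc k) * J 0 n k)) \<le> (\<integral>w. g n w \<partial>M)"
        by (rule order_trans[OF order_trans[OF norm_sum sum_mono[OF summand]] partial])
    qed
  qed
  have "(\<lambda>n. exit_sum a x q n - exp (a * of_real x) * exit_sum 0 x q n) \<longlonglongrightarrow> 0"
    by (rule Lim_null_comparison[OF always_eventually[OF allI[OF diff_le]] Eg])
  moreover have "(\<lambda>n. exit_sum a x q n - exp (a * of_real x) * exit_sum 0 x q n) \<longlonglongrightarrow>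
     (1 + (\<phi> a - of_real q) / of_real q * killed_mgf a x q) - exp (a * of_real x) * (1 + (\<phi> 0 - of_real q) / of_real q * killed_mgf 0 x q)"
    using a by (intro tendsto_intros exit_sum_tendsto q x0) auto
  ultimately have "(1 + (\<phi> a - of_real q) / of_real q * killed_mgf a x q) - exp (a * of_real x) * (1 + (\<phi> 0 - of_real q) / of_real q * killed_mgf 0 x q) = 0"
    using LIMSEQ_unique by blast
  then show ?thesis using q by (simp add: exponent_0)
qed

section \<open>The right inverse of the Laplace exponent\<close>

text \<open>At a root \<open>exp (a * of_real x)\<close> is the reciprocal of a passage probability
  in which a does not occur. All levels x are used together, since one level would leave a multiple
  of a period undetermined.\<close>

lemma exponent_eq_unique:
  assumes "0 \<le> Re a" "0 \<le> Re b" "0 < q" "\<phi> a = of_real q" "\<phi> b = of_real q"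
  shows "a = b"
proof (rule exp_scaling_unique)
  fix x :: real assume "0 \<le> x"
  show "exp (of_real x * a) = exp (of_real x * b)"
  proof (cases "x = 0")
    case False
    with \<open>0 \<le> x\<close> have x: "0 < x" by simp
    have "1 = exp (a * of_real x) * (1 - killed_mgf 0 x q)" "1 = exp (b * of_real x) * (1 - killed_mgf 0 x q)"
      using killed_identity[OF assms(1,3) x] killed_identity[OF assms(2,3) x] assms(4,5) by simp_all
    then have "exp (a * of_real x) = exp (b * of_real x)" by (metis mult_cancel_right zero_neq_one mult_zero_right)
    then show ?thesis by (simp add: mult.commute)
  qed simp
qed

text \<open>If the process were almost surely nonnegative at every time, stationarity would make
  every increment nonnegative, first for all rational times simultaneously and then, by
  right-continuity, for all times; this is excluded by \<open>not_increasing\<close>.\<close>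

lemma ex_negative:
  "\<exists>t\<ge>0. \<not> (AE w in M. 0 \<le> Y t w)"
proof (rule ccontr)
  assume "\<not> ?thesis"
  then have nonneg: "AE w in M. 0 \<le> Y t w" if "0 \<le> t" for t using that by blast
  have incr: "AE w in M. Y s w \<le> Y (s + h) w" if "0 \<le> s" "0 \<le> h" for s h
  proof -
    have "AE y in distr M borel (Y h). 0 \<le> y"
      using nonneg[OF that(2)] random_variable_Y[OF that(2)] by (subst AE_distr_iff) auto
    then have "AE y in distr M borel (\<lambda>w. Y (s + h) w - Y s w). 0 \<le> y"
      unfolding stationary_increments[OF that] .
    moreover have "(\<lambda>w. Y (s + h) w - Y s w) \<in> borel_measurable M"
      using that by (intro borel_measurable_diff random_variable_Y) auto
    ultimately show ?thesis by (subst (asm) AE_distr_iff) auto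
  qed
  have cQ: "countable {(s, h). s \<in> \<rat> \<and> h \<in> \<rat> \<and> 0 \<le> s \<and> (0::real) \<le> h}"
    by (rule countable_subset[of _ "\<rat> \<times> \<rat>"]) (auto intro: countable_rat)
  have "AE w in M. \<forall>p\<in>{(s, h). s \<in> \<rat> \<and> h \<in> \<rat> \<and> 0 \<le> s \<and> (0::real) \<le> h}. Y (fst p) w \<le> Y (fst p + snd p) w"
    using incr by (subst AE_ball_countable[OF cQ]) auto
  then have "AE w in M. mono_on {0..} (\<lambda>t. Y t w)"
  proof (rule AE_mp, intro AE_I2 impI)
    fix w assume w: "w \<in> space M" and *: "\<forall>p\<in>{(s, h). s \<in> \<rat> \<and> h \<in> \<rat> \<and> 0 \<le> s \<and> (0::real) \<le> h}. Y (fst p) w \<le> Y (fst p + snd p) w"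
    have rat: "Y s w \<le> Y u w" if "s \<in> \<rat>" "u \<in> \<rat>" "0 \<le> s" "s \<le> u" for s u
      using bspec[OF *, of "(s, u - s)"] that by auto
    show "mono_on {0..} (\<lambda>t. Y t w)"
    proof (rule mono_onI, rule ccontr)
      fix s u :: real assume su: "s \<in> {0..}" "u \<in> {0..}" "s \<le> u" "\<not> Y s w \<le> Y u w"
      define y where "y = (Y s w + Y u w) / 2"
      have y: "Y u w < y" "y < Y s w" using su(4) by (auto simp: y_def)
      have s_less: "s < u" using su by (cases "s = u") auto
      obtain d where d: "d > 0" "\<And>v. u \<le> v \<Longrightarrow> v < u + d \<Longrightarrow> Y v w < y"
        by (rule right_open_strict[OF w _ y(1)]) (use su in auto)
      obtain d' l where d': "d' > 0" "\<And>v. s \<le> v \<Longrightarrow> v < s + d' \<Longrightarrow> \<bar>Y v w - Y s w\<bar> < Y s w - y"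
        by (rule path_local[OF w, of s "Y s w - y"]) (use su y in auto)
      obtain v where v: "v \<in> \<rat>" "u < v" "v < u + d" using Rats_dense_in_real[of u "u + d"] d(1) by auto
      obtain v' where v': "v' \<in> \<rat>" "s < v'" "v' < min (s + d') u" using Rats_dense_in_real[of s "min (s + d') u"] d'(1) s_less by auto
      have "Y v' w \<le> Y v w" using v v' su by (intro rat) auto
      moreover have "Y v w < y" using d(2)[of v] v by simp
      moreover have "y < Y v' w" using d'(2)[of v'] v' by auto
      ultimately show False by simp
    qed
  qed
  then show False using not_increasing by blast
qed

text \<open>An event of positive probability on which \<open>Y t\<close> is at most
  \<open>-e\<close> already contributes a term growing like \<open>exp (a * e)\<close> to the
  transform at time t.\<close>

lemma exponent_unbounded:
  obtains a where "0 \<le> a" "q \<le> \<phi>\<^sub>r a"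
proof -
  obtain t where t: "0 \<le> t" "\<not> (AE w in M. 0 \<le> Y t w)" using ex_negative by blast
  have "t \<noteq> 0" using t(2) Y_zero by auto
  with t have t0: "0 < t" by simp
  have [measurable]: "Y t \<in> borel_measurable M" using t(1) by (rule random_variable_Y)
  have "\<exists>n. \<not> (AE w in M. - 1 / real (Suc n) < Y t w)"
  proof (rule ccontr)
    assume "\<not> ?thesis"
    then have "AE w in M. \<forall>n. - 1 / real (Suc n) < Y t w" by (simp add: AE_all_countable)
    then have "AE w in M. 0 \<le> Y t w"
    proof eventually_elim
      case (elim w)
      show ?case
      proof (rule ccontr)
        assume "\<not> 0 \<le> Y t w"
        then obtain n where "inverse (real (Suc n)) < - Y t w" using reals_Archimedean[of "- Y t w"] by auto
        with elim show False by (auto simp: inverse_eq_divide dest!: spec[of _ n])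
      qed
    qed
    with t show False by blast
  qed
  then obtain n where n: "\<not> (AE w in M. - 1 / real (Suc n) < Y t w)" by blast
  define e where "e = 1 / real (Suc n)"
  have e: "e > 0" by (simp add: e_def)
  define A where "A = {w \<in> space M. Y t w \<le> - e}"
  have A[measurable]: "A \<in> events" unfolding A_def by measurable
  define pA where "pA = prob A"
  have "AE w in M. w \<notin> A" if "pA = 0" using that A by (auto simp: pA_def AE_iff_measurable[of A] emeasure_eq_measure A_def dest: sets.sets_into_space)
  then have "pA \<noteq> 0" using n by (auto simp: A_def e_def not_le elim!: eventually_mono)
  then have pA: "pA > 0" by (simp add: pA_def zero_less_measure_iff)
  \<comment> \<open>The solution of \<open>a * e + ln pA = t * q\<close>, replaced by
    \<open>0\<close> when negative.\<close>
  define a where "a = max 0 ((t * q - ln pA) / e)"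
  have a: "0 \<le> a" by (simp add: a_def)
  have "exp (a * e) * pA = (\<integral>w. exp (a * e) * indicator A w \<partial>M)" by (simp add: pA_def)
  also have "\<dots> \<le> (\<integral>w. exp (- a * Y t w) \<partial>M)"
  proof (intro integral_mono exp_integrable[OF a t(1)])
    fix w assume "w \<in> space M"
    show "exp (a * e) * indicator A w \<le> exp (- a * Y t w)"
      using mult_left_mono[of "Y t w" "- e" a] a by (auto simp: indicator_def A_def)
  qed (auto simp: emeasure_eq_measure)
  also have "\<dots> = exp (t * \<phi>\<^sub>r a)" by (rule real_mgf_eq_exp[OF a t(1)])
  finally have "ln (exp (a * e) * pA) \<le> t * \<phi>\<^sub>r a" using pA by (metis exp_gt_zero ln_le_cancel_iff ln_exp mult_pos_pos)
  then have "a * e + ln pA \<le> t * \<phi>\<^sub>r a" using pA by (simp add: ln_mult)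
  moreover have "t * q \<le> a * e + ln pA" using e by (auto simp: a_def max_def field_simps)
  ultimately have "t * q \<le> t * \<phi>\<^sub>r a" by simp
  then show thesis using t0 a by (intro that) auto
qed

lemma exponent_continuous: "continuous_on {0..} \<phi>\<^sub>r"
proof -
  have "continuous_on {0..} (\<lambda>a. \<integral>w. exp (- a * Y 1 w) \<partial>M)"
  proof (rule continuous_on_sequentiallyI)
    fix u :: "nat \<Rightarrow> real" and a assume u: "\<forall>n. u n \<in> {0..}" and a: "a \<in> {0..}" and lim: "u \<longlonglongrightarrow> a"
    have Y1[measurable]: "Y 1 \<in> borel_measurable M" by (rule random_variable_Y) simp
    have "Bseq u" using lim by (auto intro: convergent_imp_Bseq convergentI)
    then obtain K where K: "\<And>n. norm (u n) \<le> K" by (auto simp: Bseq_def)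
    have K0: "0 \<le> K" using K[of 0] by simp
    show "(\<lambda>n. \<integral>w. exp (- u n * Y 1 w) \<partial>M) \<longlonglongrightarrow> (\<integral>w. exp (- a * Y 1 w) \<partial>M)"
    proof (rule integral_dominated_convergence[where w="\<lambda>w. 1 + exp (- K * Y 1 w)"])
      show "AE w in M. (\<lambda>n. exp (- u n * Y 1 w)) \<longlonglongrightarrow> exp (- a * Y 1 w)"
        by (intro AE_I2 tendsto_intros lim)
      show "AE w in M. norm (exp (- u n * Y 1 w)) \<le> 1 + exp (- K * Y 1 w)" for n
      proof (rule AE_I2)
        fix w
        have "0 \<le> u n" "u n \<le> K" using u K[of n] by auto
        show "norm (exp (- u n * Y 1 w)) \<le> 1 + exp (- K * Y 1 w)"
        proof (cases "0 \<le> Y 1 w")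
          case True
          then have "exp (- u n * Y 1 w) \<le> 1" using \<open>0 \<le> u n\<close> by simp
          then show ?thesis by (simp add: add_increasing2)
        next
          case False
          then have "exp (- u n * Y 1 w) \<le> exp (- K * Y 1 w)" using \<open>u n \<le> K\<close> mult_right_mono_neg[of "u n" K "Y 1 w"] by simp
          then show ?thesis by (simp add: add_increasing)
        qed
      qed
      show "integrable M (\<lambda>w. 1 + exp (- K * Y 1 w))" using exp_integrable[OF K0, of 1] by simp
    qed measurable
  qed
  moreover have "(\<integral>w. exp (- a * Y 1 w) \<partial>M) \<noteq> 0" if "a \<in> {0..}" for a using real_mgf_pos[of a 1] that by simp
  ultimately show ?thesis
    unfolding laplace_exponent_def[abs_def] by (intro continuous_on_ln) auto
qed

abbreviation "\<psi> \<equiv> right_inverse M Y"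

text \<open>Continuity, the value \<open>0\<close> at \<open>0\<close> and unboundedness give a
  solution, and \<open>exponent_eq_unique\<close> makes it the only one, so the supremum in
  \<open>right_inverse\<close> is over a singleton. The third part excludes complex solutions as
  well, which later puts all roots on the real axis.\<close>

lemma right_inverse:
  assumes q: "0 < q"
  shows right_inverse_pos: "0 < \<psi> q"
    and exponent_right_inverse: "\<phi>\<^sub>r (\<psi> q) = q"
    and complex_exponent_eq_iff: "\<And>a. 0 \<le> Re a \<Longrightarrow> \<phi> a = of_real q \<longleftrightarrow> a = of_real (\<psi> q)"
proof -
  have phi0: "\<phi>\<^sub>r 0 = 0" by (simp add: laplace_exponent_def prob_space)
  obtain A where A: "0 \<le> A" "q \<le> \<phi>\<^sub>r A" using exponent_unbounded by blast
  have "\<exists>\<theta>\<ge>0. \<theta> \<le> A \<and> \<phi>\<^sub>r \<theta> = q"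
    using phi0 q A by (intro IVT') (auto intro: continuous_on_subset[OF exponent_continuous])
  then obtain \<theta> where \<theta>: "0 \<le> \<theta>" "\<phi>\<^sub>r \<theta> = q" by blast
  have \<theta>': "\<phi> (of_real \<theta>) = of_real q" using complex_exponent_of_real[OF \<theta>(1)] \<theta>(2) by simp
  have uniq: "a = of_real \<theta>" if "0 \<le> Re a" "\<phi> a = of_real q" for a
    by (rule exponent_eq_unique[OF that(1) _ q that(2) \<theta>']) (use \<theta>(1) in simp)
  have uniq_real: "a = \<theta>" if "0 \<le> a" "\<phi>\<^sub>r a = q" for a
  proof -
    have "complex_of_real a = of_real \<theta>"
      using complex_exponent_of_real[OF that(1)] that by (intro uniq) auto
    then show ?thesis by simp
  qed
  have "{a. 0 \<le> a \<and> \<phi>\<^sub>r a = q} = {\<theta>}" using \<theta> uniq_real by blast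
  then have psi: "\<psi> q = \<theta>" by (simp add: right_inverse_def)
  have "\<theta> \<noteq> 0" using \<theta> phi0 q by auto
  then show "0 < \<psi> q" "\<phi>\<^sub>r (\<psi> q) = q" using psi \<theta> by auto
  show "\<phi> a = of_real q \<longleftrightarrow> a = of_real (\<psi> q)" if "0 \<le> Re a" for a
    using uniq[OF that] \<theta>' unfolding psi by blast
qed

lemma exponent_eq_iff: "0 < q \<Longrightarrow> 0 \<le> a \<Longrightarrow> \<phi>\<^sub>r a = q \<longleftrightarrow> a = \<psi> q"
  using complex_exponent_eq_iff[of q "of_real a"] by (simp add: complex_exponent_of_real)

text \<open>Evaluating \<open>killed_identity\<close> at its root \<psi> q gives the passage
  probability \<open>exp (- \<psi> q * x)\<close>; inserting this back makes the identity explicit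
  at every other a.\<close>

lemma killed_mgf_eq:
  assumes a: "0 \<le> Re a" and q: "0 < q" and x: "0 < x" and ne: "\<phi> a \<noteq> of_real q"
  shows "killed_mgf a x q = of_real q * (exp ((a - of_real (\<psi> q)) * of_real x) - 1) / (\<phi> a - of_real q)"
proof -
  let ?\<theta> = "complex_of_real (\<psi> q)"
  have "1 = exp (?\<theta> * of_real x) * (1 - killed_mgf 0 x q)"
    using killed_identity[of ?\<theta> q x] right_inverse_pos[OF q] complex_exponent_eq_iff[OF q, of ?\<theta>] q x by simp
  then have k0: "1 - killed_mgf 0 x q = exp (- ?\<theta> * of_real x)"
    by (simp add: exp_minus field_simps)
  have "(\<phi> a - of_real q) / of_real q * killed_mgf a x q = exp (a * of_real x) * exp (- ?\<theta> * of_real x) - 1"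
    using killed_identity[OF a q x] k0 by (simp add: algebra_simps)
  also have "exp (a * of_real x) * exp (- ?\<theta> * of_real x) = exp ((a - ?\<theta>) * of_real x)"
    by (simp add: exp_add[symmetric] algebra_simps)
  finally show ?thesis using ne q by (simp add: field_simps)
qed

end

section \<open>Time reversal\<close>

text \<open>In \<open>joint_transform\<close> the lower limit m is the running drop of the path and
  x a random level.\<close>

lemma exponential_law_tail_laplace:
  assumes e: "0 < \<epsilon>" and a: "0 \<le> Re a" and m: "0 \<le> m"
  shows "(\<integral>x. (if m \<le> x then exp (- a * complex_of_real x) else 0) \<partial>exponential_law \<epsilon>)
    = of_real \<epsilon> / (of_real \<epsilon> + a) * exp (- (of_real \<epsilon> + a) * of_real m)"
proof -
  interpret E: prob_space "exponential_law \<epsilon>" using e by (rule prob_space_exponential_density)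
  define z where "z = of_real \<epsilon> + a"
  have Rez: "0 < Re z" using e a by (simp add: z_def)
  then have z: "z \<noteq> 0" by auto
  define F where "F x = - (of_real \<epsilon> / z) * exp (- z * complex_of_real x)" for x
  have norm_le: "norm (exp (- a * complex_of_real x)) \<le> 1" if "0 \<le> x" for x
    using a that by (simp add: norm_exp_eq_Re)
  have part: "(\<integral>x. (if m \<le> x \<and> x \<le> m + real n then exp (- a * complex_of_real x) else 0) \<partial>exponential_law \<epsilon>) = F (m + real n) - F m" for n
  proof -
    have "(\<integral>x. (if m \<le> x \<and> x \<le> m + real n then exp (- a * complex_of_real x) else 0) \<partial>exponential_law \<epsilon>) =
        (\<integral>x. exponential_density \<epsilon> x *\<^sub>R (if m \<le> x \<and> x \<le> m + real n then exp (- a * complex_of_real x) else 0) \<partial>lborel)"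
      using e by (intro integral_density) (auto simp: exponential_density_def)
    also have "\<dots> = (\<integral>x. indicator {m..m + real n} x *\<^sub>R (of_real \<epsilon> * exp (- z * complex_of_real x)) \<partial>lborel)"
      using m by (intro Bochner_Integration.integral_cong refl)
        (auto simp: exponential_density_def indicator_def z_def scaleR_conv_of_real exp_of_real[symmetric] exp_add[symmetric] algebra_simps)
    also have "\<dots> = F (m + real n) - F m"
    proof (rule integral_FTC_atLeastAtMost)
      fix x
      show "(F has_vector_derivative of_real \<epsilon> * exp (- z * complex_of_real x)) (at x within {m..m + real n})"
        unfolding F_def using z
        by (intro has_vector_derivative_real_field[THEN has_vector_derivative_at_within] derivative_eq_intros
            has_field_derivative_imp_has_derivative | force)+
    qed (auto intro!: continuous_intros)
    finally show ?thesis .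
  qed
  have "(\<lambda>n. \<integral>x. (if m \<le> x \<and> x \<le> m + real n then exp (- a * complex_of_real x) else 0) \<partial>exponential_law \<epsilon>)
    \<longlonglongrightarrow> (\<integral>x. (if m \<le> x then exp (- a * complex_of_real x) else 0) \<partial>exponential_law \<epsilon>)"
  proof (rule integral_dominated_convergence[where w="\<lambda>_. 1"])
    show "AE x in exponential_law \<epsilon>. (\<lambda>n. if m \<le> x \<and> x \<le> m + real n then exp (- a * complex_of_real x) else 0)
        \<longlonglongrightarrow> (if m \<le> x then exp (- a * complex_of_real x) else 0)"
    proof (intro AE_I2 tendsto_eventually)
      fix x :: real
      obtain N where "x - m < real N" using reals_Archimedean2 by blast
      then show "eventually (\<lambda>n. (if m \<le> x \<and> x \<le> m + real n then exp (- a * complex_of_real x) else 0) = (if m \<le> x then exp (- a * complex_of_real x) else 0)) sequentially"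
        by (intro eventually_sequentiallyI[of N]) auto
    qed
  qed (use norm_le m in auto)
  moreover have "(\<lambda>n. F (m + real n) - F m) \<longlonglongrightarrow> 0 - F m"
  proof (intro tendsto_diff tendsto_const)
    have "(\<lambda>n. norm (exp (- z * complex_of_real (m + real n)))) \<longlonglongrightarrow> 0"
    proof -
      have "(\<lambda>n. exp (- Re z * m) * (exp (- Re z)) ^ n) \<longlonglongrightarrow> exp (- Re z * m) * 0"
        using Rez by (intro tendsto_mult tendsto_const LIMSEQ_power_zero) auto
      moreover have "norm (exp (- z * complex_of_real (m + real n))) = exp (- Re z * m) * (exp (- Re z)) ^ n" for n
        by (simp add: norm_exp_eq_Re exp_of_nat_mult[symmetric] exp_add[symmetric] algebra_simps)
      ultimately show ?thesis by simp
    qed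
    then have "(\<lambda>n. exp (- z * complex_of_real (m + real n))) \<longlonglongrightarrow> 0" by (rule tendsto_norm_zero_cancel)
    from tendsto_mult[OF tendsto_const this, of "- (of_real \<epsilon> / z)"] show "(\<lambda>n. F (m + real n)) \<longlonglongrightarrow> 0"
      by (simp add: F_def)
  qed
  ultimately have "(\<integral>x. (if m \<le> x then exp (- a * complex_of_real x) else 0) \<partial>exponential_law \<epsilon>) = 0 - F m"
    unfolding part using LIMSEQ_unique by blast
  then show ?thesis by (simp add: F_def z_def)
qed

lemma exponential_law_laplace:
  assumes e: "0 < \<epsilon>" and a: "0 \<le> Re a"
  shows "(\<integral>x. exp (- a * complex_of_real x) \<partial>exponential_law \<epsilon>) = of_real \<epsilon> / (of_real \<epsilon> + a)"
proof -
  have "(\<integral>x. exp (- a * complex_of_real x) \<partial>exponential_law \<epsilon>) = (\<integral>x. (if 0 \<le> x then exp (- a * complex_of_real x) else 0) \<partial>exponential_law \<epsilon>)"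
    using exponential_law_nonneg[of \<epsilon>] by (intro integral_cong_AE) (auto elim!: eventually_mono)
  then show ?thesis using exponential_law_tail_laplace[OF e a, of 0] by simp
qed

section \<open>Running extrema and their grid approximations\<close>

context levy_process
begin

text \<open>Reflection reverses the direction of the jumps, so it lives in
  \<open>levy_process\<close>. It lets the facts about \<open>rise\<close> be inherited from those
  about \<open>drop\<close>.\<close>

lemma levy_process_uminus: "levy_process M (\<lambda>t w. - Y t w)"
proof (intro levy_process.intro prob_space_axioms levy_process_axioms.intro)
  fix t w assume w: "w \<in> space M" and t: "0 \<le> (t::real)"
  show "continuous (at_right t) (\<lambda>s. - Y s w)" by (intro continuous_minus right_continuous w t)
next
  fix t w assume w: "w \<in> space M" and t: "0 < (t::real)"
  then obtain l where "((\<lambda>s. Y s w) \<longlongrightarrow> l) (at_left t)" using left_limits by blast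
  then show "\<exists>l. ((\<lambda>s. - Y s w) \<longlongrightarrow> l) (at_left t)" by (intro exI[of _ "- l"] tendsto_minus)
next
  fix \<tau> :: "nat \<Rightarrow> real" and n assume "0 \<le> \<tau> 0" "\<forall>i<n. \<tau> i \<le> \<tau> (Suc i)"
  from indep_vars_compose2[OF independent_increments[OF this], of "\<lambda>_. uminus" "\<lambda>_. borel"]
  show "indep_vars (\<lambda>_. borel) (\<lambda>i w. - Y (\<tau> (Suc i)) w - - Y (\<tau> i) w) {..<n}" by simp
next
  fix s h :: real assume sh: "0 \<le> s" "0 \<le> h"
  have m: "(\<lambda>w. Y (s + h) w - Y s w) \<in> borel_measurable M" using sh by (intro borel_measurable_diff random_variable_Y) auto
  have "distr M borel (\<lambda>w. - Y (s + h) w - - Y s w) = distr (distr M borel (\<lambda>w. Y (s + h) w - Y s w)) borel uminus"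
    using m by (subst distr_distr) (auto simp: comp_def)
  also have "\<dots> = distr (distr M borel (Y h)) borel uminus" unfolding stationary_increments[OF sh] ..
  also have "\<dots> = distr M borel (\<lambda>w. - Y h w)" using random_variable_Y[OF sh(2)] by (subst distr_distr) (auto simp: comp_def)
  finally show "distr M borel (\<lambda>w. - Y (s + h) w - - Y s w) = distr M borel (\<lambda>w. - Y h w)" .
qed (auto simp: random_variable_Y Y_zero)

text \<open>Minus the running infimum, written as a running supremum of the reflected path.\<close>

definition drop :: "real \<Rightarrow> 'a \<Rightarrow> real" where
  "drop t w = running_sup (\<lambda>t w. - Y t w) t w"

lemma bdd_above_drop: "w \<in> space M \<Longrightarrow> bdd_above ((\<lambda>s. - Y s w) ` {0..t})"
  using path_bounded[of w t] by (metis abs_le_D2 atLeastAtMost_iff bdd_above.I2)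

lemma drop_ge: "w \<in> space M \<Longrightarrow> 0 \<le> s \<Longrightarrow> s \<le> t \<Longrightarrow> - Y s w \<le> drop t w"
  unfolding drop_def running_sup_def by (intro cSUP_upper bdd_above_drop) auto

lemma drop_nonneg: "w \<in> space M \<Longrightarrow> 0 \<le> t \<Longrightarrow> 0 \<le> drop t w"
  using drop_ge[of w 0 t] by (simp add: Y_zero)

lemma drop_le_iff: "w \<in> space M \<Longrightarrow> 0 \<le> t \<Longrightarrow> drop t w \<le> x \<longleftrightarrow> stays_above x t w"
  unfolding drop_def running_sup_def stays_above_def
  by (subst cSUP_le_iff[OF _ bdd_above_drop]) (auto simp: minus_le_iff)

lemma drop_pair_measurable [measurable]: "(\<lambda>(w, t). drop (max 0 t) w) \<in> borel_measurable (M \<Otimes>\<^sub>M borel)"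
proof (rule borel_measurableI_le)
  fix x
  have "{p \<in> space (M \<Otimes>\<^sub>M borel). (case p of (w, t) \<Rightarrow> drop (max 0 t) w) \<le> x} =
      {p \<in> space (M \<Otimes>\<^sub>M borel). case p of (w, t) \<Rightarrow> stays_above x (max 0 t) w}"
    by (auto simp: space_pair_measure drop_le_iff)
  also have "\<dots> \<in> sets (M \<Otimes>\<^sub>M borel)" using stays_above_pair_measurable[of x] by (simp add: pred_def)
  finally show "{p \<in> space (M \<Otimes>\<^sub>M borel). (case p of (w, t) \<Rightarrow> drop (max 0 t) w) \<le> x} \<in> sets (M \<Otimes>\<^sub>M borel)" .
qed

lemma drop_measurable: "0 \<le> t \<Longrightarrow> drop t \<in> borel_measurable M"
  using measurable_compose[OF measurable_Pair2' drop_pair_measurable, of t] by (simp add: max_absorb2)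

text \<open>Grid maxima never exceed the supremum. Conversely, a value above y persists on an
  interval to the right of its time, which fine grids meet; the endpoint t, which has no such
  interval within the range, is itself a grid point.\<close>

lemma grid_max_tendsto_drop:
  assumes w: "w \<in> space M" and t: "0 \<le> t"
  shows "(\<lambda>n. Max ((\<lambda>k. - Y (real k * (t / real (Suc n))) w) ` {..Suc n})) \<longlonglongrightarrow> drop t w"
proof (rule order_tendstoI)
  define Mx where "Mx n = Max ((\<lambda>k. - Y (real k * (t / real (Suc n))) w) ` {..Suc n})" for n
  have le: "Mx n \<le> drop t w" for n
    unfolding Mx_def
  proof (rule Max.boundedI)
    fix y assume "y \<in> (\<lambda>k. - Y (real k * (t / real (Suc n))) w) ` {..Suc n}"
    then obtain k where k: "k \<le> Suc n" "y = - Y (real k * (t / real (Suc n))) w" by auto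
    have "real k * (t / real (Suc n)) \<le> real (Suc n) * (t / real (Suc n))" using k t by (intro mult_right_mono) auto
    then show "y \<le> drop t w" using t w by (auto simp: k(2) intro!: drop_ge)
  qed auto
  show "eventually (\<lambda>n. Max ((\<lambda>k. - Y (real k * (t / real (Suc n))) w) ` {..Suc n}) < y) sequentially" if "drop t w < y" for y
    using le_less_trans[OF le that] unfolding Mx_def by simp
  fix y assume "y < drop t w"
  then obtain s where s: "0 \<le> s" "s \<le> t" "y < - Y s w"
    unfolding drop_def running_sup_def using less_cSUP_iff[OF _ bdd_above_drop[OF w]] t by auto
  then have "Y s w < - y" by simp
  then obtain d where d: "d > 0" "\<And>u. s \<le> u \<Longrightarrow> u < s + d \<Longrightarrow> Y u w < - y"
    using right_open_strict[OF w s(1)] by blast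
  have ge: "- Y (real k * (t / real (Suc n))) w \<le> Mx n" if "k \<le> Suc n" for k n
    unfolding Mx_def using that by (intro Max_ge) auto
  show "eventually (\<lambda>n. y < Max ((\<lambda>k. - Y (real k * (t / real (Suc n))) w) ` {..Suc n})) sequentially"
  proof (cases "s = t")
    case True
    have "y < Mx n" for n using ge[of "Suc n" n] s True by simp
    then show ?thesis unfolding Mx_def by simp
  next
    case False
    then have st: "s < t" using s by simp
    have "0 < d / t" using d(1) st s(1) by simp
    from eventually_grid_small[OF this]
    show ?thesis
    proof eventually_elim
      case (elim n)
      define h where "h = t / real (Suc n)"
      have h: "0 < h" "h < d" using elim st s(1) by (auto simp: h_def field_simps)
      define k where "k = Suc (nat \<lfloor>s / h\<rfloor>)"
      have "real (nat \<lfloor>s / h\<rfloor>) \<le> s / h" "s / h < real (nat \<lfloor>s / h\<rfloor>) + 1" using s h by auto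
      then have kb: "real (nat \<lfloor>s / h\<rfloor>) * h \<le> s" "s < real k * h"
        using h by (auto simp: pos_le_divide_eq pos_divide_less_eq k_def add.commute)
      have "real (nat \<lfloor>s / h\<rfloor>) * h < real (Suc n) * h" using kb(1) st by (simp add: h_def)
      then have "real (nat \<lfloor>s / h\<rfloor>) < real (Suc n)" by (rule mult_right_less_imp_less) (use h(1) in simp)
      then have "k \<le> Suc n" by (simp add: k_def)
      have "real k * h = real (nat \<lfloor>s / h\<rfloor>) * h + h" by (simp add: k_def algebra_simps)
      then have "Y (real k * h) w < - y" using kb h by (intro d(2)) auto
      then show ?case using ge[OF \<open>k \<le> Suc n\<close>] unfolding h_def Mx_def by simp
    qed
  qed
qed

definition rise :: "real \<Rightarrow> 'a \<Rightarrow> real" where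
  "rise t w = running_sup Y t w"

lemma rise_eq_drop_uminus: "rise = levy_process.drop (\<lambda>t w. - Y t w)"
  by (simp add: fun_eq_iff rise_def levy_process.drop_def[OF levy_process_uminus] running_sup_def)

lemma rise_ge: "w \<in> space M \<Longrightarrow> 0 \<le> s \<Longrightarrow> s \<le> t \<Longrightarrow> Y s w \<le> rise t w"
  using levy_process.drop_ge[OF levy_process_uminus, of w s t] by (simp add: rise_eq_drop_uminus)

lemma rise_nonneg: "w \<in> space M \<Longrightarrow> 0 \<le> t \<Longrightarrow> 0 \<le> rise t w"
  using rise_ge[of w 0 t] by (simp add: Y_zero)

lemma rise_pair_measurable [measurable]: "(\<lambda>(w, t). rise (max 0 t) w) \<in> borel_measurable (M \<Otimes>\<^sub>M borel)"
  unfolding rise_eq_drop_uminus by (rule levy_process.drop_pair_measurable[OF levy_process_uminus])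

lemma rise_measurable: "0 \<le> t \<Longrightarrow> rise t \<in> borel_measurable M"
  unfolding rise_eq_drop_uminus by (rule levy_process.drop_measurable[OF levy_process_uminus])

lemma grid_max_tendsto_rise:
  "w \<in> space M \<Longrightarrow> 0 \<le> t \<Longrightarrow> (\<lambda>n. Max ((\<lambda>k. Y (real k * (t / real (Suc n))) w) ` {..Suc n})) \<longlonglongrightarrow> rise t w"
  using levy_process.grid_max_tendsto_drop[OF levy_process_uminus, of w t] by (simp add: rise_eq_drop_uminus)

section \<open>Reversal of the increments\<close>

lemma distr_increments_PiM:
  assumes h: "0 \<le> h"
  shows "distr M (PiM {..<Suc n} (\<lambda>_. borel)) (\<lambda>w. \<lambda>i\<in>{..<Suc n}. increment h i w) = PiM {..<Suc n} (\<lambda>_. distr M borel (Y h))"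
  using indep_vars_iff_distr_eq_PiM'[where I = "{..<Suc n}" and M' = "\<lambda>_. borel" and X = "increment h"] indep_increments[OF h, of "Suc n"]
    increment_measurable[OF h] by (simp add: distr_increment[OF h] lessThan_empty_iff)

text \<open>Independent and identically distributed increments have a product of equal factors as
  joint law, which is invariant under permuting the indices.\<close>

lemma reversed_increments_law:
  assumes h: "0 \<le> h"
  shows "distr M (PiM {..<Suc n} (\<lambda>_. borel)) (\<lambda>w. \<lambda>i\<in>{..<Suc n}. increment h (n - i) w)
    = distr M (PiM {..<Suc n} (\<lambda>_. borel)) (\<lambda>w. \<lambda>i\<in>{..<Suc n}. increment h i w)"
proof -
  let ?I = "{..<Suc n}" and ?\<nu> = "distr M borel (Y h)"
  have X: "(\<lambda>w. \<lambda>i\<in>?I. increment h i w) \<in> measurable M (PiM ?I (\<lambda>_. borel))"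
    using increment_measurable[OF h] by (intro measurable_restrict) auto
  have R: "(\<lambda>x. \<lambda>i\<in>?I. x (n - i)) \<in> measurable (PiM ?I (\<lambda>_. borel :: real measure)) (PiM ?I (\<lambda>_. borel))"
    by (intro measurable_restrict measurable_component_singleton) auto
  have "distr M (PiM ?I (\<lambda>_. borel)) (\<lambda>w. \<lambda>i\<in>?I. increment h (n - i) w) =
      distr (distr M (PiM ?I (\<lambda>_. borel)) (\<lambda>w. \<lambda>i\<in>?I. increment h i w)) (PiM ?I (\<lambda>_. borel)) (\<lambda>x. \<lambda>i\<in>?I. x (n - i))"
    by (subst distr_distr[OF R X]) (auto simp: comp_def restrict_def fun_eq_iff less_Suc_eq_le intro!: distr_cong)
  also have "\<dots> = distr (PiM ?I (\<lambda>_. ?\<nu>)) (PiM ?I (\<lambda>_. ?\<nu>)) (\<lambda>x. \<lambda>i\<in>?I. x (n - i))"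
    unfolding distr_increments_PiM[OF h] by (intro distr_cong refl sets_PiM_cong) auto
  also have "\<dots> = PiM ?I (\<lambda>_. ?\<nu>)"
  proof (rule distr_PiM_reindex)
    show "prob_space ?\<nu>" for i using random_variable_Y[OF h] by (rule prob_space_distr)
    show "inj_on ((-) n) ?I" by (rule inj_onI) auto
  qed auto
  finally show ?thesis unfolding distr_increments_PiM[OF h] .
qed

end

context spectrally_positive_levy_process
begin

text \<open>Partial sums of the reversed increments are the differences of \<open>Y t\<close> and
  the path at the mirrored grid points; their maximum is \<open>Y t\<close> plus the grid drop,
  whereas the original order gives the grid maximum of Y. The transforms therefore agree exactly on
  every grid. Both quantities are nonnegative, so \<open>1\<close> dominates in the limit.\<close>

lemma time_reversal:
  assumes a: "0 \<le> Re a" and t: "0 \<le> t"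
  shows "(\<integral>w. exp (- a * complex_of_real (Y t w + drop t w)) \<partial>M) = (\<integral>w. exp (- a * complex_of_real (rise t w)) \<partial>M)"
proof -
  note [measurable] = random_variable_Y[OF t] drop_measurable[OF t] rise_measurable[OF t]
  define h where "h n = t / real (Suc n)" for n
  have h: "0 \<le> h n" for n using t by (simp add: h_def)
  have Yk[measurable]: "Y (real k * h n) \<in> borel_measurable M" for k n using h by (intro random_variable_Y) auto
  define Up where "Up n w = Max ((\<lambda>k. Y (real k * h n) w) ` {..Suc n})" for n w
  define Dn where "Dn n w = Max ((\<lambda>k. - Y (real k * h n) w) ` {..Suc n})" for n w
  have [measurable]: "Up n \<in> borel_measurable M" "Dn n \<in> borel_measurable M" for n
    unfolding Up_def Dn_def by (intro borel_measurable_Max; measurable)+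
  have Up_nonneg: "0 \<le> Up n w" if "w \<in> space M" for n w
    unfolding Up_def by (rule Max_ge_iff[THEN iffD2]) (auto intro!: bexI[of _ 0] simp: Y_zero[OF that])
  have Dn_ge: "0 \<le> Y t w + Dn n w" for n w
  proof -
    have "- Y t w \<le> Dn n w"
      unfolding Dn_def by (rule Max_ge_iff[THEN iffD2]) (auto intro!: bexI[of _ "Suc n"] simp: h_def simp del: of_nat_Suc)
    then show ?thesis by simp
  qed
  have norm_le: "norm (exp (- a * complex_of_real y)) \<le> 1" if "0 \<le> y" for y using a that by (simp add: norm_exp_eq_Re)
  define G where "G n x = Max ((\<lambda>k. \<Sum>i<k. x i) ` {..Suc n})" for n and x :: "nat \<Rightarrow> real"
  have Gm[measurable]: "G n \<in> borel_measurable (PiM {..<Suc n} (\<lambda>_. borel))" for n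
    unfolding G_def by (intro borel_measurable_Max borel_measurable_sum measurable_component_singleton) auto
  have eq: "(\<integral>w. exp (- a * complex_of_real (Y t w + Dn n w)) \<partial>M) = (\<integral>w. exp (- a * complex_of_real (Up n w)) \<partial>M)" for n
  proof -
    let ?I = "{..<Suc n}" and ?P = "PiM {..<Suc n} (\<lambda>_. borel :: real measure)"
    let ?X = "\<lambda>w. \<lambda>i\<in>?I. increment (h n) i w" and ?R = "\<lambda>w. \<lambda>i\<in>?I. increment (h n) (n - i) w"
    have Xm: "?X \<in> measurable M ?P" "?R \<in> measurable M ?P"
      using increment_measurable[OF h] by (auto intro!: measurable_restrict)
    have GX: "G n (?X w) = Up n w" if w: "w \<in> space M" for w
    proof -
      have "(\<lambda>k. \<Sum>i<k. ?X w i) ` {..Suc n} = (\<lambda>k. Y (real k * h n) w) ` {..Suc n}"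
      proof (intro image_cong refl)
        fix k assume "k \<in> {..Suc n}"
        then have "(\<Sum>i<k. ?X w i) = (\<Sum>i<k. increment (h n) i w)" by (intro sum.cong) auto
        then show "(\<Sum>i<k. ?X w i) = Y (real k * h n) w" using sum_increment[OF w] by simp
      qed
      then show ?thesis unfolding G_def Up_def by simp
    qed
    have GR: "G n (?R w) = Y t w + Dn n w" if w: "w \<in> space M" for w
    proof -
      have telescope: "(x - y) + (y - z) = x - z" for x y z :: real by simp
      have *: "(\<Sum>i<k. ?R w i) = Y t w - Y (real (Suc n - k) * h n) w" if k: "k \<le> Suc n" for k
        using k
      proof (induction k)
        case 0 then show ?case by (simp add: h_def)
      next
        case (Suc k)
        then have nk: "Suc (n - k) = Suc n - k" "n - k = Suc n - Suc k" by simp_all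
        have "(\<Sum>i<Suc k. ?R w i) = (\<Sum>i<k. ?R w i) + increment (h n) (n - k) w" using Suc.prems by simp
        also have "(\<Sum>i<k. ?R w i) = Y t w - Y (real (Suc n - k) * h n) w" by (rule Suc.IH) (use Suc.prems in simp)
        finally show ?case unfolding increment_def nk(1) unfolding nk(2) by (rule trans) (rule telescope)
      qed
      have "(\<lambda>k. \<Sum>i<k. ?R w i) ` {..Suc n} = (\<lambda>k. Y t w + - Y (real (Suc n - k) * h n) w) ` {..Suc n}"
      proof (intro image_cong refl)
        fix k assume "k \<in> {..Suc n}"
        then have "k \<le> Suc n" by simp
        from *[OF this] show "(\<Sum>i<k. ?R w i) = Y t w + - Y (real (Suc n - k) * h n) w"
          unfolding diff_conv_add_uminus .
      qed
      also have "\<dots> = (\<lambda>k. Y t w + - Y (real k * h n) w) ` ((\<lambda>k. Suc n - k) ` {..Suc n})" by (simp add: image_image)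
      also have "(\<lambda>k. Suc n - k) ` {..Suc n} = {..Suc n}"
      proof (intro set_eqI iffI)
        fix j assume "j \<in> {..Suc n}"
        then show "j \<in> (\<lambda>k. Suc n - k) ` {..Suc n}" by (intro image_eqI[of _ _ "Suc n - j"]) auto
      qed auto
      finally have "(\<lambda>k. \<Sum>i<k. ?R w i) ` {..Suc n} = (\<lambda>y. Y t w + y) ` ((\<lambda>k. - Y (real k * h n) w) ` {..Suc n})"
        by (simp add: image_image)
      then have "G n (?R w) = Max ((\<lambda>y. Y t w + y) ` ((\<lambda>k. - Y (real k * h n) w) ` {..Suc n}))" unfolding G_def by simp
      also have "\<dots> = Y t w + Dn n w" unfolding Dn_def
        by (subst mono_Max_commute[symmetric]) (auto simp: mono_def)
      finally show ?thesis .
    qed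
    have "(\<integral>w. exp (- a * complex_of_real (Y t w + Dn n w)) \<partial>M) = (\<integral>w. exp (- a * complex_of_real (G n (?R w))) \<partial>M)"
      by (intro Bochner_Integration.integral_cong refl) (simp only: GR)
    also have "\<dots> = (\<integral>x. exp (- a * complex_of_real (G n x)) \<partial>distr M ?P ?R)"
      by (subst integral_distr[OF Xm(2)]) auto
    also have "\<dots> = (\<integral>w. exp (- a * complex_of_real (G n (?X w))) \<partial>M)"
      unfolding reversed_increments_law[OF h] by (subst integral_distr[OF Xm(1)]) auto
    also have "\<dots> = (\<integral>w. exp (- a * complex_of_real (Up n w)) \<partial>M)"
      by (intro Bochner_Integration.integral_cong refl) (simp only: GX)
    finally show ?thesis .
  qed
  have "(\<lambda>n. \<integral>w. exp (- a * complex_of_real (Up n w)) \<partial>M) \<longlonglongrightarrow> (\<integral>w. exp (- a * complex_of_real (rise t w)) \<partial>M)"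
  proof (rule integral_dominated_convergence[where w="\<lambda>_. 1"])
    show "AE w in M. (\<lambda>n. exp (- a * complex_of_real (Up n w))) \<longlonglongrightarrow> exp (- a * complex_of_real (rise t w))"
      using grid_max_tendsto_rise[OF _ t] unfolding Up_def h_def by (intro AE_I2 tendsto_intros) auto
    show "AE w in M. norm (exp (- a * complex_of_real (Up n w))) \<le> 1" for n
      by (intro AE_I2 norm_le Up_nonneg)
  qed auto
  moreover have "(\<lambda>n. \<integral>w. exp (- a * complex_of_real (Y t w + Dn n w)) \<partial>M) \<longlonglongrightarrow> (\<integral>w. exp (- a * complex_of_real (Y t w + drop t w)) \<partial>M)"
  proof (rule integral_dominated_convergence[where w="\<lambda>_. 1"])
    show "AE w in M. (\<lambda>n. exp (- a * complex_of_real (Y t w + Dn n w))) \<longlonglongrightarrow> exp (- a * complex_of_real (Y t w + drop t w))"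
      using grid_max_tendsto_drop[OF _ t] unfolding Dn_def h_def by (intro AE_I2 tendsto_intros) auto
    show "AE w in M. norm (exp (- a * complex_of_real (Y t w + Dn n w))) \<le> 1" for n
      by (intro AE_I2 norm_le Dn_ge)
  qed auto
  ultimately show ?thesis unfolding eq using LIMSEQ_unique by blast
qed

section \<open>The law at an exponential time\<close>

lemma overshoot_integrand_measurable:
  "(\<lambda>(w, t). exp (- a * complex_of_real (Y (max 0 t) w + drop (max 0 t) w)) * exp (- c * complex_of_real (drop (max 0 t) w)))
    \<in> borel_measurable (M \<Otimes>\<^sub>M exponential_law q)"
  using Y_pair_measurable drop_pair_measurable unfolding split_beta by measurable

lemma norm_exp_minus_le_1: "0 \<le> Re a \<Longrightarrow> 0 \<le> y \<Longrightarrow> norm (exp (- a * complex_of_real y)) \<le> 1"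
  by (simp add: norm_exp_eq_Re)

lemma Y_plus_drop_nonneg: "w \<in> space M \<Longrightarrow> 0 \<le> t \<Longrightarrow> 0 \<le> Y t w + drop t w"
  using drop_ge[of w t t] by simp

text \<open>\<open>killed_mgf\<close> concerns the event that the drop is at most a fixed level x.
  Averaging x over an exponential law with the extra factor \<open>exp (- a * x)\<close> turns that
  event into the exponentials of \<open>Y + drop\<close> and of the drop; integrating in the other
  order uses the explicit \<open>killed_mgf_eq\<close>.\<close>

lemma joint_transform:
  assumes a: "0 \<le> Re a" and q: "0 < q" and ne: "\<phi> a \<noteq> of_real q" and e: "0 < \<epsilon>"
  shows "(\<integral>(w, t). exp (- a * complex_of_real (Y (max 0 t) w + drop (max 0 t) w)) * exp (- of_real \<epsilon> * complex_of_real (drop (max 0 t) w)) \<partial>with_exponential_time M q)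
    = of_real q * (a - of_real (\<psi> q)) / ((\<phi> a - of_real q) * (of_real \<epsilon> + of_real (\<psi> q)))"
proof -
  let ?\<theta> = "complex_of_real (\<psi> q)" and ?q = "complex_of_real q" and ?e = "complex_of_real \<epsilon>"
  have \<theta>: "0 < \<psi> q" by (rule right_inverse_pos[OF q])
  interpret Q: prob_space "exponential_law q" using q by (rule prob_space_exponential_density)
  interpret E: prob_space "exponential_law \<epsilon>" using e by (rule prob_space_exponential_density)
  interpret P: pair_prob_space M "exponential_law q" ..
  interpret PP: pair_prob_space "M \<Otimes>\<^sub>M exponential_law q" "exponential_law \<epsilon>" ..
  define D where "D p = drop (max 0 (snd p)) (fst p)" for p
  define V where "V p = Y (max 0 (snd p)) (fst p)" for p
  have D[measurable]: "D \<in> borel_measurable (M \<Otimes>\<^sub>M exponential_law q)"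
    using drop_pair_measurable unfolding D_def split_beta by measurable
  have V[measurable]: "V \<in> borel_measurable (M \<Otimes>\<^sub>M exponential_law q)"
    using Y_pair_measurable unfolding V_def split_beta by measurable
  have D0: "0 \<le> D p" and VD: "0 \<le> V p + D p" if "p \<in> space (M \<Otimes>\<^sub>M exponential_law q)" for p
    using that by (auto simp: D_def V_def space_pair_measure intro!: drop_nonneg Y_plus_drop_nonneg)
  define f where "f p x = (if D p \<le> x then exp (- a * complex_of_real (V p + x)) else 0)" for p x
  have fm[measurable]: "(\<lambda>(p, x). f p x) \<in> borel_measurable ((M \<Otimes>\<^sub>M exponential_law q) \<Otimes>\<^sub>M exponential_law \<epsilon>)"
    unfolding f_def by measurable
  have f_le: "norm (f p x) \<le> 1" if "p \<in> space (M \<Otimes>\<^sub>M exponential_law q)" for p x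
    using norm_exp_minus_le_1[OF a, of "V p + x"] VD[OF that] by (auto simp: f_def)
  have f_int: "integrable ((M \<Otimes>\<^sub>M exponential_law q) \<Otimes>\<^sub>M exponential_law \<epsilon>) (\<lambda>(p, x). f p x)"
    by (rule PP.integrable_const_bound[of _ 1]) (use f_le fm in \<open>auto simp: space_pair_measure\<close>)
  have eq1: "(\<integral>x. f p x \<partial>exponential_law \<epsilon>) = ?e / (?e + a) * (exp (- a * complex_of_real (V p + D p)) * exp (- ?e * complex_of_real (D p)))"
    if p: "p \<in> space (M \<Otimes>\<^sub>M exponential_law q)" for p
  proof -
    have "(\<integral>x. f p x \<partial>exponential_law \<epsilon>) = (\<integral>x. exp (- a * complex_of_real (V p)) * (if D p \<le> x then exp (- a * complex_of_real x) else 0) \<partial>exponential_law \<epsilon>)"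
      by (intro Bochner_Integration.integral_cong refl) (auto simp: f_def exp_add[symmetric] algebra_simps)
    also have "\<dots> = exp (- a * complex_of_real (V p)) * (?e / (?e + a) * exp (- (?e + a) * complex_of_real (D p)))"
      by (simp only: integral_mult_right_zero exponential_law_tail_laplace[OF e a D0[OF p]])
    also have "exp (- (?e + a) * complex_of_real (D p)) = exp (- a * complex_of_real (D p)) * exp (- ?e * complex_of_real (D p))"
      by (simp add: exp_add[symmetric] algebra_simps)
    finally show ?thesis by (simp add: exp_add[symmetric] algebra_simps)
  qed
  \<comment> \<open>Levels at most \<open>0\<close> form a null set and are discarded, since
    \<open>killed_mgf_eq\<close> holds for positive levels.\<close>
  have eq2: "AE x in exponential_law \<epsilon>. (\<integral>p. f p x \<partial>(M \<Otimes>\<^sub>M exponential_law q)) = ?q / (\<phi> a - ?q) * (exp (- ?\<theta> * of_real x) - exp (- a * of_real x))"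
    using exponential_law_nonneg[of \<epsilon>] exponential_law_neq[of 0 \<epsilon>]
  proof eventually_elim
    case (elim x)
    then have x: "0 < x" by simp
    have "(\<integral>p. f p x \<partial>(M \<Otimes>\<^sub>M exponential_law q)) = (\<integral>p. exp (- a * complex_of_real x) *
        (case p of (w, t) \<Rightarrow> if stays_above x (max 0 t) w then exp (- a * complex_of_real (Y (max 0 t) w)) else 0) \<partial>(M \<Otimes>\<^sub>M exponential_law q))"
      by (intro Bochner_Integration.integral_cong refl)
        (auto simp: f_def D_def V_def drop_le_iff space_pair_measure exp_add[symmetric] algebra_simps)
    also have "\<dots> = exp (- a * complex_of_real x) * killed_mgf a x q"
      by (simp add: killed_mgf_def with_exponential_time_def)
    also have "killed_mgf a x q = ?q * (exp ((a - ?\<theta>) * of_real x) - 1) / (\<phi> a - ?q)" by (rule killed_mgf_eq[OF a q x ne])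
    also have "exp (- a * complex_of_real x) * (?q * (exp ((a - ?\<theta>) * of_real x) - 1) / (\<phi> a - ?q)) =
        ?q / (\<phi> a - ?q) * (exp (- a * complex_of_real x) * exp ((a - ?\<theta>) * of_real x) - exp (- a * complex_of_real x))"
      by (simp add: algebra_simps add_divide_distrib diff_divide_distrib)
    also have "exp (- a * complex_of_real x) * exp ((a - ?\<theta>) * of_real x) = exp (- ?\<theta> * of_real x)"
      by (simp add: exp_add[symmetric] algebra_simps)
    finally show ?case .
  qed
  have exp_int: "integrable (exponential_law \<epsilon>) (\<lambda>x. exp (- c * complex_of_real x))" if "0 \<le> Re c" for c
    using exponential_law_nonneg[of \<epsilon>] norm_exp_minus_le_1[OF that]
    by (intro E.integrable_const_bound[of _ 1]) (auto elim: eventually_mono)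
  have "?e / (?e + a) * (\<integral>(w, t). exp (- a * complex_of_real (Y (max 0 t) w + drop (max 0 t) w)) * exp (- ?e * complex_of_real (drop (max 0 t) w)) \<partial>with_exponential_time M q)
      = (\<integral>p. ?e / (?e + a) * (exp (- a * complex_of_real (V p + D p)) * exp (- ?e * complex_of_real (D p))) \<partial>(M \<Otimes>\<^sub>M exponential_law q))"
    unfolding with_exponential_time_def integral_mult_right_zero V_def D_def split_beta ..
  also have "\<dots> = (\<integral>p. (\<integral>x. f p x \<partial>exponential_law \<epsilon>) \<partial>(M \<Otimes>\<^sub>M exponential_law q))"
    by (intro Bochner_Integration.integral_cong refl) (simp only: eq1)
  also have "\<dots> = (\<integral>x. (\<integral>p. f p x \<partial>(M \<Otimes>\<^sub>M exponential_law q)) \<partial>exponential_law \<epsilon>)"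
    using PP.Fubini_integral[OF f_int] by simp
  also have "\<dots> = (\<integral>x. ?q / (\<phi> a - ?q) * (exp (- ?\<theta> * of_real x) - exp (- a * of_real x)) \<partial>exponential_law \<epsilon>)"
  proof (rule integral_cong_AE[OF _ _ eq2])
    have "(\<lambda>(x, p). f p x) \<in> borel_measurable (exponential_law \<epsilon> \<Otimes>\<^sub>M (M \<Otimes>\<^sub>M exponential_law q))"
      using measurable_pair_swap[OF fm] by (simp add: split_beta')
    then show "(\<lambda>x. \<integral>p. f p x \<partial>(M \<Otimes>\<^sub>M exponential_law q)) \<in> borel_measurable (exponential_law \<epsilon>)"
      by (rule P.borel_measurable_lebesgue_integral)
  qed simp
  also have "\<dots> = ?q / (\<phi> a - ?q) * (?e / (?e + ?\<theta>) - ?e / (?e + a))"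
    using \<theta> a exp_int[of ?\<theta>] exp_int[of a] exponential_law_laplace[OF e, of ?\<theta>] exponential_law_laplace[OF e, of a] by simp
  finally have main: "?e / (?e + a) * (\<integral>(w, t). exp (- a * complex_of_real (Y (max 0 t) w + drop (max 0 t) w)) * exp (- ?e * complex_of_real (drop (max 0 t) w)) \<partial>with_exponential_time M q)
      = ?q / (\<phi> a - ?q) * (?e / (?e + ?\<theta>) - ?e / (?e + a))" .
  have "Re (?e + a) \<noteq> Re 0" using e a by simp
  then have nz: "?e + a \<noteq> 0" by metis
  have "complex_of_real (\<epsilon> + \<psi> q) \<noteq> 0" unfolding of_real_eq_0_iff using e \<theta> by simp
  then have nz': "?e + ?\<theta> \<noteq> 0" by simp
  have e0: "?e \<noteq> 0" using e by simp
  have d0: "\<phi> a - ?q \<noteq> 0" using ne by simp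
  have alg: "I = Q * (A - T) / (D * (e + T))"
    if "e / (e + A) * I = Q / D * (e / (e + T) - e / (e + A))" "e + A \<noteq> 0" "e + T \<noteq> 0" "e \<noteq> 0" "D \<noteq> 0" for I Q A T D e :: complex
  proof -
    have "I = (e + A) / e * (e / (e + A) * I)" using that(2,4) by simp
    also have "\<dots> = (e + A) / e * (Q / D * (e / (e + T) - e / (e + A)))" unfolding that(1) ..
    also have "e / (e + T) - e / (e + A) = e * (A - T) / ((e + T) * (e + A))" using that by (simp add: field_simps)
    also have "(e + A) / e * (Q / D * (e * (A - T) / ((e + T) * (e + A)))) = Q * (A - T) / (D * (e + T))"
      using that by simp
    finally show ?thesis .
  qed
  show ?thesis by (rule alg[OF main nz nz' e0 d0])
qed

text \<open>Letting \<epsilon> tend to \<open>0\<close> removes the factor in the drop; a positive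
  \<epsilon> was what made the random level a probability law. The quantity that remains is the
  height of the path above its running infimum.\<close>

lemma overshoot_transform:
  assumes a: "0 \<le> Re a" and q: "0 < q" and ne: "\<phi> a \<noteq> of_real q"
  shows "(\<integral>(w, t). exp (- a * complex_of_real (Y (max 0 t) w + drop (max 0 t) w)) \<partial>with_exponential_time M q)
    = of_real q * (a - of_real (\<psi> q)) / ((\<phi> a - of_real q) * of_real (\<psi> q))"
proof -
  interpret Q: prob_space "exponential_law q" using q by (rule prob_space_exponential_density)
  interpret P: pair_prob_space M "exponential_law q" ..
  let ?e = "\<lambda>n. 1 / real (Suc n)"
  let ?f = "\<lambda>n (w, t). exp (- a * complex_of_real (Y (max 0 t) w + drop (max 0 t) w)) * exp (- of_real (?e n) * complex_of_real (drop (max 0 t) w))"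
  have "(\<lambda>n. \<integral>p. ?f n p \<partial>(M \<Otimes>\<^sub>M exponential_law q)) \<longlonglongrightarrow> (\<integral>(w, t). exp (- a * complex_of_real (Y (max 0 t) w + drop (max 0 t) w)) \<partial>(M \<Otimes>\<^sub>M exponential_law q))"
  proof (rule integral_dominated_convergence[where w="\<lambda>_. 1"])
    show "(\<lambda>(w, t). exp (- a * complex_of_real (Y (max 0 t) w + drop (max 0 t) w))) \<in> borel_measurable (M \<Otimes>\<^sub>M exponential_law q)"
      using overshoot_integrand_measurable[of a 0 q] by simp
    show "?f n \<in> borel_measurable (M \<Otimes>\<^sub>M exponential_law q)" for n by (rule overshoot_integrand_measurable)
    show "AE p in M \<Otimes>\<^sub>M exponential_law q. (\<lambda>n. ?f n p) \<longlonglongrightarrow> (case p of (w, t) \<Rightarrow> exp (- a * complex_of_real (Y (max 0 t) w + drop (max 0 t) w)))"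
    proof (intro AE_I2)
      fix p :: "'a \<times> real"
      obtain w t where p: "p = (w, t)" by (cases p)
      have "(\<lambda>n. exp (- a * complex_of_real (Y (max 0 t) w + drop (max 0 t) w)) * exp (- of_real (?e n) * complex_of_real (drop (max 0 t) w)))
        \<longlonglongrightarrow> exp (- a * complex_of_real (Y (max 0 t) w + drop (max 0 t) w)) * exp (- of_real 0 * complex_of_real (drop (max 0 t) w))"
        by (intro tendsto_intros inverse_Suc_tendsto_0)
      then show "(\<lambda>n. ?f n p) \<longlonglongrightarrow> (case p of (w, t) \<Rightarrow> exp (- a * complex_of_real (Y (max 0 t) w + drop (max 0 t) w)))"
        by (simp add: p)
    qed
    show "AE p in M \<Otimes>\<^sub>M exponential_law q. norm (?f n p) \<le> 1" for n
    proof (intro AE_I2)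
      fix p assume "p \<in> space (M \<Otimes>\<^sub>M exponential_law q)"
      then obtain w t where p: "p = (w, t)" "w \<in> space M" by (auto simp: space_pair_measure)
      have "norm (exp (- a * complex_of_real (Y (max 0 t) w + drop (max 0 t) w))) * norm (exp (- of_real (?e n) * complex_of_real (drop (max 0 t) w))) \<le> 1 * 1"
        using p a by (intro mult_mono norm_exp_minus_le_1 Y_plus_drop_nonneg drop_nonneg) auto
      then show "norm (?f n p) \<le> 1" by (simp add: p norm_mult)
    qed
  qed simp
  moreover have "(\<lambda>n. of_real q * (a - of_real (\<psi> q)) / ((\<phi> a - of_real q) * (of_real (?e n) + of_real (\<psi> q))))
     \<longlonglongrightarrow> of_real q * (a - of_real (\<psi> q)) / ((\<phi> a - of_real q) * (of_real 0 + of_real (\<psi> q)))"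
    using ne right_inverse_pos[OF q] by (intro tendsto_intros inverse_Suc_tendsto_0) auto
  moreover have "(\<integral>p. ?f n p \<partial>(M \<Otimes>\<^sub>M exponential_law q)) = of_real q * (a - of_real (\<psi> q)) / ((\<phi> a - of_real q) * (of_real (?e n) + of_real (\<psi> q)))" for n
    using joint_transform[OF a q ne, of "?e n"] unfolding with_exponential_time_def by simp
  ultimately show ?thesis unfolding with_exponential_time_def using LIMSEQ_unique by fastforce
qed

text \<open>For negative t the supremum in \<open>running_sup\<close> is over the empty set and
  takes an unspecified constant value. Those times are null, and \<open>max 0 t\<close> lets the
  joint measurability of \<open>rise\<close> apply.\<close>

lemma xi_integrand_AE:
  fixes a :: "'b::{real_normed_field, banach, second_countable_topology}"
  assumes q: "0 < q"
  shows "xi M Y a q = (\<integral>(w, t). exp (- a * of_real (rise (max 0 t) w)) \<partial>with_exponential_time M q)"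
proof -
  interpret Q: prob_space "exponential_law q" using q by (rule prob_space_exponential_density)
  interpret P: pair_prob_space M "exponential_law q" ..
  have eq: "running_sup Y t w = (if t < 0 then Sup {} else rise (max 0 t) w)" for t w
    by (simp add: running_sup_def rise_def max_def)
  have m: "(\<lambda>p. rise (max 0 (snd p)) (fst p)) \<in> borel_measurable (M \<Otimes>\<^sub>M exponential_law q)"
    using rise_pair_measurable unfolding split_beta by measurable
  show ?thesis
    unfolding xi_def with_exponential_time_def
  proof (rule integral_cong_AE)
    show "(\<lambda>(w, t). exp (- a * of_real (running_sup Y t w))) \<in> borel_measurable (M \<Otimes>\<^sub>M exponential_law q)"
      unfolding eq split_beta using m by measurable
    show "(\<lambda>(w, t). exp (- a * of_real (rise (max 0 t) w))) \<in> borel_measurable (M \<Otimes>\<^sub>M exponential_law q)"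
      unfolding split_beta using m by measurable
    have "AE p in M \<Otimes>\<^sub>M exponential_law q. 0 \<le> snd p"
    proof (rule P.AE_pair_measure)
      show "{p \<in> space (M \<Otimes>\<^sub>M exponential_law q). 0 \<le> snd p} \<in> sets (M \<Otimes>\<^sub>M exponential_law q)" by measurable
    qed (use exponential_law_nonneg[of q] in simp)
    then show "AE p in M \<Otimes>\<^sub>M exponential_law q. (case p of (w, t) \<Rightarrow> exp (- a * of_real (running_sup Y t w))) = (case p of (w, t) \<Rightarrow> exp (- a * of_real (rise (max 0 t) w)))"
      by eventually_elim (auto simp: eq)
  qed
qed

lemma xi_eq:
  assumes a: "0 \<le> Re a" and q: "0 < q" and ne: "\<phi> a \<noteq> of_real q"
  shows "xi M Y a q = of_real q * (a - of_real (\<psi> q)) / ((\<phi> a - of_real q) * of_real (\<psi> q))"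
proof -
  interpret Q: prob_space "exponential_law q" using q by (rule prob_space_exponential_density)
  interpret P: pair_prob_space M "exponential_law q" ..
  have m1: "(\<lambda>(w, t). exp (- a * complex_of_real (rise (max 0 t) w))) \<in> borel_measurable (M \<Otimes>\<^sub>M exponential_law q)"
    using rise_pair_measurable unfolding split_beta by measurable
  have m2: "(\<lambda>(w, t). exp (- a * complex_of_real (Y (max 0 t) w + drop (max 0 t) w))) \<in> borel_measurable (M \<Otimes>\<^sub>M exponential_law q)"
    using overshoot_integrand_measurable[of a 0 q] by simp
  have i1: "integrable (M \<Otimes>\<^sub>M exponential_law q) (\<lambda>(w, t). exp (- a * complex_of_real (rise (max 0 t) w)))"
    by (rule integrable_bounded_on_time[OF q m1, of 1]) (use norm_exp_minus_le_1[OF a] rise_nonneg in auto)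
  have i2: "integrable (M \<Otimes>\<^sub>M exponential_law q) (\<lambda>(w, t). exp (- a * complex_of_real (Y (max 0 t) w + drop (max 0 t) w)))"
  proof (rule integrable_bounded_on_time[OF q m2, of 1])
    fix w t assume "w \<in> space M"
    then show "norm (case (w, t) of (w, t) \<Rightarrow> exp (- a * complex_of_real (Y (max 0 t) w + drop (max 0 t) w))) \<le> 1"
      unfolding prod.case by (intro norm_exp_minus_le_1[OF a] Y_plus_drop_nonneg) auto
  qed
  have "xi M Y a q = (\<integral>t. \<integral>w. exp (- a * complex_of_real (rise (max 0 t) w)) \<partial>M \<partial>exponential_law q)"
    unfolding xi_integrand_AE[OF q] with_exponential_time_def by (rule P.integral_snd[symmetric, OF i1])
  also have "\<dots> = (\<integral>t. \<integral>w. exp (- a * complex_of_real (Y (max 0 t) w + drop (max 0 t) w)) \<partial>M \<partial>exponential_law q)"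
    by (intro Bochner_Integration.integral_cong refl time_reversal[OF a, symmetric]) simp
  also have "\<dots> = (\<integral>(w, t). exp (- a * complex_of_real (Y (max 0 t) w + drop (max 0 t) w)) \<partial>with_exponential_time M q)"
    unfolding with_exponential_time_def by (rule P.integral_snd[OF i2])
  finally show ?thesis unfolding overshoot_transform[OF a q ne] .
qed

lemma xi_of_real: "xi M Y (complex_of_real x) q = of_real (xi M Y x q)"
  unfolding xi_def integral_complex_of_real[symmetric]
  by (intro Bochner_Integration.integral_cong refl) (auto simp: exp_of_real[symmetric])

lemma xi_real_eq:
  assumes a: "0 \<le> a" and q: "0 < q" and ne: "a \<noteq> \<psi> q"
  shows "xi M Y a q = q * (a - \<psi> q) / ((\<phi>\<^sub>r a - q) * \<psi> q)"
proof -
  have "\<phi>\<^sub>r a \<noteq> q" using exponent_eq_iff[OF q a] ne by simp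
  then have "complex_of_real (xi M Y a q) = of_real (q * (a - \<psi> q) / ((\<phi>\<^sub>r a - q) * \<psi> q))"
    using xi_eq[of "of_real a" q] a q by (simp add: xi_of_real complex_exponent_of_real)
  then show ?thesis using of_real_eq_iff by blast
qed

section \<open>The law at an exponential time as a difference\<close>

definition sup_law :: "real \<Rightarrow> real measure" where
  "sup_law q = distr (with_exponential_time M q) borel (\<lambda>(w, t). rise (max 0 t) w)"

definition end_law :: "real \<Rightarrow> real measure" where
  "end_law q = distr (with_exponential_time M q) borel (\<lambda>(w, t). Y (max 0 t) w)"

lemma rise_time_measurable: "(\<lambda>(w, t). rise (max 0 t) w) \<in> borel_measurable (M \<Otimes>\<^sub>M exponential_law q)"
  using rise_pair_measurable unfolding split_beta by measurable

lemma Y_time_measurable: "(\<lambda>(w, t). Y (max 0 t) w) \<in> borel_measurable (M \<Otimes>\<^sub>M exponential_law q)"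
  using Y_pair_measurable unfolding split_beta by measurable

lemma prob_space_with_exponential_time: "0 < q \<Longrightarrow> prob_space (with_exponential_time M q)"
proof -
  assume q: "0 < q"
  interpret Q: prob_space "exponential_law q" using q by (rule prob_space_exponential_density)
  interpret P: pair_prob_space M "exponential_law q" ..
  show ?thesis unfolding with_exponential_time_def by (rule P.prob_space_axioms)
qed

lemma prob_space_sup_law: "0 < q \<Longrightarrow> prob_space (sup_law q)"
  unfolding sup_law_def by (intro prob_space.prob_space_distr prob_space_with_exponential_time)
    (auto simp: with_exponential_time_def rise_time_measurable)

lemma prob_space_end_law: "0 < q \<Longrightarrow> prob_space (end_law q)"
  unfolding end_law_def by (intro prob_space.prob_space_distr prob_space_with_exponential_time)
    (auto simp: with_exponential_time_def Y_time_measurable)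

lemma sup_law_nonneg: "0 < q \<Longrightarrow> AE s in sup_law q. 0 \<le> s"
  unfolding sup_law_def with_exponential_time_def
  by (subst AE_distr_iff[OF rise_time_measurable]) (auto simp: space_pair_measure intro!: rise_nonneg)

lemma xi_eq_sup_law:
  fixes a :: "'b::{real_normed_field, banach, second_countable_topology}"
  assumes q: "0 < q"
  shows "xi M Y a q = (\<integral>s. exp (- a * of_real s) \<partial>sup_law q)"
  unfolding xi_integrand_AE[OF q] sup_law_def with_exponential_time_def
  by (subst integral_distr[OF rise_time_measurable]) (auto simp: split_beta')

text \<open>At imaginary a the modulus of the transform is at most \<open>1\<close>, so the real
  part of \<phi> a is at most \<open>0\<close> and the transform at T is q/(q - \<phi> a). By
  \<open>xi_eq\<close> this equals \<open>xi\<close> times \<psi> q/(\<psi> q - a), and the second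
  factor is the transform of minus an exponential variable of rate \<psi> q.\<close>

lemma end_law_eq:
  assumes q: "0 < q"
  shows "end_law q = distr (sup_law q \<Otimes>\<^sub>M exponential_law (\<psi> q)) borel (\<lambda>(s, x). s - x)"
proof -
  let ?\<theta> = "\<psi> q"
  have \<theta>: "0 < ?\<theta>" by (rule right_inverse_pos[OF q])
  interpret Q: prob_space "exponential_law q" using q by (rule prob_space_exponential_density)
  interpret T: prob_space "exponential_law ?\<theta>" using \<theta> by (rule prob_space_exponential_density)
  interpret P: pair_prob_space M "exponential_law q" ..
  interpret S: prob_space "sup_law q" by (rule prob_space_sup_law[OF q])
  interpret ST: pair_prob_space "sup_law q" "exponential_law ?\<theta>" ..
  interpret N: prob_space "end_law q" by (rule prob_space_end_law[OF q])
  have [measurable_cong]: "sets (sup_law q) = sets borel" by (simp add: sup_law_def)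
  have dm: "(\<lambda>(s, x). s - x) \<in> borel_measurable (sup_law q \<Otimes>\<^sub>M exponential_law ?\<theta>)" by measurable
  show ?thesis
  proof (rule Levy_uniqueness)
    show "real_distribution (end_law q)"
      by (intro real_distribution.intro real_distribution_axioms.intro N.prob_space_axioms) (auto simp: end_law_def)
    show "real_distribution (distr (sup_law q \<Otimes>\<^sub>M exponential_law ?\<theta>) borel (\<lambda>(s, x). s - x))"
      by (intro real_distribution.intro real_distribution_axioms.intro ST.prob_space_distr dm) auto
    show "char (end_law q) = char (distr (sup_law q \<Otimes>\<^sub>M exponential_law ?\<theta>) borel (\<lambda>(s, x). s - x))"
    proof
      fix u :: real
      define a where "a = - \<i> * of_real u"
      have a: "Re a = 0" by (simp add: a_def)
      have a0: "0 \<le> Re a" "0 \<le> Re (- a)" using a by auto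
      have iexp: "iexp (u * x) = exp (- a * of_real x)" for x by (simp add: a_def mult.assoc)
      have "norm (mgf a 1) \<le> (\<integral>w. norm (exp (- a * complex_of_real (Y 1 w))) \<partial>M)"
        unfolding mgf_def by (rule integral_norm_bound)
      also have "\<dots> = 1" by (simp add: norm_exp_eq_Re a prob_space)
      finally have Re_phi: "Re (\<phi> a) \<le> 0" using mgf_eq_exp[OF a0(1), of 1] by (simp add: norm_exp_eq_Re)
      then have ne: "\<phi> a \<noteq> of_real q" using q by auto
      have ne': "a \<noteq> of_real ?\<theta>" using a \<theta> by auto
      have i2: "integrable (M \<Otimes>\<^sub>M exponential_law q) (\<lambda>(w, t). exp (- a * complex_of_real (Y (max 0 t) w)))"
        using Y_time_measurable[of q] unfolding split_beta
        by (intro P.integrable_const_bound[of _ 1]) (auto simp: norm_exp_eq_Re a intro!: measurable_compose[OF _ borel_measurable_exp])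
      have "char (end_law q) u = (\<integral>(w, t). exp (- a * complex_of_real (Y (max 0 t) w)) \<partial>(M \<Otimes>\<^sub>M exponential_law q))"
        unfolding char_def end_law_def with_exponential_time_def iexp
        by (subst integral_distr[OF Y_time_measurable]) (auto simp: split_beta')
      also have "\<dots> = (\<integral>t. mgf a (max 0 t) \<partial>exponential_law q)"
        unfolding mgf_def by (rule P.integral_snd[symmetric, OF i2])
      also have "\<dots> = (\<integral>t. exp (- (- \<phi> a) * of_real t) \<partial>exponential_law q)"
      proof (rule integral_cong_AE)
        show "(\<lambda>t. mgf a (max 0 t)) \<in> borel_measurable (exponential_law q)"
        proof -
          have "(\<lambda>t. mgf a (max 0 t)) = (\<lambda>t. exp (of_real (max 0 t) * \<phi> a))" using mgf_eq_exp[OF a0(1)] by auto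
          then show ?thesis by simp
        qed
        show "AE t in exponential_law q. mgf a (max 0 t) = exp (- (- \<phi> a) * of_real t)"
          using exponential_law_nonneg[of q]
          by eventually_elim (simp add: mgf_eq_exp[OF a0(1)] mult.commute max_absorb2)
      qed simp
      also have "\<dots> = of_real q / (of_real q + - \<phi> a)"
        by (rule exponential_law_laplace[OF q]) (use Re_phi in simp)
      finally have 1: "char (end_law q) u = of_real q / (of_real q - \<phi> a)" by simp
      have "char (distr (sup_law q \<Otimes>\<^sub>M exponential_law ?\<theta>) borel (\<lambda>(s, x). s - x)) u =
          (\<integral>(s, x). exp (- a * of_real s) * exp (- (- a) * of_real x) \<partial>(sup_law q \<Otimes>\<^sub>M exponential_law ?\<theta>))"
        unfolding char_def iexp
        by (subst integral_distr[OF dm]) (auto simp: exp_add[symmetric] algebra_simps intro!: Bochner_Integration.integral_cong)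
      also have "\<dots> = (\<integral>s. \<integral>x. exp (- a * of_real s) * exp (- (- a) * of_real x) \<partial>exponential_law ?\<theta> \<partial>sup_law q)"
      proof (rule ST.integral_fst[symmetric])
        show "integrable (sup_law q \<Otimes>\<^sub>M exponential_law ?\<theta>) (\<lambda>(s, x). exp (- a * complex_of_real s) * exp (- (- a) * of_real x))"
          by (intro ST.integrable_const_bound[of _ 1]) (auto simp: norm_mult norm_exp_eq_Re a)
      qed
      also have "\<dots> = xi M Y a q * (\<integral>x. exp (- (- a) * of_real x) \<partial>exponential_law ?\<theta>)"
        unfolding integral_mult_right_zero integral_mult_left_zero xi_eq_sup_law[OF q] ..
      also have "(\<integral>x. exp (- (- a) * complex_of_real x) \<partial>exponential_law ?\<theta>) = of_real ?\<theta> / (of_real ?\<theta> + - a)"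
        by (rule exponential_law_laplace[OF \<theta> a0(2)])
      also have "xi M Y a q * (of_real ?\<theta> / (of_real ?\<theta> + - a)) = of_real q / (of_real q - \<phi> a)"
      proof -
        have "Q * (A - T) / ((p - Q) * T) * (T / (T + - A)) = Q / (Q - p)" if "T \<noteq> 0" "A \<noteq> T" "p \<noteq> Q" for Q A T p :: complex
        proof -
          have "Q * (A - T) / ((p - Q) * T) * (T / (T + - A)) = (Q * (A - T)) / ((p - Q) * (T - A))" using that by simp
          also have "(p - Q) * (T - A) = (Q - p) * (A - T)" by (simp add: algebra_simps)
          finally show ?thesis using that by simp
        qed
        then show ?thesis unfolding xi_eq[OF a0(1) q ne] using \<theta> ne ne' by simp
      qed
      finally show "char (end_law q) u = char (distr (sup_law q \<Otimes>\<^sub>M exponential_law ?\<theta>) borel (\<lambda>(s, x). s - x)) u"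
        using 1 by simp
    qed
  qed
qed

end

section \<open>The renewal equation of the inspected process\<close>

lemma sum_from_1: "(\<Sum>m=1..n. f m) = (\<Sum>i<n. f (Suc i))"
  by (simp add: sum.atLeast1_atMost_eq)

lemma prod_from_1: "(\<Prod>m=1..n. f m) = (\<Prod>i<n. f (Suc i))"
  by (simp add: prod.atLeast1_atMost_eq)

text \<open>The sequence z lists the increments backwards: \<open>z k\<close> is the first step of
  the walk and \<open>z 0\<close> the last. The recursion strips off the first step while keeping
  the remaining indices, so prolonging the walk by one step inserts a single index into the product
  space.\<close>

primrec first_passage :: "nat \<Rightarrow> real \<Rightarrow> (nat \<Rightarrow> real) \<Rightarrow> bool" where
  "first_passage 0 u z \<longleftrightarrow> u < z 0"
| "first_passage (Suc k) u z \<longleftrightarrow> z (Suc k) \<le> u \<and> first_passage k (u - z (Suc k)) z"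

lemma first_passage_cong: "(\<And>i. i \<le> k \<Longrightarrow> z i = z' i) \<Longrightarrow> first_passage k u z \<longleftrightarrow> first_passage k u z'"
  by (induction k arbitrary: u) auto

lemma first_passage_measurable:
  assumes "U \<in> borel_measurable N" "\<And>i. i \<le> k \<Longrightarrow> (\<lambda>x. Z x i) \<in> borel_measurable N"
  shows "Measurable.pred N (\<lambda>x. first_passage k (U x) (Z x))"
  using assms
proof (induction k arbitrary: U)
  case 0
  then have "U \<in> borel_measurable N" "(\<lambda>x. Z x 0) \<in> borel_measurable N" by auto
  then show ?case by simp
next
  case (Suc k)
  then have [measurable]: "U \<in> borel_measurable N" "(\<lambda>x. Z x (Suc k)) \<in> borel_measurable N" by auto
  have "Measurable.pred N (\<lambda>x. first_passage k (U x - Z x (Suc k)) (Z x))"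
    by (rule Suc.IH) (use Suc.prems in auto)
  then show ?case by simp
qed

lemma first_passage_reversed:
  "first_passage k u (\<lambda>i. a (Suc k - i)) \<longleftrightarrow> (\<forall>j\<in>{1..k}. (\<Sum>m=1..j. a m) \<le> u) \<and> u < (\<Sum>m=1..Suc k. a m)"
proof (induction k arbitrary: u a)
  case (Suc k)
  have shift: "(\<Sum>m=1..Suc j. a m) = a 1 + (\<Sum>m=1..j. a (Suc m))" for j
    unfolding sum_from_1 sum.lessThan_Suc_shift by simp
  have "first_passage (Suc k) u (\<lambda>i. a (Suc (Suc k) - i)) \<longleftrightarrow> a 1 \<le> u \<and> first_passage k (u - a 1) (\<lambda>i. a (Suc (Suc k) - i))"
    by simp
  also have "first_passage k (u - a 1) (\<lambda>i. a (Suc (Suc k) - i)) \<longleftrightarrow> first_passage k (u - a 1) (\<lambda>i. (\<lambda>m. a (Suc m)) (Suc k - i))"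
    by (rule first_passage_cong) (simp add: Suc_diff_le)
  also have "\<dots> \<longleftrightarrow> (\<forall>j\<in>{1..k}. (\<Sum>m=1..j. a (Suc m)) \<le> u - a 1) \<and> u - a 1 < (\<Sum>m=1..Suc k. a (Suc m))"
    by (rule Suc.IH)
  also have "u - a 1 < (\<Sum>m=1..Suc k. a (Suc m)) \<longleftrightarrow> u < (\<Sum>m=1..Suc (Suc k). a m)" unfolding shift by linarith
  also have "(a 1 \<le> u \<and> (\<forall>j\<in>{1..k}. (\<Sum>m=1..j. a (Suc m)) \<le> u - a 1) \<and> u < (\<Sum>m=1..Suc (Suc k). a m)) \<longleftrightarrow>
      (\<forall>j\<in>{1..Suc k}. (\<Sum>m=1..j. a m) \<le> u) \<and> u < (\<Sum>m=1..Suc (Suc k). a m)"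
  proof -
    have img: "{1..Suc k} = Suc ` {0..k}" by (simp add: image_Suc_atLeastAtMost)
    have "(\<forall>j\<in>{1..Suc k}. (\<Sum>m=1..j. a m) \<le> u) \<longleftrightarrow> (\<forall>j\<in>{0..k}. (\<Sum>m=1..Suc j. a m) \<le> u)"
      unfolding img by blast
    also have "\<dots> \<longleftrightarrow> (\<Sum>m=1..Suc 0. a m) \<le> u \<and> (\<forall>j\<in>{1..k}. (\<Sum>m=1..Suc j. a m) \<le> u)"
      by (metis (no_types, lifting) One_nat_def atLeastAtMost_iff bot_nat_0.extremum le_zero_eq not_less_eq_eq)
    also have "\<dots> \<longleftrightarrow> a 1 \<le> u \<and> (\<forall>j\<in>{1..k}. (\<Sum>m=1..j. a (Suc m)) \<le> u - a 1)"
      unfolding shift by (auto simp: algebra_simps)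
    finally show ?thesis by blast
  qed
  finally show ?case .
qed simp

lemma sets_sigma_process_events: "sets (sigma (space M) (process_events M I X)) = process_events M I X"
  and space_sigma_process_events: "space (sigma (space M) (process_events M I X)) = space M"
proof -
  have G: "{X i -` A \<inter> space M |i A. i \<in> I \<and> A \<in> sets borel} \<subseteq> Pow (space M)" by auto
  have sub: "process_events M I X \<subseteq> Pow (space M)"
    unfolding process_events_def using sigma_sets_into_sp[OF G] by auto
  have "sigma_sets (space M) (process_events M I X) = process_events M I X"
    unfolding process_events_def by (rule sigma_sets_sigma_sets_eq[OF G])
  then show "sets (sigma (space M) (process_events M I X)) = process_events M I X"
    using sets_measure_of[OF sub] by simp
  show "space (sigma (space M) (process_events M I X)) = space M" by (rule space_measure_of[OF sub])
qed

section \<open>Independence of the inspected increments\<close>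

context inspected_levy_process
begin

definition inspection :: "nat \<Rightarrow> 'a \<Rightarrow> real" where
  "inspection n w = (\<Sum>m=1..n. \<Omega> m w)"

definition gap_law :: "real measure" where
  "gap_law = distr M borel (\<Omega> 1)"

lemma \<Omega>_measurable: "1 \<le> n \<Longrightarrow> \<Omega> n \<in> borel_measurable M"
  using indep_\<Omega> by (auto simp: indep_vars_def)

lemma prob_space_gap_law: "prob_space gap_law"
  unfolding gap_law_def by (rule prob_space_distr[OF \<Omega>_measurable]) simp

lemma sets_gap_law [measurable_cong, simp]: "sets gap_law = sets borel"
  by (simp add: gap_law_def)

lemma gap_law_nonneg: "AE x in gap_law. 0 \<le> x"
  unfolding gap_law_def using \<Omega>_measurable[of 1] nonneg_\<Omega>[of 1] by (subst AE_distr_iff) auto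

lemma inspection_nonneg: "w \<in> space M \<Longrightarrow> 0 \<le> inspection n w"
  unfolding inspection_def by (intro sum_nonneg nonneg_\<Omega>) auto

lemma inspection_mono: "w \<in> space M \<Longrightarrow> m \<le> n \<Longrightarrow> inspection m w \<le> inspection n w"
  unfolding inspection_def by (intro sum_mono2) (auto intro: nonneg_\<Omega>)

lemma inspection_measurable [measurable]: "inspection n \<in> borel_measurable M"
  unfolding inspection_def by (intro borel_measurable_sum \<Omega>_measurable) auto

lemma Y_inspection_measurable [measurable]: "(\<lambda>w. Y (inspection n w) w) \<in> borel_measurable M"
  by (rule Y_compose_measurable) (auto simp: inspection_nonneg)

definition inspected_increment :: "nat \<Rightarrow> 'a \<Rightarrow> real" where
  "inspected_increment m w = Y (inspection m w) w - Y (inspection (m - 1) w) w"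

lemma inspected_increment_measurable [measurable]: "inspected_increment m \<in> borel_measurable M"
  unfolding inspected_increment_def[abs_def] by measurable

lemma sum_inspected_increment: "w \<in> space M \<Longrightarrow> (\<Sum>m=1..n. inspected_increment m w) = Y (inspection n w) w"
  by (induction n) (auto simp: inspected_increment_def inspection_def Y_zero)

text \<open>The discount \<open>exp (- \<beta> \<Omega>)\<close>, which is the probability that no killing at rate \<open>\<beta>\<close> occurs
  before the inspection, enters as a density, so this step distribution has total mass below one.\<close>

definition step_law :: "real \<Rightarrow> real measure" where
  "step_law \<beta> = distr (density (M \<Otimes>\<^sub>M gap_law) (\<lambda>(w, x). ennreal (exp (- \<beta> * x)))) borel (\<lambda>(w, x). Y (max 0 x) w)"

lemma Y_gap_measurable: "(\<lambda>(w, x). Y (max 0 x) w) \<in> borel_measurable (M \<Otimes>\<^sub>M gap_law)"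
  using Y_pair_measurable unfolding split_beta by measurable

lemma nn_integral_step_law:
  assumes f: "f \<in> borel_measurable borel"
  shows "(\<integral>\<^sup>+y. f y \<partial>step_law \<beta>) = (\<integral>\<^sup>+x. ennreal (exp (- \<beta> * x)) * (\<integral>\<^sup>+w. f (Y (max 0 x) w) \<partial>M) \<partial>gap_law)"
proof -
  interpret G: prob_space gap_law by (rule prob_space_gap_law)
  interpret P: pair_prob_space M gap_law ..
  note [measurable] = f
  have m: "(\<lambda>p. f (Y (max 0 (snd p)) (fst p))) \<in> borel_measurable (M \<Otimes>\<^sub>M gap_law)"
    using measurable_compose[OF Y_gap_measurable f] by (simp add: split_beta)
  have mx: "(\<lambda>w. f (Y (max 0 x) w)) \<in> borel_measurable M" for x
    by (rule measurable_compose[OF random_variable_Y f]) simp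
  have "(\<integral>\<^sup>+y. f y \<partial>step_law \<beta>) = (\<integral>\<^sup>+p. f (Y (max 0 (snd p)) (fst p)) \<partial>density (M \<Otimes>\<^sub>M gap_law) (\<lambda>(w, x). ennreal (exp (- \<beta> * x))))"
    unfolding step_law_def using Y_gap_measurable by (subst nn_integral_distr) (auto simp: split_beta)
  also have "\<dots> = (\<integral>\<^sup>+p. ennreal (exp (- \<beta> * snd p)) * f (Y (max 0 (snd p)) (fst p)) \<partial>(M \<Otimes>\<^sub>M gap_law))"
    using m by (subst nn_integral_density) (auto simp: split_beta)
  also have "\<dots> = (\<integral>\<^sup>+x. (\<integral>\<^sup>+w. ennreal (exp (- \<beta> * x)) * f (Y (max 0 x) w) \<partial>M) \<partial>gap_law)"
    using m by (subst P.nn_integral_snd[symmetric]) auto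
  also have "\<dots> = (\<integral>\<^sup>+x. ennreal (exp (- \<beta> * x)) * (\<integral>\<^sup>+w. f (Y (max 0 x) w) \<partial>M) \<partial>gap_law)"
    using mx by (intro nn_integral_cong nn_integral_cmult)
  finally show ?thesis .
qed

lemma sets_step_law [measurable_cong, simp]: "sets (step_law \<beta>) = sets borel"
  by (simp add: step_law_def)

lemma finite_measure_step_law:
  assumes "0 \<le> \<beta>"
  shows "finite_measure (step_law \<beta>)"
proof
  interpret G: prob_space gap_law by (rule prob_space_gap_law)
  have "emeasure (step_law \<beta>) (space (step_law \<beta>)) = (\<integral>\<^sup>+y. 1 \<partial>step_law \<beta>)" by simp
  also have "\<dots> = (\<integral>\<^sup>+x. ennreal (exp (- \<beta> * x)) \<partial>gap_law)" by (subst nn_integral_step_law) (auto simp: emeasure_space_1)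
  also have "\<dots> \<le> (\<integral>\<^sup>+x. 1 \<partial>gap_law)"
    using gap_law_nonneg assms by (intro nn_integral_mono_AE) (auto elim!: eventually_mono simp: ennreal_le_1)
  also have "\<dots> = 1" by (simp add: G.emeasure_space_1)
  finally show "emeasure (step_law \<beta>) (space (step_law \<beta>)) \<noteq> \<infinity>" by (auto simp: top_unique)
qed

text \<open>Independence of Y and \<Omega> is an assumption about the sigma-algebras they generate,
  so M splits into a product only after its events have been restricted to those of the
  paths.\<close>

definition path_algebra :: "'a measure" where
  "path_algebra = sigma (space M) (process_events M {0..} Y)"

lemma space_path_algebra [simp]: "space path_algebra = space M"
  unfolding path_algebra_def by (rule space_sigma_process_events)

lemma sets_path_algebra: "sets path_algebra = process_events M {0..} Y"
  unfolding path_algebra_def by (rule sets_sigma_process_events)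

lemma Y_path_algebra: "0 \<le> t \<Longrightarrow> Y t \<in> borel_measurable path_algebra"
proof (rule measurableI)
  fix A :: "real set" assume t: "0 \<le> t" and A: "A \<in> sets borel"
  show "Y t -` A \<inter> space path_algebra \<in> sets path_algebra"
    unfolding sets_path_algebra process_events_def using t A by (intro sigma_sets.Basic) auto
qed simp

lemma process_events_subset: "process_events M {0..} Y \<subseteq> events"
  unfolding process_events_def
  by (intro sets.sigma_sets_subset) (auto intro: measurable_sets[OF random_variable_Y])

lemma path_algebra_sub: "f \<in> measurable path_algebra N \<Longrightarrow> f \<in> measurable M N"
  using process_events_subset unfolding measurable_def sets_path_algebra by auto

text \<open>Converts independence of sigma-algebras into a product measure whose first factor is M
  seen through \<open>path_algebra\<close>; afterwards a path can be integrated while the gaps are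
  held fixed.\<close>

lemma distr_paths_gaps:
  fixes n :: nat
  defines "P \<equiv> PiM {1..n} (\<lambda>_. borel :: real measure)" and "gaps \<equiv> \<lambda>w. \<lambda>m\<in>{1..n}. \<Omega> m w"
  shows "distr M path_algebra (\<lambda>w. w) \<Otimes>\<^sub>M distr M P gaps = distr M (path_algebra \<Otimes>\<^sub>M P) (\<lambda>w. (w, gaps w))"
proof -
  define gap_algebra where "gap_algebra = sigma (space M) (process_events M {1..} \<Omega>)"
  have sets_gap: "sets gap_algebra = process_events M {1..} \<Omega>"
    unfolding gap_algebra_def by (rule sets_sigma_process_events)
  have space_gap: "space gap_algebra = space M"
    unfolding gap_algebra_def by (rule space_sigma_process_events)
  have gap_m: "\<Omega> m \<in> borel_measurable gap_algebra" if "1 \<le> m" for m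
  proof (rule measurableI)
    fix A :: "real set" assume A: "A \<in> sets borel"
    show "\<Omega> m -` A \<inter> space gap_algebra \<in> sets gap_algebra"
      unfolding sets_gap space_gap process_events_def using that A by (intro sigma_sets.Basic) auto
  qed simp
  have gaps': "gaps \<in> measurable gap_algebra P"
    unfolding gaps_def P_def using gap_m by (intro measurable_restrict) auto
  have gaps: "gaps \<in> measurable M P"
    unfolding gaps_def P_def by (intro measurable_restrict \<Omega>_measurable) auto
  have idm: "(\<lambda>w. w) \<in> measurable M path_algebra" by (rule path_algebra_sub) simp
  interpret A: prob_space "distr M path_algebra (\<lambda>w. w)" by (rule prob_space_distr[OF idm])
  interpret B: prob_space "distr M P gaps" by (rule prob_space_distr[OF gaps])
  show ?thesis
  proof (rule pair_measure_eqI)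
    fix A B assume "A \<in> sets (distr M path_algebra (\<lambda>w. w))" "B \<in> sets (distr M P gaps)"
    then have A: "A \<in> sets path_algebra" and B: "B \<in> sets P" by simp_all
    have A_sub: "A \<subseteq> space M" using sets.sets_into_space[OF A] by simp
    have gB: "gaps -` B \<inter> space M \<in> process_events M {1..} \<Omega>"
      using measurable_sets[OF gaps' B] by (simp add: sets_gap space_gap)
    have "emeasure (distr M path_algebra (\<lambda>w. w)) A * emeasure (distr M P gaps) B = emeasure M A * emeasure M (gaps -` B \<inter> space M)"
      using A_sub by (simp add: emeasure_distr[OF idm A] emeasure_distr[OF gaps B] Int_absorb2)
    also have "\<dots> = ennreal (prob A * prob (gaps -` B \<inter> space M))"
      by (simp add: emeasure_eq_measure ennreal_mult)
    also have "prob A * prob (gaps -` B \<inter> space M) = prob (A \<inter> (gaps -` B \<inter> space M))"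
      using indep_setD[OF indep_Y_\<Omega> _ gB, of A] A by (simp add: sets_path_algebra)
    also have "ennreal (prob (A \<inter> (gaps -` B \<inter> space M))) = emeasure M (A \<inter> (gaps -` B \<inter> space M))"
      by (simp add: emeasure_eq_measure)
    also have "A \<inter> (gaps -` B \<inter> space M) = (\<lambda>w. (w, gaps w)) -` (A \<times> B) \<inter> space M" using A_sub by auto
    also have "emeasure M \<dots> = emeasure (distr M (path_algebra \<Otimes>\<^sub>M P) (\<lambda>w. (w, gaps w))) (A \<times> B)"
      using A B by (subst emeasure_distr[OF measurable_Pair[OF idm gaps]]) auto
    finally show "emeasure (distr M path_algebra (\<lambda>w. w)) A * emeasure (distr M P gaps) B = emeasure (distr M (path_algebra \<Otimes>\<^sub>M P) (\<lambda>w. (w, gaps w))) (A \<times> B)" .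
  qed (auto intro: A.sigma_finite_measure_axioms B.sigma_finite_measure_axioms cong: sets_pair_measure_cong)
qed

lemma distr_gaps: "1 \<le> n \<Longrightarrow> distr M (PiM {1..n} (\<lambda>_. borel)) (\<lambda>w. \<lambda>m\<in>{1..n}. \<Omega> m w) = PiM {1..n} (\<lambda>_. gap_law)"
proof -
  assume n: "1 \<le> n"
  have "indep_vars (\<lambda>_. borel) \<Omega> {1..n}" by (rule indep_vars_subset[OF indep_\<Omega>]) auto
  then have "distr M (PiM {1..n} (\<lambda>_. borel)) (\<lambda>w. \<lambda>m\<in>{1..n}. \<Omega> m w) = PiM {1..n} (\<lambda>m. distr M borel (\<Omega> m))"
    using n \<Omega>_measurable by (subst (asm) indep_vars_iff_distr_eq_PiM') auto
  also have "\<dots> = PiM {1..n} (\<lambda>_. gap_law)"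
    unfolding gap_law_def by (intro PiM_cong refl identically_distributed_\<Omega>) auto
  finally show ?thesis .
qed

lemma nn_integral_paths_gaps:
  assumes n: "1 \<le> n" and H: "H \<in> borel_measurable (path_algebra \<Otimes>\<^sub>M PiM {1..n} (\<lambda>_. borel))"
  shows "(\<integral>\<^sup>+w. H (w, \<lambda>m\<in>{1..n}. \<Omega> m w) \<partial>M) = (\<integral>\<^sup>+x. (\<integral>\<^sup>+w. H (w, x) \<partial>M) \<partial>PiM {1..n} (\<lambda>_. gap_law))"
proof -
  let ?P = "PiM {1..n} (\<lambda>_. borel :: real measure)" and ?vec = "\<lambda>w. \<lambda>m\<in>{1..n}. \<Omega> m w"
  have idm: "(\<lambda>w. w) \<in> measurable M path_algebra" by (rule path_algebra_sub) simp
  have vm: "?vec \<in> measurable M ?P" by (intro measurable_restrict \<Omega>_measurable) auto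
  interpret A: prob_space "distr M path_algebra (\<lambda>w. w)" by (rule prob_space_distr[OF idm])
  interpret B: prob_space "distr M ?P ?vec" by (rule prob_space_distr[OF vm])
  interpret AB: pair_prob_space "distr M path_algebra (\<lambda>w. w)" "distr M ?P ?vec" ..
  have "(\<integral>\<^sup>+w. H (w, ?vec w) \<partial>M) = (\<integral>\<^sup>+p. H p \<partial>distr M (path_algebra \<Otimes>\<^sub>M ?P) (\<lambda>w. (w, ?vec w)))"
    using H by (subst nn_integral_distr[OF measurable_Pair[OF idm vm]]) auto
  also have "distr M (path_algebra \<Otimes>\<^sub>M ?P) (\<lambda>w. (w, ?vec w)) = distr M path_algebra (\<lambda>w. w) \<Otimes>\<^sub>M distr M ?P ?vec"
    by (rule distr_paths_gaps[symmetric])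
  also have "(\<integral>\<^sup>+p. H p \<partial>(distr M path_algebra (\<lambda>w. w) \<Otimes>\<^sub>M distr M ?P ?vec)) = (\<integral>\<^sup>+x. (\<integral>\<^sup>+w. H (w, x) \<partial>distr M path_algebra (\<lambda>w. w)) \<partial>distr M ?P ?vec)"
    using H by (intro AB.nn_integral_snd[symmetric]) (simp cong: measurable_cong_sets)
  also have "\<dots> = (\<integral>\<^sup>+x. (\<integral>\<^sup>+w. H (w, x) \<partial>M) \<partial>distr M ?P ?vec)"
  proof (rule nn_integral_cong)
    fix x assume "x \<in> space (distr M ?P ?vec)"
    then have "(\<lambda>w. H (w, x)) \<in> borel_measurable path_algebra" by (intro measurable_Pair1[OF H]) simp
    then show "(\<integral>\<^sup>+w. H (w, x) \<partial>distr M path_algebra (\<lambda>w. w)) = (\<integral>\<^sup>+w. H (w, x) \<partial>M)"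
      by (subst nn_integral_distr[OF idm]) auto
  qed
  finally show ?thesis unfolding distr_gaps[OF n] .
qed

lemma nn_integral_increments_prod:
  assumes x: "\<And>i. i < n \<Longrightarrow> 0 \<le> x i" and B: "\<And>i. i < n \<Longrightarrow> B i \<in> sets borel"
  shows "(\<integral>\<^sup>+w. (\<Prod>i<n. indicator (B i) (Y (\<Sum>l<Suc i. x l) w - Y (\<Sum>l<i. x l) w)) \<partial>M) = (\<Prod>i<n. \<integral>\<^sup>+w. indicator (B i) (Y (x i) w) \<partial>M)"
proof -
  define \<tau> where "\<tau> i = (\<Sum>l<i. x l)" for i
  have \<tau>: "0 \<le> \<tau> i" "\<tau> (Suc i) = \<tau> i + x i" if "i \<le> n" for i
    using that x by (auto simp: \<tau>_def intro!: sum_nonneg)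
  have ind: "indep_vars (\<lambda>_. borel) (\<lambda>i w. Y (\<tau> (Suc i)) w - Y (\<tau> i) w) {..<n}"
    using x by (intro independent_increments) (auto simp: \<tau>_def)
  have "indep_vars (\<lambda>_. borel) (\<lambda>i w. indicator (B i) (Y (\<tau> (Suc i)) w - Y (\<tau> i) w) :: ennreal) {..<n}"
    by (rule indep_vars_compose2[OF ind]) (use B in auto)
  then have "(\<integral>\<^sup>+w. (\<Prod>i<n. indicator (B i) (Y (\<tau> (Suc i)) w - Y (\<tau> i) w)) \<partial>M) = (\<Prod>i<n. \<integral>\<^sup>+w. indicator (B i) (Y (\<tau> (Suc i)) w - Y (\<tau> i) w) \<partial>M)"
    by (intro indep_vars_nn_integral) auto
  also have "\<dots> = (\<Prod>i<n. \<integral>\<^sup>+w. indicator (B i) (Y (x i) w) \<partial>M)"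
  proof (rule prod.cong[OF refl])
    fix i assume "i \<in> {..<n}"
    then have i: "i < n" by simp
    have m: "(\<lambda>w. Y (\<tau> i + x i) w - Y (\<tau> i) w) \<in> borel_measurable M"
      using i \<tau>(1)[of i] x[OF i] by (intro borel_measurable_diff random_variable_Y) auto
    have "(\<integral>\<^sup>+w. indicator (B i) (Y (\<tau> (Suc i)) w - Y (\<tau> i) w) \<partial>M) = (\<integral>\<^sup>+y. indicator (B i) y \<partial>distr M borel (\<lambda>w. Y (\<tau> i + x i) w - Y (\<tau> i) w))"
      using i B m \<tau>(2)[of i] by (subst nn_integral_distr) auto
    also have "\<dots> = (\<integral>\<^sup>+y. indicator (B i) y \<partial>distr M borel (Y (x i)))"
      using i \<tau>(1)[of i] x[OF i] by (subst stationary_increments) auto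
    also have "\<dots> = (\<integral>\<^sup>+w. indicator (B i) (Y (x i) w) \<partial>M)"
      using i B random_variable_Y[OF x[OF i]] by (subst nn_integral_distr) auto
    finally show "(\<integral>\<^sup>+w. indicator (B i) (Y (\<tau> (Suc i)) w - Y (\<tau> i) w) \<partial>M) = (\<integral>\<^sup>+w. indicator (B i) (Y (x i) w) \<partial>M)" .
  qed
  finally show ?thesis unfolding \<tau>_def .
qed

text \<open>For fixed gaps the inspected increments are independent, each with the law of Y at its
  gap, and the discount at the n-th inspection is a product over the gaps. Integrating over the
  independent gaps leaves one factor \<open>step_law\<close> for each step.\<close>

lemma inspected_boxes:
  assumes n: "1 \<le> n" and B: "\<And>i. i < n \<Longrightarrow> B i \<in> sets borel"
  shows "(\<integral>\<^sup>+w. ennreal (exp (- \<beta> * inspection n w)) * (\<Prod>i<n. indicator (B i) (inspected_increment (Suc i) w)) \<partial>M)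
    = (\<Prod>i<n. emeasure (step_law \<beta>) (B i))"
proof -
  let ?P = "PiM {1..n} (\<lambda>_. borel :: real measure)"
  interpret G: prob_space gap_law by (rule prob_space_gap_law)
  interpret PG: product_prob_space "\<lambda>_. gap_law" "{1..n}" ..
  \<comment> \<open>\<open>max 0\<close> makes H measurable for arbitrary real gaps; almost surely
    the gaps are nonnegative and it has no effect.\<close>
  define H where "H p = (case p of (w, x) \<Rightarrow> (\<Prod>i<n. ennreal (exp (- \<beta> * x (Suc i)))) *
     (\<Prod>i<n. indicator (B i) (Y (max 0 (\<Sum>l<Suc i. x (Suc l))) w - Y (max 0 (\<Sum>l<i. x (Suc l))) w)))" for p
  have Yp: "(\<lambda>(w, t). Y (max 0 t) w) \<in> borel_measurable (path_algebra \<Otimes>\<^sub>M borel)"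
    by (rule right_continuous_measurable_pair[OF Y_path_algebra right_continuous]) auto
  have Hm: "H \<in> borel_measurable (path_algebra \<Otimes>\<^sub>M ?P)"
  proof -
    have comp: "(\<lambda>p. snd p (Suc i)) \<in> borel_measurable (path_algebra \<Otimes>\<^sub>M ?P)" if "i < n" for i
      by (rule measurable_compose[OF measurable_snd measurable_component_singleton]) (use that in auto)
    have Ys: "(\<lambda>p. Y (max 0 (\<Sum>l<i. snd p (Suc l))) (fst p)) \<in> borel_measurable (path_algebra \<Otimes>\<^sub>M ?P)" if "i \<le> n" for i
    proof -
      have "(\<lambda>p. (fst p, \<Sum>l<i. snd p (Suc l))) \<in> measurable (path_algebra \<Otimes>\<^sub>M ?P) (path_algebra \<Otimes>\<^sub>M borel)"
        using that by (intro measurable_Pair borel_measurable_sum comp) auto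
      from measurable_compose[OF this Yp] show ?thesis by simp
    qed
    have i1: "(\<lambda>p. ennreal (exp (- \<beta> * snd p (Suc i)))) \<in> borel_measurable (path_algebra \<Otimes>\<^sub>M ?P)" if "i < n" for i
      using comp[OF that] by measurable
    have i2: "(\<lambda>p. indicator (B i) (Y (max 0 (\<Sum>l<Suc i. snd p (Suc l))) (fst p) - Y (max 0 (\<Sum>l<i. snd p (Suc l))) (fst p)) :: ennreal) \<in> borel_measurable (path_algebra \<Otimes>\<^sub>M ?P)" if "i < n" for i
    proof (rule measurable_compose[OF borel_measurable_diff[OF Ys Ys]])
      show "(indicator (B i) :: real \<Rightarrow> ennreal) \<in> borel_measurable borel" using B[OF that] by simp
    qed (use that in auto)
    show ?thesis unfolding H_def split_beta
      by (intro borel_measurable_times_ennreal borel_measurable_prod_ennreal i1 i2) auto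
  qed
  have "(\<integral>\<^sup>+w. ennreal (exp (- \<beta> * inspection n w)) * (\<Prod>i<n. indicator (B i) (inspected_increment (Suc i) w)) \<partial>M)
      = (\<integral>\<^sup>+w. H (w, \<lambda>m\<in>{1..n}. \<Omega> m w) \<partial>M)"
  proof (rule nn_integral_cong)
    fix w assume w: "w \<in> space M"
    have s: "(\<Sum>l<i. (\<lambda>m\<in>{1..n}. \<Omega> m w) (Suc l)) = inspection i w" if "i \<le> n" for i
      unfolding inspection_def sum_from_1 using that by (intro sum.cong) auto
    have "(\<Prod>i<n. ennreal (exp (- \<beta> * (\<lambda>m\<in>{1..n}. \<Omega> m w) (Suc i)))) = ennreal (exp (- \<beta> * (\<Sum>i<n. (\<lambda>m\<in>{1..n}. \<Omega> m w) (Suc i))))"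
      by (subst prod_ennreal) (auto simp: exp_sum sum_distrib_left sum_negf[symmetric])
    also have "\<dots> = ennreal (exp (- \<beta> * inspection n w))" by (simp only: s order_refl)
    finally have 1: "(\<Prod>i<n. ennreal (exp (- \<beta> * (\<lambda>m\<in>{1..n}. \<Omega> m w) (Suc i)))) = ennreal (exp (- \<beta> * inspection n w))" .
    have 2: "indicator (B i) (Y (max 0 (\<Sum>l<Suc i. (\<lambda>m\<in>{1..n}. \<Omega> m w) (Suc l))) w - Y (max 0 (\<Sum>l<i. (\<lambda>m\<in>{1..n}. \<Omega> m w) (Suc l))) w)
        = indicator (B i) (inspected_increment (Suc i) w)" if "i < n" for i
      unfolding s[OF Suc_leI[OF that]] s[OF less_imp_le[OF that]]
      by (simp add: inspected_increment_def max_absorb2 inspection_nonneg[OF w])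
    show "ennreal (exp (- \<beta> * inspection n w)) * (\<Prod>i<n. indicator (B i) (inspected_increment (Suc i) w)) = H (w, \<lambda>m\<in>{1..n}. \<Omega> m w)"
      unfolding H_def prod.case 1 by (intro arg_cong2[where f="(*)"] refl prod.cong 2[symmetric]) auto
  qed
  also have "\<dots> = (\<integral>\<^sup>+x. (\<integral>\<^sup>+w. H (w, x) \<partial>M) \<partial>PiM {1..n} (\<lambda>_. gap_law))"
    by (rule nn_integral_paths_gaps[OF n Hm])
  also have "\<dots> = (\<integral>\<^sup>+x. (\<Prod>m\<in>{1..n}. ennreal (exp (- \<beta> * x m)) * (\<integral>\<^sup>+w. indicator (B (m - 1)) (Y (max 0 (x m)) w) \<partial>M)) \<partial>PiM {1..n} (\<lambda>_. gap_law))"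
  proof (rule nn_integral_cong_AE)
    have "AE x in PiM {1..n} (\<lambda>_. gap_law). 0 \<le> x m" if "m \<in> {1..n}" for m
      by (rule AE_PiM_component[OF prob_space_gap_law that gap_law_nonneg])
    then have "AE x in PiM {1..n} (\<lambda>_. gap_law). \<forall>m\<in>{1..n}. 0 \<le> x m" by (simp add: AE_finite_all)
    then show "AE x in PiM {1..n} (\<lambda>_. gap_law). (\<integral>\<^sup>+w. H (w, x) \<partial>M) = (\<Prod>m\<in>{1..n}. ennreal (exp (- \<beta> * x m)) * (\<integral>\<^sup>+w. indicator (B (m - 1)) (Y (max 0 (x m)) w) \<partial>M))"
    proof eventually_elim
      case (elim x)
      have x: "0 \<le> x (Suc i)" if "i < n" for i using elim that by auto
      have s: "0 \<le> (\<Sum>l<i. x (Suc l))" if "i \<le> n" for i using that x by (intro sum_nonneg) auto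
      have "(\<integral>\<^sup>+w. H (w, x) \<partial>M) = (\<integral>\<^sup>+w. (\<Prod>i<n. ennreal (exp (- \<beta> * x (Suc i)))) *
          (\<Prod>i<n. indicator (B i) (Y (\<Sum>l<Suc i. x (Suc l)) w - Y (\<Sum>l<i. x (Suc l)) w)) \<partial>M)"
        unfolding H_def prod.case
        by (intro nn_integral_cong arg_cong2[where f="(*)"] refl prod.cong) (simp add: max_absorb2 s x)
      also have "\<dots> = (\<Prod>i<n. ennreal (exp (- \<beta> * x (Suc i)))) * (\<integral>\<^sup>+w. (\<Prod>i<n. indicator (B i) (Y (\<Sum>l<Suc i. x (Suc l)) w - Y (\<Sum>l<i. x (Suc l)) w)) \<partial>M)"
      proof (rule nn_integral_cmult, rule borel_measurable_prod_ennreal)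
        fix i assume "i \<in> {..<n}"
        then show "(\<lambda>w. indicator (B i) (Y (\<Sum>l<Suc i. x (Suc l)) w - Y (\<Sum>l<i. x (Suc l)) w) :: ennreal) \<in> borel_measurable M"
          using s[of i] s[of "Suc i"] B
          by (intro measurable_compose[OF borel_measurable_diff[OF random_variable_Y random_variable_Y]] borel_measurable_indicator) auto
      qed
      also have "\<dots> = (\<Prod>i<n. ennreal (exp (- \<beta> * x (Suc i)))) * (\<Prod>i<n. \<integral>\<^sup>+w. indicator (B i) (Y (x (Suc i)) w) \<partial>M)"
        using nn_integral_increments_prod[of n "\<lambda>i. x (Suc i)" B] x B by simp
      also have "\<dots> = (\<Prod>i<n. ennreal (exp (- \<beta> * x (Suc i))) * (\<integral>\<^sup>+w. indicator (B i) (Y (x (Suc i)) w) \<partial>M))"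
        by (rule prod.distrib[symmetric])
      also have "\<dots> = (\<Prod>m\<in>{1..n}. ennreal (exp (- \<beta> * x m)) * (\<integral>\<^sup>+w. indicator (B (m - 1)) (Y (max 0 (x m)) w) \<partial>M))"
        unfolding prod_from_1 by (intro prod.cong refl) (simp add: x max_absorb2)
      finally show ?case .
    qed
  qed
  also have "\<dots> = (\<Prod>m\<in>{1..n}. \<integral>\<^sup>+x. ennreal (exp (- \<beta> * x)) * (\<integral>\<^sup>+w. indicator (B (m - 1)) (Y (max 0 x) w) \<partial>M) \<partial>gap_law)"
  proof (rule PG.product_nn_integral_prod)
    fix m assume m: "m \<in> {1..n}"
    have Yg: "(\<lambda>p. Y (max 0 (fst p)) (snd p)) \<in> borel_measurable (gap_law \<Otimes>\<^sub>M M)"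
      by (rule Y_compose_measurable) auto
    have "(indicator (B (m - 1)) :: real \<Rightarrow> ennreal) \<in> borel_measurable borel" using B[of "m - 1"] m by auto
    from measurable_compose[OF Yg this]
    have "(\<lambda>p. indicator (B (m - 1)) (Y (max 0 (fst p)) (snd p)) :: ennreal) \<in> borel_measurable (gap_law \<Otimes>\<^sub>M M)" .
    then have "(\<lambda>x. \<integral>\<^sup>+w. indicator (B (m - 1)) (Y (max 0 x) w) \<partial>M) \<in> borel_measurable gap_law"
      by (intro borel_measurable_nn_integral) (simp add: split_beta')
    then show "(\<lambda>x. ennreal (exp (- \<beta> * x)) * (\<integral>\<^sup>+w. indicator (B (m - 1)) (Y (max 0 x) w) \<partial>M)) \<in> borel_measurable gap_law"
      by measurable
  qed simp
  also have "\<dots> = (\<Prod>i<n. emeasure (step_law \<beta>) (B i))"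
    unfolding prod_from_1
  proof (rule prod.cong[OF refl])
    fix i assume "i \<in> {..<n}"
    then have "B i \<in> sets borel" using B by auto
    then show "(\<integral>\<^sup>+x. ennreal (exp (- \<beta> * x)) * (\<integral>\<^sup>+w. indicator (B (Suc i - 1)) (Y (max 0 x) w) \<partial>M) \<partial>gap_law) = emeasure (step_law \<beta>) (B i)"
      using nn_integral_step_law[of "indicator (B i)" \<beta>] by simp
  qed
  finally show ?thesis .
qed

end

lemma emeasure_exponential_law_ge:
  assumes q: "0 < q" and a: "0 \<le> a"
  shows "emeasure (exponential_law q) {t. a \<le> t} = ennreal (exp (- q * a))"
proof -
  interpret prob_space "exponential_law q" using q by (rule prob_space_exponential_density)
  have "measure (exponential_law q) {t. a \<le> t} = measure (exponential_law q) {t. a < t}"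
    using exponential_law_neq[of a q] by (intro finite_measure_eq_AE) (auto elim!: eventually_mono)
  then show ?thesis using measure_exponential_law_gt[OF q a] by (simp add: emeasure_eq_measure)
qed

section \<open>First passage of the inspected walk\<close>

context inspected_levy_process
begin

text \<open>A product of finite measures is determined by boxes, where the claim is
  \<open>inspected_boxes\<close>. The increments are numbered backwards to agree with
  \<open>first_passage\<close>.\<close>

lemma step_walk_law:
  assumes \<beta>: "0 \<le> \<beta>"
  shows "distr (density M (\<lambda>w. ennreal (exp (- \<beta> * inspection (Suc k) w)))) (PiM {..<Suc k} (\<lambda>_. borel))
    (\<lambda>w. \<lambda>i\<in>{..<Suc k}. inspected_increment (Suc k - i) w) = PiM {..<Suc k} (\<lambda>_. step_law \<beta>)" (is "distr ?D ?P ?Z = _")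
proof -
  interpret S: finite_measure "step_law \<beta>" by (rule finite_measure_step_law[OF \<beta>])
  interpret PS: product_sigma_finite "\<lambda>_. step_law \<beta>" ..
  have Z: "?Z \<in> measurable M ?P" by (intro measurable_restrict) simp
  show ?thesis
  proof (rule PS.PiM_eqI)
    show "sets (distr ?D ?P ?Z) = sets (PiM {..<Suc k} (\<lambda>_. step_law \<beta>))"
      by (simp, intro sets_PiM_cong) auto
    fix A :: "nat \<Rightarrow> real set" assume A: "\<And>i. i \<in> {..<Suc k} \<Longrightarrow> A i \<in> sets (step_law \<beta>)"
    have AP: "Pi\<^sub>E {..<Suc k} A \<in> sets ?P" using A by (intro sets_PiM_I_finite) auto
    have "emeasure (distr ?D ?P ?Z) (Pi\<^sub>E {..<Suc k} A) = (\<integral>\<^sup>+z. indicator (Pi\<^sub>E {..<Suc k} A) z \<partial>distr ?D ?P ?Z)"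
      using AP by simp
    also have "\<dots> = (\<integral>\<^sup>+w. ennreal (exp (- \<beta> * inspection (Suc k) w)) * indicator (Pi\<^sub>E {..<Suc k} A) (?Z w) \<partial>M)"
      using AP Z by (subst nn_integral_distr) (auto simp: nn_integral_density)
    also have "\<dots> = (\<integral>\<^sup>+w. ennreal (exp (- \<beta> * inspection (Suc k) w)) * (\<Prod>i<Suc k. indicator (A (k - i)) (inspected_increment (Suc i) w)) \<partial>M)"
    proof (intro nn_integral_cong arg_cong2[where f="(*)"] refl)
      fix w
      have "indicator (Pi\<^sub>E {..<Suc k} A) (?Z w) = (\<Prod>i<Suc k. indicator (A i) (inspected_increment (Suc k - i) w) :: ennreal)"
      proof (cases "\<forall>i<Suc k. inspected_increment (Suc k - i) w \<in> A i")
        case True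
        then have "?Z w \<in> Pi\<^sub>E {..<Suc k} A" by auto
        then show ?thesis using True by (simp del: prod.lessThan_Suc)
      next
        case False
        then obtain i where i: "i < Suc k" "inspected_increment (Suc k - i) w \<notin> A i" by blast
        then have "?Z w \<notin> Pi\<^sub>E {..<Suc k} A" by (auto simp: PiE_iff)
        moreover have "(\<Prod>i<Suc k. indicator (A i) (inspected_increment (Suc k - i) w) :: ennreal) = 0"
          using i by (intro prod_zero bexI[of _ i]) auto
        ultimately show ?thesis by simp
      qed
      also have "\<dots> = (\<Prod>i<Suc k. indicator (A (Suc k - Suc i)) (inspected_increment (Suc k - (Suc k - Suc i)) w))"
        by (rule prod.nat_diff_reindex[symmetric])
      also have "\<dots> = (\<Prod>i<Suc k. indicator (A (k - i)) (inspected_increment (Suc i) w))"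
        by (intro prod.cong refl) (simp add: Suc_diff_le)
      finally show "indicator (Pi\<^sub>E {..<Suc k} A) (?Z w) = (\<Prod>i<Suc k. indicator (A (k - i)) (inspected_increment (Suc i) w) :: ennreal)" .
    qed
    also have "\<dots> = (\<Prod>i<Suc k. emeasure (step_law \<beta>) (A (k - i)))"
      using A by (intro inspected_boxes) auto
    also have "\<dots> = (\<Prod>i<Suc k. emeasure (step_law \<beta>) (A (Suc k - Suc i)))" by simp
    also have "\<dots> = (\<Prod>i<Suc k. emeasure (step_law \<beta>) (A i))"
      by (rule prod.nat_diff_reindex)
    finally show "emeasure (distr ?D ?P ?Z) (Pi\<^sub>E {..<Suc k} A) = (\<Prod>i<Suc k. emeasure (step_law \<beta>) (A i))" .
  qed simp
qed

definition passage :: "real \<Rightarrow> nat \<Rightarrow> real \<Rightarrow> ennreal" where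
  "passage \<beta> k u = (\<integral>\<^sup>+z. of_bool (first_passage k u z) \<partial>PiM {..<Suc k} (\<lambda>_. step_law \<beta>))"

lemma first_passage_PiM_measurable: "Measurable.pred (PiM {..<Suc k} (\<lambda>_. borel)) (first_passage k u)"
  by (rule first_passage_measurable) (auto intro!: measurable_component_singleton)

lemma passage_eq:
  assumes \<beta>: "0 \<le> \<beta>"
  shows "passage \<beta> k u = (\<integral>\<^sup>+w. ennreal (exp (- \<beta> * inspection (Suc k) w)) *
    of_bool ((\<forall>j\<in>{1..k}. Y (inspection j w) w \<le> u) \<and> u < Y (inspection (Suc k) w) w) \<partial>M)"
proof -
  let ?Z = "\<lambda>w. \<lambda>i\<in>{..<Suc k}. inspected_increment (Suc k - i) w"
  have Z: "?Z \<in> measurable M (PiM {..<Suc k} (\<lambda>_. borel))" by (intro measurable_restrict) simp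
  note [measurable] = first_passage_PiM_measurable
  have "passage \<beta> k u = (\<integral>\<^sup>+w. ennreal (exp (- \<beta> * inspection (Suc k) w)) * of_bool (first_passage k u (?Z w)) \<partial>M)"
    unfolding passage_def step_walk_law[OF \<beta>, symmetric] using Z
    by (subst nn_integral_distr) (auto simp: nn_integral_density)
  also have "\<dots> = (\<integral>\<^sup>+w. ennreal (exp (- \<beta> * inspection (Suc k) w)) *
    of_bool ((\<forall>j\<in>{1..k}. Y (inspection j w) w \<le> u) \<and> u < Y (inspection (Suc k) w) w) \<partial>M)"
  proof (rule nn_integral_cong)
    fix w assume w: "w \<in> space M"
    have "first_passage k u (?Z w) \<longleftrightarrow> first_passage k u (\<lambda>i. inspected_increment (Suc k - i) w)"
      by (rule first_passage_cong) simp
    then have "first_passage k u (?Z w) \<longleftrightarrow> (\<forall>j\<in>{1..k}. Y (inspection j w) w \<le> u) \<and> u < Y (inspection (Suc k) w) w"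
      unfolding first_passage_reversed[of k u "\<lambda>m. inspected_increment m w"] sum_inspected_increment[OF w] .
    then show "ennreal (exp (- \<beta> * inspection (Suc k) w)) * of_bool (first_passage k u (?Z w)) = ennreal (exp (- \<beta> * inspection (Suc k) w)) *
        of_bool ((\<forall>j\<in>{1..k}. Y (inspection j w) w \<le> u) \<and> u < Y (inspection (Suc k) w) w)" by simp
  qed
  finally show ?thesis .
qed

lemma step_component_measurable: "i \<in> I \<Longrightarrow> (\<lambda>z. z i) \<in> borel_measurable (PiM I (\<lambda>_. step_law \<beta>))"
  using measurable_component_singleton[of i I "\<lambda>_. step_law \<beta>"] measurable_cong_sets[OF refl sets_step_law] by blast

lemma passage_0: "0 \<le> \<beta> \<Longrightarrow> passage \<beta> 0 u = emeasure (step_law \<beta>) {u<..}"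
proof -
  assume "0 \<le> \<beta>"
  then interpret S: finite_measure "step_law \<beta>" by (rule finite_measure_step_law)
  interpret PS: product_sigma_finite "\<lambda>_. step_law \<beta>" ..
  have "passage \<beta> 0 u = (\<integral>\<^sup>+z. indicator {u<..} (z 0) \<partial>PiM {0} (\<lambda>_::nat. step_law \<beta>))"
    unfolding passage_def by (simp add: lessThan_Suc indicator_def of_bool_def)
  also have "\<dots> = (\<integral>\<^sup>+y. indicator {u<..} y \<partial>step_law \<beta>)" by (rule PS.product_nn_integral_singleton) simp
  finally show ?thesis by simp
qed

lemma passage_Suc:
  assumes \<beta>: "0 \<le> \<beta>"
  shows "passage \<beta> (Suc k) u = (\<integral>\<^sup>+y. of_bool (y \<le> u) * passage \<beta> k (u - y) \<partial>step_law \<beta>)"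
proof -
  interpret S: finite_measure "step_law \<beta>" by (rule finite_measure_step_law[OF \<beta>])
  interpret PS: product_sigma_finite "\<lambda>_. step_law \<beta>" ..
  let ?I = "{..<Suc k}"
  have fm: "Measurable.pred (PiM (insert (Suc k) ?I) (\<lambda>_. step_law \<beta>)) (first_passage (Suc k) u)"
    by (rule first_passage_measurable) (auto intro!: step_component_measurable)
  have fk: "Measurable.pred (PiM ?I (\<lambda>_. step_law \<beta>)) (first_passage k v)" for v
    by (rule first_passage_measurable) (auto intro!: step_component_measurable)
  have "passage \<beta> (Suc k) u = (\<integral>\<^sup>+z. of_bool (first_passage (Suc k) u z) \<partial>PiM (insert (Suc k) ?I) (\<lambda>_. step_law \<beta>))"
    unfolding passage_def lessThan_Suc[of "Suc k"] ..
  also have "\<dots> = (\<integral>\<^sup>+y. (\<integral>\<^sup>+z. of_bool (first_passage (Suc k) u (z(Suc k := y))) \<partial>PiM ?I (\<lambda>_. step_law \<beta>)) \<partial>step_law \<beta>)"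
  proof (rule PS.product_nn_integral_insert_rev)
    note fm [measurable]
    show "(\<lambda>z. of_bool (first_passage (Suc k) u z) :: ennreal) \<in> borel_measurable (PiM (insert (Suc k) ?I) (\<lambda>_. step_law \<beta>))"
      by measurable
  qed auto
  also have "\<dots> = (\<integral>\<^sup>+y. of_bool (y \<le> u) * passage \<beta> k (u - y) \<partial>step_law \<beta>)"
  proof (rule nn_integral_cong)
    fix y
    have eq: "of_bool (first_passage (Suc k) u (z(Suc k := y))) = (of_bool (y \<le> u) * of_bool (first_passage k (u - y) z) :: ennreal)" for z
      using first_passage_cong[of k "z(Suc k := y)" z "u - y"] by simp
    show "(\<integral>\<^sup>+z. of_bool (first_passage (Suc k) u (z(Suc k := y))) \<partial>PiM ?I (\<lambda>_. step_law \<beta>)) = of_bool (y \<le> u) * passage \<beta> k (u - y)"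
      unfolding eq passage_def using fk by (intro nn_integral_cmult) auto
  qed
  finally show ?thesis .
qed

lemma exceedance_set_measurable:
  "{(w, t) \<in> space (M \<Otimes>\<^sub>M exponential_law \<beta>). \<exists>n\<ge>1. inspection n w \<le> t \<and> u < Y (inspection n w) w} \<in> sets (M \<Otimes>\<^sub>M exponential_law \<beta>)"
proof -
  have "Measurable.pred (M \<Otimes>\<^sub>M exponential_law \<beta>) (\<lambda>p. \<exists>n\<in>{1..}. inspection n (fst p) \<le> snd p \<and> u < Y (inspection n (fst p)) (fst p))"
    by measurable
  then have "{p \<in> space (M \<Otimes>\<^sub>M exponential_law \<beta>). \<exists>n\<in>{1..}. inspection n (fst p) \<le> snd p \<and> u < Y (inspection n (fst p)) (fst p)} \<in> sets (M \<Otimes>\<^sub>M exponential_law \<beta>)"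
    by (simp add: pred_def)
  also have "{p \<in> space (M \<Otimes>\<^sub>M exponential_law \<beta>). \<exists>n\<in>{1..}. inspection n (fst p) \<le> snd p \<and> u < Y (inspection n (fst p)) (fst p)} =
     {(w, t) \<in> space (M \<Otimes>\<^sub>M exponential_law \<beta>). \<exists>n\<ge>1. inspection n w \<le> t \<and> u < Y (inspection n w) w}" by auto
  finally show ?thesis .
qed

text \<open>Inspection times are nondecreasing, so along a path the event occurs exactly when T is
  at least the first inspection time at which the level is exceeded, which has probability
  \<open>exp (- \<beta> * inspection (Suc N) w)\<close>. At most one summand is nonzero for each
  path.\<close>

lemma exceedance_eq_sum_passage:
  assumes \<beta>: "0 < \<beta>"
  shows "ennreal (exceedance_probability M Y \<Omega> u \<beta>) = (\<Sum>k. passage \<beta> k u)"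
proof -
  interpret E: prob_space "exponential_law \<beta>" using \<beta> by (rule prob_space_exponential_density)
  interpret P: pair_prob_space M "exponential_law \<beta>" ..
  let ?S = "{(w, t) \<in> space (M \<Otimes>\<^sub>M exponential_law \<beta>). \<exists>n\<ge>1. inspection n w \<le> t \<and> u < Y (inspection n w) w}"
  define f where "f k w = ennreal (exp (- \<beta> * inspection (Suc k) w)) *
    of_bool ((\<forall>j\<in>{1..k}. Y (inspection j w) w \<le> u) \<and> u < Y (inspection (Suc k) w) w)" for k w
  have fm: "f k \<in> borel_measurable M" for k unfolding f_def by measurable
  have "ennreal (exceedance_probability M Y \<Omega> u \<beta>) = emeasure (M \<Otimes>\<^sub>M exponential_law \<beta>) ?S"
    by (simp add: exceedance_probability_def with_exponential_time_def inspection_def P.emeasure_eq_measure)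
  also have "\<dots> = (\<integral>\<^sup>+w. emeasure (exponential_law \<beta>) (Pair w -` ?S) \<partial>M)"
    by (rule E.emeasure_pair_measure_alt[OF exceedance_set_measurable])
  also have "\<dots> = (\<integral>\<^sup>+w. (\<Sum>k. f k w) \<partial>M)"
  proof (rule nn_integral_cong)
    fix w assume w: "w \<in> space M"
    have S: "Pair w -` ?S = {t. \<exists>n\<ge>1. inspection n w \<le> t \<and> u < Y (inspection n w) w}" using w by (auto simp: space_pair_measure)
    show "emeasure (exponential_law \<beta>) (Pair w -` ?S) = (\<Sum>k. f k w)"
    proof (cases "\<exists>k. u < Y (inspection (Suc k) w) w")
      case False
      have "u < Y (inspection n w) w \<Longrightarrow> n = 0" for n using False by (cases n) auto
      then have empty: "Pair w -` ?S = {}" unfolding S by fastforce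
      have "f k w = 0" for k using False by (simp add: f_def)
      then show ?thesis unfolding empty by simp
    next
      case True
      define N where "N = (LEAST k. u < Y (inspection (Suc k) w) w)"
      have N: "u < Y (inspection (Suc N) w) w" using True unfolding N_def by (rule LeastI_ex)
      have below: "\<not> u < Y (inspection (Suc k) w) w" if "k < N" for k using that unfolding N_def by (rule not_less_Least)
      have below': "Y (inspection j w) w \<le> u" if "j \<in> {1..N}" for j
      proof -
        from that obtain i where i: "j = Suc i" "i < N" by (cases j) auto
        from below[OF i(2)] show ?thesis unfolding i(1) by simp
      qed
      have "Pair w -` ?S = {t. inspection (Suc N) w \<le> t}" unfolding S
      proof (intro set_eqI iffI)
        fix t assume "t \<in> {t. \<exists>n\<ge>1. inspection n w \<le> t \<and> u < Y (inspection n w) w}"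
        then obtain n where n: "n \<ge> 1" "inspection n w \<le> t" "u < Y (inspection n w) w" by blast
        have "Suc N \<le> n" using below'[of n] n by (cases "n \<le> N") auto
        then show "t \<in> {t. inspection (Suc N) w \<le> t}" using inspection_mono[OF w, of "Suc N" n] n by simp
      next
        fix t assume "t \<in> {t. inspection (Suc N) w \<le> t}"
        then show "t \<in> {t. \<exists>n\<ge>1. inspection n w \<le> t \<and> u < Y (inspection n w) w}" using N by (auto intro!: exI[of _ "Suc N"])
      qed
      then have "emeasure (exponential_law \<beta>) (Pair w -` ?S) = ennreal (exp (- \<beta> * inspection (Suc N) w))"
        using emeasure_exponential_law_ge[OF \<beta> inspection_nonneg[OF w]] by simp
      moreover have "f k w = (if k = N then ennreal (exp (- \<beta> * inspection (Suc N) w)) else 0)" for k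
      proof -
        consider "k < N" | "k = N" | "N < k" by linarith
        then show ?thesis
        proof cases
          case 1 then show ?thesis using below[of k] by (simp add: f_def)
        next
          case 2 then show ?thesis using below' N by (simp add: f_def)
        next
          case 3
          then have "Suc N \<in> {1..k}" by auto
          then have "\<not> (\<forall>j\<in>{1..k}. Y (inspection j w) w \<le> u)" using N by (meson not_le)
          then show ?thesis using 3 by (simp add: f_def)
        qed
      qed
      ultimately show ?thesis
        using suminf_finite[of "{N}" "\<lambda>k. if k = N then ennreal (exp (- \<beta> * inspection (Suc N) w)) else 0"] by simp
    qed
  qed
  also have "\<dots> = (\<Sum>k. \<integral>\<^sup>+w. f k w \<partial>M)" by (rule nn_integral_suminf[OF fm])
  also have "\<dots> = (\<Sum>k. passage \<beta> k u)" unfolding f_def using \<beta> by (simp add: passage_eq)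
  finally show ?thesis .
qed

lemma exceedance_antimono: "u \<le> v \<Longrightarrow> 0 < \<beta> \<Longrightarrow> exceedance_probability M Y \<Omega> v \<beta> \<le> exceedance_probability M Y \<Omega> u \<beta>"
proof -
  assume uv: "u \<le> v" and \<beta>: "0 < \<beta>"
  interpret W: prob_space "with_exponential_time M \<beta>" by (rule prob_space_with_exponential_time[OF \<beta>])
  show ?thesis
    unfolding exceedance_probability_def
  proof (rule W.finite_measure_mono)
    show "{(w, t) \<in> space (with_exponential_time M \<beta>). \<exists>n\<ge>1. (\<Sum>m = 1..n. \<Omega> m w) \<le> t \<and> u < Y (\<Sum>m = 1..n. \<Omega> m w) w} \<in> W.events"
      using exceedance_set_measurable[of \<beta> u] by (simp add: with_exponential_time_def inspection_def)
  qed (use uv in force)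
qed

lemma exceedance_measurable [measurable]:
  assumes \<beta>: "0 < \<beta>"
  shows "(\<lambda>u. exceedance_probability M Y \<Omega> u \<beta>) \<in> borel_measurable borel"
proof -
  have "mono (\<lambda>u. - exceedance_probability M Y \<Omega> u \<beta>)"
    by (rule monoI) (simp add: exceedance_antimono[OF _ \<beta>])
  from borel_measurable_uminus[OF borel_measurable_mono[OF this]] show ?thesis by simp
qed

lemma exceedance_bounds: "0 < \<beta> \<Longrightarrow> 0 \<le> exceedance_probability M Y \<Omega> u \<beta>" "0 < \<beta> \<Longrightarrow> exceedance_probability M Y \<Omega> u \<beta> \<le> 1"
  unfolding exceedance_probability_def using prob_space.prob_le_1[OF prob_space_with_exponential_time] by auto

text \<open>Decomposition at the first inspection: its increment y exceeds u, or the problem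
  restarts with the level u - y. Survival of T up to that inspection is already contained in
  \<open>step_law\<close>, and lack of memory makes the restart exact; here this is the recursion
  \<open>passage_Suc\<close> summed over k.\<close>

lemma renewal_equation:
  assumes \<beta>: "0 < \<beta>"
  shows "ennreal (exceedance_probability M Y \<Omega> u \<beta>) = emeasure (step_law \<beta>) {u<..} +
    (\<integral>\<^sup>+y. of_bool (y \<le> u) * ennreal (exceedance_probability M Y \<Omega> (u - y) \<beta>) \<partial>step_law \<beta>)"
proof -
  have \<beta>0: "0 \<le> \<beta>" using \<beta> by simp
  interpret S: finite_measure "step_law \<beta>" by (rule finite_measure_step_law[OF \<beta>0])
  interpret PS: product_sigma_finite "\<lambda>_. step_law \<beta>" ..
  have pm: "(\<lambda>y. passage \<beta> k (u - y)) \<in> borel_measurable (step_law \<beta>)" for k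
    unfolding passage_def
  proof -
    interpret PP: finite_product_sigma_finite "\<lambda>_. step_law \<beta>" "{..<Suc k}" by standard simp
    have "Measurable.pred (step_law \<beta> \<Otimes>\<^sub>M PiM {..<Suc k} (\<lambda>_. step_law \<beta>)) (\<lambda>x. first_passage k (u - fst x) (snd x))"
      by (rule first_passage_measurable) (auto intro!: measurable_compose[OF measurable_snd step_component_measurable])
    then show "(\<lambda>y. \<integral>\<^sup>+z. of_bool (first_passage k (u - y) z) \<partial>PiM {..<Suc k} (\<lambda>_. step_law \<beta>)) \<in> borel_measurable (step_law \<beta>)"
      by (intro PP.borel_measurable_nn_integral) (simp add: split_beta')
  qed
  have "ennreal (exceedance_probability M Y \<Omega> u \<beta>) = (\<Sum>k. passage \<beta> k u)" by (rule exceedance_eq_sum_passage[OF \<beta>])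
  also have "\<dots> = passage \<beta> 0 u + (\<Sum>k. passage \<beta> (Suc k) u)"
    using suminf_offset[of "\<lambda>k. passage \<beta> k u" 1] by simp
  also have "(\<Sum>k. passage \<beta> (Suc k) u) = (\<integral>\<^sup>+y. (\<Sum>k. of_bool (y \<le> u) * passage \<beta> k (u - y)) \<partial>step_law \<beta>)"
    unfolding passage_Suc[OF \<beta>0] using pm by (intro nn_integral_suminf[symmetric]) auto
  also have "\<dots> = (\<integral>\<^sup>+y. of_bool (y \<le> u) * ennreal (exceedance_probability M Y \<Omega> (u - y) \<beta>) \<partial>step_law \<beta>)"
    by (simp add: exceedance_eq_sum_passage[OF \<beta>])
  finally show ?thesis unfolding passage_0[OF \<beta>0] .
qed

end

section \<open>The transform of the renewal equation\<close>

lemma nn_integral_lborel_shift: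
  assumes [measurable]: "f \<in> borel_measurable borel"
  shows "(\<integral>\<^sup>+u. f (u + c) \<partial>lborel) = (\<integral>\<^sup>+v. f v \<partial>(lborel :: real measure))"
  using nn_integral_real_affine[of f 1 c] by (simp add: add.commute)

lemma has_real_derivative_exp_scaled:
  fixes c t x :: real
  shows "c \<noteq> 0 \<Longrightarrow> ((\<lambda>x. - t / c * exp (- c * x)) has_real_derivative t * exp (- c * x)) (at x)"
  by (auto intro!: derivative_eq_intros)

lemma nn_integral_exponential_law_upto:
  assumes \<theta>: "0 < \<theta>" and L: "0 \<le> L" and ne: "a \<noteq> \<theta>"
  shows "(\<integral>\<^sup>+x. of_bool (x \<le> L) * ennreal (exp (a * x)) \<partial>exponential_law \<theta>) = ennreal (\<theta> / (\<theta> - a) * (1 - exp (- (\<theta> - a) * L)))"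
proof -
  have "(\<integral>\<^sup>+x. of_bool (x \<le> L) * ennreal (exp (a * x)) \<partial>exponential_law \<theta>) =
      (\<integral>\<^sup>+x. ennreal (exponential_density \<theta> x) * (of_bool (x \<le> L) * ennreal (exp (a * x))) \<partial>lborel)"
    by (intro nn_integral_density) auto
  also have "\<dots> = (\<integral>\<^sup>+x. ennreal (\<theta> * exp (- (\<theta> - a) * x)) * indicator {0..L} x \<partial>lborel)"
  proof (rule nn_integral_cong)
    fix x :: real
    have "\<theta> * exp (- \<theta> * x) * exp (a * x) = \<theta> * exp (- (\<theta> - a) * x)"
      by (simp add: exp_add[symmetric] algebra_simps)
    then show "ennreal (exponential_density \<theta> x) * (of_bool (x \<le> L) * ennreal (exp (a * x))) = ennreal (\<theta> * exp (- (\<theta> - a) * x)) * indicator {0..L} x"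
      using \<theta> by (auto simp: exponential_density_def indicator_def ennreal_mult[symmetric] mult.commute)
  qed
  also have "\<dots> = ennreal (- \<theta> / (\<theta> - a) * exp (- (\<theta> - a) * L) - - \<theta> / (\<theta> - a) * exp (- (\<theta> - a) * 0))"
  proof (rule nn_integral_FTC_Icc)
    fix x
    show "((\<lambda>x. - \<theta> / (\<theta> - a) * exp (- (\<theta> - a) * x)) has_real_derivative \<theta> * exp (- (\<theta> - a) * x)) (at x)"
      by (rule has_real_derivative_exp_scaled) (use ne in simp)
  qed (use \<theta> L in auto)
  also have "- \<theta> / (\<theta> - a) * exp (- (\<theta> - a) * L) - - \<theta> / (\<theta> - a) * exp (- (\<theta> - a) * 0) = \<theta> / (\<theta> - a) * (1 - exp (- (\<theta> - a) * L))"
    by (simp add: algebra_simps)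
  finally show ?thesis .
qed

lemma emeasure_exponential_law_less:
  assumes \<theta>: "0 < \<theta>"
  shows "emeasure (exponential_law \<theta>) {x. x < L} = ennreal (if 0 \<le> L then 1 - exp (- \<theta> * L) else 0)"
proof (cases "0 \<le> L")
  case True
  interpret prob_space "exponential_law \<theta>" using \<theta> by (rule prob_space_exponential_density)
  have "{x. x < L} = space (exponential_law \<theta>) - {x. L \<le> x}" by auto
  then have "prob {x. x < L} = prob (space (exponential_law \<theta>) - {x. L \<le> x})" by (rule arg_cong)
  also have "\<dots> = 1 - prob {x. L \<le> x}" by (rule prob_compl) simp
  also have "prob {x. L \<le> x} = exp (- \<theta> * L)"
    using emeasure_exponential_law_ge[OF \<theta> True] by (simp add: emeasure_eq_measure)
  finally show ?thesis using True by (simp add: emeasure_eq_measure)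
next
  case False
  have "emeasure (exponential_law \<theta>) {x. x < L} = 0"
    using exponential_law_nonneg[of \<theta>] False
    by (subst AE_iff_measurable[symmetric, where P = "\<lambda>x. \<not> x < L"]) (auto elim!: eventually_mono)
  then show ?thesis using False by simp
qed

text \<open>The case of exceeding the level at once, when the supremum is s and the exponential part
  x is subtracted. The sign is recorded separately because \<open>ennreal\<close> sends negative
  reals to \<open>0\<close>, and equality of \<alpha> and \<theta> is excluded because the
  antiderivative changes its form there.\<close>

lemma level_transform_exponential:
  assumes \<theta>: "0 < \<theta>" and \<alpha>: "0 < \<alpha>" and ne: "\<alpha> \<noteq> \<theta>" and s: "0 \<le> s"
  shows "(\<integral>\<^sup>+u. indicator {0..} u * (ennreal (exp (- \<alpha> * u)) * emeasure (exponential_law \<theta>) {x. u < s - x}) \<partial>lborel)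
    = ennreal (1 / \<alpha> - \<theta> / (\<alpha> * (\<theta> - \<alpha>)) * exp (- \<alpha> * s) + exp (- \<theta> * s) / (\<theta> - \<alpha>))" (is ?transform)
    and "0 \<le> 1 / \<alpha> - \<theta> / (\<alpha> * (\<theta> - \<alpha>)) * exp (- \<alpha> * s) + exp (- \<theta> * s) / (\<theta> - \<alpha>)" (is "0 \<le> ?value")
proof -
  let ?F = "\<lambda>u. - exp (- \<alpha> * u) / \<alpha> - exp (- \<theta> * s) * exp ((\<theta> - \<alpha>) * u) / (\<theta> - \<alpha>)"
  have eq: "exp (- \<alpha> * u) * (1 - exp (- \<theta> * (s - u))) = exp (- \<alpha> * u) - exp (- \<theta> * s) * exp ((\<theta> - \<alpha>) * u)" for u
  proof -
    have "exp (- \<theta> * s) * exp ((\<theta> - \<alpha>) * u) = exp (- \<alpha> * u) * exp (- \<theta> * (s - u))"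
      by (simp add: exp_add[symmetric] algebra_simps)
    then show ?thesis by (simp add: right_diff_distrib)
  qed
  have deriv: "(?F has_real_derivative exp (- \<alpha> * u) * (1 - exp (- \<theta> * (s - u)))) (at u)" for u
    unfolding eq using ne \<alpha> by (auto intro!: derivative_eq_intros)
  have nonneg: "0 \<le> exp (- \<alpha> * u) * (1 - exp (- \<theta> * (s - u)))" if "u \<le> s" for u
    using \<theta> that by (intro mult_nonneg_nonneg) (auto simp: mult_nonneg_nonneg)
  have closed_form: "?F s - ?F 0 = ?value"
  proof -
    have "exp (- \<theta> * s) * exp ((\<theta> - \<alpha>) * s) = exp (- \<alpha> * s)" by (simp add: exp_add[symmetric] algebra_simps)
    moreover have "- A / \<alpha> - A / (\<theta> - \<alpha>) - (- 1 / \<alpha> - B * 1 / (\<theta> - \<alpha>)) = 1 / \<alpha> - \<theta> / (\<alpha> * (\<theta> - \<alpha>)) * A + B / (\<theta> - \<alpha>)" for A B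
      using \<alpha> ne by (simp add: field_simps)
    ultimately show ?thesis by simp
  qed
  have "?F 0 \<le> ?F s" by (rule DERIV_nonneg_imp_nondecreasing[OF s]) (use deriv nonneg in blast)
  then show "0 \<le> ?value" using closed_form by simp
  have set: "{x. u < s - x} = {x. x < s - u}" for u by auto
  have "(\<integral>\<^sup>+u. indicator {0..} u * (ennreal (exp (- \<alpha> * u)) * emeasure (exponential_law \<theta>) {x. u < s - x}) \<partial>lborel) =
      (\<integral>\<^sup>+u. ennreal (exp (- \<alpha> * u) * (1 - exp (- \<theta> * (s - u)))) * indicator {0..s} u \<partial>lborel)"
    unfolding set emeasure_exponential_law_less[OF \<theta>]
    by (intro nn_integral_cong) (auto simp: indicator_def ennreal_mult'[symmetric])
  also have "\<dots> = ennreal (?F s - ?F 0)"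
    by (rule nn_integral_FTC_Icc[where f = "\<lambda>u. exp (- \<alpha> * u) * (1 - exp (- \<theta> * (s - u)))"
          and F = ?F and a = 0 and b = s, OF _ deriv nonneg s]) auto
  finally show ?transform unfolding closed_form .
qed

definition level_transform :: "(real \<Rightarrow> real) \<Rightarrow> real \<Rightarrow> ennreal" where
  "level_transform P \<alpha> = (\<integral>\<^sup>+u. indicator {0..} u * (ennreal (exp (- \<alpha> * u)) * ennreal (P u)) \<partial>lborel)"

lemma level_transform_finite:
  assumes \<alpha>: "0 < \<alpha>" and P: "\<And>u. 0 \<le> P u" "\<And>u. P u \<le> 1"
  shows "level_transform P \<alpha> < \<infinity>"
proof -
  have "level_transform P \<alpha> \<le> (\<integral>\<^sup>+u. ennreal (1 / \<alpha>) * ennreal (exponential_density \<alpha> u) \<partial>lborel)"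
    unfolding level_transform_def
  proof (rule nn_integral_mono)
    fix u :: real
    have "ennreal (exp (- \<alpha> * u)) * ennreal (P u) \<le> ennreal (exp (- \<alpha> * u)) * 1"
      using P by (intro mult_left_mono) (auto simp: ennreal_le_1)
    then show "indicator {0..} u * (ennreal (exp (- \<alpha> * u)) * ennreal (P u)) \<le> ennreal (1 / \<alpha>) * ennreal (exponential_density \<alpha> u)"
      using \<alpha> by (auto simp: exponential_density_def indicator_def ennreal_mult[symmetric] mult.commute)
  qed
  also have "\<dots> = ennreal (1 / \<alpha>) * (\<integral>\<^sup>+u. ennreal (exponential_density \<alpha> u) \<partial>lborel)" by (intro nn_integral_cmult) auto
  also have "(\<integral>\<^sup>+u. ennreal (exponential_density \<alpha> u) \<partial>lborel) = emeasure (exponential_law \<alpha>) (space (exponential_law \<alpha>))"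
    by (simp add: emeasure_density)
  also have "\<dots> = 1" using prob_space.emeasure_space_1[OF prob_space_exponential_density[OF \<alpha>]] .
  finally show ?thesis by (simp add: le_less_trans)
qed

text \<open>After the substitution \<open>v = u - s + x\<close> the constraint \<open>u \<ge> 0\<close> reads \<open>x \<le> v + s\<close>, which
  truncates the exponential integral and produces the term in \<open>level_transform P \<theta>\<close>.\<close>

lemma level_transform_shift_exponential:
  assumes \<theta>: "0 < \<theta>" and \<alpha>: "0 < \<alpha>" and ne: "\<alpha> \<noteq> \<theta>" and s: "0 \<le> s"
    and P [measurable]: "P \<in> borel_measurable borel" and P01: "\<And>u. 0 \<le> P u" "\<And>u. P u \<le> 1"
  shows "(\<integral>\<^sup>+u. indicator {0..} u * (ennreal (exp (- \<alpha> * u)) * (\<integral>\<^sup>+x. of_bool (s - x \<le> u) * ennreal (P (u - (s - x))) \<partial>exponential_law \<theta>)) \<partial>lborel)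
    = ennreal (\<theta> / (\<theta> - \<alpha>) * (exp (- \<alpha> * s) * enn2real (level_transform P \<alpha>) - exp (- \<theta> * s) * enn2real (level_transform P \<theta>)))" (is ?transform)
    and "0 \<le> \<theta> / (\<theta> - \<alpha>) * (exp (- \<alpha> * s) * enn2real (level_transform P \<alpha>) - exp (- \<theta> * s) * enn2real (level_transform P \<theta>))" (is "0 \<le> ?value")
proof -
  interpret T: prob_space "exponential_law \<theta>" using \<theta> by (rule prob_space_exponential_density)
  interpret LT: pair_sigma_finite lborel "exponential_law \<theta>"
    by (intro pair_sigma_finite.intro sigma_finite_lborel T.sigma_finite_measure_axioms)
  let ?f = "\<lambda>u x. indicator {0..} u * (ennreal (exp (- \<alpha> * u)) * (of_bool (s - x \<le> u) * ennreal (P (u - (s - x)))))"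
  let ?g = "\<lambda>x v. of_bool (x \<le> v + s) * (indicator {0..} v * (ennreal (exp (- \<alpha> * (v + (s - x)))) * ennreal (P v)))"
  define p where "p a v = indicator {0..} v * (exp (- a * v) * P v)" for a v :: real
  have p_nn: "(\<integral>\<^sup>+v. ennreal (p a v) \<partial>lborel) = level_transform P a" for a
    unfolding level_transform_def p_def using P01
    by (intro nn_integral_cong) (auto simp: indicator_def ennreal_mult)
  have p0: "0 \<le> p a v" for a v using P01 by (simp add: p_def)
  have pm [measurable]: "p a \<in> borel_measurable lborel" for a unfolding p_def by measurable
  have p_int: "integrable lborel (p a)" and p_eq: "(\<integral>v. p a v \<partial>lborel) = enn2real (level_transform P a)" if "0 < a" for a
  proof -
    show "integrable lborel (p a)"
      using level_transform_finite[OF that P01] p0 by (intro integrableI_nonneg) (auto simp: p_nn)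
    show "(\<integral>v. p a v \<partial>lborel) = enn2real (level_transform P a)"
      using p0 by (subst integral_eq_nn_integral) (auto simp: p_nn)
  qed
  let ?h = "\<lambda>v. \<theta> / (\<theta> - \<alpha>) * (exp (- \<alpha> * s) * p \<alpha> v - exp (- \<theta> * s) * p \<theta> v)"
  have h_int: "integrable lborel ?h" using p_int[OF \<alpha>] p_int[OF \<theta>] by simp
  have h0: "0 \<le> ?h v" for v
  proof (cases "0 \<le> v")
    case True
    have "?h v = \<theta> / (\<theta> - \<alpha>) * (exp (- \<alpha> * (s + v)) - exp (- \<theta> * (s + v))) * P v"
      using True by (simp add: p_def exp_add[symmetric] algebra_simps)
    also have "\<dots> \<ge> 0"
    proof (rule mult_nonneg_nonneg[OF _ P01(1)])
      show "0 \<le> \<theta> / (\<theta> - \<alpha>) * (exp (- \<alpha> * (s + v)) - exp (- \<theta> * (s + v)))"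
      \<comment> \<open>The prefactor and the difference of the exponentials change sign together,
        so the product is nonnegative in both cases.\<close>
      proof (cases "\<alpha> < \<theta>")
        case True
        then have "\<alpha> * (s + v) \<le> \<theta> * (s + v)" using s \<open>0 \<le> v\<close> by (intro mult_right_mono) auto
        then show ?thesis using True \<theta> by (intro mult_nonneg_nonneg divide_nonneg_nonneg) auto
      next
        case False
        with ne have less: "\<theta> < \<alpha>" by simp
        then have "\<theta> * (s + v) \<le> \<alpha> * (s + v)" using s \<open>0 \<le> v\<close> by (intro mult_right_mono) auto
        then show ?thesis using less \<theta> by (intro mult_nonpos_nonpos divide_nonneg_nonpos) auto
      qed
    qed
    finally show ?thesis .
  qed (simp add: p_def)
  have h_value: "(\<integral>v. ?h v \<partial>lborel) = ?value"
    using p_int[OF \<alpha>] p_int[OF \<theta>] by (simp add: p_eq[OF \<alpha>] p_eq[OF \<theta>])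
  show "0 \<le> ?value" unfolding h_value[symmetric] using h0 by (intro Bochner_Integration.integral_nonneg)
  have "(\<integral>\<^sup>+u. indicator {0..} u * (ennreal (exp (- \<alpha> * u)) * (\<integral>\<^sup>+x. of_bool (s - x \<le> u) * ennreal (P (u - (s - x))) \<partial>exponential_law \<theta>)) \<partial>lborel)
      = (\<integral>\<^sup>+u. (\<integral>\<^sup>+x. ?f u x \<partial>exponential_law \<theta>) \<partial>lborel)"
    by (subst nn_integral_cmult, measurable)+
  also have "\<dots> = (\<integral>\<^sup>+x. (\<integral>\<^sup>+u. ?f u x \<partial>lborel) \<partial>exponential_law \<theta>)"
    by (rule LT.Fubini'[symmetric]) measurable
  also have "\<dots> = (\<integral>\<^sup>+x. (\<integral>\<^sup>+v. ?g x v \<partial>lborel) \<partial>exponential_law \<theta>)"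
  proof (rule nn_integral_cong)
    fix x
    have "(\<integral>\<^sup>+u. ?f u x \<partial>lborel) = (\<integral>\<^sup>+u. ?g x (u + - (s - x)) \<partial>lborel)"
      by (intro nn_integral_cong) (auto simp: indicator_def algebra_simps)
    also have "\<dots> = (\<integral>\<^sup>+v. ?g x v \<partial>lborel)" by (rule nn_integral_lborel_shift) measurable
    finally show "(\<integral>\<^sup>+u. ?f u x \<partial>lborel) = (\<integral>\<^sup>+v. ?g x v \<partial>lborel)" .
  qed
  also have "\<dots> = (\<integral>\<^sup>+v. (\<integral>\<^sup>+x. ?g x v \<partial>exponential_law \<theta>) \<partial>lborel)"
    by (rule LT.Fubini') measurable
  also have "\<dots> = (\<integral>\<^sup>+v. indicator {0..} v * ennreal (\<theta> / (\<theta> - \<alpha>) * (exp (- \<alpha> * s) * exp (- \<alpha> * v) - exp (- \<theta> * s) * exp (- \<theta> * v)) * P v) \<partial>lborel)"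
  proof (rule nn_integral_cong)
    fix v :: real
    show "(\<integral>\<^sup>+x. ?g x v \<partial>exponential_law \<theta>) = indicator {0..} v * ennreal (\<theta> / (\<theta> - \<alpha>) * (exp (- \<alpha> * s) * exp (- \<alpha> * v) - exp (- \<theta> * s) * exp (- \<theta> * v)) * P v)"
    proof (cases "0 \<le> v")
      case True
      let ?c = "exp (- \<alpha> * (v + s)) * P v"
      have c: "0 \<le> ?c" using P01 by simp
      have "(\<integral>\<^sup>+x. ?g x v \<partial>exponential_law \<theta>) = (\<integral>\<^sup>+x. ennreal ?c * (of_bool (x \<le> v + s) * ennreal (exp (\<alpha> * x))) \<partial>exponential_law \<theta>)"
      proof (rule nn_integral_cong)
        fix x
        have "exp (- \<alpha> * (v + (s - x))) * P v = ?c * exp (\<alpha> * x)" by (simp add: exp_add[symmetric] algebra_simps)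
        then have "ennreal (exp (- \<alpha> * (v + (s - x)))) * ennreal (P v) = ennreal ?c * ennreal (exp (\<alpha> * x))"
          using P01 c by (simp add: ennreal_mult[symmetric])
        then show "?g x v = ennreal ?c * (of_bool (x \<le> v + s) * ennreal (exp (\<alpha> * x)))" using True by simp
      qed
      also have "\<dots> = ennreal ?c * (\<integral>\<^sup>+x. of_bool (x \<le> v + s) * ennreal (exp (\<alpha> * x)) \<partial>exponential_law \<theta>)"
        by (intro nn_integral_cmult) measurable
      also have "\<dots> = ennreal ?c * ennreal (\<theta> / (\<theta> - \<alpha>) * (1 - exp (- (\<theta> - \<alpha>) * (v + s))))"
        using True s by (subst nn_integral_exponential_law_upto[OF \<theta> _ ne]) auto
      also have "\<dots> = ennreal (?c * (\<theta> / (\<theta> - \<alpha>) * (1 - exp (- (\<theta> - \<alpha>) * (v + s)))))"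
        by (rule ennreal_mult'[symmetric]) (rule c)
      also have "?c * (\<theta> / (\<theta> - \<alpha>) * (1 - exp (- (\<theta> - \<alpha>) * (v + s)))) = \<theta> / (\<theta> - \<alpha>) * (exp (- \<alpha> * s) * exp (- \<alpha> * v) - exp (- \<theta> * s) * exp (- \<theta> * v)) * P v"
      proof -
        have e1: "exp (- \<alpha> * (v + s)) = exp (- \<alpha> * s) * exp (- \<alpha> * v)" by (simp add: exp_add[symmetric] algebra_simps)
        have e2: "exp (- \<alpha> * (v + s)) * exp (- (\<theta> - \<alpha>) * (v + s)) = exp (- \<theta> * s) * exp (- \<theta> * v)" by (simp add: exp_add[symmetric] algebra_simps)
        have "?c * (\<theta> / (\<theta> - \<alpha>) * (1 - exp (- (\<theta> - \<alpha>) * (v + s)))) =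
          \<theta> / (\<theta> - \<alpha>) * (exp (- \<alpha> * (v + s)) - exp (- \<alpha> * (v + s)) * exp (- (\<theta> - \<alpha>) * (v + s))) * P v"
          by (simp add: algebra_simps)
        then show ?thesis unfolding e2 unfolding e1 .
      qed
      finally show ?thesis using True by simp
    qed simp
  qed
  also have "\<dots> = (\<integral>\<^sup>+v. ennreal (?h v) \<partial>lborel)"
      by (intro nn_integral_cong) (auto simp: indicator_def p_def algebra_simps)
  also have "\<dots> = ennreal (\<integral>v. ?h v \<partial>lborel)" using h_int h0 by (intro nn_integral_eq_integral) auto
  finally show ?transform unfolding h_value .
qed

section \<open>Hyperexponential gaps\<close>

locale hyperexponential_inspection = inspected_levy_process M Y \<Omega>
  for M :: "'a measure" and Y :: "real \<Rightarrow> 'a \<Rightarrow> real" and \<Omega> :: "nat \<Rightarrow> 'a \<Rightarrow> real" +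
  fixes d :: nat and \<omega> p :: "nat \<Rightarrow> real" and \<beta> :: real
  assumes \<omega>_pos: "i \<in> {1..d} \<Longrightarrow> 0 < \<omega> i" and p_pos: "i \<in> {1..d} \<Longrightarrow> 0 < p i"
    and p_sum: "(\<Sum>i=1..d. p i) = 1"
    and distributed_gap: "distributed M lborel (\<Omega> 1) (hyperexponential_density d \<omega> p)"
    and \<beta>_pos: "0 < \<beta>"
begin

abbreviation rate :: "nat \<Rightarrow> real" where "rate i \<equiv> \<beta> + \<omega> i"

abbreviation exceedance :: "real \<Rightarrow> real" where
  "exceedance u \<equiv> exceedance_probability M Y \<Omega> u \<beta>"

text \<open>An infinite transform would be sent to \<open>0\<close> by \<open>enn2real\<close>; at
  positive \<alpha> this is excluded by \<open>exceedance_transform_finite\<close>.\<close>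

definition transform :: "real \<Rightarrow> real" where
  "transform \<alpha> = enn2real (exceedance_transform M Y \<Omega> \<alpha> \<beta>)"

lemma rate_pos: "i \<in> {1..d} \<Longrightarrow> 0 < rate i"
  using \<omega>_pos[of i] \<beta>_pos by simp

lemma weight_nonneg: "i \<in> {1..d} \<Longrightarrow> 0 \<le> p i * (\<omega> i / rate i)"
  by (intro mult_nonneg_nonneg divide_nonneg_nonneg less_imp_le[OF \<omega>_pos] less_imp_le[OF p_pos] less_imp_le[OF rate_pos])

lemma exceedance_transform_eq: "exceedance_transform M Y \<Omega> \<alpha> \<beta> = level_transform exceedance \<alpha>"
  unfolding exceedance_transform_def level_transform_def
  using exceedance_bounds[OF \<beta>_pos] by (intro nn_integral_cong) (simp add: ennreal_mult mult.commute)

lemma exceedance_transform_finite: "0 < \<alpha> \<Longrightarrow> exceedance_transform M Y \<Omega> \<alpha> \<beta> < \<infinity>"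
  unfolding exceedance_transform_eq using exceedance_bounds[OF \<beta>_pos] by (intro level_transform_finite)

lemma gap_law_eq: "gap_law = density lborel (\<lambda>x. ennreal (hyperexponential_density d \<omega> p x))"
proof -
  have "gap_law = distr M lborel (\<Omega> 1)" unfolding gap_law_def by (rule distr_cong) auto
  also have "\<dots> = density lborel (\<lambda>x. ennreal (hyperexponential_density d \<omega> p x))"
    using distributed_gap unfolding distributed_def by blast
  finally show ?thesis .
qed

lemma nn_integral_end_law:
  assumes q: "0 < q" and f: "f \<in> borel_measurable borel"
  shows "(\<integral>\<^sup>+y. f y \<partial>end_law q) = (\<integral>\<^sup>+t. (\<integral>\<^sup>+w. f (Y (max 0 t) w) \<partial>M) \<partial>exponential_law q)"
proof -
  interpret Q: prob_space "exponential_law q" using q by (rule prob_space_exponential_density)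
  interpret P: pair_prob_space M "exponential_law q" ..
  have m: "(\<lambda>p. f (Y (max 0 (snd p)) (fst p))) \<in> borel_measurable (M \<Otimes>\<^sub>M exponential_law q)"
    using measurable_compose[OF Y_time_measurable f] by (simp add: split_beta)
  have "(\<integral>\<^sup>+y. f y \<partial>end_law q) = (\<integral>\<^sup>+p. f (Y (max 0 (snd p)) (fst p)) \<partial>(M \<Otimes>\<^sub>M exponential_law q))"
    unfolding end_law_def with_exponential_time_def using f
    by (subst nn_integral_distr[OF Y_time_measurable]) (auto simp: split_beta)
  also have "\<dots> = (\<integral>\<^sup>+t. (\<integral>\<^sup>+w. f (Y (max 0 t) w) \<partial>M) \<partial>exponential_law q)"
    using P.nn_integral_snd[OF m] by simp
  finally show ?thesis .
qed

text \<open>Multiplying an exponential density of rate \<open>\<omega> i\<close> by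
  \<open>exp (- \<beta> * x)\<close> gives \<omega> i/(\<beta> + \<omega> i) times the exponential
  density of rate \<open>rate i\<close>, so discounting preserves the mixture form. The densities
  disagree at \<open>0\<close>, a null set.\<close>

lemma nn_integral_step_law_mixture:
  assumes f: "f \<in> borel_measurable borel"
  shows "(\<integral>\<^sup>+y. f y \<partial>step_law \<beta>) = (\<Sum>i=1..d. ennreal (p i * (\<omega> i / rate i)) * (\<integral>\<^sup>+y. f y \<partial>end_law (rate i)))"
proof -
  define g where "g x = (\<integral>\<^sup>+w. f (Y (max 0 x) w) \<partial>M)" for x
  have g[measurable]: "g \<in> borel_measurable borel"
  proof -
    have "(\<lambda>x. f (Y (max 0 (fst x)) (snd x))) \<in> borel_measurable (borel \<Otimes>\<^sub>M M)"
      by (rule measurable_compose[OF Y_compose_measurable f]) auto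
    then show ?thesis unfolding g_def by (intro borel_measurable_nn_integral) (simp add: split_beta')
  qed
  have hm[measurable]: "hyperexponential_density d \<omega> p \<in> borel_measurable borel"
    unfolding hyperexponential_density_def[abs_def] by measurable
  have "(\<integral>\<^sup>+y. f y \<partial>step_law \<beta>) = (\<integral>\<^sup>+x. ennreal (exp (- \<beta> * x)) * g x \<partial>gap_law)"
    unfolding g_def by (rule nn_integral_step_law[OF f])
  also have "\<dots> = (\<integral>\<^sup>+x. ennreal (hyperexponential_density d \<omega> p x) * (ennreal (exp (- \<beta> * x)) * g x) \<partial>lborel)"
    unfolding gap_law_eq by (intro nn_integral_density) auto
  also have "\<dots> = (\<integral>\<^sup>+x. (\<Sum>i=1..d. ennreal (p i * (\<omega> i / rate i)) * (ennreal (exponential_density (rate i) x) * g x)) \<partial>lborel)"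
  proof (rule nn_integral_cong_AE)
    show "AE x in lborel. ennreal (hyperexponential_density d \<omega> p x) * (ennreal (exp (- \<beta> * x)) * g x) =
        (\<Sum>i=1..d. ennreal (p i * (\<omega> i / rate i)) * (ennreal (exponential_density (rate i) x) * g x))"
      using AE_lborel_singleton[of "0 :: real"]
    proof eventually_elim
      case (elim x)
      show ?case
      proof (cases "0 < x")
        case True
        have "ennreal (hyperexponential_density d \<omega> p x) * ennreal (exp (- \<beta> * x)) = ennreal (\<Sum>i=1..d. p i * \<omega> i * exp (- \<omega> i * x) * exp (- \<beta> * x))"
        proof -
          have nn: "0 \<le> (\<Sum>i=1..d. p i * \<omega> i * exp (- \<omega> i * x))"
            by (intro sum_nonneg mult_nonneg_nonneg less_imp_le[OF \<omega>_pos] less_imp_le[OF p_pos]) auto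
          show ?thesis
            unfolding hyperexponential_density_def sum_distrib_right[symmetric] using True by (simp only: if_True ennreal_mult'[OF nn])
        qed
        also have "(\<Sum>i=1..d. p i * \<omega> i * exp (- \<omega> i * x) * exp (- \<beta> * x)) = (\<Sum>i=1..d. p i * (\<omega> i / rate i) * exponential_density (rate i) x)"
        proof (rule sum.cong[OF refl])
          fix i assume i: "i \<in> {1..d}"
          have e: "exp (- \<omega> i * x) * exp (- \<beta> * x) = exp (- x * rate i)"
            by (simp only: exp_add[symmetric]) (simp add: algebra_simps)
          have ed: "exponential_density (rate i) x = rate i * exp (- x * rate i)"
            using True by (simp add: exponential_density_def)
          have r: "rate i \<noteq> 0" using rate_pos[OF i] by simp
          have "p i * \<omega> i * exp (- \<omega> i * x) * exp (- \<beta> * x) = p i * \<omega> i * exp (- x * rate i)"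
            unfolding e[symmetric] by (simp only: mult.assoc)
          also have "\<dots> = p i * (\<omega> i / rate i) * exponential_density (rate i) x" unfolding ed using r by simp
          finally show "p i * \<omega> i * exp (- \<omega> i * x) * exp (- \<beta> * x) = p i * (\<omega> i / rate i) * exponential_density (rate i) x" .
        qed
        also have "ennreal \<dots> = (\<Sum>i=1..d. ennreal (p i * (\<omega> i / rate i) * exponential_density (rate i) x))"
          by (intro sum_ennreal[symmetric] mult_nonneg_nonneg[OF weight_nonneg exponential_density_nonneg[OF rate_pos]])
        also have "\<dots> = (\<Sum>i=1..d. ennreal (p i * (\<omega> i / rate i)) * ennreal (exponential_density (rate i) x))"
          by (intro sum.cong refl ennreal_mult' weight_nonneg)
        finally show ?thesis by (simp add: sum_distrib_right mult.assoc[symmetric])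
      next
        case False
        with elim have "x < 0" by simp
        then show ?thesis by (simp add: hyperexponential_density_def exponential_density_def)
      qed
    qed
  qed
  also have "\<dots> = (\<Sum>i=1..d. ennreal (p i * (\<omega> i / rate i)) * (\<integral>\<^sup>+x. ennreal (exponential_density (rate i) x) * g x \<partial>lborel))"
    by (subst nn_integral_sum) (auto simp: nn_integral_cmult)
  also have "\<dots> = (\<Sum>i=1..d. ennreal (p i * (\<omega> i / rate i)) * (\<integral>\<^sup>+y. f y \<partial>end_law (rate i)))"
  proof (rule sum.cong[OF refl])
    fix i assume "i \<in> {1..d}"
    then have "(\<integral>\<^sup>+y. f y \<partial>end_law (rate i)) = (\<integral>\<^sup>+x. g x \<partial>exponential_law (rate i))"
      unfolding g_def by (intro nn_integral_end_law rate_pos f)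
    also have "\<dots> = (\<integral>\<^sup>+x. ennreal (exponential_density (rate i) x) * g x \<partial>lborel)" by (intro nn_integral_density) auto
    finally show "ennreal (p i * (\<omega> i / rate i)) * (\<integral>\<^sup>+x. ennreal (exponential_density (rate i) x) * g x \<partial>lborel) =
        ennreal (p i * (\<omega> i / rate i)) * (\<integral>\<^sup>+y. f y \<partial>end_law (rate i))" by simp
  qed
  finally show ?thesis .
qed

lemma nn_integral_end_law_difference:
  assumes q: "0 < q" and f: "f \<in> borel_measurable borel"
  shows "(\<integral>\<^sup>+y. f y \<partial>end_law q) = (\<integral>\<^sup>+s. (\<integral>\<^sup>+x. f (s - x) \<partial>exponential_law (\<psi> q)) \<partial>sup_law q)"
proof -
  interpret T: prob_space "exponential_law (\<psi> q)" using right_inverse_pos[OF q] by (rule prob_space_exponential_density)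
  have [measurable_cong]: "sets (sup_law q) = sets borel" by (simp add: sup_law_def)
  note [measurable] = f
  have dm: "(\<lambda>(s, x). s - x) \<in> borel_measurable (sup_law q \<Otimes>\<^sub>M exponential_law (\<psi> q))" by measurable
  have "(\<integral>\<^sup>+y. f y \<partial>end_law q) = (\<integral>\<^sup>+z. f (fst z - snd z) \<partial>(sup_law q \<Otimes>\<^sub>M exponential_law (\<psi> q)))"
    unfolding end_law_eq[OF q] by (subst nn_integral_distr[OF dm]) (auto simp: split_beta)
  also have "\<dots> = (\<integral>\<^sup>+s. (\<integral>\<^sup>+x. f (fst (s, x) - snd (s, x)) \<partial>exponential_law (\<psi> q)) \<partial>sup_law q)"
    by (rule T.nn_integral_fst[symmetric]) measurable
  finally show ?thesis by simp
qed

text \<open>The contribution of one mixture component to the transformed renewal equation: the first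
  line is \<open>F\<close> and belongs to exceeding the level at once, the second belongs to the
  restart.\<close>

definition step_transform :: "real \<Rightarrow> real \<Rightarrow> real" where
  "step_transform q \<alpha> = (\<alpha> * xi M Y (\<psi> q) q - \<psi> q * xi M Y \<alpha> q) / (\<alpha> * (\<psi> q - \<alpha>)) + 1 / \<alpha> +
     \<psi> q / (\<psi> q - \<alpha>) * (xi M Y \<alpha> q * transform \<alpha> - xi M Y (\<psi> q) q * transform (\<psi> q))"

text \<open>Given the supremum s, the exponential part integrates to A s for exceeding the level at
  once and to B s for the restart. In both, s occurs only through
  \<open>exp (- \<alpha> * s)\<close> and \<open>exp (- \<psi> q * s)\<close>, so integrating
  against \<open>sup_law\<close> yields values of \<open>xi\<close> at \<alpha> and at \<psi>
  q.\<close>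

lemma level_transform_end_law:
  assumes q: "0 < q" and \<alpha>: "0 < \<alpha>" and ne: "\<alpha> \<noteq> \<psi> q"
  shows "(\<integral>\<^sup>+u. indicator {0..} u * (ennreal (exp (- \<alpha> * u)) *
      (\<integral>\<^sup>+y. indicator {u<..} y + of_bool (y \<le> u) * ennreal (exceedance (u - y)) \<partial>end_law q)) \<partial>lborel) = ennreal (step_transform q \<alpha>)"
    and "0 \<le> step_transform q \<alpha>"
proof -
  let ?\<theta> = "\<psi> q"
  have \<theta>: "0 < ?\<theta>" by (rule right_inverse_pos[OF q])
  interpret T: prob_space "exponential_law ?\<theta>" using \<theta> by (rule prob_space_exponential_density)
  interpret S: prob_space "sup_law q" by (rule prob_space_sup_law[OF q])
  interpret LS: pair_sigma_finite lborel "sup_law q"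
    by (intro pair_sigma_finite.intro sigma_finite_lborel S.sigma_finite_measure_axioms)
  have sS[measurable_cong]: "sets (sup_law q) = sets borel" by (simp add: sup_law_def)
  have Pm[measurable]: "exceedance \<in> borel_measurable borel" by (rule exceedance_measurable[OF \<beta>_pos])
  note P01 = exceedance_bounds[OF \<beta>_pos]
  define f where "f u y = indicator {u<..} y + of_bool (y \<le> u) * ennreal (exceedance (u - y))" for u y
  have f_alt: "f u y = (if u < y then 1 else ennreal (exceedance (u - y)))" for u y by (simp add: f_def)
  have fm[measurable]: "case_prod f \<in> borel_measurable (borel \<Otimes>\<^sub>M borel)" unfolding f_alt by measurable
  have fm1[measurable]: "f u \<in> borel_measurable borel" for u unfolding f_alt by measurable
  define A where "A s = 1 / \<alpha> - ?\<theta> / (\<alpha> * (?\<theta> - \<alpha>)) * exp (- \<alpha> * s) + exp (- ?\<theta> * s) / (?\<theta> - \<alpha>)" for s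
  define B where "B s = ?\<theta> / (?\<theta> - \<alpha>) * (exp (- \<alpha> * s) * transform \<alpha> - exp (- ?\<theta> * s) * transform ?\<theta>)" for s
  have transform_eq: "enn2real (level_transform exceedance a) = transform a" for a
    by (simp add: transform_def exceedance_transform_eq)
  have AB: "(\<integral>\<^sup>+u. indicator {0..} u * (ennreal (exp (- \<alpha> * u)) * (\<integral>\<^sup>+x. f u (s - x) \<partial>exponential_law ?\<theta>)) \<partial>lborel) = ennreal (A s + B s)"
    and AB0: "0 \<le> A s + B s" if s: "0 \<le> s" for s
  proof -
    note lA = level_transform_exponential[OF \<theta> \<alpha> ne s]
    note lB = level_transform_shift_exponential[OF \<theta> \<alpha> ne s Pm P01, unfolded transform_eq]
    show "0 \<le> A s + B s" using lA(2) lB(2) by (simp add: A_def B_def)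
    have split: "(\<integral>\<^sup>+x. f u (s - x) \<partial>exponential_law ?\<theta>) = emeasure (exponential_law ?\<theta>) {x. u < s - x} + (\<integral>\<^sup>+x. of_bool (s - x \<le> u) * ennreal (exceedance (u - (s - x))) \<partial>exponential_law ?\<theta>)" for u
    proof -
      have "(\<integral>\<^sup>+x. f u (s - x) \<partial>exponential_law ?\<theta>) = (\<integral>\<^sup>+x. indicator {x. u < s - x} x + of_bool (s - x \<le> u) * ennreal (exceedance (u - (s - x))) \<partial>exponential_law ?\<theta>)"
        by (intro nn_integral_cong) (auto simp: f_def indicator_def)
      also have "\<dots> = (\<integral>\<^sup>+x. indicator {x. u < s - x} x \<partial>exponential_law ?\<theta>) + (\<integral>\<^sup>+x. of_bool (s - x \<le> u) * ennreal (exceedance (u - (s - x))) \<partial>exponential_law ?\<theta>)"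
        by (intro nn_integral_add) measurable
      also have "(\<integral>\<^sup>+x. indicator {x. u < s - x} x \<partial>exponential_law ?\<theta>) = emeasure (exponential_law ?\<theta>) {x. u < s - x}"
        by (intro nn_integral_indicator) measurable
      finally show ?thesis .
    qed
    have "(\<integral>\<^sup>+u. indicator {0..} u * (ennreal (exp (- \<alpha> * u)) * (\<integral>\<^sup>+x. f u (s - x) \<partial>exponential_law ?\<theta>)) \<partial>lborel) =
        (\<integral>\<^sup>+u. indicator {0..} u * (ennreal (exp (- \<alpha> * u)) * emeasure (exponential_law ?\<theta>) {x. u < s - x}) +
          indicator {0..} u * (ennreal (exp (- \<alpha> * u)) * (\<integral>\<^sup>+x. of_bool (s - x \<le> u) * ennreal (exceedance (u - (s - x))) \<partial>exponential_law ?\<theta>)) \<partial>lborel)"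
      unfolding split by (simp only: distrib_left)
    also have "\<dots> = ennreal (A s) + ennreal (B s)"
    proof -
      have "(\<lambda>u. \<integral>\<^sup>+x. indicator {0<..} (s - x - u) \<partial>exponential_law ?\<theta>) \<in> borel_measurable lborel" by measurable
      moreover have "(\<integral>\<^sup>+x. indicator {0<..} (s - x - u) \<partial>exponential_law ?\<theta>) = emeasure (exponential_law ?\<theta>) {x. u < s - x}" for u
      proof -
        have "(\<integral>\<^sup>+x. indicator {0<..} (s - x - u) \<partial>exponential_law ?\<theta>) = (\<integral>\<^sup>+x. indicator {x. u < s - x} x \<partial>exponential_law ?\<theta>)"
          by (intro nn_integral_cong) (auto simp: indicator_def)
        also have "\<dots> = emeasure (exponential_law ?\<theta>) {x. u < s - x}" by (intro nn_integral_indicator) measurable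
        finally show ?thesis .
      qed
      ultimately have [measurable]: "(\<lambda>u. emeasure (exponential_law ?\<theta>) {x. u < s - x}) \<in> borel_measurable lborel" by simp
      show ?thesis unfolding A_def B_def lA(1)[symmetric] lB(1)[symmetric] by (intro nn_integral_add) measurable
    qed
    also have "\<dots> = ennreal (A s + B s)" using lA(2) lB(2) by (intro ennreal_plus[symmetric]) (simp_all add: A_def B_def)
    finally show "(\<integral>\<^sup>+u. indicator {0..} u * (ennreal (exp (- \<alpha> * u)) * (\<integral>\<^sup>+x. f u (s - x) \<partial>exponential_law ?\<theta>)) \<partial>lborel) = ennreal (A s + B s)" .
  qed
  have exp_int: "integrable (sup_law q) (\<lambda>s. exp (- a * s))" if "0 \<le> a" for a
    using sup_law_nonneg[OF q] that by (intro S.integrable_const_bound[of _ 1]) (auto elim!: eventually_mono)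
  have xi: "(\<integral>s. exp (- a * s) \<partial>sup_law q) = xi M Y a q" for a
    using xi_eq_sup_law[OF q, of a] by simp
  have AB_int: "integrable (sup_law q) (\<lambda>s. A s + B s)"
    unfolding A_def B_def using exp_int[of \<alpha>] exp_int[of ?\<theta>] \<alpha> \<theta> by simp
  have AB_value: "(\<integral>s. A s + B s \<partial>sup_law q) = step_transform q \<alpha>"
  proof -
    have "(\<integral>s. A s + B s \<partial>sup_law q) = 1 / \<alpha> - ?\<theta> / (\<alpha> * (?\<theta> - \<alpha>)) * xi M Y \<alpha> q + xi M Y ?\<theta> q / (?\<theta> - \<alpha>) +
        ?\<theta> / (?\<theta> - \<alpha>) * (xi M Y \<alpha> q * transform \<alpha> - xi M Y ?\<theta> q * transform ?\<theta>)"
      unfolding A_def B_def xi[symmetric] using exp_int[of \<alpha>] exp_int[of ?\<theta>] \<alpha> \<theta> by (simp add: S.prob_space)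
    also have "\<dots> = step_transform q \<alpha>"
      unfolding step_transform_def using ne \<alpha> by (simp add: diff_divide_distrib)
    finally show ?thesis .
  qed
  have AB_AE: "AE s in sup_law q. 0 \<le> A s + B s" using sup_law_nonneg[OF q] by eventually_elim (rule AB0)
  then show "0 \<le> step_transform q \<alpha>" unfolding AB_value[symmetric] by (rule integral_nonneg_AE)
  have "(\<integral>\<^sup>+u. indicator {0..} u * (ennreal (exp (- \<alpha> * u)) * (\<integral>\<^sup>+y. f u y \<partial>end_law q)) \<partial>lborel) =
      (\<integral>\<^sup>+u. (\<integral>\<^sup>+s. indicator {0..} u * (ennreal (exp (- \<alpha> * u)) * (\<integral>\<^sup>+x. f u (s - x) \<partial>exponential_law ?\<theta>)) \<partial>sup_law q) \<partial>lborel)"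
  proof (rule nn_integral_cong)
    fix u
    have m: "(\<lambda>s. \<integral>\<^sup>+x. f u (s - x) \<partial>exponential_law ?\<theta>) \<in> borel_measurable (sup_law q)" by measurable
    have "(\<integral>\<^sup>+s. indicator {0..} u * (ennreal (exp (- \<alpha> * u)) * (\<integral>\<^sup>+x. f u (s - x) \<partial>exponential_law ?\<theta>)) \<partial>sup_law q) =
        indicator {0..} u * (ennreal (exp (- \<alpha> * u)) * (\<integral>\<^sup>+s. (\<integral>\<^sup>+x. f u (s - x) \<partial>exponential_law ?\<theta>) \<partial>sup_law q))"
      using m by (simp add: nn_integral_cmult)
    then show "indicator {0..} u * (ennreal (exp (- \<alpha> * u)) * (\<integral>\<^sup>+y. f u y \<partial>end_law q)) =
        (\<integral>\<^sup>+s. indicator {0..} u * (ennreal (exp (- \<alpha> * u)) * (\<integral>\<^sup>+x. f u (s - x) \<partial>exponential_law ?\<theta>)) \<partial>sup_law q)"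
      by (simp add: nn_integral_end_law_difference[OF q fm1])
  qed
  also have "\<dots> = (\<integral>\<^sup>+s. (\<integral>\<^sup>+u. indicator {0..} u * (ennreal (exp (- \<alpha> * u)) * (\<integral>\<^sup>+x. f u (s - x) \<partial>exponential_law ?\<theta>)) \<partial>lborel) \<partial>sup_law q)"
    by (rule LS.Fubini'[symmetric]) measurable
  also have "\<dots> = (\<integral>\<^sup>+s. ennreal (A s + B s) \<partial>sup_law q)"
  proof (rule nn_integral_cong_AE)
    show "AE s in sup_law q. (\<integral>\<^sup>+u. indicator {0..} u * (ennreal (exp (- \<alpha> * u)) * (\<integral>\<^sup>+x. f u (s - x) \<partial>exponential_law ?\<theta>)) \<partial>lborel) = ennreal (A s + B s)"
      using sup_law_nonneg[OF q] by eventually_elim (rule AB)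
  qed
  also have "\<dots> = ennreal (step_transform q \<alpha>)"
    unfolding AB_value[symmetric] using AB_int AB_AE by (intro nn_integral_eq_integral)
  finally show "(\<integral>\<^sup>+u. indicator {0..} u * (ennreal (exp (- \<alpha> * u)) *
      (\<integral>\<^sup>+y. indicator {u<..} y + of_bool (y \<le> u) * ennreal (exceedance (u - y)) \<partial>end_law q)) \<partial>lborel) = ennreal (step_transform q \<alpha>)"
    unfolding f_def .
qed

lemma transform_eq_mixture:
  assumes \<alpha>: "0 < \<alpha>" and ne: "\<And>i. i \<in> {1..d} \<Longrightarrow> \<alpha> \<noteq> \<psi> (rate i)"
  shows "transform \<alpha> = (\<Sum>i=1..d. p i * (\<omega> i / rate i) * step_transform (rate i) \<alpha>)"
proof -
  have Pm[measurable]: "exceedance \<in> borel_measurable borel" by (rule exceedance_measurable[OF \<beta>_pos])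
  let ?f = "\<lambda>u y. indicator {u<..} y + of_bool (y \<le> u) * ennreal (exceedance (u - y))"
  let ?c = "\<lambda>i. p i * (\<omega> i / rate i)"
  have fm: "?f u \<in> borel_measurable borel" for u by measurable
  have P: "ennreal (exceedance u) = (\<Sum>i=1..d. ennreal (?c i) * (\<integral>\<^sup>+y. ?f u y \<partial>end_law (rate i)))" for u
  proof -
    have "ennreal (exceedance u) = (\<integral>\<^sup>+y. indicator {u<..} y \<partial>step_law \<beta>) + (\<integral>\<^sup>+y. of_bool (y \<le> u) * ennreal (exceedance (u - y)) \<partial>step_law \<beta>)"
      using renewal_equation[OF \<beta>_pos, of u] by simp
    also have "\<dots> = (\<integral>\<^sup>+y. ?f u y \<partial>step_law \<beta>)" by (intro nn_integral_add[symmetric]) measurable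
    also have "\<dots> = (\<Sum>i=1..d. ennreal (?c i) * (\<integral>\<^sup>+y. ?f u y \<partial>end_law (rate i)))" by (rule nn_integral_step_law_mixture[OF fm])
    finally show ?thesis .
  qed
  have gm: "(\<lambda>u. \<integral>\<^sup>+y. ?f u y \<partial>end_law (rate i)) \<in> borel_measurable borel" if i: "i \<in> {1..d}" for i
  proof -
    interpret N: prob_space "end_law (rate i)" by (rule prob_space_end_law[OF rate_pos[OF i]])
    have [measurable_cong]: "sets (end_law (rate i)) = sets borel" by (simp add: end_law_def)
    have "(\<lambda>(u, y). if u < y then 1 else ennreal (exceedance (u - y))) \<in> borel_measurable (borel \<Otimes>\<^sub>M end_law (rate i))" by measurable
    then have "(\<lambda>u. \<integral>\<^sup>+y. (if u < y then 1 else ennreal (exceedance (u - y))) \<partial>end_law (rate i)) \<in> borel_measurable borel"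
      by (rule N.borel_measurable_nn_integral)
    moreover have "(if u < y then 1 else ennreal (exceedance (u - y))) = ?f u y" for u y by simp
    ultimately show ?thesis by (simp only:)
  qed
  have "exceedance_transform M Y \<Omega> \<alpha> \<beta> = (\<integral>\<^sup>+u. (\<Sum>i=1..d. ennreal (?c i) * (indicator {0..} u * (ennreal (exp (- \<alpha> * u)) * (\<integral>\<^sup>+y. ?f u y \<partial>end_law (rate i))))) \<partial>lborel)"
    unfolding exceedance_transform_eq level_transform_def
  proof (rule nn_integral_cong)
    fix u :: real
    have "indicator {0..} u * (ennreal (exp (- \<alpha> * u)) * ennreal (exceedance u)) =
        indicator {0..} u * (ennreal (exp (- \<alpha> * u)) * (\<Sum>i=1..d. ennreal (?c i) * (\<integral>\<^sup>+y. ?f u y \<partial>end_law (rate i))))"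
      by (rule arg_cong[OF P])
    also have "\<dots> = (\<Sum>i=1..d. ennreal (?c i) * (indicator {0..} u * (ennreal (exp (- \<alpha> * u)) * (\<integral>\<^sup>+y. ?f u y \<partial>end_law (rate i)))))"
      unfolding sum_distrib_left by (intro sum.cong refl) (simp only: mult.left_commute)
    finally show "indicator {0..} u * (ennreal (exp (- \<alpha> * u)) * ennreal (exceedance u)) =
        (\<Sum>i=1..d. ennreal (?c i) * (indicator {0..} u * (ennreal (exp (- \<alpha> * u)) * (\<integral>\<^sup>+y. ?f u y \<partial>end_law (rate i)))))" .
  qed
  also have "\<dots> = (\<Sum>i=1..d. ennreal (?c i) * (\<integral>\<^sup>+u. indicator {0..} u * (ennreal (exp (- \<alpha> * u)) * (\<integral>\<^sup>+y. ?f u y \<partial>end_law (rate i))) \<partial>lborel))"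
  proof (subst nn_integral_sum)
    fix i assume i: "i \<in> {1..d}"
    note [measurable] = gm[OF i]
    show "(\<lambda>u. ennreal (?c i) * (indicator {0..} u * (ennreal (exp (- \<alpha> * u)) * (\<integral>\<^sup>+y. ?f u y \<partial>end_law (rate i))))) \<in> borel_measurable lborel"
      by measurable
  next
    show "(\<Sum>i=1..d. \<integral>\<^sup>+u. ennreal (?c i) * (indicator {0..} u * (ennreal (exp (- \<alpha> * u)) * (\<integral>\<^sup>+y. ?f u y \<partial>end_law (rate i)))) \<partial>lborel) =
        (\<Sum>i=1..d. ennreal (?c i) * (\<integral>\<^sup>+u. indicator {0..} u * (ennreal (exp (- \<alpha> * u)) * (\<integral>\<^sup>+y. ?f u y \<partial>end_law (rate i))) \<partial>lborel))"
    proof (intro sum.cong refl nn_integral_cmult)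
      fix i assume i: "i \<in> {1..d}"
      note [measurable] = gm[OF i]
      show "(\<lambda>u. indicator {0..} u * (ennreal (exp (- \<alpha> * u)) * (\<integral>\<^sup>+y. ?f u y \<partial>end_law (rate i)))) \<in> borel_measurable lborel"
        by measurable
    qed
  qed
  also have "\<dots> = (\<Sum>i=1..d. ennreal (?c i) * ennreal (step_transform (rate i) \<alpha>))"
    by (intro sum.cong refl arg_cong2[where f="(*)"] level_transform_end_law(1) rate_pos \<alpha> ne)
  also have "\<dots> = (\<Sum>i=1..d. ennreal (?c i * step_transform (rate i) \<alpha>))"
    by (intro sum.cong refl ennreal_mult'[symmetric] weight_nonneg)
  also have "\<dots> = ennreal (\<Sum>i=1..d. ?c i * step_transform (rate i) \<alpha>)"
    by (intro sum_ennreal mult_nonneg_nonneg weight_nonneg level_transform_end_law(2) rate_pos \<alpha> ne)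
  finally have "transform \<alpha> = enn2real (ennreal (\<Sum>i=1..d. ?c i * step_transform (rate i) \<alpha>))" unfolding transform_def by simp
  also have "\<dots> = (\<Sum>i=1..d. ?c i * step_transform (rate i) \<alpha>)"
    by (intro enn2real_ennreal sum_nonneg mult_nonneg_nonneg weight_nonneg level_transform_end_law(2) rate_pos \<alpha> ne)
  finally show ?thesis .
qed

definition numerator :: "real \<Rightarrow> real" where
  "numerator \<alpha> = (\<Sum>i=1..d. p i * (\<omega> i / rate i) * (F M Y \<alpha> \<beta> (\<omega> i) - Gbar M Y \<alpha> \<beta> (\<omega> i) * transform (\<psi> (rate i))))"

definition denominator :: "real \<Rightarrow> real" where
  "denominator \<alpha> = 1 - (\<Sum>i=1..d. p i * (\<omega> i / (rate i - \<phi>\<^sub>r \<alpha>)))"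

text \<open>In \<open>step_transform\<close> the coefficient of \<open>transform \<alpha>\<close> is
  \<open>xi\<close> times \<theta>/(\<theta> - \<alpha>), which the formula for \<open>xi\<close>
  reduces to q/(q - \<phi> \<alpha>); the weight cancels the numerator and a summand of the
  denominator results. The product form remains valid where \<open>denominator\<close> vanishes, and
  this is what produces the linear equations.\<close>

theorem transform_identity:
  assumes \<alpha>: "0 < \<alpha>" and ne: "\<And>i. i \<in> {1..d} \<Longrightarrow> \<alpha> \<noteq> \<psi> (rate i)"
  shows "transform \<alpha> * denominator \<alpha> = numerator \<alpha>"
proof -
  have term_eq: "p i * (\<omega> i / rate i) * step_transform (rate i) \<alpha> =
      p i * (\<omega> i / rate i) * (F M Y \<alpha> \<beta> (\<omega> i) - Gbar M Y \<alpha> \<beta> (\<omega> i) * transform (\<psi> (rate i))) +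
      p i * (\<omega> i / (rate i - \<phi>\<^sub>r \<alpha>)) * transform \<alpha>" if i: "i \<in> {1..d}" for i
  proof -
    let ?q = "rate i" and ?\<theta> = "\<psi> (rate i)"
    have q: "0 < ?q" by (rule rate_pos[OF i])
    have \<theta>: "0 < ?\<theta>" by (rule right_inverse_pos[OF q])
    have phi: "\<phi>\<^sub>r \<alpha> \<noteq> ?q" using exponent_eq_iff[OF q less_imp_le[OF \<alpha>]] ne[OF i] by simp
    have "Q * (A - T) / ((f - Q) * T) * (T / (T - A)) = Q / (Q - f)" if "T \<noteq> 0" "A \<noteq> T" "f \<noteq> Q" for Q A T f :: real
    proof -
      have "Q * (A - T) / ((f - Q) * T) * (T / (T - A)) = (Q * (A - T)) / ((f - Q) * (T - A))" using that by simp
      also have "(f - Q) * (T - A) = (Q - f) * (A - T)" by (simp add: algebra_simps)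
      finally show ?thesis using that by simp
    qed
    from this[of ?\<theta> \<alpha> "\<phi>\<^sub>r \<alpha>" ?q] have xi: "xi M Y \<alpha> ?q * (?\<theta> / (?\<theta> - \<alpha>)) = ?q / (?q - \<phi>\<^sub>r \<alpha>)"
      using xi_real_eq[OF less_imp_le[OF \<alpha>] q ne[OF i]] \<theta> ne[OF i] phi by simp
    have "step_transform ?q \<alpha> = F M Y \<alpha> \<beta> (\<omega> i) - Gbar M Y \<alpha> \<beta> (\<omega> i) * transform ?\<theta> + xi M Y \<alpha> ?q * (?\<theta> / (?\<theta> - \<alpha>)) * transform \<alpha>"
      by (simp add: step_transform_def F_def Gbar_def Let_def algebra_simps)
    also have "\<dots> = F M Y \<alpha> \<beta> (\<omega> i) - Gbar M Y \<alpha> \<beta> (\<omega> i) * transform ?\<theta> + ?q / (?q - \<phi>\<^sub>r \<alpha>) * transform \<alpha>" unfolding xi ..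
    finally have "p i * (\<omega> i / ?q) * step_transform ?q \<alpha> = p i * (\<omega> i / ?q) * (F M Y \<alpha> \<beta> (\<omega> i) - Gbar M Y \<alpha> \<beta> (\<omega> i) * transform ?\<theta>) +
        p i * (\<omega> i / ?q) * (?q / (?q - \<phi>\<^sub>r \<alpha>) * transform \<alpha>)" by (simp only: distrib_left)
    also have "p i * (\<omega> i / ?q) * (?q / (?q - \<phi>\<^sub>r \<alpha>) * transform \<alpha>) = p i * (\<omega> i / (?q - \<phi>\<^sub>r \<alpha>)) * transform \<alpha>" using q by simp
    finally show ?thesis .
  qed
  have "transform \<alpha> = (\<Sum>i=1..d. p i * (\<omega> i / rate i) * step_transform (rate i) \<alpha>)"
    by (rule transform_eq_mixture[OF \<alpha> ne])
  also have "\<dots> = (\<Sum>i=1..d. p i * (\<omega> i / rate i) * (F M Y \<alpha> \<beta> (\<omega> i) - Gbar M Y \<alpha> \<beta> (\<omega> i) * transform (\<psi> (rate i))) +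
      p i * (\<omega> i / (rate i - \<phi>\<^sub>r \<alpha>)) * transform \<alpha>)"
    by (intro sum.cong refl term_eq)
  also have "\<dots> = numerator \<alpha> + (\<Sum>i=1..d. p i * (\<omega> i / (rate i - \<phi>\<^sub>r \<alpha>))) * transform \<alpha>"
    unfolding numerator_def sum_distrib_right sum.distrib[symmetric] ..
  finally have "transform \<alpha> = numerator \<alpha> + (\<Sum>i=1..d. p i * (\<omega> i / (rate i - \<phi>\<^sub>r \<alpha>))) * transform \<alpha>" .
  then show ?thesis by (simp add: denominator_def algebra_simps)
qed

end

section \<open>Roots of the denominator and the linear system\<close>

definition node_poly :: "'i set \<Rightarrow> ('i \<Rightarrow> complex) \<Rightarrow> complex poly" where
  "node_poly I a = (\<Prod>i\<in>I. [:a i, -1:])"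

text \<open>The common numerator of the partial fractions y i/(a i - x).\<close>

definition interpolation_poly :: "'i set \<Rightarrow> ('i \<Rightarrow> complex) \<Rightarrow> ('i \<Rightarrow> complex) \<Rightarrow> complex poly" where
  "interpolation_poly I a y = (\<Sum>i\<in>I. smult (y i) (node_poly (I - {i}) a))"

lemma poly_node_poly: "poly (node_poly I a) x = (\<Prod>i\<in>I. a i - x)"
  by (simp add: node_poly_def poly_prod)

lemma degree_node_poly: "finite I \<Longrightarrow> degree (node_poly I a) = card I"
  unfolding node_poly_def by (subst degree_prod_eq_sum_degree) auto

lemma degree_interpolation_poly:
  assumes "finite I" "I \<noteq> {}"
  shows "degree (interpolation_poly I a y) < card I"
proof -
  have "degree (interpolation_poly I a y) \<le> card I - 1"
    unfolding interpolation_poly_def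
  proof (rule degree_sum_le[OF assms(1)])
    fix i assume "i \<in> I"
    then show "degree (smult (y i) (node_poly (I - {i}) a)) \<le> card I - 1"
      using assms(1) by (intro order_trans[OF degree_smult_le]) (simp add: degree_node_poly)
  qed
  moreover have "0 < card I" using assms by (simp add: card_gt_0_iff)
  ultimately show ?thesis by simp
qed

lemma poly_interpolation_poly:
  assumes "finite I" and x: "\<And>i. i \<in> I \<Longrightarrow> x \<noteq> a i"
  shows "poly (interpolation_poly I a y) x = (\<Prod>i\<in>I. a i - x) * (\<Sum>i\<in>I. y i / (a i - x))"
  unfolding interpolation_poly_def poly_sum poly_smult poly_node_poly sum_distrib_left
proof (rule sum.cong[OF refl])
  fix i assume i: "i \<in> I"
  have "(\<Prod>j\<in>I. a j - x) = (a i - x) * (\<Prod>j\<in>I - {i}. a j - x)" by (rule prod.remove[OF assms(1) i])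
  then show "y i * (\<Prod>j\<in>I - {i}. a j - x) = (\<Prod>j\<in>I. a j - x) * (y i / (a i - x))"
    using x[OF i] by simp
qed

lemma poly_interpolation_poly_node:
  assumes "finite I" "k \<in> I"
  shows "poly (interpolation_poly I a y) (a k) = y k * (\<Prod>j\<in>I - {k}. a j - a k)"
proof -
  have "(\<Sum>i\<in>I. y i * (\<Prod>j\<in>I - {i}. a j - a k)) = y k * (\<Prod>j\<in>I - {k}. a j - a k) + (\<Sum>i\<in>I - {k}. y i * (\<Prod>j\<in>I - {i}. a j - a k))"
    by (rule sum.remove[OF assms])
  also have "(\<Sum>i\<in>I - {k}. y i * (\<Prod>j\<in>I - {i}. a j - a k)) = 0"
    using assms by (intro sum.neutral ballI) (auto intro!: prod_zero bexI[of _ k])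
  finally show ?thesis by (simp add: interpolation_poly_def poly_sum poly_node_poly)
qed

lemma prod_node_differences_nonzero:
  fixes a :: "'i \<Rightarrow> complex"
  assumes fin: "finite I" and a: "inj_on a I" and k: "k \<in> I"
  shows "(\<Prod>j\<in>I - {k}. a j - a k) \<noteq> 0"
proof -
  have "a j - a k \<noteq> 0" if "j \<in> I - {k}" for j
    using inj_onD[OF a, of j k] that k by fastforce
  then show ?thesis using fin by (subst prod_zero_iff) blast+
qed

text \<open>The common numerator has degree below the number of nodes but vanishes at all points b
  j, which are equally many and distinct, so it is zero. Its value at the node \<open>a k\<close> is
  \<open>y k\<close> times a nonzero product, which isolates the unknown without a
  determinant.\<close>

lemma cauchy_system_trivial:
  fixes a b y :: "'i \<Rightarrow> complex"
  assumes fin: "finite I" and a: "inj_on a I" and b: "inj_on b I"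
    and disj: "\<And>i j. i \<in> I \<Longrightarrow> j \<in> I \<Longrightarrow> b j \<noteq> a i"
    and eq: "\<And>j. j \<in> I \<Longrightarrow> (\<Sum>i\<in>I. y i / (a i - b j)) = 0"
    and k: "k \<in> I"
  shows "y k = 0"
proof -
  have ne: "I \<noteq> {}" using k by auto
  let ?S = "interpolation_poly I a y"
  have "b ` I \<subseteq> {x. poly ?S x = 0}" using eq disj by (auto simp: poly_interpolation_poly[OF fin])
  have "?S = 0"
  proof (rule ccontr)
    assume "?S \<noteq> 0"
    then have "card (b ` I) \<le> card {x. poly ?S x = 0}"
      by (intro card_mono poly_roots_finite \<open>b ` I \<subseteq> {x. poly ?S x = 0}\<close>)
    also have "\<dots> \<le> degree ?S" using \<open>?S \<noteq> 0\<close> by (rule card_poly_roots_bound)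
    finally have "card (b ` I) \<le> degree ?S" .
    then show False using degree_interpolation_poly[OF fin ne, of a y] card_image[OF b] by simp
  qed
  then have "y k * (\<Prod>j\<in>I - {k}. a j - a k) = 0" using poly_interpolation_poly_node[OF fin k, of a y] by simp
  moreover have "(\<Prod>j\<in>I - {k}. a j - a k) \<noteq> 0" by (rule prod_node_differences_nonzero[OF fin a k])
  ultimately show ?thesis by simp
qed

section \<open>Counting the roots and solving the system\<close>

context hyperexponential_inspection
begin

text \<open>The denominator cleared of fractions, as a polynomial in the level c = \<phi> \<alpha>.
  The partial fractions only contribute lower degree, so its degree is d.\<close>

definition rate_poly :: "complex poly" where
  "rate_poly = node_poly {1..d} (\<lambda>i. of_real (rate i)) - interpolation_poly {1..d} (\<lambda>i. of_real (rate i)) (\<lambda>i. of_real (p i * \<omega> i))"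

definition rate_sum :: "complex \<Rightarrow> complex" where
  "rate_sum c = (\<Sum>i=1..d. of_real (p i * \<omega> i) / (of_real (rate i) - c))"

lemma d_pos: "{1..d} \<noteq> {}"
  using p_sum by (cases "d = 0") auto

lemma poly_rate_poly:
  assumes "\<And>i. i \<in> {1..d} \<Longrightarrow> c \<noteq> of_real (rate i)"
  shows "poly rate_poly c = (\<Prod>i\<in>{1..d}. of_real (rate i) - c) * (1 - rate_sum c)"
proof -
  have *: "poly (interpolation_poly {1..d} (\<lambda>i. of_real (rate i)) (\<lambda>i. of_real (p i * \<omega> i))) c =
      (\<Prod>i\<in>{1..d}. of_real (rate i) - c) * (\<Sum>i\<in>{1..d}. of_real (p i * \<omega> i) / (of_real (rate i) - c))"
    by (rule poly_interpolation_poly[OF finite_atLeastAtMost assms])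
  show ?thesis
    unfolding rate_poly_def rate_sum_def poly_diff poly_node_poly * by (simp only: right_diff_distrib mult_1_right)
qed

lemma degree_rate_poly: "degree rate_poly = d"
proof -
  have "degree (interpolation_poly {1..d} (\<lambda>i. complex_of_real (rate i)) (\<lambda>i. of_real (p i * \<omega> i))) < degree (node_poly {1..d} (\<lambda>i. complex_of_real (rate i)))"
    using degree_interpolation_poly[OF finite_atLeastAtMost d_pos] by (simp add: degree_node_poly)
  then show ?thesis unfolding rate_poly_def diff_conv_add_uminus
    by (subst degree_add_eq_left) (simp_all add: degree_node_poly)
qed

lemma rate_poly_nonzero: "rate_poly \<noteq> 0"
  using degree_rate_poly d_pos by auto

text \<open>Each summand has an imaginary part that is a positive multiple of \<open>Im c\<close>,
  so c is real. At a real level v \<le> 0 every summand lies strictly below \<open>p i\<close>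
  because \<beta> is positive, and the sum would be less than \<open>1\<close>.\<close>

lemma rate_sum_eq_1_imp_real:
  assumes ne: "\<And>i. i \<in> {1..d} \<Longrightarrow> c \<noteq> of_real (rate i)" and eq: "rate_sum c = 1"
  obtains v where "c = of_real v" "0 < v"
proof -
  have k: "0 < p i * \<omega> i" if "i \<in> {1..d}" for i using p_pos[OF that] \<omega>_pos[OF that] by simp
  have Im_term: "Im (of_real (p i * \<omega> i) / (of_real (rate i) - c)) = p i * \<omega> i / (norm (of_real (rate i) - c))\<^sup>2 * Im c" for i
    by (simp add: Im_divide cmod_power2)
  have "0 = Im (rate_sum c)" using eq by simp
  also have "\<dots> = (\<Sum>i=1..d. p i * \<omega> i / (norm (of_real (rate i) - c))\<^sup>2) * Im c"
    unfolding rate_sum_def Im_sum Im_term sum_distrib_right ..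
  finally have "(\<Sum>i=1..d. p i * \<omega> i / (norm (of_real (rate i) - c))\<^sup>2) * Im c = 0" by simp
  moreover have "0 < (\<Sum>i=1..d. p i * \<omega> i / (norm (of_real (rate i) - c))\<^sup>2)"
  proof (rule sum_pos[OF _ d_pos])
    fix i assume i: "i \<in> {1..d}"
    then show "0 < p i * \<omega> i / (norm (of_real (rate i) - c))\<^sup>2"
      using ne[OF i] k[OF i] by (intro divide_pos_pos) auto
  qed simp
  ultimately have Im: "Im c = 0" by simp
  define v where "v = Re c"
  have c: "c = of_real v" using Im by (simp add: v_def complex_eq_iff)
  have "rate_sum c = of_real (\<Sum>i=1..d. p i * \<omega> i / (rate i - v))" unfolding rate_sum_def c by simp
  then have sum: "(\<Sum>i=1..d. p i * \<omega> i / (rate i - v)) = 1" using eq by (metis of_real_eq_1_iff)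
  have "0 < v"
  proof (rule ccontr)
    assume "\<not> 0 < v"
    have "(\<Sum>i=1..d. p i * \<omega> i / (rate i - v)) < (\<Sum>i=1..d. p i)"
    proof (rule sum_strict_mono[OF _ d_pos])
      fix i assume i: "i \<in> {1..d}"
      have r: "\<omega> i < rate i - v" using \<open>\<not> 0 < v\<close> \<beta>_pos by simp
      then have "p i * \<omega> i < p i * (rate i - v)" using p_pos[OF i] by simp
      then show "p i * \<omega> i / (rate i - v) < p i" using r \<omega>_pos[OF i] by (simp add: pos_divide_less_eq)
    qed simp
    then show False using sum p_sum by simp
  qed
  with c show thesis by (rule that)
qed

abbreviation roots :: "complex set" where
  "roots \<equiv> hyperexponential_roots M Y d \<omega> p \<beta>"

definition root_levels :: "complex set" where
  "root_levels = {c. (\<forall>i\<in>{1..d}. c \<noteq> of_real (rate i)) \<and> rate_sum c = 1}"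

text \<open>The fibres of \<phi> in the half-plane are known over positive real levels only, each
  being the single point given by \<psi>. This suffices because every level in
  \<open>root_levels\<close> is real and positive.\<close>

lemma roots_eq: "roots = (\<lambda>c. of_real (\<psi> (Re c))) ` root_levels"
proof (intro set_eqI iffI)
  fix \<alpha> assume "\<alpha> \<in> roots"
  then have \<alpha>: "0 < Re \<alpha>" and lev: "\<phi> \<alpha> \<in> root_levels"
    by (auto simp: hyperexponential_roots_def root_levels_def rate_sum_def)
  obtain v where v: "\<phi> \<alpha> = of_real v" "0 < v"
    using lev rate_sum_eq_1_imp_real[of "\<phi> \<alpha>"] unfolding root_levels_def by blast
  have "\<alpha> = of_real (\<psi> v)" using complex_exponent_eq_iff[OF v(2), of \<alpha>] \<alpha> v(1) by simp
  then have "\<alpha> = of_real (\<psi> (Re (\<phi> \<alpha>)))" unfolding v(1) by simp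
  then show "\<alpha> \<in> (\<lambda>c. of_real (\<psi> (Re c))) ` root_levels" using lev by (rule image_eqI)
next
  fix \<alpha> assume "\<alpha> \<in> (\<lambda>c. complex_of_real (\<psi> (Re c))) ` root_levels"
  then obtain c where c: "c \<in> root_levels" "\<alpha> = of_real (\<psi> (Re c))" by blast
  obtain v where v: "c = of_real v" "0 < v"
    using c(1) rate_sum_eq_1_imp_real[of c] unfolding root_levels_def by blast
  have \<alpha>: "\<alpha> = of_real (\<psi> v)" using c(2) v(1) by simp
  have "0 < \<psi> v" by (rule right_inverse_pos[OF v(2)])
  then have phi: "\<phi> \<alpha> = c" using complex_exponent_eq_iff[OF v(2), of \<alpha>] \<alpha> v(1) by simp
  have ne: "complex_of_real (rate i) - c \<noteq> 0" if "i \<in> {1..d}" for i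
    using c(1) that unfolding root_levels_def by auto
  have "rate_sum c = 1" using c(1) unfolding root_levels_def by blast
  then show "\<alpha> \<in> roots"
    unfolding hyperexponential_roots_def mem_Collect_eq phi rate_sum_def using \<open>0 < \<psi> v\<close> \<alpha> ne by simp
qed

lemma rootE:
  assumes "\<alpha> \<in> roots"
  obtains v where "0 < v" "\<alpha> = of_real (\<psi> v)" "\<And>i. i \<in> {1..d} \<Longrightarrow> v \<noteq> rate i" "(\<Sum>i=1..d. p i * (\<omega> i / (rate i - v))) = 1"
proof -
  obtain c where c: "c \<in> root_levels" "\<alpha> = of_real (\<psi> (Re c))" using assms unfolding roots_eq by blast
  obtain v where v: "c = of_real v" "0 < v"
    using c(1) rate_sum_eq_1_imp_real[of c] unfolding root_levels_def by blast
  show thesis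
  proof (rule that[OF v(2)])
    show "\<alpha> = of_real (\<psi> v)" using c(2) v(1) by simp
    show "v \<noteq> rate i" if "i \<in> {1..d}" for i using c(1) v(1) that unfolding root_levels_def by auto
    have "rate_sum c = of_real (\<Sum>i=1..d. p i * (\<omega> i / (rate i - v)))" unfolding rate_sum_def v(1) by simp
    moreover have "rate_sum c = 1" using c(1) unfolding root_levels_def by blast
    ultimately show "(\<Sum>i=1..d. p i * (\<omega> i / (rate i - v))) = 1" by (metis of_real_eq_1_iff)
  qed
qed

lemma F_of_real: "F M Y (complex_of_real a) \<beta> w = of_real (F M Y a \<beta> w)"
  unfolding F_def Let_def xi_of_real by (simp add: xi_of_real)

lemma Gbar_of_real: "Gbar M Y (complex_of_real a) \<beta> w = of_real (Gbar M Y a \<beta> w)"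
  unfolding Gbar_def Let_def xi_of_real by (simp add: xi_of_real)

text \<open>The level of a root differs from every rate, so \<open>transform_identity\<close>
  applies at the root itself; a finite transform times the vanishing denominator forces the
  numerator to vanish.\<close>

lemma root_equation:
  assumes "\<alpha> \<in> roots"
  shows "(\<Sum>i=1..d. of_real (p i * (\<omega> i / rate i)) * (F M Y \<alpha> \<beta> (\<omega> i) - Gbar M Y \<alpha> \<beta> (\<omega> i) * of_real (transform (\<psi> (rate i))))) = 0"
proof -
  obtain v where v: "0 < v" "\<alpha> = of_real (\<psi> v)" "\<And>i. i \<in> {1..d} \<Longrightarrow> v \<noteq> rate i" "(\<Sum>i=1..d. p i * (\<omega> i / (rate i - v))) = 1"
    using rootE[OF assms] by blast
  have ne: "\<psi> v \<noteq> \<psi> (rate i)" if "i \<in> {1..d}" for i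
    using v(3)[OF that] exponent_right_inverse[OF v(1)] exponent_right_inverse[OF rate_pos[OF that]] by metis
  have "denominator (\<psi> v) = 0" unfolding denominator_def exponent_right_inverse[OF v(1)] using v(4) by simp
  then have "numerator (\<psi> v) = 0" using transform_identity[OF right_inverse_pos[OF v(1)] ne] by simp
  moreover have "(\<Sum>i=1..d. of_real (p i * (\<omega> i / rate i)) * (F M Y \<alpha> \<beta> (\<omega> i) - Gbar M Y \<alpha> \<beta> (\<omega> i) * of_real (transform (\<psi> (rate i))))) = complex_of_real (numerator (\<psi> v))"
    unfolding v(2) F_of_real Gbar_of_real numerator_def by simp
  ultimately show ?thesis by simp
qed

text \<open>Distinct rates keep the zeros away from the rates: at a rate only one partial fraction
  survives, with a nonzero product of differences. A zero is therefore a root level and real; there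
  the derivative is minus the nonzero node product times a sum of the terms p i \<omega> i/(rate i -
  v)^2, all positive, so the zero is simple.\<close>

lemma rsquarefree_rate_poly:
  assumes inj: "inj_on \<omega> {1..d}"
  shows "rsquarefree rate_poly" "{c. poly rate_poly c = 0} = root_levels"
proof -
  let ?r = "\<lambda>i. complex_of_real (rate i)"
  have r_inj: "inj_on ?r {1..d}"
  proof (rule inj_onI)
    fix i j assume ij: "i \<in> {1..d}" "j \<in> {1..d}" "?r i = ?r j"
    then have "\<omega> i = \<omega> j" by simp
    then show "i = j" by (rule inj_onD[OF inj _ ij(1,2)])
  qed
  have not_pole: "c \<noteq> ?r k" if "poly rate_poly c = 0" "k \<in> {1..d}" for c k
  proof
    assume c: "c = ?r k"
    have "poly (node_poly {1..d} ?r) (?r k) = 0" unfolding poly_node_poly using that(2) by (intro prod_zero) auto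
    then have "poly rate_poly c = - (of_real (p k * \<omega> k) * (\<Prod>j\<in>{1..d} - {k}. ?r j - ?r k))"
      unfolding rate_poly_def c poly_diff poly_interpolation_poly_node[OF finite_atLeastAtMost that(2), of ?r] by simp
    moreover have "(\<Prod>j\<in>{1..d} - {k}. ?r j - ?r k) \<noteq> 0"
      by (rule prod_node_differences_nonzero[OF finite_atLeastAtMost r_inj that(2)])
    ultimately show False using that p_pos[OF that(2)] \<omega>_pos[OF that(2)] by simp
  qed
  show lev: "{c. poly rate_poly c = 0} = root_levels"
  proof (intro set_eqI iffI)
    fix c assume "c \<in> {c. poly rate_poly c = 0}"
    then have c: "poly rate_poly c = 0" by simp
    then have "(\<Prod>i\<in>{1..d}. ?r i - c) * (1 - rate_sum c) = 0"
      using poly_rate_poly[of c] not_pole[OF c] by simp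
    moreover have "(\<Prod>i\<in>{1..d}. ?r i - c) \<noteq> 0"
    proof -
      have "?r i - c \<noteq> 0" if "i \<in> {1..d}" for i using not_pole[OF c that] by simp
      then show ?thesis using finite_atLeastAtMost[of 1 d] by (subst prod_zero_iff) blast+
    qed
    ultimately show "c \<in> root_levels" using not_pole[OF c] unfolding root_levels_def by auto
  next
    fix c assume "c \<in> root_levels"
    then show "c \<in> {c. poly rate_poly c = 0}" using poly_rate_poly[of c] by (simp add: root_levels_def)
  qed
  show "rsquarefree rate_poly"
    unfolding rsquarefree_roots
  proof (intro allI notI)
    fix c assume "poly rate_poly c = 0 \<and> poly (pderiv rate_poly) c = 0"
    then have c: "poly rate_poly c = 0" "poly (pderiv rate_poly) c = 0" by auto
    have "c \<in> root_levels" using c(1) lev by blast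
    then have ne: "\<And>i. i \<in> {1..d} \<Longrightarrow> c \<noteq> ?r i" and one: "rate_sum c = 1" unfolding root_levels_def by blast+
    obtain v where v: "c = of_real v" "0 < v" using rate_sum_eq_1_imp_real[OF ne one] by blast
    define D where "D x = (\<Prod>i\<in>{1..d}. ?r i - x)" for x
    define R' where "R' = (\<Sum>i=1..d. of_real (p i * \<omega> i) / (?r i - c)\<^sup>2)"
    have D: "D c \<noteq> 0"
    proof -
      have "?r i - c \<noteq> 0" if "i \<in> {1..d}" for i using ne[OF that] by simp
      then show ?thesis unfolding D_def using finite_atLeastAtMost[of 1 d] by (subst prod_zero_iff) blast+
    qed
    have "poly (node_poly {1..d} ?r) = D" by (simp add: fun_eq_iff poly_node_poly D_def)
    then have D_deriv: "(D has_field_derivative poly (pderiv (node_poly {1..d} ?r)) c) (at c)"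
      using poly_DERIV[of "node_poly {1..d} ?r" c] by simp
    have R_deriv: "(rate_sum has_field_derivative R') (at c)"
      unfolding rate_sum_def[abs_def] R'_def
    proof (intro DERIV_sum)
      fix i assume i: "i \<in> {1..d}"
      show "((\<lambda>x. of_real (p i * \<omega> i) / (?r i - x)) has_field_derivative of_real (p i * \<omega> i) / (?r i - c)\<^sup>2) (at c)"
        using ne[OF i] by (auto intro!: derivative_eq_intros simp: power2_eq_square)
    qed
    have prod_deriv: "((\<lambda>x. D x * (1 - rate_sum x)) has_field_derivative - D c * R') (at c)"
      by (rule derivative_eq_intros D_deriv R_deriv refl | simp add: one)+
    have op: "open (- (?r ` {1..d}))" by (intro open_Compl finite_imp_closed) simp
    have "(poly rate_poly has_field_derivative - D c * R') (at c)"
    proof (rule has_field_derivative_transform_within_open[OF prod_deriv op])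
      show "c \<in> - (?r ` {1..d})" using ne by blast
      show "D x * (1 - rate_sum x) = poly rate_poly x" if "x \<in> - (?r ` {1..d})" for x
        unfolding D_def by (rule poly_rate_poly[symmetric]) (use that in blast)
    qed
    then have "poly (pderiv rate_poly) c = - D c * R'" using DERIV_unique[OF poly_DERIV] by blast
    moreover have "R' \<noteq> 0"
    proof -
      have "R' = of_real (\<Sum>i=1..d. p i * \<omega> i / (rate i - v)\<^sup>2)" unfolding R'_def v(1) by simp
      moreover have "0 < (\<Sum>i=1..d. p i * \<omega> i / (rate i - v)\<^sup>2)"
      proof (rule sum_pos[OF _ d_pos])
        fix i assume i: "i \<in> {1..d}"
        have "rate i - v \<noteq> 0" using ne[OF i] v(1) by auto
        then show "0 < p i * \<omega> i / (rate i - v)\<^sup>2" using p_pos[OF i] \<omega>_pos[OF i] by simp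
      qed simp
      ultimately show ?thesis by (metis of_real_eq_0_iff less_irrefl)
    qed
    ultimately show False using c(2) D by simp
  qed
qed

text \<open>A squarefree complex polynomial has as many zeros as its degree, and \<psi> is injective
  on positive levels because the Laplace exponent inverts it.\<close>

lemma card_roots:
  assumes inj: "inj_on \<omega> {1..d}"
  shows "finite roots" "card roots = d"
proof -
  note sf = rsquarefree_rate_poly[OF inj]
  have fin: "finite root_levels" using poly_roots_finite[OF rate_poly_nonzero] sf(2) by simp
  have "d = degree (smult (lead_coeff rate_poly) (\<Prod>z|poly rate_poly z = 0. [:- z, 1:]))"
    using complex_poly_decompose_rsquarefree[OF sf(1)] degree_rate_poly by simp
  also have "\<dots> = card root_levels"
    using rate_poly_nonzero unfolding sf(2) by (simp add: degree_prod_eq_sum_degree)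
  finally have card: "card root_levels = d" by simp
  have "inj_on (\<lambda>c. complex_of_real (\<psi> (Re c))) root_levels"
  proof (rule inj_onI)
    fix c c' assume c: "c \<in> root_levels" "c' \<in> root_levels" and eq: "complex_of_real (\<psi> (Re c)) = complex_of_real (\<psi> (Re c'))"
    obtain v where v: "c = of_real v" "0 < v"
      using c(1) rate_sum_eq_1_imp_real[of c] unfolding root_levels_def by blast
    obtain v' where v': "c' = of_real v'" "0 < v'"
      using c(2) rate_sum_eq_1_imp_real[of c'] unfolding root_levels_def by blast
    have "\<psi> v = \<psi> v'" using eq v(1) v'(1) by simp
    then have "v = v'" using exponent_right_inverse[OF v(2)] exponent_right_inverse[OF v'(2)] by metis
    then show "c = c'" using v(1) v'(1) by simp
  qed
  then show "finite roots" "card roots = d" unfolding roots_eq using fin card by (simp_all add: card_image)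
qed

lemma xi_pos: "0 < q \<Longrightarrow> 0 \<le> a \<Longrightarrow> 0 < xi M Y (a::real) q"
proof -
  assume q: "0 < q" and a: "0 \<le> a"
  interpret S: prob_space "sup_law q" by (rule prob_space_sup_law[OF q])
  have "integrable (sup_law q) (\<lambda>s. exp (- a * s))"
    using sup_law_nonneg[OF q] a by (intro S.integrable_const_bound[of _ 1]) (auto elim!: eventually_mono simp: sup_law_def)
  then have "(\<integral>s. 0 \<partial>sup_law q) < (\<integral>s. exp (- a * s) \<partial>sup_law q)"
    by (intro S.integral_less_AE_space) (auto simp: S.emeasure_space_1)
  then show ?thesis using xi_eq_sup_law[OF q, of a] by simp
qed

text \<open>Subtracting the equations satisfied by the true values removes \<open>F\<close>. After
  absorbing the positive factors of \<open>Gbar\<close> that are independent of the root into the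
  unknowns, a homogeneous Cauchy system with nodes \<theta> i and points \<alpha> j remains.\<close>

lemma system_unique:
  assumes inj: "inj_on \<omega> {1..d}" and \<alpha>: "bij_betw \<alpha> {1..d} roots"
    and eq: "\<And>j. j \<in> {1..d} \<Longrightarrow> (\<Sum>i=1..d. of_real (p i * (\<omega> i / rate i)) * (F M Y (\<alpha> j) \<beta> (\<omega> i) - Gbar M Y (\<alpha> j) \<beta> (\<omega> i) * x i)) = 0"
    and k: "k \<in> {1..d}"
  shows "x k = complex_of_real (transform (\<psi> (rate k)))"
proof -
  let ?z = "\<lambda>i. complex_of_real (transform (\<psi> (rate i)))"
  let ?\<theta> = "\<lambda>i. complex_of_real (\<psi> (rate i))"
  define y where "y i = of_real (p i * (\<omega> i / rate i)) * (?\<theta> i * xi M Y (?\<theta> i) (rate i)) * (x i - ?z i)" for i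
  have "y k = 0"
  proof (rule cauchy_system_trivial[of "{1..d}" ?\<theta> \<alpha>])
    show "inj_on ?\<theta> {1..d}"
    proof (rule inj_onI)
      fix i j assume ij: "i \<in> {1..d}" "j \<in> {1..d}" "?\<theta> i = ?\<theta> j"
      then have "\<psi> (rate i) = \<psi> (rate j)" by simp
      then have "rate i = rate j" using exponent_right_inverse[OF rate_pos[OF ij(1)]] exponent_right_inverse[OF rate_pos[OF ij(2)]] by metis
      then have "\<omega> i = \<omega> j" by simp
      then show "i = j" by (rule inj_onD[OF inj _ ij(1,2)])
    qed
    show "inj_on \<alpha> {1..d}" using \<alpha> by (rule bij_betw_imp_inj_on)
    show "\<alpha> j \<noteq> ?\<theta> i" if ij: "i \<in> {1..d}" "j \<in> {1..d}" for i j
    proof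
      assume e: "\<alpha> j = ?\<theta> i"
      have "\<alpha> j \<in> roots" using \<alpha> ij(2) by (auto simp: bij_betw_def)
      then obtain v where v: "0 < v" "\<alpha> j = of_real (\<psi> v)" "\<And>i. i \<in> {1..d} \<Longrightarrow> v \<noteq> rate i" by (rule rootE) blast
      have "\<psi> v = \<psi> (rate i)" using e v(2) by simp
      then have "v = rate i" using exponent_right_inverse[OF v(1)] exponent_right_inverse[OF rate_pos[OF ij(1)]] by metis
      then show False using v(3)[OF ij(1)] by simp
    qed
    show "(\<Sum>i\<in>{1..d}. y i / (?\<theta> i - \<alpha> j)) = 0" if j: "j \<in> {1..d}" for j
    proof -
      have "\<alpha> j \<in> roots" using \<alpha> j by (auto simp: bij_betw_def)
      from root_equation[OF this] eq[OF j]
      have "0 = (\<Sum>i=1..d. of_real (p i * (\<omega> i / rate i)) * (F M Y (\<alpha> j) \<beta> (\<omega> i) - Gbar M Y (\<alpha> j) \<beta> (\<omega> i) * ?z i)) -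
          (\<Sum>i=1..d. of_real (p i * (\<omega> i / rate i)) * (F M Y (\<alpha> j) \<beta> (\<omega> i) - Gbar M Y (\<alpha> j) \<beta> (\<omega> i) * x i))" by simp
      also have "\<dots> = (\<Sum>i=1..d. y i / (?\<theta> i - \<alpha> j))"
        unfolding sum_subtractf[symmetric]
      proof (rule sum.cong[OF refl])
        fix i
        have alg: "C * (f - K / t * z) - C * (f - K / t * w) = C * K * (w - z) / t" for C f K t z w :: complex
          by (simp add: algebra_simps diff_divide_distrib)
        have G: "Gbar M Y (\<alpha> j) \<beta> (\<omega> i) = ?\<theta> i * xi M Y (?\<theta> i) (rate i) / (?\<theta> i - \<alpha> j)" by (simp add: Gbar_def Let_def)
        show "of_real (p i * (\<omega> i / rate i)) * (F M Y (\<alpha> j) \<beta> (\<omega> i) - Gbar M Y (\<alpha> j) \<beta> (\<omega> i) * ?z i) -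
            of_real (p i * (\<omega> i / rate i)) * (F M Y (\<alpha> j) \<beta> (\<omega> i) - Gbar M Y (\<alpha> j) \<beta> (\<omega> i) * x i) = y i / (?\<theta> i - \<alpha> j)"
          unfolding y_def G by (rule alg)
      qed
      finally show ?thesis by simp
    qed
  qed (use k in auto)
  moreover have "complex_of_real (p k * (\<omega> k / rate k)) * (?\<theta> k * xi M Y (?\<theta> k) (rate k)) \<noteq> 0"
  proof -
    have q: "0 < rate k" by (rule rate_pos[OF k])
    have "0 < \<psi> (rate k)" by (rule right_inverse_pos[OF q])
    moreover from this have "0 < xi M Y (\<psi> (rate k)) (rate k)" by (intro xi_pos q) simp
    ultimately show ?thesis
      unfolding xi_of_real of_real_mult[symmetric] of_real_eq_0_iff using p_pos[OF k] \<omega>_pos[OF k] q by simp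
  qed
  ultimately have "x k - ?z k = 0" unfolding y_def by (metis mult_eq_0_iff)
  then show ?thesis by simp
qed

text \<open>At \<open>a = 0\<close> the limit may be infinite and no dominating function is
  available, but the integrands stay below their limit, so Fatou's lemma from below and monotonicity
  from above give convergence. At positive a the integrand at \<open>a / 2\<close> eventually
  dominates.\<close>

lemma transform_tendsto:
  assumes a: "0 \<le> a"
  shows "((\<lambda>\<alpha>. exceedance_transform M Y \<Omega> \<alpha> \<beta>) \<longlongrightarrow> exceedance_transform M Y \<Omega> a \<beta>) (at a within {0<..})"
  unfolding tendsto_at_iff_sequentially
proof (intro allI impI)
  fix X :: "nat \<Rightarrow> real" assume X: "\<forall>i. X i \<in> {0<..} - {a}" and lim: "X \<longlonglongrightarrow> a"
  note P01 = exceedance_bounds[OF \<beta>_pos]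
  have Pm[measurable]: "exceedance \<in> borel_measurable borel" by (rule exceedance_measurable[OF \<beta>_pos])
  have X0: "0 < X n" for n using X by auto
  define f where "f \<alpha> u = indicator {0..} u * (ennreal (exp (- \<alpha> * u)) * ennreal (exceedance u))" for \<alpha> u :: real
  have T: "exceedance_transform M Y \<Omega> \<alpha> \<beta> = (\<integral>\<^sup>+u. f \<alpha> u \<partial>lborel)" for \<alpha>
    by (simp add: exceedance_transform_eq level_transform_def f_def)
  have fm[measurable]: "f \<alpha> \<in> borel_measurable lborel" for \<alpha> unfolding f_def by measurable
  have f_lim: "(\<lambda>n. f (X n) u) \<longlonglongrightarrow> f a u" for u
  proof -
    have f_eq: "f \<alpha> u = ennreal (indicator {0..} u * (exp (- \<alpha> * u) * exceedance u))" for \<alpha>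
      using P01 by (auto simp: f_def indicator_def ennreal_mult)
    show ?thesis unfolding f_eq by (intro tendsto_ennrealI tendsto_intros lim)
  qed
  have f_mono: "f \<alpha> u \<le> f \<alpha>' u" if "\<alpha>' \<le> \<alpha>" for \<alpha> \<alpha>' u
  proof (cases "0 \<le> u")
    case True
    then have "exp (- \<alpha> * u) \<le> exp (- \<alpha>' * u)" using mult_right_mono[OF that True] by simp
    then show ?thesis unfolding f_def by (intro mult_left_mono mult_right_mono ennreal_leI) auto
  qed (simp add: f_def)
  show "((\<lambda>\<alpha>. exceedance_transform M Y \<Omega> \<alpha> \<beta>) \<circ> X) \<longlonglongrightarrow> exceedance_transform M Y \<Omega> a \<beta>"
  proof (cases "a = 0")
    case True
    have "(\<integral>\<^sup>+u. f a u \<partial>lborel) = (\<integral>\<^sup>+u. liminf (\<lambda>n. f (X n) u) \<partial>lborel)"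
      using f_lim by (intro nn_integral_cong lim_imp_Liminf[symmetric]) auto
    also have "\<dots> \<le> liminf (\<lambda>n. \<integral>\<^sup>+u. f (X n) u \<partial>lborel)" by (intro nn_integral_liminf) measurable
    finally have lower: "(\<integral>\<^sup>+u. f a u \<partial>lborel) \<le> liminf (\<lambda>n. \<integral>\<^sup>+u. f (X n) u \<partial>lborel)" .
    have "(\<integral>\<^sup>+u. f (X n) u \<partial>lborel) \<le> (\<integral>\<^sup>+u. f a u \<partial>lborel)" for n
      using X0[of n] True by (intro nn_integral_mono f_mono) simp
    then have upper: "limsup (\<lambda>n. \<integral>\<^sup>+u. f (X n) u \<partial>lborel) \<le> (\<integral>\<^sup>+u. f a u \<partial>lborel)"
      by (intro Limsup_bounded always_eventually allI)
    have "liminf (\<lambda>n. \<integral>\<^sup>+u. f (X n) u \<partial>lborel) \<le> limsup (\<lambda>n. \<integral>\<^sup>+u. f (X n) u \<partial>lborel)"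
      by (intro Liminf_le_Limsup) simp
    then have "(\<lambda>n. \<integral>\<^sup>+u. f (X n) u \<partial>lborel) \<longlonglongrightarrow> (\<integral>\<^sup>+u. f a u \<partial>lborel)"
      using lower upper by (subst tendsto_iff_Liminf_eq_Limsup) (auto intro: antisym order_trans)
    then show ?thesis by (simp add: T comp_def)
  next
    case False
    with a have a2: "0 < a / 2" by simp
    have "eventually (\<lambda>n. a / 2 < X n) sequentially" using order_tendstoD(1)[OF lim, of "a / 2"] a2 by simp
    then obtain N where N: "\<And>n. n \<ge> N \<Longrightarrow> a / 2 < X n" unfolding eventually_sequentially by blast
    have "(\<lambda>n. \<integral>\<^sup>+u. f (X (n + N)) u \<partial>lborel) \<longlonglongrightarrow> (\<integral>\<^sup>+u. f a u \<partial>lborel)"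
    proof (rule nn_integral_dominated_convergence[where w = "f (a / 2)"])
      show "(\<integral>\<^sup>+u. f (a / 2) u \<partial>lborel) < \<infinity>" using exceedance_transform_finite[OF a2] by (simp add: T)
      show "AE u in lborel. f (X (n + N)) u \<le> f (a / 2) u" for n using N[of "n + N"] by (intro AE_I2 f_mono) simp
      show "AE u in lborel. (\<lambda>n. f (X (n + N)) u) \<longlonglongrightarrow> f a u"
        by (intro AE_I2 LIMSEQ_ignore_initial_segment f_lim)
    qed measurable
    then have "(\<lambda>n. \<integral>\<^sup>+u. f (X n) u \<partial>lborel) \<longlonglongrightarrow> (\<integral>\<^sup>+u. f a u \<partial>lborel)" by (rule LIMSEQ_offset)
    then show ?thesis by (simp add: T comp_def)
  qed
qed

text \<open>Finiteness isolates these points, so the quotient formula holds in a punctured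
  right-half-line neighbourhood of every a \<ge> 0, and a limit sees nothing else.\<close>

lemma finite_exceptional: "finite {a. 0 < a \<and> ((\<exists>i\<in>{1..d}. a = \<psi> (rate i)) \<or> denominator a = 0)}"
proof (rule finite_subset)
  show "finite ((\<lambda>i. \<psi> (rate i)) ` {1..d} \<union> (\<lambda>c. \<psi> (Re c)) ` {c. poly rate_poly c = 0})"
    using poly_roots_finite[OF rate_poly_nonzero] by simp
  show "{a. 0 < a \<and> ((\<exists>i\<in>{1..d}. a = \<psi> (rate i)) \<or> denominator a = 0)} \<subseteq>
      (\<lambda>i. \<psi> (rate i)) ` {1..d} \<union> (\<lambda>c. \<psi> (Re c)) ` {c. poly rate_poly c = 0}"
  proof
    fix a assume "a \<in> {a. 0 < a \<and> ((\<exists>i\<in>{1..d}. a = \<psi> (rate i)) \<or> denominator a = 0)}"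
    then have a: "0 < a" "(\<exists>i\<in>{1..d}. a = \<psi> (rate i)) \<or> denominator a = 0" by auto
    show "a \<in> (\<lambda>i. \<psi> (rate i)) ` {1..d} \<union> (\<lambda>c. \<psi> (Re c)) ` {c. poly rate_poly c = 0}"
    proof (cases "\<exists>i\<in>{1..d}. a = \<psi> (rate i)")
      case False
      define c where "c = complex_of_real (\<phi>\<^sub>r a)"
      have ne: "c \<noteq> of_real (rate i)" if i: "i \<in> {1..d}" for i
      proof
        assume "c = of_real (rate i)"
        then have "\<phi>\<^sub>r a = rate i" unfolding c_def of_real_eq_iff .
        then have "a = \<psi> (rate i)" using exponent_eq_iff[OF rate_pos[OF i] less_imp_le[OF a(1)]] by blast
        with False i show False by blast
      qed
      have "rate_sum c = of_real (\<Sum>i=1..d. p i * (\<omega> i / (rate i - \<phi>\<^sub>r a)))" unfolding rate_sum_def c_def by simp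
      also have "(\<Sum>i=1..d. p i * (\<omega> i / (rate i - \<phi>\<^sub>r a))) = 1" using a(2) False by (simp add: denominator_def)
      finally have one: "rate_sum c = 1" by simp
      obtain v where v: "c = of_real v" "0 < v" using rate_sum_eq_1_imp_real[OF ne one] by blast
      have "\<phi>\<^sub>r a = v" using v(1) by (simp add: c_def)
      then have "a = \<psi> (Re c)" using exponent_eq_iff[OF v(2), of a] a(1) v(1) by simp
      moreover have "poly rate_poly c = 0" using poly_rate_poly[OF ne] one by simp
      ultimately show ?thesis by blast
    qed blast
  qed
qed

lemma quotient_tendsto:
  assumes a: "0 \<le> a"
  shows "((\<lambda>\<alpha>. ennreal (numerator \<alpha> / denominator \<alpha>)) \<longlongrightarrow> exceedance_transform M Y \<Omega> a \<beta>) (at a within {0<..})"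
proof -
  let ?B = "{a. 0 < a \<and> ((\<exists>i\<in>{1..d}. a = \<psi> (rate i)) \<or> denominator a = 0)}"
  have "open (- (?B - {a}))" by (intro open_Compl finite_imp_closed) (use finite_exceptional in auto)
  then have "eventually (\<lambda>\<alpha>. \<alpha> \<in> - (?B - {a})) (nhds a)" by (rule eventually_nhds_in_open) simp
  then have "eventually (\<lambda>\<alpha>. \<alpha> \<in> - (?B - {a})) (at a within {0<..})"
    unfolding eventually_at_filter by (rule eventually_mono) blast
  moreover have "eventually (\<lambda>\<alpha>. \<alpha> \<in> {0<..} \<and> \<alpha> \<noteq> a) (at a within {0<..})" by (auto simp: eventually_at_filter)
  ultimately have "eventually (\<lambda>\<alpha>. exceedance_transform M Y \<Omega> \<alpha> \<beta> = ennreal (numerator \<alpha> / denominator \<alpha>)) (at a within {0<..})"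
  proof eventually_elim
    case (elim \<alpha>)
    then have \<alpha>: "0 < \<alpha>" "\<And>i. i \<in> {1..d} \<Longrightarrow> \<alpha> \<noteq> \<psi> (rate i)" "denominator \<alpha> \<noteq> 0" by auto
    have "transform \<alpha> = numerator \<alpha> / denominator \<alpha>" using transform_identity[OF \<alpha>(1,2)] \<alpha>(3) by (simp add: field_simps)
    moreover have "exceedance_transform M Y \<Omega> \<alpha> \<beta> = ennreal (transform \<alpha>)"
      using exceedance_transform_finite[OF \<alpha>(1)] by (simp add: transform_def ennreal_enn2real less_top)
    ultimately show ?case by simp
  qed
  with transform_tendsto[OF a] show ?thesis by (rule Lim_transform_eventually)
qed

end

theorem theorem2:
  fixes M :: "'a measure" and Y :: "real \<Rightarrow> 'a \<Rightarrow> real" and \<Omega> :: "nat \<Rightarrow> 'a \<Rightarrow> real"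
    and d :: nat and \<omega> p :: "nat \<Rightarrow> real" and \<beta> :: real
  assumes "inspected_levy_process M Y \<Omega>"
    and "\<And>i. i \<in> {1..d} \<Longrightarrow> \<omega> i > 0"
    and "\<And>i. i \<in> {1..d} \<Longrightarrow> p i > 0"
    and "(\<Sum>i=1..d. p i) = 1"
    and "distributed M lborel (\<Omega> 1) (hyperexponential_density d \<omega> p)"
    and "\<beta> > 0"
  shows
    "let \<theta> = (\<lambda>i. right_inverse M Y (\<beta> + \<omega> i));
         z = (\<lambda>i. enn2real (exceedance_transform M Y \<Omega> (\<theta> i) \<beta>));
         numer = (\<lambda>\<alpha>::real. \<Sum>i=1..d. p i * (\<omega> i / (\<beta> + \<omega> i)) *
                    (F M Y \<alpha> \<beta> (\<omega> i) - Gbar M Y \<alpha> \<beta> (\<omega> i) * z i));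
         denom = (\<lambda>\<alpha>::real. 1 - (\<Sum>i=1..d. p i * (\<omega> i / (\<beta> + \<omega> i - laplace_exponent M Y \<alpha>))));
         roots = hyperexponential_roots M Y d \<omega> p \<beta>;
         equation = (\<lambda>(\<alpha>::complex) (x :: nat \<Rightarrow> complex).
                    (\<Sum>i=1..d. complex_of_real (p i * (\<omega> i / (\<beta> + \<omega> i))) *
                       (F M Y \<alpha> \<beta> (\<omega> i) - Gbar M Y \<alpha> \<beta> (\<omega> i) * x i)) = 0)
     in
       (\<comment> \<open>the formula wherever its right-hand side is defined, and at the remaining
           \<open>\<alpha> \<ge> 0\<close> (removable singularities, and \<open>\<alpha> = 0\<close>) by continuity\<close>
        \<forall>\<alpha>>0. exceedance_transform M Y \<Omega> \<alpha> \<beta> < \<infinity> \<and>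
          ((\<forall>i\<in>{1..d}. \<alpha> \<noteq> \<theta> i) \<and> denom \<alpha> \<noteq> 0 \<longrightarrow>
             enn2real (exceedance_transform M Y \<Omega> \<alpha> \<beta>) = numer \<alpha> / denom \<alpha>)) \<and>
       (\<forall>\<alpha>\<ge>0. ((\<lambda>a. ennreal (numer a / denom a)) \<longlongrightarrow> exceedance_transform M Y \<Omega> \<alpha> \<beta>)
          (at \<alpha> within {0<..})) \<and>
       (\<forall>\<alpha>\<in>roots. equation \<alpha> (\<lambda>i. complex_of_real (z i))) \<and>
       (\<comment> \<open>\<open>d\<close> distinct roots exist, and the system determines \<open>z\<close>, exactly when the rates are distinct\<close>
        inj_on \<omega> {1..d} \<longrightarrow>
          (\<exists>\<alpha>. bij_betw \<alpha> {1..d} roots \<and>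
             (\<forall>x. (\<forall>j\<in>{1..d}. equation (\<alpha> j) x) \<longleftrightarrow>
                  (\<forall>i\<in>{1..d}. x i = complex_of_real (z i)))))"
proof -
  interpret inspected_levy_process M Y \<Omega> by (rule assms(1))
  interpret hyperexponential_inspection M Y \<Omega> d \<omega> p \<beta>
    by standard (use assms in auto)
  have formula: "transform \<alpha> = numerator \<alpha> / denominator \<alpha>"
    if "0 < \<alpha>" "\<forall>i\<in>{1..d}. \<alpha> \<noteq> \<psi> (rate i)" "denominator \<alpha> \<noteq> 0" for \<alpha>
  proof -
    have "transform \<alpha> * denominator \<alpha> = numerator \<alpha>" by (rule transform_identity[OF that(1)]) (use that(2) in blast)
    then show ?thesis using that(3) by (simp add: field_simps)
  qed
  have system: "\<exists>\<alpha>. bij_betw \<alpha> {1..d} roots \<and>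
      (\<forall>x. (\<forall>j\<in>{1..d}. (\<Sum>i=1..d. complex_of_real (p i * (\<omega> i / rate i)) * (F M Y (\<alpha> j) \<beta> (\<omega> i) - Gbar M Y (\<alpha> j) \<beta> (\<omega> i) * x i)) = 0) \<longleftrightarrow>
        (\<forall>i\<in>{1..d}. x i = complex_of_real (transform (\<psi> (rate i)))))"
    if inj: "inj_on \<omega> {1..d}"
  proof -
    obtain \<alpha> where \<alpha>: "bij_betw \<alpha> {1..d} roots"
      using ex_bij_betw_nat_finite_1[OF card_roots(1)[OF inj]] unfolding card_roots(2)[OF inj] by blast
    have "(\<forall>j\<in>{1..d}. (\<Sum>i=1..d. complex_of_real (p i * (\<omega> i / rate i)) * (F M Y (\<alpha> j) \<beta> (\<omega> i) - Gbar M Y (\<alpha> j) \<beta> (\<omega> i) * x i)) = 0) \<longleftrightarrow>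
        (\<forall>i\<in>{1..d}. x i = complex_of_real (transform (\<psi> (rate i))))" for x
    proof (intro iffI ballI)
      fix k assume "\<forall>j\<in>{1..d}. (\<Sum>i=1..d. complex_of_real (p i * (\<omega> i / rate i)) * (F M Y (\<alpha> j) \<beta> (\<omega> i) - Gbar M Y (\<alpha> j) \<beta> (\<omega> i) * x i)) = 0"
        and "k \<in> {1..d}"
      then show "x k = complex_of_real (transform (\<psi> (rate k)))" by (intro system_unique[OF inj \<alpha>]) blast+
    next
      fix j assume x: "\<forall>i\<in>{1..d}. x i = complex_of_real (transform (\<psi> (rate i)))" and j: "j \<in> {1..d}"
      have "\<alpha> j \<in> roots" using \<alpha> j by (auto simp: bij_betw_def)
      from root_equation[OF this]
      show "(\<Sum>i=1..d. complex_of_real (p i * (\<omega> i / rate i)) * (F M Y (\<alpha> j) \<beta> (\<omega> i) - Gbar M Y (\<alpha> j) \<beta> (\<omega> i) * x i)) = 0"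
        using x by simp
    qed
    with \<alpha> show ?thesis by blast
  qed
  show ?thesis
    unfolding Let_def transform_def[symmetric]
    unfolding numerator_def[symmetric] denominator_def[symmetric]
  proof (intro conjI allI impI ballI)
    fix \<alpha> :: real assume \<alpha>: "0 < \<alpha>"
    show "exceedance_transform M Y \<Omega> \<alpha> \<beta> < \<infinity>" by (rule exceedance_transform_finite[OF \<alpha>])
    assume "(\<forall>i\<in>{1..d}. \<alpha> \<noteq> \<psi> (rate i)) \<and> denominator \<alpha> \<noteq> 0"
    then show "transform \<alpha> = numerator \<alpha> / denominator \<alpha>" by (intro formula[OF \<alpha>]) blast+
  next
    fix \<alpha> :: real assume "0 \<le> \<alpha>"
    then show "((\<lambda>a. ennreal (numerator a / denominator a)) \<longlongrightarrow> exceedance_transform M Y \<Omega> \<alpha> \<beta>) (at \<alpha> within {0<..})"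
      by (rule quotient_tendsto)
  qed (fact root_equation system)+
qed

end
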